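(* Let $s$ and $t$ be integers with $t\geq s\geq 2$, and suppose that the pair $(s,t)$ is admissible. For $n$ sufficiently large, the maximum spread over the family of $K_{s,t}$-minor-free graphs on $n$ vertices is achieved by $$(s-1)K_1\vee \left( \ell_0 K_t \cup \left(n-s+1- t\ell_0\right) P_1\right),$$ where $\ell_0$ is the nearest integer (or either of the two nearest integers) to $$\ell_1:=\frac{2}{3t}\left(n-s+1-\frac{(t-1)^2}{9(s-1)}\right).$$ In particular, the extremal graph is unique (up to isomorphism) when $\ell_1$ is not a half-integer; otherwise, there are exactly two extremal graphs.
   Context: All graphs are finite and simple. For a graph $G$ on $n$ vertices, $\lambda_1(G)\ge\dots\ge\lambda_n(G)$ are the eigenvalues of its adjacency matrix, and the spread is $S(G)=\lambda_1(G)-\lambda_n(G)$. A graph $H$ is a minor of $G$ if a graph isomorphic to $H$ can be obtained from a subgraph of $G$ by contracting edges; $G$ is $H$-minor-free if $H$ is not a minor of $G$. $G\vee H$ is the join, $G\cup H$ the disjoint union, $kG$ the disjoint union of $k$ copies of $G$, and $P_1=K_1$ is a single vertex. For a graph $L$ on $s-1$ vertices with degrees $d_L(v)$ put $$\psi(L)=3\sum_{v\in V(L)}d_L(v)^2-\frac{2}{s-1} \left(\sum_{v\in V(L)} d_L(v)\right)^2 - (t-1)\sum_{v\in V(L)} d_L(v).$$ A pair $(s,t)$ of integers with $t\ge s\ge 2$ is called admissible if $\psi(L)\leq 0$ for every graph $L$ on $s-1$ vertices, with $\psi(L)=0$ only if $L=(s-1)K_1$ (the edgeless graph). A half-integer is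 a number of the form $m+\frac12$ with $m$ an integer. An extremal graph is one attaining the maximum spread. *)

theory Defs
  imports
    "Graph_Theory.Graph_Theory"
    "Jordan_Normal_Form.Spectral_Radius"
begin

text \<open>
  Finite simple graphs are pair digraphs satisfying the locale predicate \<^const>\<open>pair_graph\<close>:
  every edge is represented by its two arcs.
  Isomorphism is \<^const>\<open>digraph_iso\<close>, and \<^const>\<open>with_proj\<close> is a declared coercion.
\<close>

definition complete_graph :: "nat \<Rightarrow> nat pair_pre_digraph" where
  "complete_graph k = \<lparr> pverts = {..<k}, parcs = {(i, j). i < k \<and> j < k \<and> i \<noteq> j} \<rparr>"

lemma complete_digraph_complete_graph: "K\<^bsub>k\<^esub> (with_proj (complete_graph k))"
  by (auto simp: complete_digraph_pair_def complete_graph_def)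

definition disjoint_union ::
  "'a pair_pre_digraph \<Rightarrow> 'b pair_pre_digraph \<Rightarrow> ('a + 'b) pair_pre_digraph" where
  "disjoint_union G H =
     \<lparr> pverts = pverts G <+> pverts H,
       parcs = map_prod Inl Inl ` parcs G \<union> map_prod Inr Inr ` parcs H \<rparr>"

definition join ::
  "'a pair_pre_digraph \<Rightarrow> 'b pair_pre_digraph \<Rightarrow> ('a + 'b) pair_pre_digraph" where
  "join G H =
     \<lparr> pverts = pverts G <+> pverts H,
       parcs = parcs (disjoint_union G H)
         \<union> (Inl ` pverts G) \<times> (Inr ` pverts H) \<union> (Inr ` pverts H) \<times> (Inl ` pverts G) \<rparr>"

definition copies :: "nat \<Rightarrow> 'a pair_pre_digraph \<Rightarrow> (nat \<times> 'a) pair_pre_digraph" where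
  "copies k G =
     \<lparr> pverts = {..<k} \<times> pverts G,
       parcs = {((i, u), (i, v)) | i u v. i < k \<and> (u, v) \<in> parcs G} \<rparr>"

text \<open>
  Contracting the edge \<open>uv\<close> merges \<open>v\<close> into \<open>u\<close>; the resulting loop is dropped, and parallel
  edges are identified because arcs form a set.
\<close>

definition contract_edge :: "'a \<Rightarrow> 'a \<Rightarrow> 'a pair_pre_digraph \<Rightarrow> 'a pair_pre_digraph" where
  "contract_edge u v G =
     \<lparr> pverts = pverts G - {v},
       parcs = {((id(v := u)) a, (id(v := u)) b) | a b.
                  (a, b) \<in> parcs G \<and> (id(v := u)) a \<noteq> (id(v := u)) b} \<rparr>"

inductive contracts_to :: "'a pair_pre_digraph \<Rightarrow> 'a pair_pre_digraph \<Rightarrow> bool"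
  for G :: "'a pair_pre_digraph" where
  refl: "contracts_to G G"
| step: "contracts_to G H \<Longrightarrow> (u, v) \<in> parcs H \<Longrightarrow> contracts_to G (contract_edge u v H)"

definition is_minor :: "'a pair_pre_digraph \<Rightarrow> 'b pair_pre_digraph \<Rightarrow> bool" where
  "is_minor H G \<longleftrightarrow>
     (\<exists>G' G''. pair_graph G' \<and> subgraph (with_proj G') (with_proj G) \<and>
               contracts_to G' G'' \<and> digraph_iso (with_proj H) (with_proj G''))"

definition biclique_minor_free :: "nat \<Rightarrow> nat \<Rightarrow> 'a pair_pre_digraph \<Rightarrow> bool" where
  "biclique_minor_free s t G \<longleftrightarrow>
     (\<forall>H :: nat pair_pre_digraph. K\<^bsub>s,t\<^esub> (with_proj H) \<longrightarrow> \<not> is_minor H G)"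

text \<open>
  The adjacency matrix is only meaningful for graphs with vertex set \<open>{..<n}\<close>. It is symmetric,
  so all its eigenvalues are real and the real spectrum contains the largest and the smallest.
\<close>

definition adjacency_matrix :: "nat pair_pre_digraph \<Rightarrow> real mat" where
  "adjacency_matrix G =
     mat (card (pverts G)) (card (pverts G)) (\<lambda>(i, j). if (i, j) \<in> parcs G then 1 else 0)"

definition spread :: "nat pair_pre_digraph \<Rightarrow> real" where
  "spread G = Max (spectrum (adjacency_matrix G)) - Min (spectrum (adjacency_matrix G))"

text \<open>Up to isomorphism, every graph on \<open>n\<close> vertices has vertex set \<open>{..<n}\<close>.\<close>

definition in_family :: "nat \<Rightarrow> nat \<Rightarrow> nat \<Rightarrow> nat pair_pre_digraph \<Rightarrow> bool" where
  "in_family s t n G \<longleftrightarrow> pair_graph G \<and> pverts G = {..<n} \<and> biclique_minor_free s t G"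

definition extremal :: "nat \<Rightarrow> nat \<Rightarrow> nat \<Rightarrow> nat pair_pre_digraph \<Rightarrow> bool" where
  "extremal s t n G \<longleftrightarrow> is_arg_max spread (in_family s t n) G"

text \<open>In a symmetric digraph the out-degree of a vertex is its degree in the undirected graph.\<close>

definition psi :: "nat \<Rightarrow> nat \<Rightarrow> 'a pair_pre_digraph \<Rightarrow> real" where
  "psi s t L =
     3 * (\<Sum>v\<in>pverts L. (real (out_degree (with_proj L) v))\<^sup>2)
     - 2 / (real s - 1) * (\<Sum>v\<in>pverts L. real (out_degree (with_proj L) v))\<^sup>2
     - (real t - 1) * (\<Sum>v\<in>pverts L. real (out_degree (with_proj L) v))"

definition admissible :: "nat \<Rightarrow> nat \<Rightarrow> bool" where
  "admissible s t \<longleftrightarrow> 2 \<le> s \<and> s \<le> t \<and>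
     (\<forall>L :: nat pair_pre_digraph. pair_graph L \<and> card (pverts L) = s - 1 \<longrightarrow>
        psi s t L \<le> 0 \<and>
        (psi s t L = 0 \<longrightarrow>
           digraph_iso (with_proj L) (with_proj (copies (s - 1) (complete_graph 1)))))"

text \<open>
  The subtractions are on natural numbers; they do not truncate when \<open>1 \<le> s \<le> n\<close> and
  \<open>t * l \<le> n - s + 1\<close>.
\<close>

definition extremal_candidate ::
  "nat \<Rightarrow> nat \<Rightarrow> nat \<Rightarrow> nat \<Rightarrow> (nat \<times> nat + (nat \<times> nat + nat \<times> nat)) pair_pre_digraph" where
  "extremal_candidate s t n l =
     join (copies (s - 1) (complete_graph 1))
       (disjoint_union (copies l (complete_graph t))
         (copies (n - s + 1 - t * l) (complete_graph 1)))"

definition ell1 :: "nat \<Rightarrow> nat \<Rightarrow> nat \<Rightarrow> real" where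
  "ell1 s t n =
     2 / (3 * real t) * (real n - real s + 1 - (real t - 1)\<^sup>2 / (9 * (real s - 1)))"

definition nearest_integer :: "real \<Rightarrow> int \<Rightarrow> bool" where
  "nearest_integer x l \<longleftrightarrow> is_arg_min (\<lambda>m :: int. \<bar>x - of_int m\<bar>) (\<lambda>_. True) l"

definition half_integer :: "real \<Rightarrow> bool" where
  "half_integer x \<longleftrightarrow> (\<exists>m :: int. x = of_int m + 1 / 2)"

end

theory Submission
  imports Defs "HOL-Analysis.Function_Topology" "HOL-Analysis.L2_Norm"
begin

text \<open>
  A graph without a \<open>K\<^bsub>s,t\<^esub>\<close> minor is sparse, so for large spread almost all mass of the extreme
  eigenvectors sits on the edges between a set \<open>K\<close> of \<open>s - 1\<close> hubs and their common neighbours.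
  Replacing the vertices that miss a hub by vertices attached to \<open>K\<close> with weight below 1 yields a weighted
  matrix of at least the same spread. Expanding its extreme eigenvalues \<open>p\<close> and \<open>- q\<close> in inverse powers gives
  an upper bound for \<open>(p + q)\<^sup>2\<close> whose constant term contains \<open>\<psi>\<close> of the graph induced on \<open>K\<close>; by
  admissibility near-extremal graphs have no weighted vertices and no edge inside \<open>K\<close>.

  Then \<open>p\<close> and \<open>- q\<close> are approximate roots of a cubic, with an error controlled by the vertices whose
  degree outside \<open>K\<close> lies strictly between \<open>0\<close> and \<open>t - 1\<close>. This error lowers \<open>(p + q)\<^sup>2\<close> by order
  \<open>1 / n\<close>, more than can be lost otherwise, so all these degrees are \<open>0\<close> or \<open>t - 1\<close>, and excluding minors
  turns the non-trivial components into copies of \<open>K\<^sub>t\<close>. For \<open>l\<close> copies the third root of the cubic is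
  \<open>(t - 1) / 3 + d\<close> with \<open>(p + q)\<^sup>2 = const - 3 d\<^sup>2\<close>, and \<open>l - l\<^sub>1\<close> is an odd cubic in \<open>d\<close>, monotone in the
  relevant range. So the spread is maximal exactly when \<open>|l - l\<^sub>1|\<close> is minimal.
\<close>

section \<open>Quadratic forms and extreme eigenvectors\<close>

text \<open>Everything is compared through \<open>(p + q)^2\<close>, whose leading term
  \<open>4 (s - 1) (n - s + 1)\<close> is the same for all competitors, so losses can be ranked by
  scale. A vertex missing a hub or an edge inside \<open>K\<close> costs a constant: the weight
  \<open>1 - kap\<close> is below 1 by a fixed amount, and \<open>psi\<close> times
  \<open>s - 1\<close> is an integer. The expansion has an error of order \<open>1 / sqrt n\<close>
  and detects exactly these losses. A degree outside \<open>K\<close> other than \<open>0\<close>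
  and \<open>t - 1\<close> costs only order \<open>1 / n\<close>, below that error; it becomes
  visible because over independent hubs the expansion turns into a cubic whose remainder has a known
  sign. The best candidate has \<open>d\<close> of order \<open>1 / n\<close> and loses only order
  \<open>1 / n^2\<close>. The obstacle is that the hub argument gives common neighbourhoods of size
  \<open>(1 - z) n\<close> and not more. Joining the other vertices fully to \<open>K\<close> would
  raise the spread but leave no trace of the change; a weight slightly below 1 dominates the old
  edges and still records a loss. The new matrix need not come from a minor-free graph: only the
  degree bound \<open>t - 1\<close> outside \<open>K\<close> is carried over.\<close>

definition qform :: "'a set \<Rightarrow> ('a \<Rightarrow> 'a \<Rightarrow> real) \<Rightarrow> ('a \<Rightarrow> real) \<Rightarrow> real" where
  "qform V A x = (\<Sum>i\<in>V. \<Sum>j\<in>V. A i j * x i * x j)"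

definition sqnorm :: "'a set \<Rightarrow> ('a \<Rightarrow> real) \<Rightarrow> real" where
  "sqnorm V x = (\<Sum>i\<in>V. (x i)\<^sup>2)"

lemma sqnorm_nonneg: "0 \<le> sqnorm V x"
  by (simp add: sqnorm_def sum_nonneg)

lemma sqnorm_eq_0_iff: "finite V \<Longrightarrow> sqnorm V x = 0 \<longleftrightarrow> (\<forall>i\<in>V. x i = 0)"
  by (simp add: sqnorm_def sum_nonneg_eq_0_iff)

lemma sqnorm_scale: "sqnorm V (\<lambda>i. c * x i) = c\<^sup>2 * sqnorm V x"
  by (simp add: sqnorm_def sum_distrib_left power_mult_distrib)

lemma qform_scale: "qform V A (\<lambda>i. c * x i) = c\<^sup>2 * qform V A x"
  by (simp add: qform_def sum_distrib_left power2_eq_square mult_ac)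

lemma qform_uminus: "qform V (\<lambda>i j. - A i j) x = - qform V A x"
  by (simp add: qform_def sum_negf)

lemma qform_cong:
  assumes "\<And>i j. i \<in> V \<Longrightarrow> j \<in> V \<Longrightarrow> A i j = B i j" "\<And>i. i \<in> V \<Longrightarrow> x i = y i"
  shows "qform V A x = qform V B y"
  unfolding qform_def using assms by (intro sum.cong) auto

lemma sqnorm_cong: "(\<And>i. i \<in> V \<Longrightarrow> x i = y i) \<Longrightarrow> sqnorm V x = sqnorm V y"
  unfolding sqnorm_def by (intro sum.cong) auto

lemma qform_eigenvector:
  assumes "\<And>i. i \<in> V \<Longrightarrow> (\<Sum>j\<in>V. A i j * x j) = l * x i"
  shows "qform V A x = l * sqnorm V x"
proof -
  have "qform V A x = (\<Sum>i\<in>V. x i * (\<Sum>j\<in>V. A i j * x j))"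
    by (simp add: qform_def sum_distrib_left mult_ac)
  also have "\<dots> = (\<Sum>i\<in>V. l * (x i)\<^sup>2)"
    by (intro sum.cong) (auto simp: assms power2_eq_square)
  finally show ?thesis by (simp add: sqnorm_def sum_distrib_left)
qed

text \<open>Vectors are functions on the whole vertex type with the product topology, so compactness
  of a box is Tychonoff's theorem.\<close>

lemma compact_PiE_UNIV:
  fixes S :: "'a \<Rightarrow> real set"
  assumes "\<And>i. compact (S i)"
  shows "compact (PiE UNIV S)"
proof -
  have "compactin (product_topology (\<lambda>i::'a. euclidean :: real topology) UNIV) (PiE UNIV S)"
    using assms by (simp add: compactin_PiE)
  then show ?thesis by (simp add: euclidean_product_topology)
qed

text \<open>A maximiser of the form on the unit sphere is an eigenvector: otherwise moving it along
  its residual \<open>A x - l x\<close> would increase the Rayleigh quotient.\<close>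

theorem top_eigenvector_exists:
  fixes A :: "'a \<Rightarrow> 'a \<Rightarrow> real"
  assumes fin: "finite V" and ne: "V \<noteq> {}"
    and sym: "\<And>i j. i \<in> V \<Longrightarrow> j \<in> V \<Longrightarrow> A i j = A j i"
  obtains l x where "sqnorm V x = 1" "\<And>i. i \<in> V \<Longrightarrow> (\<Sum>j\<in>V. A i j * x j) = l * x i"
    "\<And>y. qform V A y \<le> l * sqnorm V y"
proof -
  \<comment> \<open>Coordinates off \<open>V\<close> are frozen at 0; \<open>sqnorm V\<close>
    ignores them, so the sphere alone would not be compact.\<close>
  define S where "S = (\<lambda>i. if i \<in> V then {-1..1::real} else {0})"
  define K where "K = PiE UNIV S \<inter> {x. sqnorm V x = 1}"
  have cont_sq: "continuous_on UNIV (sqnorm V)"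
    unfolding sqnorm_def
    by (intro continuous_intros continuous_on_product_then_coordinatewise)
  have cont_q: "continuous_on UNIV (qform V A)"
    unfolding qform_def
    by (intro continuous_intros continuous_on_product_then_coordinatewise)
  have "closed {x. sqnorm V x = 1}"
    by (rule closed_Collect_eq[OF cont_sq continuous_on_const])
  moreover have "compact (PiE UNIV S)"
    by (rule compact_PiE_UNIV) (simp add: S_def)
  ultimately have "compact K" unfolding K_def by (rule compact_Int_closed[rotated])
  obtain v where v: "v \<in> V" using ne by blast
  have "(\<lambda>i. if i = v then 1 else 0) \<in> K"
    using v fin by (auto simp: K_def S_def sqnorm_def if_distrib[of "\<lambda>a. a\<^sup>2"] cong: if_cong)
  then have "K \<noteq> {}" by blast
  then obtain x where x: "x \<in> K" and max: "\<And>y. y \<in> K \<Longrightarrow> qform V A y \<le> qform V A x"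
    using continuous_attains_sup[OF \<open>compact K\<close>, of "qform V A"] cont_q
    by (metis continuous_on_subset subset_UNIV)
  define l where "l = qform V A x"
  have nx: "sqnorm V x = 1" using x by (simp add: K_def)
  have le: "qform V A y \<le> l * sqnorm V y" for y
  proof (cases "sqnorm V y = 0")
    case True
    then have "\<forall>i\<in>V. y i = 0" using fin by (simp add: sqnorm_eq_0_iff)
    then have "qform V A y = 0" by (simp add: qform_def)
    then show ?thesis using True by simp
  next
    case False
    then have pos: "sqnorm V y > 0" using sqnorm_nonneg[of V y] by simp
    define c where "c = 1 / sqrt (sqnorm V y)"
    have c2: "c\<^sup>2 * sqnorm V y = 1" using pos by (simp add: c_def power_divide)
    define w where "w = (\<lambda>i. if i \<in> V then c * y i else 0)"
    have nw: "sqnorm V w = 1"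
      using c2 sqnorm_scale[of V c y] sqnorm_cong[of V w "\<lambda>i. c * y i"] by (simp add: w_def)
    have "\<bar>w i\<bar> \<le> 1" if "i \<in> V" for i
    proof -
      have "(w i)\<^sup>2 \<le> sqnorm V w" unfolding sqnorm_def
        using member_le_sum[of i V "\<lambda>i. (w i)\<^sup>2"] that fin by simp
      then show ?thesis using nw by (simp add: abs_square_le_1)
    qed
    then have "w \<in> K" using nw by (auto simp: K_def S_def w_def abs_le_iff PiE_iff)
    then have "qform V A w \<le> l" using max by (simp add: l_def)
    moreover have "qform V A w = c\<^sup>2 * qform V A y"
      using qform_scale[of V A c y] qform_cong[of V A A w "\<lambda>i. c * y i"] by (simp add: w_def)
    ultimately have "c\<^sup>2 * qform V A y \<le> l * (c\<^sup>2 * sqnorm V y)" using c2 by simp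
    moreover have "c\<^sup>2 > 0" using pos by (simp add: c_def)
    ultimately show ?thesis by (simp add: mult.left_commute)
  qed
  define r where "r = (\<lambda>i. (\<Sum>j\<in>V. A i j * x j) - l * x i)"
  have bil: "(\<Sum>i\<in>V. \<Sum>j\<in>V. A i j * x i * r j) = (\<Sum>i\<in>V. r i * (\<Sum>j\<in>V. A i j * x j))"
  proof -
    have "(\<Sum>i\<in>V. \<Sum>j\<in>V. A i j * x i * r j) = (\<Sum>j\<in>V. \<Sum>i\<in>V. A i j * x i * r j)"
      by (rule sum.swap)
    also have "\<dots> = (\<Sum>j\<in>V. \<Sum>i\<in>V. A j i * x i * r j)"
      by (intro sum.cong) (auto simp: sym)
    finally show ?thesis by (simp add: sum_distrib_left mult_ac)
  qed
  have bil': "(\<Sum>i\<in>V. \<Sum>j\<in>V. A i j * r i * x j) = (\<Sum>i\<in>V. r i * (\<Sum>j\<in>V. A i j * x j))"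
    by (simp add: sum_distrib_left mult_ac)
  have exq: "qform V A (\<lambda>i. x i + e * r i)
      = l + 2 * e * (\<Sum>i\<in>V. r i * (\<Sum>j\<in>V. A i j * x j)) + e\<^sup>2 * qform V A r" for e
  proof -
    have "qform V A (\<lambda>i. x i + e * r i) =
      (\<Sum>i\<in>V. \<Sum>j\<in>V. A i j * x i * x j + e * (A i j * x i * r j) + e * (A i j * r i * x j) + e\<^sup>2 * (A i j * r i * r j))"
      unfolding qform_def by (intro sum.cong[OF HOL.refl]) (simp add: algebra_simps power2_eq_square)
    also have "\<dots> = qform V A x + e * (\<Sum>i\<in>V. \<Sum>j\<in>V. A i j * x i * r j)
        + e * (\<Sum>i\<in>V. \<Sum>j\<in>V. A i j * r i * x j) + e\<^sup>2 * qform V A r"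
      unfolding qform_def by (simp add: sum.distrib sum_distrib_left)
    finally show ?thesis unfolding bil bil' l_def by simp
  qed
  have exs: "sqnorm V (\<lambda>i. x i + e * r i) = 1 + 2 * e * (\<Sum>i\<in>V. r i * x i) + e\<^sup>2 * sqnorm V r" for e
  proof -
    have "sqnorm V (\<lambda>i. x i + e * r i) = (\<Sum>i\<in>V. (x i)\<^sup>2 + 2 * e * (r i * x i) + e\<^sup>2 * (r i)\<^sup>2)"
      unfolding sqnorm_def by (intro sum.cong[OF HOL.refl]) (simp add: algebra_simps power2_eq_square)
    also have "\<dots> = sqnorm V x + 2 * e * (\<Sum>i\<in>V. r i * x i) + e\<^sup>2 * sqnorm V r"
      unfolding sqnorm_def by (simp add: sum.distrib sum_distrib_left)
    finally show ?thesis by (simp add: nx)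
  qed
  have rr: "sqnorm V r = (\<Sum>i\<in>V. r i * (\<Sum>j\<in>V. A i j * x j)) - l * (\<Sum>i\<in>V. r i * x i)"
  proof -
    have "(r i)\<^sup>2 = r i * (\<Sum>j\<in>V. A i j * x j) - l * (r i * x i)" for i
    proof -
      have "(r i)\<^sup>2 = r i * ((\<Sum>j\<in>V. A i j * x j) - l * x i)"
        unfolding power2_eq_square by (simp add: r_def)
      then show ?thesis by (simp add: right_diff_distrib)
    qed
    then show ?thesis by (simp add: sqnorm_def sum_subtractf sum_distrib_left)
  qed
  have "sqnorm V r = 0"
  proof (rule ccontr)
    assume "sqnorm V r \<noteq> 0"
    then have pos: "sqnorm V r > 0" using sqnorm_nonneg[of V r] by simp
    \<comment> \<open>This is \<open>le\<close> at \<open>x + e r\<close>: the gain is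
      \<open>2 e\<close> times the squared residual, the possible loss only of order
      \<open>e^2\<close>.\<close>
    have key: "2 * e * sqnorm V r \<le> e\<^sup>2 * (l * sqnorm V r - qform V A r)" for e
      using le[of "\<lambda>i. x i + e * r i"] unfolding exq exs rr by (simp add: algebra_simps)
    define c where "c = \<bar>l * sqnorm V r - qform V A r\<bar> + 1"
    have c: "c > 0" "l * sqnorm V r - qform V A r \<le> c" by (auto simp: c_def)
    define e where "e = sqnorm V r / c"
    have e: "e > 0" using pos c by (simp add: e_def)
    have "2 * e * sqnorm V r \<le> e\<^sup>2 * c"
      using key[of e] c(2) by (meson mult_left_mono order_trans zero_le_power2)
    also have "\<dots> = e * sqnorm V r" using c by (simp add: e_def power2_eq_square)
    finally show False using e pos by simp
  qed
  then have "\<forall>i\<in>V. r i = 0" using fin by (simp add: sqnorm_eq_0_iff)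
  then have "(\<Sum>j\<in>V. A i j * x j) = l * x i" if "i \<in> V" for i using that by (simp add: r_def)
  then show ?thesis using that nx le by blast
qed

text \<open>
  The least eigenvalue is \<open>- q\<close>, so that the spread is \<open>p + q\<close> and both ends are treated alike.
\<close>

definition is_spread :: "'a set \<Rightarrow> ('a \<Rightarrow> 'a \<Rightarrow> real) \<Rightarrow> real \<Rightarrow> real \<Rightarrow> ('a \<Rightarrow> real) \<Rightarrow> ('a \<Rightarrow> real) \<Rightarrow> bool" where
  "is_spread V A p q x z \<longleftrightarrow> sqnorm V x = 1 \<and> sqnorm V z = 1 \<and>
     (\<forall>i\<in>V. (\<Sum>j\<in>V. A i j * x j) = p * x i) \<and> (\<forall>i\<in>V. (\<Sum>j\<in>V. A i j * z j) = - q * z i) \<and>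
     (\<forall>y. qform V A y \<le> p * sqnorm V y) \<and> (\<forall>y. - qform V A y \<le> q * sqnorm V y)"

lemma is_spread_exists:
  assumes "finite V" "V \<noteq> {}" "\<And>i j. i \<in> V \<Longrightarrow> j \<in> V \<Longrightarrow> A i j = A j i"
  obtains p q x z where "is_spread V A p q x z"
proof -
  obtain p x where x: "sqnorm V x = 1" "\<And>i. i \<in> V \<Longrightarrow> (\<Sum>j\<in>V. A i j * x j) = p * x i"
    "\<And>y. qform V A y \<le> p * sqnorm V y"
    by (rule top_eigenvector_exists[of V A, OF assms]) (assumption | rule that)+
  obtain q z where z: "sqnorm V z = 1" "\<And>i. i \<in> V \<Longrightarrow> (\<Sum>j\<in>V. - A i j * z j) = q * z i"
    "\<And>y. qform V (\<lambda>i j. - A i j) y \<le> q * sqnorm V y"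
  proof (rule top_eigenvector_exists[of V "\<lambda>i j. - A i j"])
    show "- A i j = - A j i" if "i \<in> V" "j \<in> V" for i j using assms(3)[OF that] by simp
  qed (use assms in auto)
  have "(\<Sum>j\<in>V. A i j * z j) = - q * z i" if "i \<in> V" for i
    using z(2)[OF that] by (simp add: sum_negf)
  then have "is_spread V A p q x z"
    unfolding is_spread_def using x z by (simp add: qform_uminus)
  then show ?thesis by (rule that)
qed

text \<open>With nonnegative entries, replacing the bottom eigenvector by its absolute values does
  not decrease the size of the form. Hence \<open>p\<close> is at least half of the spread, the
  starting point of every later localisation.\<close>

lemma spread_bottom_le_top:
  assumes sp: "is_spread V M p q x z" and nn: "\<And>i j. i \<in> V \<Longrightarrow> j \<in> V \<Longrightarrow> 0 \<le> M i j"
  shows "q \<le> p"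
proof -
  note sp = sp[unfolded is_spread_def]
  have "qform V M z = - q * sqnorm V z"
    using sp by (intro qform_eigenvector) auto
  then have "q = - qform V M z" using sp by simp
  also have "\<dots> \<le> qform V M (\<lambda>i. \<bar>z i\<bar>)"
    unfolding qform_def sum_negf[symmetric]
  proof (intro sum_mono)
    fix i j assume "i \<in> V" "j \<in> V"
    then have "M i j * \<bar>z i * z j\<bar> \<ge> M i j * - (z i * z j)"
      by (intro mult_left_mono nn) auto
    then show "- (M i j * z i * z j) \<le> M i j * \<bar>z i\<bar> * \<bar>z j\<bar>"
      by (simp add: abs_mult mult.assoc)
  qed
  also have "\<dots> \<le> p * sqnorm V (\<lambda>i. \<bar>z i\<bar>)" using sp by blast
  also have "sqnorm V (\<lambda>i. \<bar>z i\<bar>) = 1" using sp by (simp add: sqnorm_def)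
  finally show ?thesis by simp
qed

section \<open>Adjacency matrices and the spread of a graph\<close>

definition adj :: "'a rel \<Rightarrow> 'a \<Rightarrow> 'a \<Rightarrow> real" where
  "adj E i j = (if (i, j) \<in> E then 1 else 0)"

lemma eigenvalue_adjacency_iff:
  assumes V: "pverts G = {..<n}"
  shows "eigenvalue (adjacency_matrix G) l \<longleftrightarrow>
    (\<exists>x. (\<exists>i<n. x i \<noteq> 0) \<and> (\<forall>i<n. (\<Sum>j<n. adj (parcs G) i j * x j) = l * x i))"
proof -
  let ?A = "adjacency_matrix G"
  have dim: "dim_row ?A = n" "dim_col ?A = n" by (auto simp: adjacency_matrix_def V)
  have mv: "(?A *\<^sub>v v) $ i = (\<Sum>j<n. adj (parcs G) i j * v $ j)" if "i < n" "dim_vec v = n" for v i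
    using that by (simp add: adjacency_matrix_def V scalar_prod_def adj_def lessThan_atLeast0)
  show ?thesis
  proof
    assume "eigenvalue ?A l"
    then obtain v where v: "v \<in> carrier_vec n" "v \<noteq> 0\<^sub>v n" "?A *\<^sub>v v = l \<cdot>\<^sub>v v"
      unfolding eigenvalue_def eigenvector_def dim by blast
    have "\<exists>i<n. v $ i \<noteq> 0" using v(1,2) by (metis carrier_vecD eq_vecI index_zero_vec(1) index_zero_vec(2))
    moreover have "(\<Sum>j<n. adj (parcs G) i j * v $ j) = l * v $ i" if "i < n" for i
      using arg_cong[OF v(3), of "\<lambda>w. w $ i"] mv[OF that, of v] v(1) that by simp
    ultimately show "\<exists>x. (\<exists>i<n. x i \<noteq> 0) \<and> (\<forall>i<n. (\<Sum>j<n. adj (parcs G) i j * x j) = l * x i)"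
      by (intro exI[of _ "\<lambda>i. v $ i"]) auto
  next
    assume "\<exists>x. (\<exists>i<n. x i \<noteq> 0) \<and> (\<forall>i<n. (\<Sum>j<n. adj (parcs G) i j * x j) = l * x i)"
    then obtain x i where x: "i < n" "x i \<noteq> 0" "\<And>i. i < n \<Longrightarrow> (\<Sum>j<n. adj (parcs G) i j * x j) = l * x i"
      by blast
    let ?v = "vec n x"
    have "?v \<noteq> 0\<^sub>v n" using x(1,2) by (metis index_vec index_zero_vec(1))
    moreover have "?A *\<^sub>v ?v = l \<cdot>\<^sub>v ?v"
    proof (rule eq_vecI)
      fix i assume "i < dim_vec (l \<cdot>\<^sub>v ?v)"
      then have i: "i < n" by simp
      have "(?A *\<^sub>v ?v) $ i = (\<Sum>j<n. adj (parcs G) i j * ?v $ j)" using i by (intro mv) auto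
      also have "\<dots> = l * x i" using x(3)[OF i] by simp
      finally show "(?A *\<^sub>v ?v) $ i = (l \<cdot>\<^sub>v ?v) $ i" using i by simp
    qed (simp add: dim)
    ultimately show "eigenvalue ?A l"
      unfolding eigenvalue_def eigenvector_def dim by (intro exI[of _ ?v]) simp
  qed
qed

lemma spread_eq:
  assumes V: "pverts G = {..<n}" and n: "n > 0" and sp: "is_spread {..<n} (adj (parcs G)) p q x z"
  shows "spread G = p + q"
proof -
  let ?A = "adjacency_matrix G"
  note sp = sp[unfolded is_spread_def]
  have nz: "\<exists>i<n. y i \<noteq> 0" if "sqnorm {..<n} y = 1" for y
  proof (rule ccontr)
    assume "\<not> (\<exists>i<n. y i \<noteq> 0)"
    then have "sqnorm {..<n} y = 0" by (simp add: sqnorm_def)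
    then show False using that by simp
  qed
  have fin: "finite (spectrum ?A)"
    by (rule card_finite_spectrum(1)[of _ n]) (simp add: adjacency_matrix_def V)
  have p: "p \<in> spectrum ?A" and q: "- q \<in> spectrum ?A"
    unfolding spectrum_def mem_Collect_eq eigenvalue_adjacency_iff[OF V]
    using sp nz by (metis lessThan_iff)+
  have bnd: "l \<le> p \<and> - q \<le> l" if "l \<in> spectrum ?A" for l
  proof -
    from that obtain y i where y: "i < n" "y i \<noteq> 0"
      "\<And>i. i < n \<Longrightarrow> (\<Sum>j<n. adj (parcs G) i j * y j) = l * y i"
      unfolding spectrum_def using eigenvalue_adjacency_iff[OF V] by auto
    have "sqnorm {..<n} y \<noteq> 0" using y(1,2) by (auto simp: sqnorm_eq_0_iff)
    then have pos: "sqnorm {..<n} y > 0" using sqnorm_nonneg[of "{..<n}" y] by simp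
    have "qform {..<n} (adj (parcs G)) y = l * sqnorm {..<n} y"
      by (rule qform_eigenvector) (simp add: y(3))
    then have "l * sqnorm {..<n} y \<le> p * sqnorm {..<n} y" "- l * sqnorm {..<n} y \<le> q * sqnorm {..<n} y"
      using sp by (metis, metis minus_mult_left)
    then have "l \<le> p" "- l \<le> q" using pos mult_right_le_imp_le by blast+
    then show ?thesis by linarith
  qed
  have "Max (spectrum ?A) = p" using fin p bnd by (intro Max_eqI) auto
  moreover have "Min (spectrum ?A) = - q" using fin q bnd by (intro Min_eqI) auto
  ultimately show ?thesis by (simp add: spread_def)
qed

section \<open>Isomorphisms, contractions and biclique models\<close>

text \<open>For pair digraphs tail and head are the two projections, so the arc part of an
  isomorphism is forced by its vertex part.\<close>

lemma digraph_iso_with_proj_iff: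
  assumes "pair_wf_digraph G"
  shows "digraph_iso (with_proj G) (with_proj H) \<longleftrightarrow>
    (\<exists>h. inj_on h (pverts G) \<and> pverts H = h ` pverts G \<and> parcs H = map_prod h h ` parcs G)"
proof
  assume "digraph_iso (with_proj G) (with_proj H)"
  then obtain f where f: "pre_digraph.digraph_isomorphism (with_proj G) f"
    and H: "with_proj H = app_iso f (with_proj G)"
    unfolding digraph_iso_def by blast
  have vH: "pverts H = iso_verts f ` pverts G" and aH: "parcs H = iso_arcs f ` parcs G"
    and tl: "iso_tail f = fst" and hd: "iso_head f = snd"
    using arg_cong[OF H, of verts] arg_cong[OF H, of arcs] arg_cong[OF H, of tail] arg_cong[OF H, of head]
    by auto
  have "iso_arcs f a = map_prod (iso_verts f) (iso_verts f) a" if "a \<in> parcs G" for a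
    using f that tl hd unfolding pre_digraph.digraph_isomorphism_def
    by (simp add: prod_eq_iff)
  then have "parcs H = map_prod (iso_verts f) (iso_verts f) ` parcs G"
    unfolding aH by (intro image_cong) auto
  moreover have "inj_on (iso_verts f) (pverts G)"
    using f unfolding pre_digraph.digraph_isomorphism_def by simp
  ultimately show "\<exists>h. inj_on h (pverts G) \<and> pverts H = h ` pverts G \<and> parcs H = map_prod h h ` parcs G"
    using vH by blast
next
  assume "\<exists>h. inj_on h (pverts G) \<and> pverts H = h ` pverts G \<and> parcs H = map_prod h h ` parcs G"
  then obtain h where h: "inj_on h (pverts G)" "pverts H = h ` pverts G"
    "parcs H = map_prod h h ` parcs G" by blast
  interpret pair_wf_digraph G by fact
  let ?f = "\<lparr>iso_verts = h, iso_arcs = map_prod h h, iso_head = snd, iso_tail = fst\<rparr>"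
  have "inj_on (map_prod h h) (parcs G)"
  proof (rule inj_onI)
    fix e e' assume e: "e \<in> parcs G" "e' \<in> parcs G" "map_prod h h e = map_prod h h e'"
    have "fst e = fst e'" "snd e = snd e'"
      using e inj_onD[OF h(1), of "fst e" "fst e'"] inj_onD[OF h(1), of "snd e" "snd e'"]
        arc_fst_in_verts arc_snd_in_verts by (auto simp: prod_eq_iff)
    then show "e = e'" by (rule prod_eqI)
  qed
  then have "pre_digraph.digraph_isomorphism (with_proj G) ?f"
    unfolding pre_digraph.digraph_isomorphism_def using h(1) wf_digraph_axioms by simp
  moreover have "with_proj H = app_iso ?f (with_proj G)"
    using h(2,3) by (simp add: app_iso_def with_proj_def)
  ultimately show "digraph_iso (with_proj G) (with_proj H)"
    unfolding digraph_iso_def by blast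
qed

section \<open>Contraction sequences as quotients by a single vertex map\<close>

definition map_graph :: "('a \<Rightarrow> 'b) \<Rightarrow> 'a pair_pre_digraph \<Rightarrow> 'b pair_pre_digraph" where
  "map_graph f G = \<lparr> pverts = f ` pverts G, parcs = {(f a, f b) | a b. (a, b) \<in> parcs G \<and> f a \<noteq> f b} \<rparr>"

lemma contract_edge_eq_map_graph:
  assumes "u \<in> pverts G" "u \<noteq> v"
  shows "contract_edge u v G = map_graph (id(v := u)) G"
  using assms by (auto simp: contract_edge_def map_graph_def image_iff)

lemma map_graph_comp: "map_graph g (map_graph f G) = map_graph (g \<circ> f) G"
  by (fastforce simp: map_graph_def image_comp)

lemma map_graph_id:
  assumes "\<And>v. v \<in> pverts G \<Longrightarrow> f v = v" "parcs G \<subseteq> pverts G \<times> pverts G" "irrefl (parcs G)"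
  shows "map_graph f G = G"
proof -
  have "f ` pverts G = pverts G" using assms(1) by force
  moreover have "{(f a, f b) | a b. (a, b) \<in> parcs G \<and> f a \<noteq> f b} = parcs G"
  proof (intro equalityI subrelI)
    fix x y assume "(x, y) \<in> {(f a, f b) | a b. (a, b) \<in> parcs G \<and> f a \<noteq> f b}"
    then obtain a b where "x = f a" "y = f b" "(a, b) \<in> parcs G" by blast
    then show "(x, y) \<in> parcs G" using assms(1,2) by (metis SigmaE2 subsetD)
  next
    fix x y assume xy: "(x, y) \<in> parcs G"
    then have "x \<noteq> y" "x \<in> pverts G" "y \<in> pverts G" using assms(2,3) by (auto simp: irrefl_def)
    then have "(x, y) = (f x, f y) \<and> (x, y) \<in> parcs G \<and> f x \<noteq> f y" using assms(1) xy by simp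
    then show "(x, y) \<in> {(f a, f b) | a b. (a, b) \<in> parcs G \<and> f a \<noteq> f b}" by blast
  qed
  ultimately show ?thesis by (simp add: map_graph_def)
qed

lemma contracts_to_trans:
  assumes "contracts_to H I" "contracts_to G H"
  shows "contracts_to G I"
  using assms(1) by induction (auto intro: contracts_to.step assms(2))

lemma rtrancl_map:
  assumes "(x, y) \<in> R\<^sup>*" "\<And>a b. (a, b) \<in> R \<Longrightarrow> g a = g b \<or> (g a, g b) \<in> S"
  shows "(g x, g y) \<in> S\<^sup>*"
  using assms(1)
proof induction
  case (step y z)
  then show ?case using assms(2)[of y z] by (metis rtrancl.rtrancl_into_rtrancl)
qed simp

text \<open>Here \<open>f\<close> sends each vertex to a representative of its branch set. Vertices
  that are not representatives are merged one at a time, and their number is the induction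
  measure.\<close>

lemma contracts_to_map_graph:
  fixes G :: "'a pair_pre_digraph"
  assumes "finite (pverts G)" "parcs G \<subseteq> pverts G \<times> pverts G" "irrefl (parcs G)" "sym (parcs G)"
    and "\<And>v. v \<in> pverts G \<Longrightarrow> f v \<in> pverts G \<and> f (f v) = f v \<and>
           (v, f v) \<in> {(x, y) \<in> parcs G. f x = f y}\<^sup>*"
  shows "contracts_to G (map_graph f G)"
  using assms
proof (induction "card {v \<in> pverts G. f v \<noteq> v}" arbitrary: G rule: less_induct)
  case less
  note f = less.prems(5)
  show ?case
  proof (cases "\<exists>v\<in>pverts G. f v \<noteq> v")
    case False
    then have "map_graph f G = G" using less.prems by (intro map_graph_id) auto
    then show ?thesis by (simp add: contracts_to.refl)
  next
    case True
    then obtain v where v: "v \<in> pverts G" "f v \<noteq> v" by blast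
    define u where "u = f v"
    have "(v, u) \<in> {(x, y) \<in> parcs G. f x = f y}\<^sup>*" "v \<noteq> u" using f v by (auto simp: u_def)
    \<comment> \<open>The last arc of a path to the representative \<open>u\<close>. Merging
      \<open>w\<close> into \<open>u\<close> keeps all hypotheses, since \<open>f w = u\<close>
      makes \<open>f\<close> constant on the merged pair.\<close>
    then obtain w where w: "(w, u) \<in> parcs G" "f w = f u" by (auto elim: rtranclE)
    have fu: "f u = u" using f v(1) by (simp add: u_def)
    have wu: "w \<noteq> u" "(u, w) \<in> parcs G" "w \<in> pverts G" "u \<in> pverts G" "f w = u"
      using w fu less.prems(2,3,4) by (auto simp: irrefl_def sym_def)
    define g where "g = id(w := u)"
    define G1 where "G1 = contract_edge u w G"
    have G1: "G1 = map_graph g G"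
      unfolding G1_def g_def using wu by (intro contract_edge_eq_map_graph) auto
    have vG1: "pverts G1 = pverts G - {w}" by (simp add: G1_def contract_edge_def)
    have aG1: "parcs G1 = {(g a, g b) | a b. (a, b) \<in> parcs G \<and> g a \<noteq> g b}"
      by (simp add: G1 map_graph_def)
    have fg: "f (g a) = f a" for a using wu fu by (simp add: g_def)
    have "contracts_to G1 (map_graph f G1)"
    proof (rule less.hyps)
      have "{v \<in> pverts G1. f v \<noteq> v} \<subseteq> {v \<in> pverts G. f v \<noteq> v}"
        unfolding vG1 by blast
      moreover have "w \<in> {v \<in> pverts G. f v \<noteq> v}" "w \<notin> {v \<in> pverts G1. f v \<noteq> v}"
        using wu(1,3,5) by (simp_all add: vG1)
      ultimately have "{v \<in> pverts G1. f v \<noteq> v} \<subset> {v \<in> pverts G. f v \<noteq> v}" by blast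
      then show "card {v \<in> pverts G1. f v \<noteq> v} < card {v \<in> pverts G. f v \<noteq> v}"
        using less.prems(1) by (intro psubset_card_mono) auto
      show "finite (pverts G1)" using less.prems(1) by (simp add: vG1)
      show "parcs G1 \<subseteq> pverts G1 \<times> pverts G1"
        using less.prems(2) wu by (auto simp: aG1 vG1 g_def split: if_splits)
      show "irrefl (parcs G1)" by (auto simp: aG1 irrefl_def)
      show "sym (parcs G1)"
      proof (rule symI)
        fix x y assume "(x, y) \<in> parcs G1"
        then obtain a b where ab: "(a, b) \<in> parcs G" "x = g a" "y = g b" "g a \<noteq> g b"
          unfolding aG1 by blast
        have "(b, a) \<in> parcs G" using less.prems(4) ab(1) by (rule symD)
        then show "(y, x) \<in> parcs G1"
          unfolding aG1 ab(2,3) using ab(4) by (intro CollectI exI[of _ b] exI[of _ a]) auto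
      qed
      fix x assume x: "x \<in> pverts G1"
      then have xG: "x \<in> pverts G" "x \<noteq> w" by (auto simp: vG1)
      have "f x \<noteq> w" using f[OF xG(1)] wu by metis
      then have 1: "f x \<in> pverts G1" "f (f x) = f x" using f[OF xG(1)] by (auto simp: vG1)
      have "(g x, g (f x)) \<in> {(x, y) \<in> parcs G1. f x = f y}\<^sup>*"
      proof (rule rtrancl_map[of x "f x" "{(x, y) \<in> parcs G. f x = f y}" g])
        show "(x, f x) \<in> {(x, y) \<in> parcs G. f x = f y}\<^sup>*" using f[OF xG(1)] by simp
        fix a b assume "(a, b) \<in> {(x, y) \<in> parcs G. f x = f y}"
        then show "g a = g b \<or> (g a, g b) \<in> {(x, y) \<in> parcs G1. f x = f y}"
          using fg by (auto simp: aG1)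
      qed
      moreover have "g x = x" "g (f x) = f x" using xG \<open>f x \<noteq> w\<close> by (auto simp: g_def)
      ultimately show "f x \<in> pverts G1 \<and> f (f x) = f x \<and>
           (x, f x) \<in> {(x, y) \<in> parcs G1. f x = f y}\<^sup>*" using 1 by simp
    qed
    moreover have "map_graph f G1 = map_graph f G"
    proof -
      have "f \<circ> g = f" using fg by auto
      then show ?thesis by (simp add: G1 map_graph_comp)
    qed
    moreover have "contracts_to G G1"
      unfolding G1_def using wu by (intro contracts_to.step contracts_to.refl)
    ultimately show ?thesis using contracts_to_trans by metis
  qed
qed

text \<open>The converse direction, with connected fibres. One more contraction unites two fibres,
  and the contracted arc connects their union.\<close>

lemma contracts_to_imp_map_graph:
  fixes G :: "'a pair_pre_digraph"
  assumes "contracts_to G H" "parcs G \<subseteq> pverts G \<times> pverts G" "irrefl (parcs G)" "sym (parcs G)"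
  shows "\<exists>f. H = map_graph f G \<and> (\<forall>a\<in>pverts G. \<forall>b\<in>pverts G. f a = f b \<longrightarrow>
           (a, b) \<in> {(x, y) \<in> parcs G. f x = f y}\<^sup>*)"
  using assms(1)
proof induction
  case refl
  have "map_graph id G = G" using assms by (intro map_graph_id) auto
  then show ?case by (intro exI[of _ id]) (simp add: id_def)
next
  case (step H u v)
  then obtain f where H: "H = map_graph f G"
    and f: "\<And>a b. a \<in> pverts G \<Longrightarrow> b \<in> pverts G \<Longrightarrow> f a = f b \<Longrightarrow>
           (a, b) \<in> {(x, y) \<in> parcs G. f x = f y}\<^sup>*" by blast
  obtain a0 b0 where ab0: "(a0, b0) \<in> parcs G" "f a0 = u" "f b0 = v" "u \<noteq> v"
    using step(2) unfolding H map_graph_def by auto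
  have ab0': "a0 \<in> pverts G" "b0 \<in> pverts G" using ab0(1) assms(2) by auto
  define g where "g = id(v := u)"
  define R where "R = {(x, y) \<in> parcs G. (g \<circ> f) x = (g \<circ> f) y}"
  have "u \<in> pverts H" using ab0 ab0' by (auto simp: H map_graph_def)
  then have 1: "contract_edge u v H = map_graph (g \<circ> f) G"
    using contract_edge_eq_map_graph[of u H v] ab0(4) by (simp add: H map_graph_comp g_def)
  have "{(x, y) \<in> parcs G. f x = f y} \<subseteq> R" by (auto simp: R_def)
  then have mono: "(a, b) \<in> R\<^sup>*" if "a \<in> pverts G" "b \<in> pverts G" "f a = f b" for a b
    by (rule subsetD[OF rtrancl_mono f[OF that]])
  have e: "(a0, b0) \<in> R" using ab0 by (simp add: R_def g_def)
  have "sym R" using assms(4) by (auto simp: R_def sym_def)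
  then have symR: "(a, b) \<in> R\<^sup>* \<Longrightarrow> (b, a) \<in> R\<^sup>*" for a b by (metis sym_rtrancl symD)
  have uv: "(a, b) \<in> R\<^sup>*" if "a \<in> pverts G" "b \<in> pverts G" "f a = u" "f b = v" for a b
  proof -
    have "(a, a0) \<in> R\<^sup>*" "(b0, b) \<in> R\<^sup>*"
      using that ab0(2,3) by (auto intro!: mono ab0')
    then show ?thesis using e by (meson rtrancl.rtrancl_into_rtrancl rtrancl_trans)
  qed
  have "(a, b) \<in> R\<^sup>*" if "a \<in> pverts G" "b \<in> pverts G" "(g \<circ> f) a = (g \<circ> f) b" for a b
  proof (cases "f a = f b")
    case True then show ?thesis using mono that by blast
  next
    case False
    then have "f a = u \<and> f b = v \<or> f a = v \<and> f b = u"
      using that(3) by (auto simp: g_def split: if_splits)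
    then show ?thesis using uv symR that(1,2) by blast
  qed
  then show ?case unfolding 1 R_def by blast
qed

section \<open>Minors through branch sets\<close>

definition connected_in :: "'a rel \<Rightarrow> 'a set \<Rightarrow> bool" where
  "connected_in E U \<longleftrightarrow> (\<forall>a\<in>U. \<forall>b\<in>U. (a, b) \<in> (E \<inter> U \<times> U)\<^sup>*)"

text \<open>This form of a minor involves no order of contractions. As \<open>connected_in\<close>
  holds for the empty set, nonemptiness is demanded separately.\<close>

definition biclique_model :: "nat \<Rightarrow> nat \<Rightarrow> 'a set \<Rightarrow> 'a rel \<Rightarrow> 'a set set \<Rightarrow> 'a set set \<Rightarrow> bool" where
  "biclique_model s t V E \<X> \<Y> \<longleftrightarrow> finite \<X> \<and> finite \<Y> \<and> card \<X> = s \<and> card \<Y> = t \<and> \<X> \<inter> \<Y> = {} \<and>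
     disjoint (\<X> \<union> \<Y>) \<and> (\<forall>A\<in>\<X> \<union> \<Y>. A \<noteq> {} \<and> A \<subseteq> V \<and> connected_in E A) \<and>
     (\<forall>A\<in>\<X>. \<forall>B\<in>\<Y>. \<exists>a\<in>A. \<exists>b\<in>B. (a, b) \<in> E)"

text \<open>The branch set of a vertex of the biclique is its fibre under the contraction
  map.\<close>

lemma biclique_model_if_minor:
  assumes G: "pair_graph G" and nf: "\<not> biclique_minor_free s t G"
  shows "\<exists>\<X> \<Y>. biclique_model s t (pverts G) (parcs G) \<X> \<Y>"
proof -
  obtain H :: "nat pair_pre_digraph" and G' G'' where H: "K\<^bsub>s,t\<^esub> (with_proj H)"
    and G': "pair_graph G'" "subgraph (with_proj G') (with_proj G)"
    and c: "contracts_to G' G''" and iso: "digraph_iso (with_proj H) (with_proj G'')"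
    using nf unfolding biclique_minor_free_def is_minor_def by blast
  interpret G': pair_graph G' by fact
  interpret H: pair_graph H using H by (rule pair_graphI_complete_bipartite)
  have wf: "parcs G' \<subseteq> pverts G' \<times> pverts G'" "irrefl (parcs G')" "sym (parcs G')"
    using G'.in_arcsD1 G'.in_arcsD2 G'.pair_sym_arcs
    by (auto simp: irrefl_def symmetric_def dest: G'.pair_no_loops)
  obtain f where G'': "G'' = map_graph f G'" and f: "\<And>a b. a \<in> pverts G' \<Longrightarrow> b \<in> pverts G' \<Longrightarrow>
      f a = f b \<Longrightarrow> (a, b) \<in> {(x, y) \<in> parcs G'. f x = f y}\<^sup>*"
    using contracts_to_imp_map_graph[OF c wf] by blast
  obtain h where h: "inj_on h (pverts H)" "pverts G'' = h ` pverts H" "parcs G'' = map_prod h h ` parcs H"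
    using iso digraph_iso_with_proj_iff[of H G''] H.pair_wf_digraph_axioms by blast
  obtain U W where UW: "pverts H = U \<union> W" "U \<inter> W = {}" "card U = s" "card W = t"
    "parcs H = U \<times> W \<union> W \<times> U" and fH: "finite (pverts H)"
    using H unfolding complete_bipartite_digraph_pair_def by blast
  define F where "F = (\<lambda>u. {v \<in> pverts G'. f v = h u})"
  have ne: "F u \<noteq> {}" if "u \<in> pverts H" for u
    using that h(2) by (auto simp: F_def G'' map_graph_def image_iff set_eq_iff) metis
  have inj: "inj_on F (pverts H)"
  proof (rule inj_onI)
    fix u w assume uw: "u \<in> pverts H" "w \<in> pverts H" "F u = F w"
    then obtain v where "v \<in> F u" "v \<in> F w" using ne by blast
    then have "h u = h w" by (simp add: F_def)
    then show "u = w" using uw h(1) by (auto dest: inj_onD)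
  qed
  have disj: "F u \<inter> F w = {}" if "u \<in> pverts H" "w \<in> pverts H" "u \<noteq> w" for u w
    using that h(1) by (auto simp: F_def dest: inj_onD)
  have sub: "pverts G' \<subseteq> pverts G" "parcs G' \<subseteq> parcs G"
    using G'(2) by (auto simp: subgraph_def)
  have conn: "connected_in (parcs G) (F u)" for u
    unfolding connected_in_def
  proof (intro ballI)
    fix a b assume ab: "a \<in> F u" "b \<in> F u"
    then have "(a, b) \<in> {(x, y) \<in> parcs G'. f x = f y}\<^sup>*" by (intro f) (auto simp: F_def)
    then show "(a, b) \<in> (parcs G \<inter> F u \<times> F u)\<^sup>*"
    proof (induction rule: converse_rtrancl_induct)
      case base then show ?case by simp
    next
      case (step y z)
      from step(2) ab have "f z = h u" 
        by (induction rule: converse_rtrancl_induct) (auto simp: F_def)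
      then have "(y, z) \<in> parcs G \<inter> F u \<times> F u" using step(1) wf sub by (auto simp: F_def)
      then show ?case using step(3) by (rule converse_rtrancl_into_rtrancl)
    qed
  qed
  have edge: "\<exists>a\<in>F u. \<exists>b\<in>F w. (a, b) \<in> parcs G" if "u \<in> U" "w \<in> W" for u w
  proof -
    have "(h u, h w) \<in> parcs G''" using that by (force simp: h(3) UW(5))
    then obtain a b where "(a, b) \<in> parcs G'" "f a = h u" "f b = h w"
      by (auto simp: G'' map_graph_def)
    then have "a \<in> F u" "b \<in> F w" "(a, b) \<in> parcs G" using wf sub by (auto simp: F_def)
    then show ?thesis by blast
  qed
  have fin: "finite U" "finite W" using fH UW(1) by auto
  have "biclique_model s t (pverts G) (parcs G) (F ` U) (F ` W)"
    unfolding biclique_model_def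
  proof (intro conjI)
    show "card (F ` U) = s" "card (F ` W) = t"
      using inj UW by (auto simp: card_image inj_on_Un)
    show "F ` U \<inter> F ` W = {}"
    proof -
      have "F u \<noteq> F w" if "u \<in> U" "w \<in> W" for u w
        using that inj_onD[OF inj, of u w] UW(1,2) by blast
      then show ?thesis by blast
    qed
    show "disjoint (F ` U \<union> F ` W)"
      using disj UW(1) by (auto simp: disjoint_def)
    show "\<forall>A\<in>F ` U \<union> F ` W. A \<noteq> {} \<and> A \<subseteq> pverts G \<and> connected_in (parcs G) A"
      using ne conn sub UW(1) by (fastforce simp: F_def)
    show "\<forall>A\<in>F ` U. \<forall>B\<in>F ` W. \<exists>a\<in>A. \<exists>b\<in>B. (a, b) \<in> parcs G" using edge by blast
  qed (use fin in auto)
  then show ?thesis by blast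
qed

text \<open>Arcs between different branch sets of the same side are deleted before contracting, so
  that the quotient is the biclique itself and not a proper supergraph of it.\<close>

lemma not_minor_free_if_biclique_model:
  fixes G :: "nat pair_pre_digraph"
  assumes G: "pair_graph G" and m: "biclique_model s t (pverts G) (parcs G) \<X> \<Y>"
  shows "\<not> biclique_minor_free s t G"
proof -
  interpret pair_graph G by fact
  note m = m[unfolded biclique_model_def]
  define U where "U = \<Union> (\<X> \<union> \<Y>)"
  define same where "same = (\<lambda>a b. \<exists>A\<in>\<X> \<union> \<Y>. a \<in> A \<and> b \<in> A)"
  define cross where "cross = (\<lambda>a b. \<exists>A\<in>\<X>. \<exists>B\<in>\<Y>. a \<in> A \<and> b \<in> B)"
  define G' where "G' = \<lparr> pverts = U, parcs = {(a, b) \<in> parcs G. same a b \<or> cross a b \<or> cross b a} \<rparr>"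
  have UG: "U \<subseteq> pverts G" using m by (auto simp: U_def)
  have symG: "(a, b) \<in> parcs G \<Longrightarrow> (b, a) \<in> parcs G" for a b
    using pair_sym_arcs by (auto simp: symmetric_def dest: symD)
  have wf: "parcs G' \<subseteq> pverts G' \<times> pverts G'"
    by (auto simp: G'_def U_def same_def cross_def)
  have irr: "irrefl (parcs G')" by (auto simp: G'_def irrefl_def dest: pair_no_loops)
  have symG': "sym (parcs G')" using symG by (auto simp: G'_def sym_def same_def)
  have finU: "finite U" using UG pair_finite_verts finite_subset by blast
  have pg: "pair_graph G'"
  proof (unfold_locales)
    show "finite (parcs G')" using wf finU by (auto simp: G'_def intro: finite_subset)
    show "symmetric (with_proj G')" using symG' by (simp add: symmetric_def)
  qed (use wf irr finU in \<open>auto simp: irrefl_def G'_def\<close>)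
  interpret G': pair_graph G' by fact
  have sub: "subgraph (with_proj G') (with_proj G)"
    using UG G'.wf_digraph_axioms wf_digraph_axioms by (auto simp: subgraph_def G'_def compatible_def)
  define c where "c = (\<lambda>v. THE A. A \<in> \<X> \<union> \<Y> \<and> v \<in> A)"
  have uniq: "A = B" if "A \<in> \<X> \<union> \<Y>" "B \<in> \<X> \<union> \<Y>" "v \<in> A" "v \<in> B" for A B v
    using m that unfolding disjoint_def by blast
  have c_eq: "c v = A" if "A \<in> \<X> \<union> \<Y>" "v \<in> A" for A v
    unfolding c_def using that uniq by (intro the_equality) blast+
  define r where "r = (\<lambda>A::nat set. SOME v. v \<in> A)"
  have r: "r A \<in> A" if "A \<in> \<X> \<union> \<Y>" for A
    using m that unfolding r_def by (metis some_in_eq)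
  define f where "f = r \<circ> c"
  have f_eq: "f v = r A" if "A \<in> \<X> \<union> \<Y>" "v \<in> A" for A v
    using c_eq[OF that] by (simp add: f_def)
  have r_inj: "r A = r B \<longleftrightarrow> A = B" if "A \<in> \<X> \<union> \<Y>" "B \<in> \<X> \<union> \<Y>" for A B
    using r uniq that by metis
  have ct: "contracts_to G' (map_graph f G')"
  proof (rule contracts_to_map_graph)
    show "finite (pverts G')" using finU by (simp add: G'_def)
    fix v assume "v \<in> pverts G'"
    then obtain A where A: "A \<in> \<X> \<union> \<Y>" "v \<in> A" by (auto simp: G'_def U_def)
    have fv: "f v = r A" "f (r A) = r A" using f_eq[OF A] f_eq[OF A(1) r[OF A(1)]] by auto
    have "(v, r A) \<in> (parcs G \<inter> A \<times> A)\<^sup>*"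
      using m A r[OF A(1)] unfolding connected_in_def by blast
    moreover have "parcs G \<inter> A \<times> A \<subseteq> {(x, y) \<in> parcs G'. f x = f y}"
      using A(1) f_eq[OF A(1)] by (auto simp: G'_def same_def)
    ultimately have "(v, r A) \<in> {(x, y) \<in> parcs G'. f x = f y}\<^sup>*"
      using rtrancl_mono by blast
    then show "f v \<in> pverts G' \<and> f (f v) = f v \<and> (v, f v) \<in> {(x, y) \<in> parcs G'. f x = f y}\<^sup>*"
      using fv r[OF A(1)] A(1) by (auto simp: G'_def U_def)
  qed (fact wf irr symG')+
  have vH: "pverts (map_graph f G') = r ` \<X> \<union> r ` \<Y>"
  proof -
    have "f ` U = r ` (\<X> \<union> \<Y>)"
    proof (intro equalityI subsetI)
      fix x assume "x \<in> f ` U" then show "x \<in> r ` (\<X> \<union> \<Y>)" using f_eq by (auto simp: U_def)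
    next
      fix x assume "x \<in> r ` (\<X> \<union> \<Y>)"
      then obtain A where "A \<in> \<X> \<union> \<Y>" "x = r A" by blast
      then show "x \<in> f ` U" using f_eq[of A "r A"] r[of A] by (force simp: U_def)
    qed
    then show ?thesis by (simp add: map_graph_def G'_def image_Un)
  qed
  have aH: "parcs (map_graph f G') = r ` \<X> \<times> r ` \<Y> \<union> r ` \<Y> \<times> r ` \<X>"
  proof (intro equalityI subrelI)
    fix x y assume "(x, y) \<in> parcs (map_graph f G')"
    then obtain a b where ab: "x = f a" "y = f b" "(a, b) \<in> parcs G'" "f a \<noteq> f b"
      by (auto simp: map_graph_def)
    have "\<not> same a b" using ab(4) f_eq unfolding same_def by metis
    then have "cross a b \<or> cross b a" using ab(3) by (auto simp: G'_def)
    then show "(x, y) \<in> r ` \<X> \<times> r ` \<Y> \<union> r ` \<Y> \<times> r ` \<X>"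
      using f_eq ab(1,2) by (auto simp: cross_def)
  next
    have 1: "(r A, r B) \<in> parcs (map_graph f G') \<and> (r B, r A) \<in> parcs (map_graph f G')"
      if AB: "A \<in> \<X>" "B \<in> \<Y>" for A B
    proof -
      obtain a b where ab: "a \<in> A" "b \<in> B" "(a, b) \<in> parcs G" using m AB by blast
      have "(a, b) \<in> parcs G'" "(b, a) \<in> parcs G'"
        using ab AB symG by (auto simp: G'_def cross_def)
      moreover have "f a = r A" "f b = r B" using f_eq AB ab by auto
      moreover have "r A \<noteq> r B" using r_inj[of A B] AB m by blast
      ultimately show ?thesis by (auto simp: map_graph_def) metis+
    qed
    fix x y assume "(x, y) \<in> r ` \<X> \<times> r ` \<Y> \<union> r ` \<Y> \<times> r ` \<X>"
    then show "(x, y) \<in> parcs (map_graph f G')" using 1 by blast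
  qed
  have "inj_on r (\<X> \<union> \<Y>)" using r_inj by (auto simp: inj_on_def)
  then have cards: "card (r ` \<X>) = s" "card (r ` \<Y>) = t" "r ` \<X> \<inter> r ` \<Y> = {}"
    using m by (auto simp: card_image inj_on_Un)
  have K: "K\<^bsub>s,t\<^esub> (with_proj (map_graph f G'))"
    unfolding complete_bipartite_digraph_pair_def vH aH using m cards by blast
  have "digraph_iso (with_proj (map_graph f G')) (with_proj (map_graph f G'))"
    using pair_graphI_complete_bipartite[OF K]
    by (subst digraph_iso_with_proj_iff) (auto intro!: exI[of _ id] simp: pair_graph_def pair_digraph_def pair_fin_digraph_def map_prod.id)
  then have "is_minor (map_graph f G') G" unfolding is_minor_def using pg sub ct by blast
  then show ?thesis unfolding biclique_minor_free_def using K by blast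
qed

section \<open>Sparsity\<close>

lemma connected_in_singleton: "connected_in E {v}"
  by (simp add: connected_in_def)

lemma connected_in_insert:
  assumes "connected_in E X" "sym E" "x \<in> X" "(x, y) \<in> E"
  shows "connected_in E (insert y X)"
proof -
  let ?R = "E \<inter> insert y X \<times> insert y X"
  have "E \<inter> X \<times> X \<subseteq> ?R" by auto
  then have old: "(a, b) \<in> ?R\<^sup>*" if "a \<in> X" "b \<in> X" for a b
    using assms(1) that rtrancl_mono unfolding connected_in_def by blast
  have e: "(x, y) \<in> ?R" "(y, x) \<in> ?R" using assms by (auto dest: symD)
  have "(a, y) \<in> ?R\<^sup>*" "(y, a) \<in> ?R\<^sup>*" if "a \<in> X" for a
    using old[OF that assms(3)] old[OF assms(3) that] e
    by (meson rtrancl.rtrancl_into_rtrancl converse_rtrancl_into_rtrancl)+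
  then show ?thesis using old unfolding connected_in_def by blast
qed

text \<open>A complete minor on \<open>r\<close> vertices, again in branch-set form.\<close>

definition clique_model :: "nat \<Rightarrow> 'a set \<Rightarrow> 'a rel \<Rightarrow> 'a set set \<Rightarrow> bool" where
  "clique_model r U E \<X> \<longleftrightarrow> finite \<X> \<and> card \<X> = r \<and> disjoint \<X> \<and>
     (\<forall>A\<in>\<X>. A \<noteq> {} \<and> A \<subseteq> U \<and> connected_in E A) \<and>
     (\<forall>A\<in>\<X>. \<forall>B\<in>\<X>. A \<noteq> B \<longrightarrow> (\<exists>a\<in>A. \<exists>b\<in>B. (a, b) \<in> E))"

text \<open>Ordered pairs are counted, so this is twice the number of edges, and its quotient by
  \<open>card U\<close> is the average degree.\<close>

definition arcs_in :: "'a rel \<Rightarrow> 'a set \<Rightarrow> nat" where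
  "arcs_in E U = card (E \<inter> U \<times> U)"

lemma arcs_in_insert:
  assumes "finite U" "y \<notin> U" "sym E" "irrefl E"
  shows "arcs_in E (insert y U) = arcs_in E U + 2 * card (E `` {y} \<inter> U)"
proof -
  let ?N = "E `` {y} \<inter> U"
  have "E \<inter> insert y U \<times> insert y U = (E \<inter> U \<times> U) \<union> ((\<lambda>v. (y, v)) ` ?N \<union> (\<lambda>v. (v, y)) ` ?N)"
    using assms(3,4) by (auto simp: irrefl_def dest: symD)
  moreover have "card ((\<lambda>v. (y, v)) ` ?N \<union> (\<lambda>v. (v, y)) ` ?N) = card ?N + card ?N"
    using assms(1,2) by (subst card_Un_disjoint) (auto simp: card_image inj_on_def)
  moreover have "card ((E \<inter> U \<times> U) \<union> ((\<lambda>v. (y, v)) ` ?N \<union> (\<lambda>v. (v, y)) ` ?N)) =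
      card (E \<inter> U \<times> U) + card ((\<lambda>v. (y, v)) ` ?N \<union> (\<lambda>v. (v, y)) ` ?N)"
    using assms(1,2) by (intro card_Un_disjoint) auto
  ultimately show ?thesis by (simp add: arcs_in_def)
qed

lemma arcs_in_eq_sum:
  assumes "finite U"
  shows "arcs_in E U = (\<Sum>v\<in>U. card (E `` {v} \<inter> U))"
proof -
  have "E \<inter> U \<times> U = Sigma U (\<lambda>v. E `` {v} \<inter> U)" by auto
  then show ?thesis using assms by (simp add: arcs_in_def)
qed

text \<open>
  Mader's bound. A maximal connected set \<open>X\<close> whose contraction keeps the average degree large has a
  neighbourhood of large minimum degree, in which one branch set fewer is found by induction.
\<close>

lemma clique_model_exists:
  fixes E :: "'a rel"
  assumes "sym E" "irrefl E" "finite U" "U \<noteq> {}" "2 ^ r * card U \<le> arcs_in E U"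
  shows "\<exists>\<X>. clique_model r U E \<X>"
  using assms(3-)
proof (induction r arbitrary: U)
  case 0
  show ?case by (intro exI[of _ "{}"]) (simp add: clique_model_def)
next
  case (Suc r)
  let ?K = "2 ^ Suc r :: nat"
  have "\<exists>\<X>. clique_model (Suc r) U E \<X>"
    if "finite U" "U \<noteq> {}" "?K * card U \<le> arcs_in E U" for U
    using that
  proof (induction "card U" arbitrary: U rule: less_induct)
    case less
    define N where "N = (\<lambda>X. (E `` X \<inter> U) - X)"
    \<comment> \<open>Contracting \<open>X\<close> to a point leaves \<open>card (U - X) + 1\<close>
      vertices and \<open>arcs_in E (U - X) + 2 * card (N X)\<close> arcs, so \<open>good\<close>
      says that the average degree is still at least \<open>2 ^ Suc r\<close>.\<close>
    define good where "good = (\<lambda>X. X \<subseteq> U \<and> X \<noteq> {} \<and> connected_in E X \<and>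
      ?K * (card (U - X) + 1) \<le> arcs_in E (U - X) + 2 * card (N X))"
    have "\<exists>X. good X"
    proof -
      obtain x where x: "x \<in> U" using less.prems by blast
      have "arcs_in E (insert x (U - {x})) = arcs_in E (U - {x}) + 2 * card (E `` {x} \<inter> (U - {x}))"
        using less.prems assms by (intro arcs_in_insert) auto
      moreover have "insert x (U - {x}) = U" using x by blast
      moreover have "E `` {x} \<inter> (U - {x}) = N {x}" by (auto simp: N_def)
      moreover have "card (U - {x}) + 1 = card U"
        using x less.prems by (metis Suc_eq_plus1 card_Suc_Diff1)
      ultimately have "?K * (card (U - {x}) + 1) \<le> arcs_in E (U - {x}) + 2 * card (N {x})"
        using less.prems by metis
      then have "good {x}"
        using x by (simp only: good_def) (simp add: connected_in_singleton)
      then show ?thesis by blast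
    qed
    moreover have "card X \<le> card U" if "good X" for X
      using that less.prems by (simp add: good_def card_mono)
    ultimately obtain X where X: "good X" and max: "\<And>Y. good Y \<Longrightarrow> card Y \<le> card X"
      using ex_has_greatest_nat[of good _ card "card U + 1"] by (metis less_Suc_eq_le Suc_eq_plus1)
    have finX: "finite X" "finite (U - X)" "finite (N X)"
      using X less.prems finite_subset[of X U] by (auto simp: good_def N_def)
    show ?case
    proof (cases "N X = {}")
      case True
      have "U - X \<noteq> {}" using X True by (auto simp: good_def arcs_in_def)
      moreover have "card (U - X) < card U"
        using X less.prems by (intro psubset_card_mono) (auto simp: good_def)
      moreover have "?K * card (U - X) \<le> arcs_in E (U - X)" using X True by (simp add: good_def)
      ultimately obtain \<X> where "clique_model (Suc r) (U - X) E \<X>"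
        using less.hyps[of "U - X"] finX by blast
      then have "clique_model (Suc r) U E \<X>" unfolding clique_model_def by blast
      then show ?thesis by blast
    next
      case False
      \<comment> \<open>Adding \<open>y\<close> to \<open>X\<close> removes one vertex and, for each
        neighbour of \<open>y\<close> in \<open>N X\<close> and for the edge to \<open>X\<close>
        itself, two arcs. As maximality forbids \<open>insert y X\<close> to be good, more than
        \<open>2 ^ Suc r\<close> arcs disappear.\<close>
      have deg: "2 ^ r \<le> card (E `` {y} \<inter> N X)" if y: "y \<in> N X" for y
      proof -
        have yU: "y \<in> U" "y \<notin> X" using y by (auto simp: N_def)
        obtain x where x: "x \<in> X" "(x, y) \<in> E" using y by (auto simp: N_def)
        have "connected_in E (insert y X)"
          using connected_in_insert[of E X x y] X x assms(1) by (simp add: good_def)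
        moreover have "\<not> good (insert y X)"
          using max[of "insert y X"] finX yU by auto
        ultimately have less': "arcs_in E (U - insert y X) + 2 * card (N (insert y X)) <
            ?K * (card (U - insert y X) + 1)"
          using X yU by (auto simp: good_def not_le)
        define Q where "Q = E `` {y} \<inter> ((U - X) - N X)"
        have Ux: "U - X = insert y (U - insert y X)" using yU by blast
        have a: "arcs_in E (U - X) = arcs_in E (U - insert y X) + 2 * card (E `` {y} \<inter> (U - insert y X))"
          by (subst Ux, rule arcs_in_insert) (use less.prems assms in auto)
        have b: "card (U - X) = card (U - insert y X) + 1"
          by (subst Ux) (use less.prems in simp)
        have ny: "y \<notin> E `` {y}" using assms(2) by (auto simp: irrefl_def)
        have "E `` {y} \<inter> (U - insert y X) = Q \<union> (E `` {y} \<inter> N X)"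
          using ny by (auto simp: Q_def N_def)
        then have c: "card (E `` {y} \<inter> (U - insert y X)) = card Q + card (E `` {y} \<inter> N X)"
          using finX by (simp add: card_Un_disjoint Q_def Diff_Int_distrib2) (subst card_Un_disjoint, auto)
        have "N (insert y X) = (N X - {y}) \<union> Q"
          using yU ny by (auto simp: N_def Q_def)
        then have "card (N (insert y X)) = card (N X - {y}) + card Q"
          using finX by (simp add: Q_def) (subst card_Un_disjoint, auto)
        then have d: "card (N (insert y X)) + 1 = card (N X) + card Q"
          using y finX by (metis add.commute add.left_commute card_Suc_Diff1 plus_1_eq_Suc)
        have "?K * (card (U - X) + 1) \<le> arcs_in E (U - X) + 2 * card (N X)"
          using X by (simp add: good_def)
        then show ?thesis using less' a b c d by (simp add: algebra_simps)
      qed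
      have "2 ^ r * card (N X) \<le> arcs_in E (N X)"
        unfolding arcs_in_eq_sum[OF finX(3)]
        using sum_mono[of "N X" "\<lambda>_. 2 ^ r" "\<lambda>y. card (E `` {y} \<inter> N X)"] deg
        by (simp add: mult.commute)
      then obtain \<X> where \<X>: "clique_model r (N X) E \<X>"
        using Suc.IH[of "N X"] finX False by blast
      note \<X>' = \<X>[unfolded clique_model_def]
      have new: "X \<notin> \<X>" "\<And>A. A \<in> \<X> \<Longrightarrow> X \<inter> A = {}"
      proof -
        show "\<And>A. A \<in> \<X> \<Longrightarrow> X \<inter> A = {}" using \<X>' by (auto simp: N_def)
        then show "X \<notin> \<X>" using X by (auto simp: good_def)
      qed
      have adj: "(\<exists>a\<in>X. \<exists>b\<in>A. (a, b) \<in> E) \<and> (\<exists>b\<in>A. \<exists>a\<in>X. (b, a) \<in> E)" if A: "A \<in> \<X>" for A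
      proof -
        obtain b where "b \<in> A" "b \<in> N X" using \<X>' A by blast
        then obtain a where "a \<in> X" "(a, b) \<in> E" by (auto simp: N_def)
        then show ?thesis using \<open>b \<in> A\<close> assms(1) by (blast dest: symD)
      qed
      have "clique_model (Suc r) U E (insert X \<X>)"
        unfolding clique_model_def
      proof (intro conjI)
        show "disjoint (insert X \<X>)" using \<X>' new(2) by (auto simp: disjoint_def)
        show "\<forall>A\<in>insert X \<X>. A \<noteq> {} \<and> A \<subseteq> U \<and> connected_in E A"
          using \<X>' X by (auto simp: good_def N_def)
        show "\<forall>A\<in>insert X \<X>. \<forall>B\<in>insert X \<X>. A \<noteq> B \<longrightarrow> (\<exists>a\<in>A. \<exists>b\<in>B. (a, b) \<in> E)"
          using \<X>' adj by blast
      qed (use \<X>' new in auto)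
      then show ?thesis by blast
    qed
  qed
  then show ?case using Suc.prems by blast
qed

section \<open>Quadratic forms of sparse graphs\<close>

locale simple_graph =
  fixes V :: "'a set" and E :: "'a rel"
  assumes finV: "finite V" and E_sub: "E \<subseteq> V \<times> V" and E_sym: "sym E" and E_irr: "irrefl E"
begin

lemma edge_sym: "(a, b) \<in> E \<Longrightarrow> (b, a) \<in> E"
  using E_sym by (rule symD)

lemma edge_neq: "(a, b) \<in> E \<Longrightarrow> a \<noteq> b"
  using E_irr by (auto simp: irrefl_def)

lemma edge_verts: "(a, b) \<in> E \<Longrightarrow> a \<in> V \<and> b \<in> V"
  using E_sub by blast

lemma adj_sym: "adj E a b = adj E b a"
  using edge_sym by (auto simp: adj_def)

lemma adj_irr [simp]: "adj E a a = 0"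
  using E_irr by (auto simp: adj_def irrefl_def)

lemma sum_adj:
  assumes "finite U"
  shows "(\<Sum>u\<in>U. adj E v u * f u) = (\<Sum>u\<in>E `` {v} \<inter> U. f u)"
proof -
  have "(\<Sum>u\<in>U. adj E v u * f u) = (\<Sum>u\<in>U. if u \<in> E `` {v} then f u else 0)"
    by (intro sum.cong) (auto simp: adj_def)
  also have "\<dots> = (\<Sum>u\<in>U \<inter> E `` {v}. f u)" using assms by (simp add: sum.inter_restrict)
  finally show ?thesis by (simp add: Int_commute)
qed

lemma card_nbrs_eq_sum:
  assumes "finite U"
  shows "real (card (E `` {v} \<inter> U)) = (\<Sum>u\<in>U. adj E v u)"
  using sum_adj[OF assms, of v "\<lambda>_. 1"] by simp

end

lemma adj_nonneg [simp]: "0 \<le> adj E i j"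
  by (simp add: adj_def)

locale biclique_free = simple_graph +
  fixes s t :: nat
  assumes no_model: "\<And>\<X> \<Y>. \<not> biclique_model s t V E \<X> \<Y>"
begin

text \<open>Singletons would serve as branch sets: the biclique would already be a subgraph.\<close>

lemma few_common_nbrs:
  assumes "S \<subseteq> V" "card S = s" "finite S"
  shows "card {v \<in> V. \<forall>a\<in>S. (a, v) \<in> E} < t"
proof (rule ccontr)
  assume "\<not> ?thesis"
  then obtain T where T: "T \<subseteq> {v \<in> V. \<forall>a\<in>S. (a, v) \<in> E}" "card T = t" "finite T"
    by (meson not_less obtain_subset_with_card_n)
  have ST: "S \<inter> T = {}" using T(1) edge_neq by blast
  have "biclique_model s t V E ((\<lambda>v. {v}) ` S) ((\<lambda>v. {v}) ` T)"
    unfolding biclique_model_def using assms T ST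
    by (auto simp: card_image disjoint_def connected_in_singleton)
  then show False using no_model by blast
qed

text \<open>Otherwise Mader's bound gives a complete minor on \<open>s + t\<close> vertices, and its
  branch sets split into the two sides of a biclique model.\<close>

lemma sparse:
  assumes "U \<subseteq> V" "U \<noteq> {}"
  shows "arcs_in E U < 2 ^ (s + t) * card U"
proof (rule ccontr)
  assume "\<not> ?thesis"
  then obtain \<X> where \<X>: "clique_model (s + t) U E \<X>"
    using clique_model_exists[OF E_sym E_irr, of U "s + t"] assms finV
    by (meson finite_subset not_less)
  note \<X>' = \<X>[unfolded clique_model_def]
  obtain \<Y> where \<Y>: "\<Y> \<subseteq> \<X>" "card \<Y> = s" "finite \<Y>"
    using \<X>' by (metis le_add1 obtain_subset_with_card_n)
  have Un: "\<Y> \<union> (\<X> - \<Y>) = \<X>" using \<Y> by blast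
  have "card (\<X> - \<Y>) = t" using \<X>' \<Y> by (simp add: card_Diff_subset)
  then have "biclique_model s t V E \<Y> (\<X> - \<Y>)"
    unfolding biclique_model_def Un
  proof (intro conjI)
    show "\<forall>A\<in>\<X>. A \<noteq> {} \<and> A \<subseteq> V \<and> connected_in E A"
      using \<X>' assms(1) by (meson order_trans)
    show "\<forall>A\<in>\<Y>. \<forall>B\<in>\<X> - \<Y>. \<exists>a\<in>A. \<exists>b\<in>B. (a, b) \<in> E"
      using \<X>' \<Y>(1) by (metis DiffD1 DiffD2 subsetD)
  qed (use \<X>' \<Y> in auto)
  then show False using no_model by blast
qed

lemma low_degree_vertex:
  assumes "U \<subseteq> V" "U \<noteq> {}"
  obtains v where "v \<in> U" "card (E `` {v} \<inter> U) < 2 ^ (s + t)"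
proof (rule ccontr)
  assume "\<not> thesis"
  then have "2 ^ (s + t) \<le> card (E `` {v} \<inter> U)" if "v \<in> U" for v
    using that not_less \<open>\<And>v. \<lbrakk>v \<in> U; _ v\<rbrakk> \<Longrightarrow> thesis\<close> by blast
  moreover have finU: "finite U" using assms finV finite_subset by blast
  ultimately have "2 ^ (s + t) * card U \<le> arcs_in E U"
    unfolding arcs_in_eq_sum[OF finU]
    using sum_mono[of U "\<lambda>_. 2 ^ (s + t)" "\<lambda>y. card (E `` {y} \<inter> U)"] by (simp add: mult.commute)
  then show False using sparse[OF assms] by simp
qed

text \<open>Induction along a degeneracy order: a vertex of least degree is removed repeatedly, so
  each vertex has few edges back to those already present. A form can then be estimated by charging
  every edge to its later endpoint.\<close>

lemma peel_induct [consumes 1, case_names empty insert]: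
  assumes "U \<subseteq> V" "P {}"
    and "\<And>w U. w \<notin> U \<Longrightarrow> insert w U \<subseteq> V \<Longrightarrow> finite U \<Longrightarrow> P U \<Longrightarrow>
           card (E `` {w} \<inter> U) \<le> 2 ^ (s + t) \<Longrightarrow> P (insert w U)"
  shows "P U"
  using assms(1)
proof (induction "card U" arbitrary: U)
  case 0
  then show ?case using assms(2) finV finite_subset by fastforce
next
  case (Suc n)
  then have "U \<noteq> {}" and fin: "finite U" using finV finite_subset by auto
  then obtain w where w: "w \<in> U" "card (E `` {w} \<inter> U) < 2 ^ (s + t)"
    using low_degree_vertex Suc.prems by metis
  have "E `` {w} \<inter> U = E `` {w} \<inter> (U - {w})" using edge_neq by blast
  then have "P (insert w (U - {w}))"
    using w Suc.hyps(2) Suc.prems fin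
    by (intro assms(3) Suc.hyps(1)) (auto simp: insert_absorb)
  then show ?case using w(1) by (simp add: insert_absorb)
qed

lemma qform_insert:
  assumes "w \<notin> U" "finite U"
  shows "qform (insert w U) (adj E) x = qform U (adj E) x + 2 * (\<Sum>u\<in>E `` {w} \<inter> U. x w * x u)"
proof -
  have "(\<Sum>i\<in>U. adj E i w * x i * x w) = (\<Sum>u\<in>U. adj E w u * (x w * x u))"
    by (intro sum.cong) (auto simp: adj_sym[of _ w] mult_ac)
  moreover have "(\<Sum>j\<in>U. adj E w j * x w * x j) = (\<Sum>u\<in>U. adj E w u * (x w * x u))"
    by (simp add: mult_ac)
  ultimately show ?thesis
    using assms by (simp add: qform_def sum.distrib sum_adj)
qed

text \<open>Each back edge is split by the weighted inequality
  \<open>2 x y <= g x^2 + y^2 / g\<close>. The later endpoint pays the first part at most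
  \<open>2 ^ (s + t)\<close> times, the earlier one the second part at most as often as its
  degree.\<close>

lemma qform_degree_bound:
  fixes x :: "'a \<Rightarrow> real"
  assumes "U \<subseteq> V" "g > 0"
  shows "qform U (adj E) x \<le> 2 ^ (s + t) * g * sqnorm U x
           + (\<Sum>v\<in>U. real (card (E `` {v} \<inter> U)) * (x v)\<^sup>2) / g"
  using assms(1)
proof (induction rule: peel_induct)
  case empty
  then show ?case by (simp add: qform_def sqnorm_def)
next
  case (insert w U)
  let ?N = "E `` {w} \<inter> U" and ?C = "2 ^ (s + t) :: real"
  have am: "2 * (x w * x u) \<le> g * (x w)\<^sup>2 + (x u)\<^sup>2 / g" for u
  proof -
    have "0 \<le> (g * x w - x u)\<^sup>2 / g" using assms(2) by simp
    also have "\<dots> = g * (x w)\<^sup>2 + (x u)\<^sup>2 / g - 2 * (x w * x u)"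
      using assms(2) by (simp add: power2_eq_square field_simps)
    finally show ?thesis by simp
  qed
  have "2 * (\<Sum>u\<in>?N. x w * x u) \<le> (\<Sum>u\<in>?N. g * (x w)\<^sup>2 + (x u)\<^sup>2 / g)"
    unfolding sum_distrib_left using am by (intro sum_mono)
  also have "\<dots> = real (card ?N) * (g * (x w)\<^sup>2) + (\<Sum>u\<in>?N. (x u)\<^sup>2) / g"
    by (simp add: sum.distrib sum_divide_distrib)
  also have "\<dots> \<le> ?C * (g * (x w)\<^sup>2) + (\<Sum>u\<in>?N. (x u)\<^sup>2) / g"
  proof -
    have "real (card ?N) \<le> ?C" using of_nat_mono[OF insert.hyps(4), where 'a = real] by simp
    then have "real (card ?N) * (g * (x w)\<^sup>2) \<le> ?C * (g * (x w)\<^sup>2)"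
      using assms(2) by (intro mult_right_mono) auto
    then show ?thesis by simp
  qed
  finally have 1: "2 * (\<Sum>u\<in>?N. x w * x u) \<le> ?C * (g * (x w)\<^sup>2) + (\<Sum>u\<in>?N. (x u)\<^sup>2) / g" .
  have 2: "(\<Sum>v\<in>U. real (card (E `` {v} \<inter> insert w U)) * (x v)\<^sup>2)
      = (\<Sum>v\<in>U. real (card (E `` {v} \<inter> U)) * (x v)\<^sup>2) + (\<Sum>u\<in>?N. (x u)\<^sup>2)"
  proof -
    have "real (card (E `` {v} \<inter> insert w U)) = card (E `` {v} \<inter> U) + adj E w v" for v
      using insert(1,3) by (simp add: card_nbrs_eq_sum adj_sym[of w v] del: of_nat_Suc)
    then show ?thesis
      using insert(3) by (simp add: distrib_right sum.distrib sum_adj)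
  qed
  have "(\<Sum>v\<in>U. real (card (E `` {v} \<inter> insert w U)) * (x v)\<^sup>2)
      \<le> (\<Sum>v\<in>insert w U. real (card (E `` {v} \<inter> insert w U)) * (x v)\<^sup>2)"
    using insert(1,3) by simp
  then have 3: "((\<Sum>v\<in>U. real (card (E `` {v} \<inter> U)) * (x v)\<^sup>2) + (\<Sum>u\<in>?N. (x u)\<^sup>2)) / g
      \<le> (\<Sum>v\<in>insert w U. real (card (E `` {v} \<inter> insert w U)) * (x v)\<^sup>2) / g"
    unfolding 2 using assms(2) by (intro divide_right_mono) auto
  have "sqnorm (insert w U) x = (x w)\<^sup>2 + sqnorm U x"
    using insert(1,3) by (simp add: sqnorm_def)
  then show ?case
    using qform_insert[OF insert(1,3), of x] insert.IH 1 3
    by (simp add: algebra_simps add_divide_distrib)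
qed

text \<open>The choice \<open>g = sqrt D\<close> balances the two terms. Degeneracy thus improves
  the trivial bound \<open>D\<close> on the form to order \<open>sqrt D\<close>.\<close>

lemma qform_max_degree_bound:
  fixes x :: "'a \<Rightarrow> real"
  assumes "U \<subseteq> V" "D > 0" "\<And>v. v \<in> U \<Longrightarrow> real (card (E `` {v} \<inter> U)) \<le> D"
  shows "qform U (adj E) x \<le> (2 ^ (s + t) + 1) * sqrt D * sqnorm U x"
proof -
  have "(\<Sum>v\<in>U. real (card (E `` {v} \<inter> U)) * (x v)\<^sup>2) \<le> D * sqnorm U x"
    unfolding sqnorm_def sum_distrib_left using assms(3) by (intro sum_mono mult_right_mono) auto
  then have "(\<Sum>v\<in>U. real (card (E `` {v} \<inter> U)) * (x v)\<^sup>2) / sqrt D \<le> D * sqnorm U x / sqrt D"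
    using assms(2) by (intro divide_right_mono) auto
  also have "\<dots> = sqrt D * sqnorm U x"
    using assms(2) by (simp add: field_simps)
  finally show ?thesis
    using qform_degree_bound[OF assms(1), of "sqrt D" x] assms(2) by (simp add: algebra_simps)
qed

text \<open>In contrast to the previous bounds this one is linear in the absolute values. That makes
  it comparable, vertex by vertex, with the gain from new edges to the hubs.\<close>

lemma qform_sup_bound:
  assumes "U \<subseteq> V" "\<And>v. v \<in> U \<Longrightarrow> \<bar>x v\<bar> \<le> d" "d \<ge> 0"
  shows "qform U (adj E) (\<lambda>v. \<bar>x v\<bar>) \<le> 2 * 2 ^ (s + t) * d * (\<Sum>v\<in>U. \<bar>x v\<bar>)"
  using assms(1,2)
proof (induction rule: peel_induct)
  case empty
  then show ?case by (simp add: qform_def)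
next
  case (insert w U)
  let ?N = "E `` {w} \<inter> U" and ?C = "2 ^ (s + t) :: real"
  have "(\<Sum>u\<in>?N. \<bar>x w\<bar> * \<bar>x u\<bar>) \<le> (\<Sum>u\<in>?N. \<bar>x w\<bar> * d)"
    using insert.prems by (intro sum_mono mult_left_mono) auto
  also have "\<dots> = real (card ?N) * (\<bar>x w\<bar> * d)" by simp
  also have "\<dots> \<le> ?C * (\<bar>x w\<bar> * d)"
    using of_nat_mono[OF insert.hyps(4), where 'a = real] assms(3)
    by (intro mult_right_mono) auto
  finally show ?case
    using qform_insert[OF insert(1,3), of "\<lambda>v. \<bar>x v\<bar>"] insert.IH insert.hyps(1,3) insert.prems by (simp add: algebra_simps)
qed

end

section \<open>Existence of hubs\<close>

lemma sum_le_sqrt_sqnorm: "\<bar>\<Sum>u\<in>U. f u * g u\<bar> \<le> sqrt (sqnorm U f) * sqrt (sqnorm U g)"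
proof -
  have "\<bar>\<Sum>u\<in>U. f u * g u\<bar> \<le> (\<Sum>u\<in>U. \<bar>f u\<bar> * \<bar>g u\<bar>)"
    by (rule order_trans[OF sum_abs]) (simp add: abs_mult)
  then show ?thesis using L2_set_mult_ineq[of f g U] by (simp add: L2_set_def sqnorm_def)
qed

lemma sum_squared_le_card:
  fixes f :: "'a \<Rightarrow> real"
  shows "(\<Sum>u\<in>U. f u)\<^sup>2 \<le> card U * sqnorm U f"
proof -
  have "\<bar>\<Sum>u\<in>U. f u\<bar> \<le> sqrt (card U) * sqrt (sqnorm U f)"
    using sum_le_sqrt_sqnorm[of "\<lambda>_. 1" f U] by (simp add: sqnorm_def)
  then have "\<bar>\<Sum>u\<in>U. f u\<bar>\<^sup>2 \<le> (sqrt (card U) * sqrt (sqnorm U f))\<^sup>2"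
    by (intro power_mono) auto
  then show ?thesis by (simp add: power_mult_distrib sqnorm_nonneg)
qed

lemma sqnorm_mono: "A \<subseteq> B \<Longrightarrow> finite B \<Longrightarrow> sqnorm A x \<le> sqnorm B x"
  unfolding sqnorm_def by (intro sum_mono2) auto

lemma sqnorm_Un_disjoint: "finite A \<Longrightarrow> finite B \<Longrightarrow> A \<inter> B = {} \<Longrightarrow> sqnorm (A \<union> B) x = sqnorm A x + sqnorm B x"
  unfolding sqnorm_def by (rule sum.union_disjoint)

lemma qform_Un_disjoint:
  assumes "finite A" "finite B" "A \<inter> B = {}" "\<And>i j. M i j = M j i"
  shows "qform (A \<union> B) M x = qform A M x + qform B M x + 2 * (\<Sum>a\<in>A. x a * (\<Sum>b\<in>B. M a b * x b))"
proof -
  have "(\<Sum>i\<in>B. \<Sum>j\<in>A. M i j * x i * x j) = (\<Sum>j\<in>A. \<Sum>i\<in>B. M i j * x i * x j)"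
    by (rule sum.swap)
  also have "\<dots> = (\<Sum>a\<in>A. x a * (\<Sum>b\<in>B. M a b * x b))"
    unfolding sum_distrib_left using assms(4) by (intro sum.cong) (auto simp: mult_ac)
  finally have 1: "(\<Sum>i\<in>B. \<Sum>j\<in>A. M i j * x i * x j) = (\<Sum>a\<in>A. x a * (\<Sum>b\<in>B. M a b * x b))" .
  have 2: "(\<Sum>i\<in>A. \<Sum>j\<in>B. M i j * x i * x j) = (\<Sum>a\<in>A. x a * (\<Sum>b\<in>B. M a b * x b))"
    unfolding sum_distrib_left by (intro sum.cong) (auto simp: mult_ac)
  show ?thesis
    unfolding qform_def using assms(1-3) 1 2 by (simp add: sum.union_disjoint sum.distrib)
qed

lemma qform_le_card:
  assumes "finite U" "\<And>i j. \<bar>M i j\<bar> \<le> 1"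
  shows "qform U M x \<le> card U * sqnorm U x"
proof -
  have "qform U M x \<le> (\<Sum>i\<in>U. \<Sum>j\<in>U. \<bar>x i\<bar> * \<bar>x j\<bar>)"
    unfolding qform_def
  proof (intro sum_mono)
    fix i j
    have "M i j * x i * x j \<le> \<bar>M i j\<bar> * (\<bar>x i\<bar> * \<bar>x j\<bar>)"
      by (metis abs_ge_self abs_mult mult.assoc)
    also have "\<dots> \<le> 1 * (\<bar>x i\<bar> * \<bar>x j\<bar>)" using assms(2) by (intro mult_right_mono) auto
    finally show "M i j * x i * x j \<le> \<bar>x i\<bar> * \<bar>x j\<bar>" by simp
  qed
  also have "\<dots> = (\<Sum>i\<in>U. \<bar>x i\<bar>)\<^sup>2" by (simp add: power2_eq_square sum_product)
  also have "\<dots> \<le> card U * sqnorm U (\<lambda>i. \<bar>x i\<bar>)" by (rule sum_squared_le_card)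
  finally show ?thesis by (simp add: sqnorm_def)
qed

lemma adj_le_1: "\<bar>adj E i j\<bar> \<le> 1"
  by (simp add: adj_def)

lemma sqrt_dominates:
  fixes a c :: real
  assumes "c > 0"
  shows "\<exists>N. \<forall>n\<ge>N. a \<le> c * sqrt (real n)"
proof -
  obtain N where N: "real N \<ge> (a / c)\<^sup>2" using real_arch_simple by blast
  have "a \<le> c * sqrt (real n)" if "n \<ge> N" for n
  proof -
    have "(a / c)\<^sup>2 \<le> real n" using N that by linarith
    then have "sqrt ((a / c)\<^sup>2) \<le> sqrt (real n)" by (rule real_sqrt_le_mono)
    then have "\<bar>a / c\<bar> \<le> sqrt (real n)" by simp
    then have "a / c \<le> sqrt (real n)" by linarith
    then show ?thesis using assms by (simp add: field_simps)
  qed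
  then show ?thesis by blast
qed

lemma sqrt_add_le: "0 \<le> a \<Longrightarrow> 0 \<le> b \<Longrightarrow> sqrt (a + b) \<le> sqrt a + sqrt b"
  by (rule real_le_lsqrt) (auto simp: power2_sum)

context biclique_free
begin

text \<open>Vertices of linear degree. Sparsity leaves only boundedly many, and the hubs are found
  among them.\<close>

definition heavy :: "real \<Rightarrow> 'a set" where
  "heavy h = {v \<in> V. h * card V \<le> card (E `` {v} \<inter> V)}"

lemma card_heavy:
  assumes "h > 0" "V \<noteq> {}"
  shows "card (heavy h) \<le> 2 ^ (s + t) / h"
proof -
  have fin: "finite (heavy h)" using finV by (simp add: heavy_def)
  have n: "real (card V) > 0" using assms(2) finV by (simp add: card_gt_0_iff)
  have "h * card V * card (heavy h) = (\<Sum>v\<in>heavy h. h * card V)" by simp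
  also have "\<dots> \<le> (\<Sum>v\<in>heavy h. real (card (E `` {v} \<inter> V)))"
    by (intro sum_mono) (simp add: heavy_def)
  also have "\<dots> \<le> (\<Sum>v\<in>V. real (card (E `` {v} \<inter> V)))"
    using finV by (intro sum_mono2) (auto simp: heavy_def)
  also have "\<dots> = real (arcs_in E V)" using finV by (simp add: arcs_in_eq_sum)
  also have "\<dots> \<le> real (2 ^ (s + t) * card V)"
    using sparse[of V] assms(2) of_nat_le_iff by (metis order.refl less_imp_le)
  finally have "h * card (heavy h) * card V \<le> 2 ^ (s + t) * real (card V)" by (simp add: mult_ac)
  then have "h * card (heavy h) \<le> 2 ^ (s + t)" using n by (rule mult_right_le_imp_le)
  then show ?thesis using assms(1) by (simp add: field_simps)
qed

text \<open>Such a vertex is a common neighbour of some \<open>s\<close>-subset of \<open>B\<close>;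
  there are at most \<open>2 ^ card B\<close> subsets, each with fewer than \<open>t\<close> common
  neighbours.\<close>

lemma exceptional_bound:
  assumes "B \<subseteq> V"
  shows "card {v \<in> V. s \<le> card (E `` {v} \<inter> B)} \<le> 2 ^ card B * t"
proof -
  have finB: "finite B" using assms finV finite_subset by blast
  let ?F = "{S. S \<subseteq> B \<and> card S = s}"
  let ?c = "\<lambda>S. {v \<in> V. \<forall>a\<in>S. (a, v) \<in> E}"
  have finF: "finite ?F" using finB by simp
  have "{v \<in> V. s \<le> card (E `` {v} \<inter> B)} \<subseteq> (\<Union>S\<in>?F. ?c S)"
  proof
    fix v assume v: "v \<in> {v \<in> V. s \<le> card (E `` {v} \<inter> B)}"
    then obtain S where "S \<subseteq> E `` {v} \<inter> B" "card S = s"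
      by (metis (no_types, lifting) mem_Collect_eq obtain_subset_with_card_n)
    then show "v \<in> (\<Union>S\<in>?F. ?c S)" using v edge_sym by blast
  qed
  then have "card {v \<in> V. s \<le> card (E `` {v} \<inter> B)} \<le> card (\<Union>S\<in>?F. ?c S)"
    using finF finV by (intro card_mono) auto
  also have "\<dots> \<le> (\<Sum>S\<in>?F. card (?c S))" by (rule card_UN_le[OF finF])
  also have "\<dots> \<le> (\<Sum>S\<in>?F. t)"
  proof (rule sum_mono)
    fix S assume "S \<in> ?F"
    then show "card (?c S) \<le> t"
      using few_common_nbrs[of S] assms finB finite_subset[of S B] subset_trans[of S B V]
      by (simp add: less_imp_le)
  qed
  also have "\<dots> = card ?F * t" by simp
  also have "\<dots> \<le> 2 ^ card B * t"
  proof -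
    have "card ?F \<le> card (Pow B)" using finB by (intro card_mono) auto
    then show ?thesis using finB by (simp add: card_Pow)
  qed
  finally show ?thesis .
qed

definition hub_sum :: "'a set \<Rightarrow> ('a \<Rightarrow> real) \<Rightarrow> 'a \<Rightarrow> real" where
  "hub_sum B x v = (\<Sum>b\<in>E `` {v} \<inter> B. x b)"

text \<open>
  For a top eigenvector \<open>x\<close> the squared hub sums add up to about \<open>(s - 1) |V|\<close> times the mass of \<open>x\<close> on \<open>B\<close>,
  while a vertex with fewer than \<open>s\<close> neighbours in \<open>B\<close> contributes at most \<open>s - 1\<close> times that mass. Hence
  almost all vertices nearly attain equality in Cauchy-Schwarz, which forces a common neighbourhood.
\<close>

definition nice :: "'a set \<Rightarrow> ('a \<Rightarrow> real) \<Rightarrow> real \<Rightarrow> 'a set" where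
  "nice B x th = {v \<in> V. card (E `` {v} \<inter> B) < s \<and> (1 - th) * (real s - 1) * sqnorm B x < (hub_sum B x v)\<^sup>2}"

lemma hub_sum_sq_le:
  fixes x :: "'a \<Rightarrow> real"
  assumes "B \<subseteq> V"
  shows "(hub_sum B x v)\<^sup>2 \<le> card (E `` {v} \<inter> B) * sqnorm (E `` {v} \<inter> B) x"
    and "sqnorm (E `` {v} \<inter> B) x \<le> sqnorm B x"
proof -
  have finB: "finite B" using assms finV finite_subset by blast
  show "(hub_sum B x v)\<^sup>2 \<le> card (E `` {v} \<inter> B) * sqnorm (E `` {v} \<inter> B) x"
    unfolding hub_sum_def by (rule sum_squared_le_card)
  show "sqnorm (E `` {v} \<inter> B) x \<le> sqnorm B x" using finB by (intro sqnorm_mono) auto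
qed

text \<open>Vertices with \<open>s\<close> or more neighbours in \<open>B\<close> are boundedly many
  and go into the additive term. Every other vertex outside \<open>nice\<close> loses the factor
  \<open>1 - th\<close>.\<close>

lemma hub_sum_total:
  fixes z th :: real and x :: "'a \<Rightarrow> real"
  assumes BV: "B \<subseteq> V" and s: "s \<ge> 1" and th: "0 \<le> th" "th \<le> 1"
    and z: "z * card V \<le> card (V - nice B x th)" and b: "card B \<le> b"
  shows "(\<Sum>v\<in>V. (hub_sum B x v)\<^sup>2) \<le> ((real s - 1) * card V * (1 - th * z) + 2 ^ b * t * b) * sqnorm B x"
proof -
  have finB: "finite B" using BV finV finite_subset by blast
  let ?p = "sqnorm B x" and ?X = "{v \<in> V. s \<le> card (E `` {v} \<inter> B)}"
  let ?w = "\<lambda>v. if v \<in> nice B x th then 1 else 1 - th"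
  have p: "?p \<ge> 0" by (rule sqnorm_nonneg)
  have finX: "finite ?X" using finV by simp
  have pt: "(hub_sum B x v)\<^sup>2 \<le> ?w v * ((real s - 1) * ?p) + (if v \<in> ?X then b * ?p else 0)" if "v \<in> V" for v
  proof -
    have le: "(hub_sum B x v)\<^sup>2 \<le> real (card (E `` {v} \<inter> B)) * ?p"
      using hub_sum_sq_le[OF BV, where x = x and v = v] by (meson mult_left_mono of_nat_0_le_iff order_trans)
    have w0: "?w v * ((real s - 1) * ?p) \<ge> 0" using p s th by auto
    show ?thesis
    proof (cases "v \<in> ?X")
      case True
      have "card (E `` {v} \<inter> B) \<le> b" using b card_mono[OF finB, of "E `` {v} \<inter> B"] by simp
      then have "real (card (E `` {v} \<inter> B)) * ?p \<le> b * ?p" using p by (intro mult_right_mono) auto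
      then show ?thesis using True le w0 by simp
    next
      case False
      then have c: "card (E `` {v} \<inter> B) < s" using that by simp
      then have "real (card (E `` {v} \<inter> B)) \<le> real s - 1" by linarith
      then have "real (card (E `` {v} \<inter> B)) * ?p \<le> (real s - 1) * ?p" using p by (intro mult_right_mono) auto
      then have "(hub_sum B x v)\<^sup>2 \<le> ?w v * ((real s - 1) * ?p)"
        using le c that by (auto simp: nice_def mult_ac)
      then show ?thesis unfolding if_not_P[OF False] by simp
    qed
  qed
  have "(\<Sum>v\<in>V. (hub_sum B x v)\<^sup>2) \<le> (\<Sum>v\<in>V. ?w v * ((real s - 1) * ?p) + (if v \<in> ?X then b * ?p else 0))"
    by (intro sum_mono pt)
  also have "\<dots> = (\<Sum>v\<in>V. ?w v) * ((real s - 1) * ?p) + (\<Sum>v\<in>V. if v \<in> ?X then b * ?p else 0)"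
    by (simp only: sum.distrib sum_distrib_right)
  also have "(\<Sum>v\<in>V. if v \<in> ?X then b * ?p else 0) = card ?X * (b * ?p)"
  proof -
    have "(\<Sum>v\<in>V. if v \<in> ?X then b * ?p else 0) = (\<Sum>v\<in>V \<inter> ?X. b * ?p)"
      by (rule sum.inter_restrict[OF finV, symmetric])
    also have "V \<inter> ?X = ?X" by blast
    finally show ?thesis by simp
  qed
  also have "(\<Sum>v\<in>V. ?w v) = card V - th * card (V - nice B x th)"
  proof -
    have "(\<Sum>v\<in>V. ?w v) = (\<Sum>v\<in>V. 1 - (if v \<in> V - nice B x th then th else 0))"
      by (intro sum.cong) auto
    also have "\<dots> = card V - (\<Sum>v\<in>V. if v \<in> V - nice B x th then th else 0)"
      by (simp add: sum_subtractf)
    also have "(\<Sum>v\<in>V. if v \<in> V - nice B x th then th else 0) = (\<Sum>v\<in>V \<inter> (V - nice B x th). th)"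
      using finV by (subst sum.inter_restrict) auto
    also have "V \<inter> (V - nice B x th) = V - nice B x th" by blast
    finally show ?thesis by (simp add: mult.commute)
  qed
  also have "(real (card V) - th * real (card (V - nice B x th))) * ((real s - 1) * ?p)
      \<le> (real (card V) - th * (z * card V)) * ((real s - 1) * ?p)"
    using z th p s by (intro mult_right_mono diff_left_mono mult_left_mono) auto
  also have "card ?X * (b * ?p) \<le> (2 ^ b * t) * (b * ?p)"
  proof (rule mult_right_mono)
    have "card ?X \<le> 2 ^ card B * t" by (rule exceptional_bound[OF BV])
    also have "\<dots> \<le> 2 ^ b * t" using b by simp
    finally show "real (card ?X) \<le> 2 ^ b * t"
      by (rule of_nat_mono)
  qed (use p in simp)
  finally show ?thesis by (simp add: algebra_simps)
qed

text \<open>Heavy pairs contribute a constant and light pairs order \<open>sqrt (h n)\<close>. The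
  cross term is estimated by Cauchy-Schwarz; the masses \<open>p\<close> and \<open>q\<close> of the
  two parts add up to 1, so \<open>sqrt (q p)\<close> is at most one half.\<close>

lemma qform_heavy_bound:
  fixes z th h :: real and x :: "'a \<Rightarrow> real"
  assumes nV: "V \<noteq> {}" and s: "s \<ge> 1" and h: "h > 0" and th: "0 \<le> th" "th \<le> 1"
    and x: "sqnorm V x = 1"
    and z: "0 \<le> z" "z * card V \<le> card (V - nice (heavy h) x th)" and b: "card (heavy h) \<le> b"
  shows "qform V (adj E) x \<le> real b + 2 * sqrt (2 ^ b * t * b)
      + sqrt ((real s - 1) * card V * (1 - th * z)) + (2 ^ (s + t) + 1) * sqrt (h * card V)"
proof -
  let ?B = "heavy h" and ?R = "V - heavy h" and ?n = "real (card V)"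
  have BV: "?B \<subseteq> V" by (auto simp: heavy_def)
  have fin: "finite ?B" "finite ?R" using BV finV finite_subset by auto
  have Un: "V = ?R \<union> ?B" using BV by blast
  have n: "?n > 0" using nV finV by (simp add: card_gt_0_iff)
  have "card (V - nice ?B x th) \<le> card V" using finV by (intro card_mono) auto
  then have "z * ?n \<le> 1 * ?n" using z(2) by linarith
  then have z1: "z \<le> 1" using n by (rule mult_right_le_imp_le)
  have thz: "th * z \<le> 1" using th z1 z(1) by (meson mult_le_one)
  define p q where "p = sqnorm ?B x" and "q = sqnorm ?R x"
  have pq: "p + q = 1" "p \<ge> 0" "q \<ge> 0"
  proof -
    have "sqnorm (?R \<union> ?B) x = q + p"
      unfolding p_def q_def using fin by (intro sqnorm_Un_disjoint) auto
    then show "p + q = 1" using x by (simp only: Un[symmetric])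
  qed (auto simp: p_def q_def sqnorm_nonneg)
  have split: "qform V (adj E) x = qform ?R (adj E) x + qform ?B (adj E) x
      + 2 * (\<Sum>a\<in>?R. x a * (\<Sum>b\<in>?B. adj E a b * x b))"
    by (subst Un, rule qform_Un_disjoint) (use fin adj_sym in auto)
  have 1: "qform ?B (adj E) x \<le> b"
  proof -
    have "qform ?B (adj E) x \<le> card ?B * p"
      unfolding p_def using fin adj_le_1 by (intro qform_le_card) auto
    also have "\<dots> \<le> real b * 1" using b pq by (intro mult_mono) auto
    finally show ?thesis by simp
  qed
  have 2: "qform ?R (adj E) x \<le> (2 ^ (s + t) + 1) * sqrt (h * ?n)"
  proof -
    have "qform ?R (adj E) x \<le> (2 ^ (s + t) + 1) * sqrt (h * ?n) * sqnorm ?R x"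
    proof (rule qform_max_degree_bound)
      fix v assume v: "v \<in> ?R"
      then have "real (card (E `` {v} \<inter> V)) < h * ?n" by (auto simp: heavy_def)
      moreover have "card (E `` {v} \<inter> ?R) \<le> card (E `` {v} \<inter> V)"
        using finV by (intro card_mono) auto
      ultimately show "real (card (E `` {v} \<inter> ?R)) \<le> h * ?n" by linarith
    qed (use h n in auto)
    also have "\<dots> \<le> (2 ^ (s + t) + 1) * sqrt (h * ?n) * 1"
      using pq h by (intro mult_left_mono) (auto simp: q_def)
    finally show ?thesis by simp
  qed
  define A c where "A = (real s - 1) * ?n * (1 - th * z)" and "c = real (2 ^ b * t * b)"
  have Ac: "A \<ge> 0" "c \<ge> 0" using s thz by (auto simp: A_def c_def)
  have 3: "(\<Sum>a\<in>?R. x a * (\<Sum>b\<in>?B. adj E a b * x b)) \<le> sqrt q * sqrt ((A + c) * p)"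
  proof -
    have "(\<Sum>a\<in>?R. x a * (\<Sum>b\<in>?B. adj E a b * x b)) = (\<Sum>a\<in>?R. x a * hub_sum ?B x a)"
      using fin by (simp add: sum_adj hub_sum_def)
    also have "\<dots> \<le> sqrt q * sqrt (sqnorm ?R (hub_sum ?B x))"
      using sum_le_sqrt_sqnorm[of x "hub_sum ?B x" ?R] by (simp add: q_def)
    also have "sqnorm ?R (hub_sum ?B x) \<le> sqnorm V (hub_sum ?B x)"
      using finV by (intro sqnorm_mono) auto
    also have "\<dots> \<le> (A + c) * p"
      using hub_sum_total[OF BV s th z(2) b] by (simp add: sqnorm_def A_def c_def p_def)
    finally show ?thesis using pq by (simp add: mult_left_mono)
  qed
  have "sqrt q * sqrt ((A + c) * p) = sqrt (q * p) * sqrt (A + c)"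
    by (simp add: real_sqrt_mult)
  also have "\<dots> \<le> (1 / 2) * (sqrt A + sqrt c)"
  proof (rule mult_mono)
    show "sqrt (q * p) \<le> 1 / 2" using arith_geo_mean_sqrt[of q p] pq by simp
  qed (use sqrt_add_le Ac pq in auto)
  finally have "2 * (sqrt q * sqrt ((A + c) * p)) \<le> sqrt A + sqrt c" by simp
  then have "2 * (\<Sum>a\<in>?R. x a * (\<Sum>b\<in>?B. adj E a b * x b)) \<le> sqrt A + 2 * sqrt c"
    using 3 Ac by (smt (verit) real_sqrt_ge_zero)
  then show ?thesis using split 1 2 unfolding A_def c_def by linarith
qed

text \<open>If the neighbourhoods differ, some \<open>b\<close> is adjacent to \<open>v\<close> and
  not to \<open>w\<close>. Almost all mass on \<open>B\<close> lies on the neighbours of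
  \<open>w\<close>, so \<open>x b\<close> is negligible, and \<open>v\<close> effectively has only
  \<open>s - 2\<close> neighbours, too few for its hub sum.\<close>

lemma nice_same_nbrs:
  fixes th :: real and x :: "'a \<Rightarrow> real"
  assumes BV: "B \<subseteq> V" and s: "s \<ge> 2" and th: "th = 1 / (16 * (real s)\<^sup>2)"
    and v: "v \<in> nice B x th" and w: "w \<in> nice B x th"
  shows "card (E `` {v} \<inter> B) = s - 1" "E `` {v} \<inter> B = E `` {w} \<inter> B"
proof -
  have finB: "finite B" using BV finV finite_subset by blast
  define p where "p = sqnorm B x"
  have p0: "p \<ge> 0" by (simp add: p_def sqnorm_nonneg)
  have sr: "real s \<ge> 2" using s by simp
  have th0: "th > 0" using s by (simp add: th)
  have ths: "th * real s \<le> 1 / 32"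
  proof -
    have "th * real s = 1 / (16 * real s)" using sr by (simp add: th power2_eq_square)
    also have "\<dots> \<le> 1 / (16 * 2)" using sr by (intro divide_left_mono) auto
    finally show ?thesis by simp
  qed
  have *: "card (E `` {v} \<inter> B) = s - 1 \<and> (1 - th) * p < sqnorm (E `` {v} \<inter> B) x \<and>
      (1 - th) * (real s - 1) * p < (hub_sum B x v)\<^sup>2 \<and> p > 0" if v: "v \<in> nice B x th" for v
  proof -
    let ?T = "E `` {v} \<inter> B"
    have c: "card ?T < s" and g: "(1 - th) * (real s - 1) * p < (hub_sum B x v)\<^sup>2"
      using v by (auto simp: nice_def p_def)
    note le = hub_sum_sq_le[OF BV, where x = x and v = v]
    have le2: "real (card ?T) * sqnorm ?T x \<le> real (card ?T) * p"
      using le(2) by (intro mult_left_mono) (auto simp: p_def)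
    have lt: "(1 - th) * (real s - 1) * p < real (card ?T) * p" using g le(1) le2 by linarith
    have p: "p > 0"
    proof (rule ccontr)
      assume "\<not> p > 0" then show False using lt p0 by simp
    qed
    have lt2: "(1 - th) * (real s - 1) < real (card ?T)" using lt p by (rule mult_right_less_imp_less[OF _ less_imp_le])
    have card: "card ?T = s - 1"
    proof (rule ccontr)
      assume "card ?T \<noteq> s - 1"
      then have "real (card ?T) \<le> real s - 2" using c by linarith
      then have "1 < th * (real s - 1)" using lt2 by (simp add: algebra_simps)
      also have "\<dots> \<le> th * real s" using th0 by simp
      finally show False using ths by simp
    qed
    have "(1 - th) * (real s - 1) * p < (real s - 1) * sqnorm ?T x"
    proof -
      have "real (card ?T) = real s - 1" using card s by (simp add: of_nat_diff)
      then show ?thesis using g le(1) by simp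
    qed
    then have "(real s - 1) * ((1 - th) * p) < (real s - 1) * sqnorm ?T x" by (simp add: mult_ac)
    then have "(1 - th) * p < sqnorm ?T x" using sr by (simp add: mult_less_cancel_left_pos)
    then show ?thesis using card g p by blast
  qed
  show cv: "card (E `` {v} \<inter> B) = s - 1" using *[OF v] by blast
  show "E `` {v} \<inter> B = E `` {w} \<inter> B"
  proof (rule ccontr)
    let ?T = "E `` {v} \<inter> B" and ?T' = "E `` {w} \<inter> B"
    assume ne: "?T \<noteq> ?T'"
    have fin: "finite ?T" "finite ?T'" using finB by auto
    have "\<not> ?T \<subseteq> ?T'" using card_subset_eq[OF fin(2), of ?T] cv *[OF w] ne by auto
    then obtain b where b: "b \<in> ?T" "b \<notin> ?T'" by blast
    have "sqnorm (insert b ?T') x \<le> p" unfolding p_def using b finB by (intro sqnorm_mono) auto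
    then have "(x b)\<^sup>2 + sqnorm ?T' x \<le> p" using fin b by (simp add: sqnorm_def)
    then have xb: "(x b)\<^sup>2 < th * p" using *[OF w] by (simp add: algebra_simps)
    define r where "r = sqrt p"
    have r: "r > 0" "r\<^sup>2 = p" using *[OF v] by (auto simp: r_def)
    have "(x b)\<^sup>2 < (r / (4 * real s))\<^sup>2" using xb by (simp add: th power_divide power_mult_distrib r(2) mult.commute)
    then have xb': "\<bar>x b\<bar> < r / (4 * real s)" using abs_le_square_iff[of "r / (4 * real s)" "x b"] r by force
    \<comment> \<open>The constant 16 in \<open>th\<close> is made for this splitting:
      \<open>x b\<close> is below \<open>r / (4 s)\<close> and \<open>S\<close> at most
      \<open>s r\<close> in absolute value, so the cross term \<open>2 x_b S\<close> costs at most
      \<open>p / 2\<close>.\<close>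
    define S where "S = (\<Sum>u\<in>?T - {b}. x u)"
    have hs: "hub_sum B x v = x b + S" unfolding hub_sum_def S_def using b fin by (simp add: sum.remove)
    have S2: "S\<^sup>2 \<le> (real s - 2) * p"
    proof -
      have "S\<^sup>2 \<le> real (card (?T - {b})) * sqnorm (?T - {b}) x"
        unfolding S_def by (rule sum_squared_le_card)
      also have "\<dots> \<le> real (card (?T - {b})) * p"
        unfolding p_def using finB by (intro mult_left_mono sqnorm_mono) auto
      also have "real (card (?T - {b})) = real s - 2" using cv b fin s by (simp add: of_nat_diff)
      finally show ?thesis .
    qed
    have "S\<^sup>2 \<le> (real s * r)\<^sup>2"
    proof -
      have "real s * 1 \<le> real s * real s" using sr by (intro mult_left_mono) auto
      then have "real s - 2 \<le> (real s)\<^sup>2" unfolding power2_eq_square by linarith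
      then have "(real s - 2) * p \<le> (real s)\<^sup>2 * p" using p0 by (rule mult_right_mono)
      then show ?thesis using S2 by (simp add: power_mult_distrib r(2))
    qed
    then have Sa: "\<bar>S\<bar> \<le> real s * r" using r sr by (simp add: abs_le_square_iff[symmetric])
    have "x b * S \<le> \<bar>x b\<bar> * \<bar>S\<bar>" by (metis abs_ge_self abs_mult)
    also have "\<dots> \<le> (r / (4 * real s)) * (real s * r)" using xb' Sa r by (intro mult_mono) auto
    also have "\<dots> = p / 4" using sr r(2) by (simp add: power2_eq_square)
    finally have xS: "x b * S \<le> p / 4" .
    have "(hub_sum B x v)\<^sup>2 = (x b)\<^sup>2 + 2 * (x b * S) + S\<^sup>2" by (simp add: hs power2_sum)
    also have "\<dots> \<le> th * p + p / 2 + (real s - 2) * p" using xb xS S2 by linarith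
    also have "\<dots> \<le> (1 - th) * (real s - 1) * p"
    proof -
      have "th + 1 / 2 + (real s - 2) \<le> (1 - th) * (real s - 1)" using ths by (simp add: algebra_simps)
      then have "(th + 1 / 2 + (real s - 2)) * p \<le> (1 - th) * (real s - 1) * p" using p0 by (rule mult_right_mono)
      then show ?thesis by (simp add: algebra_simps)
    qed
    finally show False using *[OF v] by simp
  qed
qed

end

section \<open>Locating the hubs\<close>

definition common_nbrs :: "'a set \<Rightarrow> 'a rel \<Rightarrow> 'a set \<Rightarrow> 'a set" where
  "common_nbrs V E K = {v \<in> V. \<forall>k\<in>K. (k, v) \<in> E}"

text \<open>The estimate with no gain from missing vertices, that is with \<open>th = z = 0\<close>.
  Bounding \<open>p\<close> from above is what forces \<open>q\<close> to be large when
  \<open>p + q\<close> is.\<close>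

lemma qform_upper_bound:
  assumes s: "s \<ge> 2" and e: "e > 0"
  shows "\<exists>N. \<forall>V (E :: 'a rel) x. biclique_free V E s t \<longrightarrow> N \<le> card V \<longrightarrow> sqnorm V x = 1 \<longrightarrow>
     qform V (adj E) x \<le> sqrt ((real s - 1) * card V) + e * sqrt (card V)"
proof -
  define C where "C = (2 ^ (s + t) + 1 :: real)"
  have C: "C > 0" by (simp add: C_def add_pos_nonneg)
  define h where "h = (e / (2 * C))\<^sup>2"
  have h: "h > 0" using e C by (simp add: h_def)
  have Ch: "C * sqrt h = e / 2" using C e by (simp add: h_def)
  define b where "b = nat \<lceil>2 ^ (s + t) / h\<rceil>"
  obtain N where N: "\<And>n. n \<ge> N \<Longrightarrow> real b + 2 * sqrt (2 ^ b * t * b) \<le> e / 2 * sqrt (real n)"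
    using sqrt_dominates[of "e / 2"] e by (metis half_gt_zero)
  show ?thesis
  proof (intro exI[of _ "max N 1"] allI impI)
    fix V and E :: "'a rel" and x
    assume bf: "biclique_free V E s t" and n: "max N 1 \<le> card V" and x: "sqnorm V x = 1"
    interpret biclique_free V E s t by fact
    have nV: "V \<noteq> {}" using n by auto
    have "real (card (heavy h)) \<le> 2 ^ (s + t) / h" using h nV by (rule card_heavy)
    then have cb: "card (heavy h) \<le> b" unfolding b_def by linarith
    have "qform V (adj E) x \<le> real b + 2 * sqrt (2 ^ b * t * b)
      + sqrt ((real s - 1) * card V * (1 - 0 * 0)) + (2 ^ (s + t) + 1) * sqrt (h * card V)"
      by (rule qform_heavy_bound) (use nV s h x cb in auto)
    also have "(2 ^ (s + t) + 1) * sqrt (h * card V) = e / 2 * sqrt (card V)"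
      using Ch by (simp add: real_sqrt_mult C_def[symmetric])
    finally show "qform V (adj E) x \<le> sqrt ((real s - 1) * card V) + e * sqrt (card V)"
      using N[of "card V"] n by simp
  qed
qed

text \<open>If a fraction \<open>z\<close> of the vertices were not nice, the factor
  \<open>1 - th z\<close> under the root would cost order \<open>sqrt n\<close>, more than the
  assumed lower bound allows. So some vertex is nice, and its heavy neighbours are shared by all
  nice vertices.\<close>

theorem hubs_exist:
  fixes z :: real
  assumes s: "s \<ge> 2" and z: "0 < z" "z < 1"
  shows "\<exists>N. \<forall>V (E :: 'a rel) x. biclique_free V E s t \<longrightarrow> N \<le> card V \<longrightarrow> sqnorm V x = 1 \<longrightarrow>
     sqrt ((real s - 1) * (real (card V) - real s + 1)) \<le> qform V (adj E) x \<longrightarrow>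
     (\<exists>K\<subseteq>V. card K = s - 1 \<and> (1 - z) * card V \<le> card (common_nbrs V E K))"
proof -
  define th where "th = 1 / (16 * (real s)\<^sup>2)"
  have th: "th > 0" "th \<le> 1" 
  proof -
    show "th > 0" using s by (simp add: th_def)
    have "1 \<le> (real s)\<^sup>2" using s by (simp add: one_le_power)
    then show "th \<le> 1" by (simp add: th_def divide_le_eq)
  qed
  have tz: "0 < th * z" "th * z < 1" using th z mult_le_less_imp_less[of th 1 z 1] by auto
  define C where "C = (2 ^ (s + t) + 1 :: real)"
  have C: "C > 0" by (simp add: C_def add_pos_nonneg)
  \<comment> \<open>The loss is at least \<open>th z / 2\<close> times \<open>sqrt n\<close>. This
    \<open>h\<close> lets the light pairs recover only half of it, and the bounded terms at most a
    further quarter.\<close>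
  define h where "h = (th * z / (4 * C))\<^sup>2"
  have h: "h > 0" using th z C by (simp add: h_def)
  have Ch: "C * sqrt h = th * z / 4" using C tz by (simp add: h_def)
  define b where "b = nat \<lceil>2 ^ (s + t) / h\<rceil>"
  obtain N where N: "\<And>n. n \<ge> N \<Longrightarrow> real b + 2 * sqrt (2 ^ b * t * b) + real s \<le> th * z / 8 * sqrt (real n)"
    using sqrt_dominates[of "th * z / 8"] tz by (metis zero_less_divide_iff zero_less_numeral)
  show ?thesis
  proof (intro exI[of _ "max N s"] allI impI)
    fix V and E :: "'a rel" and x
    assume bf: "biclique_free V E s t" and n: "max N s \<le> card V" and x: "sqnorm V x = 1"
      and q: "sqrt ((real s - 1) * (real (card V) - real s + 1)) \<le> qform V (adj E) x"
    interpret biclique_free V E s t by fact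
    let ?n = "real (card V)"
    have nV: "V \<noteq> {}" using n s by auto
    have n0: "?n > 0" "?n \<ge> real s" using n s by auto
    have BV: "heavy h \<subseteq> V" by (auto simp: heavy_def)
    have "real (card (heavy h)) \<le> 2 ^ (s + t) / h" using h nV by (rule card_heavy)
    then have cb: "card (heavy h) \<le> b" unfolding b_def by linarith
    have bad: "real (card (V - nice (heavy h) x th)) < z * ?n"
    proof (rule ccontr)
      assume "\<not> ?thesis"
      then have zz: "z * ?n \<le> card (V - nice (heavy h) x th)" by simp
      have "qform V (adj E) x \<le> real b + 2 * sqrt (2 ^ b * t * b)
        + sqrt ((real s - 1) * ?n * (1 - th * z)) + (2 ^ (s + t) + 1) * sqrt (h * ?n)"
        by (rule qform_heavy_bound) (use nV s h x cb zz z th in auto)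
      also have "(2 ^ (s + t) + 1) * sqrt (h * ?n) = th * z / 4 * sqrt ?n"
        using Ch by (simp add: real_sqrt_mult C_def[symmetric])
      also have "sqrt ((real s - 1) * ?n * (1 - th * z)) \<le> sqrt ((real s - 1) * ?n) - th * z / 2 * sqrt ?n"
      proof -
        have "sqrt (1 - th * z) \<le> 1 - th * z / 2"
          using tz by (intro real_le_lsqrt) (auto simp: power2_diff)
        then have "sqrt ((real s - 1) * ?n) * sqrt (1 - th * z) \<le> sqrt ((real s - 1) * ?n) * (1 - th * z / 2)"
          using s by (intro mult_left_mono) auto
        moreover have "sqrt ?n \<le> sqrt ((real s - 1) * ?n)"
        proof (rule real_sqrt_le_mono)
          have "1 * ?n \<le> (real s - 1) * ?n" using s by (intro mult_right_mono) auto
          then show "?n \<le> (real s - 1) * ?n" by simp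
        qed
        then have "th * z / 2 * sqrt ?n \<le> th * z / 2 * sqrt ((real s - 1) * ?n)"
          using tz by (intro mult_left_mono) auto
        moreover have "A * (1 - th * z / 2) = A - th * z / 2 * A" for A by (simp add: algebra_simps)
        ultimately show ?thesis
          unfolding real_sqrt_mult[of "(real s - 1) * ?n" "1 - th * z"] by (smt (verit))
      qed
      also have "sqrt ((real s - 1) * ?n) \<le> sqrt ((real s - 1) * (?n - real s + 1)) + real s"
      proof -
        have "(real s - 1) * ?n = (real s - 1) * (?n - real s + 1) + (real s - 1)\<^sup>2"
          by (simp add: algebra_simps power2_eq_square)
        then have "sqrt ((real s - 1) * ?n) \<le> sqrt ((real s - 1) * (?n - real s + 1)) + sqrt ((real s - 1)\<^sup>2)"
          using s n0 sqrt_add_le[of "(real s - 1) * (?n - real s + 1)" "(real s - 1)\<^sup>2"] by simp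
        then show ?thesis using s by simp
      qed
      finally have "sqrt ((real s - 1) * (?n - real s + 1)) + th * z / 4 * sqrt ?n
          \<le> sqrt ((real s - 1) * (?n - real s + 1)) + (real b + 2 * sqrt (2 ^ b * t * b) + real s)"
        using q by linarith
      then have "th * z / 4 * sqrt ?n \<le> th * z / 8 * sqrt ?n" using N[of "card V"] n by simp
      moreover have "th * z * sqrt ?n > 0" using tz n0 by simp
      ultimately show False by simp
    qed
    have nsub: "nice (heavy h) x th \<subseteq> V" by (auto simp: nice_def)
    have "real (card (V - nice (heavy h) x th)) = ?n - card (nice (heavy h) x th)"
      using nsub finV by (simp add: card_Diff_subset finite_subset of_nat_diff card_mono)
    then have many: "(1 - z) * ?n \<le> card (nice (heavy h) x th)"
      using bad by (simp add: algebra_simps)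
    then have "real (card (nice (heavy h) x th)) > 0" using z n0 by (smt (verit) mult_pos_pos)
    then obtain v where v: "v \<in> nice (heavy h) x th" by (metis card_gt_0_iff equals0I of_nat_0_less_iff)
    let ?K = "E `` {v} \<inter> heavy h"
    have "nice (heavy h) x th \<subseteq> common_nbrs V E ?K"
    proof
      fix w assume w: "w \<in> nice (heavy h) x th"
      have "?K = E `` {w} \<inter> heavy h"
        by (rule nice_same_nbrs(2)[OF BV s th_def v w])
      then show "w \<in> common_nbrs V E ?K"
        using w nsub edge_sym by (auto simp: common_nbrs_def)
    qed
    then have "card (nice (heavy h) x th) \<le> card (common_nbrs V E ?K)"
      using finV by (intro card_mono) (auto simp: common_nbrs_def)
    then have "(1 - z) * ?n \<le> card (common_nbrs V E ?K)" using many by linarith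
    moreover have "card ?K = s - 1" by (rule nice_same_nbrs(1)[OF BV s th_def v v])
    moreover have "?K \<subseteq> V" using BV by blast
    ultimately show "\<exists>K\<subseteq>V. card K = s - 1 \<and> (1 - z) * ?n \<le> card (common_nbrs V E K)"
      by blast
  qed
qed

section \<open>Weighted hub matrices\<close>

lemma cubic_upper:
  fixes l p B :: real
  assumes "l > 0" "p > 0" "B \<ge> 0" "p ^ 3 \<le> l\<^sup>2 * (p + B)"
  shows "p \<le> l + B"
proof (rule ccontr)
  assume "\<not> ?thesis"
  then have p: "p > l + B" by simp
  have "l\<^sup>2 * B \<le> (p * (p + l)) * B"
  proof (rule mult_right_mono)
    have "l * l \<le> p * (p + l)" using p assms by (intro mult_mono) auto
    then show "l\<^sup>2 \<le> p * (p + l)" by (simp add: power2_eq_square)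
  qed (use assms in auto)
  also have "\<dots> < (p * (p + l)) * (p - l)" using p assms by (intro mult_strict_left_mono) auto
  also have "\<dots> = p ^ 3 - l\<^sup>2 * p" by (simp add: power3_eq_cube power2_eq_square algebra_simps)
  finally show False using assms(4) by (simp add: algebra_simps)
qed

text \<open>With \<open>p = l + a\<close> the difference \<open>p^3 - l^2 p\<close> equals
  \<open>2 l^2 a + 3 l a^2 + a^3\<close>. The middle term is nonnegative and is dropped, and the
  first one dominates, so \<open>a\<close> is at most \<open>g1 / 2\<close> up to order
  \<open>1 / l\<close>.\<close>

lemma cubic_refined:
  fixes l p B :: real
  assumes l: "l \<ge> 1" and a: "\<bar>p - l\<bar> \<le> B" and p: "p \<ge> l / 2" "p \<ge> 1"
    and G: "\<bar>g2\<bar> \<le> G" "C \<ge> 0" and le: "p ^ 3 \<le> l\<^sup>2 * (p + g1 + g2 / p + C / p\<^sup>2)"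
  shows "p - l \<le> g1 / 2 + (2 * (G + C) + B ^ 3) / (2 * l)"
proof -
  define a where "a = p - l"
  have "g2 / p + C / p\<^sup>2 \<le> G / p + C / p"
  proof (rule add_mono)
    show "g2 / p \<le> G / p" using G p by (intro divide_right_mono) auto
    have "p \<le> p\<^sup>2" using p by (simp add: power2_eq_square)
    then show "C / p\<^sup>2 \<le> C / p" using G p by (intro divide_left_mono) auto
  qed
  also have "\<dots> = (G + C) / p" by (simp add: add_divide_distrib)
  also have "\<dots> \<le> (G + C) / (l / 2)" using p l G by (intro divide_left_mono) auto
  also have "\<dots> = 2 * (G + C) / l" by simp
  finally have 1: "g2 / p + C / p\<^sup>2 \<le> 2 * (G + C) / l" .
  have "p ^ 3 \<le> l\<^sup>2 * (p + g1 + 2 * (G + C) / l)"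
  proof -
    have "l\<^sup>2 * (p + g1 + g2 / p + C / p\<^sup>2) \<le> l\<^sup>2 * (p + g1 + 2 * (G + C) / l)"
      using 1 by (intro mult_left_mono) auto
    then show ?thesis using le by linarith
  qed
  also have "\<dots> = l\<^sup>2 * p + l\<^sup>2 * g1 + 2 * (G + C) * l"
    using l by (simp add: field_simps power2_eq_square)
  finally have 2: "p ^ 3 - l\<^sup>2 * p \<le> l\<^sup>2 * g1 + 2 * (G + C) * l" by simp
  have "p ^ 3 - l\<^sup>2 * p = 2 * l\<^sup>2 * a + 3 * l * a\<^sup>2 + a ^ 3"
    by (simp add: a_def power3_eq_cube power2_eq_square algebra_simps)
  moreover have "3 * l * a\<^sup>2 \<ge> 0" using l by simp
  moreover have "- (a ^ 3) \<le> B ^ 3 * l"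
  proof -
    have "- (a ^ 3) \<le> \<bar>a\<bar> ^ 3" by (metis abs_ge_minus_self power_abs)
    also have "\<dots> \<le> B ^ 3" using a by (intro power_mono) (auto simp: a_def)
    also have "\<dots> * 1 \<le> B ^ 3 * l" using a l by (intro mult_left_mono) auto
    finally show ?thesis by simp
  qed
  ultimately have "2 * l\<^sup>2 * a \<le> l\<^sup>2 * g1 + (2 * (G + C) + B ^ 3) * l"
    using 2 by (simp add: algebra_simps)
  moreover have "l\<^sup>2 * (g1 + Q / l) = l\<^sup>2 * g1 + Q * l" for Q
    using l by (simp add: field_simps power2_eq_square)
  ultimately have "l\<^sup>2 * (2 * a) \<le> l\<^sup>2 * (g1 + (2 * (G + C) + B ^ 3) / l)" by simp
  then have "2 * a \<le> g1 + (2 * (G + C) + B ^ 3) / l" using l by (simp add: mult_le_cancel_left)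
  then have "a \<le> (g1 + (2 * (G + C) + B ^ 3) / l) / 2" by simp
  also have "\<dots> = g1 / 2 + (2 * (G + C) + B ^ 3) / (2 * l)" by (simp add: add_divide_distrib mult.commute)
  finally show ?thesis by (simp add: a_def)
qed

text \<open>
  With \<open>u = p - q\<close> one has \<open>(p\<^sup>3 + q\<^sup>3) / (p + q) = ((p + q)\<^sup>2 + 3u\<^sup>2) / 4\<close>, so adding the two cubic
  inequalities bounds \<open>p + q\<close> directly.
\<close>

lemma spread_expansion_bound:
  fixes G C :: real
  assumes G: "G \<ge> 0" "C \<ge> 0"
  defines "B \<equiv> 2 * G + C"
  defines "c1 \<equiv> 2 * (G + C) + B ^ 3"
  defines "C' \<equiv> 16 * G * (2 * B + B\<^sup>2) + 16 * C + 6 * G * c1"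
  assumes l: "l \<ge> 2 * B + 2" and g: "\<bar>g1\<bar> \<le> G" "\<bar>g2\<bar> \<le> G" and pq: "p + q \<ge> 2 * l" "p \<ge> 1" "q \<ge> 1"
    and p: "p ^ 3 \<le> l\<^sup>2 * (p + g1 + g2 / p + C / p\<^sup>2)"
    and q: "q ^ 3 \<le> l\<^sup>2 * (q - g1 + g2 / q + C / q\<^sup>2)"
  shows "(p + q)\<^sup>2 \<le> 4 * l\<^sup>2 + 4 * g2 - 3 * g1\<^sup>2 + C' / l"
proof -
  have B0: "B \<ge> 0" using G by (simp add: B_def)
  have l1: "l \<ge> 1" "l > 0" using l B0 by auto
  have up: "r \<le> l + B" if r: "r \<ge> 1" and h: "\<bar>h\<bar> \<le> G" and le: "r ^ 3 \<le> l\<^sup>2 * (r + h + g2 / r + C / r\<^sup>2)" for r h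
  proof (rule cubic_upper)
    have a1: "g2 / r \<le> G" 
    proof -
      have "g2 / r \<le> G / r" using g r by (intro divide_right_mono) auto
      also have "\<dots> \<le> G / 1" using G r by (intro divide_left_mono) auto
      finally show ?thesis by simp
    qed
    have a2: "C / r\<^sup>2 \<le> C"
    proof -
      have "C / r\<^sup>2 \<le> C / 1" using G r by (intro divide_left_mono) (auto simp: one_le_power)
      then show ?thesis by simp
    qed
    have "l\<^sup>2 * (r + h + g2 / r + C / r\<^sup>2) \<le> l\<^sup>2 * (r + B)"
      using h a1 a2 by (intro mult_left_mono) (auto simp: B_def)
    then show "r ^ 3 \<le> l\<^sup>2 * (r + B)" using le by linarith
  qed (use l1 r B0 in auto)
  have pu: "p \<le> l + B" by (rule up[OF pq(2) g(1) p])
  have qu: "q \<le> l + B" using up[of q "- g1"] pq(3) g(1) q by simp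
  define a b where "a = p - l" and "b = q - l"
  have ab: "\<bar>a\<bar> \<le> B" "\<bar>b\<bar> \<le> B" "a + b \<ge> 0" using pu qu pq by (auto simp: a_def b_def)
  have half: "p \<ge> l / 2" "q \<ge> l / 2" using ab l B0 by (auto simp: a_def b_def abs_le_iff)
  have a_le: "a \<le> g1 / 2 + c1 / (2 * l)"
    unfolding a_def c1_def
    by (rule cubic_refined) (use l1 ab half pq g G p in \<open>auto simp: a_def\<close>)
  have b_le: "b \<le> - g1 / 2 + c1 / (2 * l)"
    unfolding b_def c1_def
    by (rule cubic_refined[of _ _ _ g2]) (use l1 ab half pq g G q in \<open>auto simp: b_def\<close>)
  define u S where "u = p - q" and "S = p + q"
  have u_ab: "u = a - b" by (simp add: u_def a_def b_def)
  \<comment> \<open>Only upper bounds for \<open>a\<close> and \<open>b\<close> are known. Together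
    with \<open>a + b >= 0\<close>, from the lower bound on the spread, they become two-sided and
    determine \<open>u\<close> up to order \<open>1 / l\<close>.\<close>
  have "\<bar>u - g1\<bar> \<le> c1 / l"
  proof -
    have "\<bar>a - b - g1\<bar> \<le> 2 * (c1 / (2 * l))"
      using a_le b_le ab(3) by (intro abs_leI) linarith+
    then show ?thesis by (simp add: u_ab)
  qed
  then have u2: "g1\<^sup>2 - 2 * G * c1 / l \<le> u\<^sup>2"
  proof -
    have "g1\<^sup>2 \<le> u\<^sup>2 + 2 * (g1 * (g1 - u))"
      using zero_le_power2[of "g1 - u"] by (simp add: power2_eq_square algebra_simps)
    also have "g1 * (g1 - u) \<le> \<bar>g1\<bar> * \<bar>g1 - u\<bar>" by (metis abs_ge_self abs_mult)
    also have "\<bar>g1\<bar> * \<bar>g1 - u\<bar> \<le> G * (c1 / l)"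
      using g(1) \<open>\<bar>u - g1\<bar> \<le> c1 / l\<close> G by (intro mult_mono) (auto simp: abs_minus_commute)
    finally show ?thesis by simp
  qed
  have S: "S \<ge> 2 * l" "S > 0" using pq l1 by (auto simp: S_def)
  have pos: "p > 0" "q > 0" using pq by auto
  have "p ^ 3 + q ^ 3 \<le> l\<^sup>2 * (p + g1 + g2 / p + C / p\<^sup>2) + l\<^sup>2 * (q - g1 + g2 / q + C / q\<^sup>2)"
    using p q by linarith
  also have "\<dots> = l\<^sup>2 * S + l\<^sup>2 * (g2 / p + g2 / q) + l\<^sup>2 * (C / p\<^sup>2 + C / q\<^sup>2)"
    by (simp add: S_def algebra_simps)
  also have "g2 / p + g2 / q = S * (g2 / (p * q))" using pos by (simp add: S_def field_simps)
  also have "l\<^sup>2 * (C / p\<^sup>2 + C / q\<^sup>2) \<le> S * (4 * C / l)"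
  proof -
    have C1: "C / r\<^sup>2 \<le> C / (l / 2)\<^sup>2" if "r \<ge> l / 2" for r
    proof -
      have "(l / 2)\<^sup>2 \<le> r\<^sup>2" using that l1 by (intro power_mono) auto
      then show ?thesis using G l1 that by (intro divide_left_mono) auto
    qed
    have "l\<^sup>2 * (C / p\<^sup>2 + C / q\<^sup>2) \<le> l\<^sup>2 * (C / (l / 2)\<^sup>2 + C / (l / 2)\<^sup>2)"
      using C1 half by (intro mult_left_mono add_mono) auto
    also have "\<dots> = 2 * l * (4 * C / l)" using l1 by (simp add: field_simps power2_eq_square)
    also have "\<dots> \<le> S * (4 * C / l)" using S G l1 by (intro mult_right_mono) auto
    finally show ?thesis .
  qed
  also have "p ^ 3 + q ^ 3 = S * ((S\<^sup>2 + 3 * u\<^sup>2) / 4)"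
    by (simp add: S_def u_def power3_eq_cube power2_eq_square algebra_simps)
  finally have "S * ((S\<^sup>2 + 3 * u\<^sup>2) / 4) \<le> S * (l\<^sup>2 + l\<^sup>2 * (g2 / (p * q)) + 4 * C / l)"
    by (simp add: algebra_simps)
  then have main: "(S\<^sup>2 + 3 * u\<^sup>2) / 4 \<le> l\<^sup>2 + l\<^sup>2 * (g2 / (p * q)) + 4 * C / l"
    using S(2) by (simp only: mult_le_cancel_left_pos)
  have "l\<^sup>2 * (g2 / (p * q)) \<le> g2 + 4 * G * (2 * B + B\<^sup>2) / l"
  proof -
    have pq4: "l\<^sup>2 / 4 \<le> p * q"
    proof -
      have "(l / 2) * (l / 2) \<le> p * q" using half l1 pos by (intro mult_mono) auto
      then show ?thesis by (simp add: power2_eq_square)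
    qed
    have "l\<^sup>2 - p * q = - (l * (a + b)) - a * b"
      by (simp add: a_def b_def algebra_simps power2_eq_square)
    then have "\<bar>l\<^sup>2 - p * q\<bar> \<le> \<bar>l * (a + b)\<bar> + \<bar>a * b\<bar>" by linarith
    also have "\<bar>l * (a + b)\<bar> \<le> l * (2 * B)" using ab l1 by (simp add: abs_mult)
    also have "\<bar>a * b\<bar> \<le> B * B" unfolding abs_mult using ab by (intro mult_mono) auto
    also have "l * (2 * B) + B * B \<le> l * (2 * B) + l * (B * B)"
      using l1 mult_right_mono[of 1 l "B * B"] by simp
    finally have d: "\<bar>l\<^sup>2 - p * q\<bar> \<le> l * (2 * B + B\<^sup>2)" by (simp add: algebra_simps power2_eq_square)
    have "l\<^sup>2 * (g2 / (p * q)) - g2 = g2 * (l\<^sup>2 - p * q) / (p * q)" using pos by (simp add: field_simps)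
    also have "\<dots> \<le> \<bar>g2 * (l\<^sup>2 - p * q)\<bar> / (p * q)" using pos by (intro divide_right_mono) auto
    also have "\<dots> \<le> (G * (l * (2 * B + B\<^sup>2))) / (p * q)"
      unfolding abs_mult using pos g d G by (intro divide_right_mono mult_mono) auto
    also have "\<dots> \<le> (G * (l * (2 * B + B\<^sup>2))) / (l\<^sup>2 / 4)"
      using pq4 l1 G B0 pos by (intro divide_left_mono mult_nonneg_nonneg) auto
    also have "\<dots> = 4 * G * (2 * B + B\<^sup>2) / l" using l1 by (simp add: field_simps power2_eq_square)
    finally show ?thesis by simp
  qed
  then have "S\<^sup>2 + 3 * u\<^sup>2 \<le> 4 * l\<^sup>2 + 4 * g2 + (16 * G * (2 * B + B\<^sup>2) / l + 16 * C / l)"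
  proof -
    define Q1 Q2 where "Q1 = 4 * G * (2 * B + B\<^sup>2) / l" and "Q2 = 4 * C / l"
    have q: "16 * G * (2 * B + B\<^sup>2) / l = 4 * Q1" "16 * C / l = 4 * Q2"
      by (simp_all add: Q1_def Q2_def)
    have "X + 3 * Y \<le> 4 * L + 4 * g2 + (4 * Q1 + 4 * Q2)"
      if "(X + 3 * Y) / 4 \<le> L + Z + Q2" "Z \<le> g2 + Q1" for X Y L Z :: real
      using that by (simp add: field_simps)
    then show ?thesis
      unfolding q using main \<open>l\<^sup>2 * (g2 / (p * q)) \<le> g2 + 4 * G * (2 * B + B\<^sup>2) / l\<close>
      unfolding Q1_def[symmetric] Q2_def[symmetric] by blast
  qed
  then have "S\<^sup>2 \<le> 4 * l\<^sup>2 + 4 * g2 - 3 * g1\<^sup>2 + (16 * G * (2 * B + B\<^sup>2) / l + 16 * C / l + 3 * (2 * G * c1 / l))"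
    using u2 by linarith
  also have "16 * G * (2 * B + B\<^sup>2) / l + 16 * C / l + 3 * (2 * G * c1 / l) = C' / l"
    by (simp add: C'_def add_divide_distrib)
  finally show ?thesis by (simp add: S_def)
qed

text \<open>Here \<open>psi\<close> arises: \<alpha>, the average degree outside the hubs, is
  eliminated by completing the square, and the rest depends on the graph inside the hubs alone. For
  \<open>l1 = 0\<close> the optimum is \<open>2 T / 3\<close>, which is why about two thirds of the
  vertices outside the hubs end up in cliques.\<close>

lemma expansion_coefficients:
  fixes m T \<alpha> l1 l2 :: real
  assumes "m > 0"
  shows "4 * (T * \<alpha> + \<alpha> * (l1 / m) + l2 / m) - 3 * (\<alpha> + l1 / m)\<^sup>2
    \<le> 4 / 3 * T\<^sup>2 + 4 / (3 * m) * (3 * l2 - 2 / m * l1\<^sup>2 - T * l1)"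
proof -
  define b1 b2 where "b1 = l1 / m" and "b2 = l2 / m"
  have "4 / (3 * m) * (3 * l2 - 2 / m * l1\<^sup>2 - T * l1) = 4 / 3 * (3 * b2 - 2 * b1\<^sup>2 - T * b1)"
    using assms by (simp add: b1_def b2_def field_simps power2_eq_square)
  moreover have "4 / 3 * T\<^sup>2 + 4 / 3 * (3 * b2 - 2 * b1\<^sup>2 - T * b1)
      - (4 * (T * \<alpha> + \<alpha> * b1 + b2) - 3 * (\<alpha> + b1)\<^sup>2) = 3 * (\<alpha> - 2 / 3 * (T - b1 / 2))\<^sup>2"
    by (simp add: power2_eq_square field_simps)
  then have "4 * (T * \<alpha> + \<alpha> * b1 + b2) - 3 * (\<alpha> + b1)\<^sup>2 \<le> 4 / 3 * T\<^sup>2 + 4 / 3 * (3 * b2 - 2 * b1\<^sup>2 - T * b1)"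
    using zero_le_power2[of "\<alpha> - 2 / 3 * (T - b1 / 2)"] by linarith
  ultimately show ?thesis unfolding b1_def[symmetric] b2_def[symmetric] by linarith
qed

section \<open>Eigenvectors of weighted hub matrices\<close>

locale hub_graph =
  fixes K U :: "'a set" and E :: "'a rel" and c :: "'a \<Rightarrow> real" and s t :: nat
  assumes finK: "finite K" and finU: "finite U" and KU: "K \<inter> U = {}"
    and symE: "sym E" and irrE: "irrefl E"
    and cardK: "card K = s - 1" and s2: "2 \<le> s" and t1: "1 \<le> t"
    and c01: "\<And>u. u \<in> U \<Longrightarrow> 0 \<le> c u \<and> c u \<le> 1"
    and c1: "\<And>u v. u \<in> U \<Longrightarrow> v \<in> U \<Longrightarrow> (u, v) \<in> E \<Longrightarrow> c u = 1"
    and deg: "\<And>u. u \<in> U \<Longrightarrow> card (E `` {u} \<inter> U) \<le> t - 1"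
begin

text \<open>Entries between \<open>K\<close> and \<open>U\<close> are taken from \<open>c\<close>
  and not from \<open>E\<close>. One analysis thus covers the comparison matrix and, with
  \<open>c\<close> constantly 1, the adjacency matrix of a graph with complete hubs.\<close>

definition hubmat :: "'a \<Rightarrow> 'a \<Rightarrow> real" where
  "hubmat i j = (if i \<in> K \<and> j \<in> U then c j else if i \<in> U \<and> j \<in> K then c i else adj E i j)"

abbreviation m :: real where "m \<equiv> real s - 1"
abbreviation T :: real where "T \<equiv> real t - 1"
definition weight :: real where "weight = (\<Sum>u\<in>U. (c u)\<^sup>2)"
definition dU :: "'a \<Rightarrow> real" where "dU u = (\<Sum>v\<in>U. adj E u v)"
definition dK :: "'a \<Rightarrow> real" where "dK k = (\<Sum>v\<in>K. adj E k v)"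
definition l1 :: real where "l1 = (\<Sum>k\<in>K. dK k)"
definition l2 :: real where "l2 = (\<Sum>k\<in>K. (dK k)\<^sup>2)"
definition a1 :: real where "a1 = (\<Sum>u\<in>U. dU u)"
text \<open>Measures how far the degree function \<open>dU\<close> is from being an eigenvector of
  the graph on \<open>U\<close> with eigenvalue \<open>T\<close>. It vanishes on all of
  \<open>U\<close> exactly when every degree there is \<open>0\<close> or \<open>T\<close>.\<close>

definition defect :: "'a \<Rightarrow> real" where "defect u = T * dU u - (\<Sum>v\<in>U. adj E u v * dU v)"

lemma adj_comm: "adj E i j = adj E j i"
  using symE by (auto simp: adj_def dest: symD)

lemma hubmat_sym: "hubmat i j = hubmat j i"
  using KU adj_comm by (auto simp: hubmat_def)

lemma hubmat_nonneg: "i \<in> K \<union> U \<Longrightarrow> j \<in> K \<union> U \<Longrightarrow> 0 \<le> hubmat i j"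
  using c01 by (auto simp: hubmat_def)

lemma m1: "m \<ge> 1" using s2 by simp
lemma T0: "T \<ge> 0" using t1 by simp
lemma card_K: "real (card K) = m" using cardK s2 by (simp add: of_nat_diff)

lemma sum_adj_eq_card:
  assumes "finite X"
  shows "(\<Sum>v\<in>X. adj E u v) = card (E `` {u} \<inter> X)"
proof -
  have "(\<Sum>v\<in>X. adj E u v) = (\<Sum>v\<in>X. if v \<in> E `` {u} then 1 else 0)"
    by (intro sum.cong) (auto simp: adj_def)
  also have "\<dots> = (\<Sum>v\<in>X \<inter> E `` {u}. 1)" by (rule sum.inter_restrict[OF assms, symmetric])
  finally show ?thesis by (simp add: Int_commute)
qed

lemma dU_card: "dU u = card (E `` {u} \<inter> U)"
  unfolding dU_def using finU by (rule sum_adj_eq_card)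

lemma dU_bounds: assumes "u \<in> U" shows "0 \<le> dU u" "dU u \<le> T"
proof -
  show "0 \<le> dU u" by (simp add: dU_card)
  show "dU u \<le> T" using deg[OF assms] t1 by (simp add: dU_card)
qed

lemma dK_bounds: assumes "k \<in> K" shows "0 \<le> dK k" "dK k \<le> m"
proof -
  have d: "dK k = card (E `` {k} \<inter> K)" unfolding dK_def using finK by (rule sum_adj_eq_card)
  show "0 \<le> dK k" by (simp add: d)
  have "card (E `` {k} \<inter> K) \<le> card K" using finK by (intro card_mono) auto
  then show "dK k \<le> m" using card_K by (simp add: d)
qed

lemma dU_pos_c: assumes "u \<in> U" "dU u \<noteq> 0" shows "c u = 1"
proof -
  have "E `` {u} \<inter> U \<noteq> {}" using assms(2) by (auto simp: dU_card)
  then show ?thesis using c1[OF assms(1)] by blast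
qed

lemma dU_c: "u \<in> U \<Longrightarrow> dU u * c u = dU u"
  using dU_pos_c[of u] by (cases "dU u = 0") auto

lemma a1_bounds: "0 \<le> a1" "a1 \<le> T * weight"
proof -
  show "0 \<le> a1" unfolding a1_def using dU_bounds by (intro sum_nonneg) auto
  have "dU u \<le> T * (c u)\<^sup>2" if "u \<in> U" for u
    using dU_bounds[OF that] dU_pos_c[OF that] T0 by (cases "dU u = 0") auto
  then show "a1 \<le> T * weight" unfolding a1_def weight_def sum_distrib_left by (intro sum_mono) auto
qed

lemma swap_adj: "(\<Sum>u\<in>X. f u * (\<Sum>v\<in>X. adj E u v * g v)) = (\<Sum>v\<in>X. g v * (\<Sum>u\<in>X. adj E v u * f u))"
proof -
  have "(\<Sum>u\<in>X. f u * (\<Sum>v\<in>X. adj E u v * g v)) = (\<Sum>u\<in>X. \<Sum>v\<in>X. f u * (adj E u v * g v))"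
    by (simp add: sum_distrib_left)
  also have "\<dots> = (\<Sum>v\<in>X. \<Sum>u\<in>X. f u * (adj E u v * g v))" by (rule sum.swap)
  also have "\<dots> = (\<Sum>v\<in>X. \<Sum>u\<in>X. g v * (adj E v u * f u))"
    by (intro sum.cong) (auto simp: adj_comm mult_ac)
  finally show ?thesis by (simp add: sum_distrib_left)
qed

lemma defect_nonneg: "u \<in> U \<Longrightarrow> 0 \<le> defect u"
proof -
  have "(\<Sum>v\<in>U. adj E u v * dU v) \<le> (\<Sum>v\<in>U. adj E u v * T)"
    using dU_bounds by (intro sum_mono mult_left_mono) auto
  also have "\<dots> = T * dU u" by (simp add: dU_def sum_distrib_left mult.commute)
  finally show ?thesis by (simp add: defect_def)
qed

lemma defect_pos_c: assumes "u \<in> U" "defect u \<noteq> 0" shows "c u = 1"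
proof (rule ccontr)
  assume "c u \<noteq> 1"
  then have "dU u = 0" using dU_pos_c[OF assms(1)] by blast
  then have "E `` {u} \<inter> U = {}" using finU by (simp add: dU_card)
  then have "adj E u v = 0" if "v \<in> U" for v using that by (auto simp: adj_def)
  then have "(\<Sum>v\<in>U. adj E u v * dU v) = 0" by (intro sum.neutral) auto
  then have "defect u = 0" using \<open>dU u = 0\<close> by (simp add: defect_def)
  then show False using assms(2) by simp
qed

text \<open>Summing the degrees of all neighbours counts each degree as often as its own value,
  which gives the sum of squared degrees.\<close>

lemma sum_defect: "(\<Sum>u\<in>U. defect u) = (\<Sum>u\<in>U. dU u * (T - dU u))"
proof -
  have "(\<Sum>u\<in>U. 1 * (\<Sum>v\<in>U. adj E u v * dU v)) = (\<Sum>v\<in>U. dU v * (\<Sum>u\<in>U. adj E v u * 1))"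
    by (rule swap_adj)
  then have "(\<Sum>u\<in>U. \<Sum>v\<in>U. adj E u v * dU v) = (\<Sum>v\<in>U. dU v * dU v)" by (simp add: dU_def)
  then show ?thesis
    by (simp add: defect_def sum_subtractf right_diff_distrib sum_distrib_left mult.commute)
qed

end

text \<open>The eigenvalue may be negative, so both \<open>p\<close> and \<open>- q\<close> are
  instances. The threshold makes \<open>T / (|lam| - T)\<close> and \<open>m / |lam|\<close> at most
  one half.\<close>

locale hub_eigen = hub_graph +
  fixes lam :: real and x :: "'a \<Rightarrow> real"
  assumes eig: "\<And>i. i \<in> K \<union> U \<Longrightarrow> (\<Sum>j\<in>K \<union> U. hubmat i j * x j) = lam * x i"
    and nz: "sqnorm (K \<union> U) x = 1"
    and big: "\<bar>lam\<bar> \<ge> 3 * T + 2 * m + 1"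
begin

definition sig :: real where "sig = (\<Sum>k\<in>K. x k)"
definition mass :: real where "mass = (\<Sum>u\<in>U. c u * x u)"

lemma eig_K: assumes "k \<in> K" shows "lam * x k = (\<Sum>v\<in>K. adj E k v * x v) + mass"
proof -
  have kU: "k \<notin> U" using assms KU by blast
  have "lam * x k = (\<Sum>j\<in>K. hubmat k j * x j) + (\<Sum>j\<in>U. hubmat k j * x j)"
    using eig[of k] assms finK finU KU by (simp add: sum.union_disjoint)
  also have "(\<Sum>j\<in>K. hubmat k j * x j) = (\<Sum>v\<in>K. adj E k v * x v)"
    using KU kU by (intro sum.cong) (auto simp: hubmat_def)
  also have "(\<Sum>j\<in>U. hubmat k j * x j) = mass"
    unfolding mass_def using assms by (intro sum.cong) (auto simp: hubmat_def)
  finally show ?thesis .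
qed

lemma eig_U: assumes "u \<in> U" shows "lam * x u = c u * sig + (\<Sum>v\<in>U. adj E u v * x v)"
proof -
  have uK: "u \<notin> K" using assms KU by blast
  have "lam * x u = (\<Sum>j\<in>K. hubmat u j * x j) + (\<Sum>j\<in>U. hubmat u j * x j)"
    using eig[of u] assms finK finU KU by (simp add: sum.union_disjoint)
  also have "(\<Sum>j\<in>K. hubmat u j * x j) = c u * sig"
    unfolding sig_def sum_distrib_left using assms uK by (intro sum.cong) (auto simp: hubmat_def)
  also have "(\<Sum>j\<in>U. hubmat u j * x j) = (\<Sum>v\<in>U. adj E u v * x v)"
    using uK KU by (intro sum.cong) (auto simp: hubmat_def)
  finally show ?thesis .
qed

lemma abs_sum_adj_le:
  assumes "finite X" "\<And>v. v \<in> X \<Longrightarrow> \<bar>x v\<bar> \<le> b"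
  shows "\<bar>\<Sum>v\<in>X. adj E u v * x v\<bar> \<le> (\<Sum>v\<in>X. adj E u v) * b"
proof -
  have "\<bar>\<Sum>v\<in>X. adj E u v * x v\<bar> \<le> (\<Sum>v\<in>X. \<bar>adj E u v * x v\<bar>)" by (rule sum_abs)
  also have "\<dots> \<le> (\<Sum>v\<in>X. adj E u v * b)"
    unfolding abs_mult using assms(2) by (intro sum_mono mult_mono) auto
  finally show ?thesis by (simp add: sum_distrib_right)
qed

text \<open>The eigenvalue equation at an entry of largest absolute value in \<open>U\<close>: the
  neighbours in \<open>U\<close> contribute at most \<open>T\<close> times that same value.\<close>

lemma sup_U: assumes "u \<in> U" shows "\<bar>x u\<bar> * (\<bar>lam\<bar> - T) \<le> \<bar>sig\<bar>"
proof -
  define b where "b = Max ((\<lambda>v. \<bar>x v\<bar>) ` U)"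
  have le: "\<bar>x v\<bar> \<le> b" if "v \<in> U" for v unfolding b_def using finU that by (intro Max_ge) auto
  have "b \<in> (\<lambda>v. \<bar>x v\<bar>) ` U" unfolding b_def using finU assms by (intro Max_in) auto
  then obtain w where w: "w \<in> U" "b = \<bar>x w\<bar>" by auto
  have b0: "b \<ge> 0" using w by simp
  have "\<bar>lam\<bar> * b = \<bar>c w * sig + (\<Sum>v\<in>U. adj E w v * x v)\<bar>"
    using eig_U[OF w(1)] w(2) by (simp add: abs_mult[symmetric])
  also have "\<dots> \<le> \<bar>c w * sig\<bar> + \<bar>\<Sum>v\<in>U. adj E w v * x v\<bar>" by (rule abs_triangle_ineq)
  also have "\<bar>\<Sum>v\<in>U. adj E w v * x v\<bar> \<le> dU w * b"
    unfolding dU_def using finU le by (rule abs_sum_adj_le)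
  also have "\<dots> \<le> T * b" using dU_bounds[OF w(1)] b0 by (intro mult_right_mono) auto
  also have "\<bar>c w * sig\<bar> \<le> 1 * \<bar>sig\<bar>"
    unfolding abs_mult using c01[OF w(1)] by (intro mult_right_mono) auto
  finally have "b * (\<bar>lam\<bar> - T) \<le> \<bar>sig\<bar>" by (simp add: algebra_simps)
  moreover have "\<bar>x u\<bar> * (\<bar>lam\<bar> - T) \<le> b * (\<bar>lam\<bar> - T)"
    using le[OF assms] big T0 m1 by (intro mult_right_mono) auto
  ultimately show ?thesis by linarith
qed

lemma sup_K: assumes "k \<in> K" shows "\<bar>x k\<bar> * (\<bar>lam\<bar> - m) \<le> \<bar>mass\<bar>"
proof -
  define b where "b = Max ((\<lambda>v. \<bar>x v\<bar>) ` K)"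
  have le: "\<bar>x v\<bar> \<le> b" if "v \<in> K" for v unfolding b_def using finK that by (intro Max_ge) auto
  have "b \<in> (\<lambda>v. \<bar>x v\<bar>) ` K" unfolding b_def using finK assms by (intro Max_in) auto
  then obtain w where w: "w \<in> K" "b = \<bar>x w\<bar>" by auto
  have b0: "b \<ge> 0" using w by simp
  have "\<bar>lam\<bar> * b = \<bar>(\<Sum>v\<in>K. adj E w v * x v) + mass\<bar>"
    using eig_K[OF w(1)] w(2) by (simp add: abs_mult[symmetric])
  also have "\<dots> \<le> \<bar>\<Sum>v\<in>K. adj E w v * x v\<bar> + \<bar>mass\<bar>" by (rule abs_triangle_ineq)
  also have "\<bar>\<Sum>v\<in>K. adj E w v * x v\<bar> \<le> dK w * b"
    unfolding dK_def using finK le by (rule abs_sum_adj_le)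
  also have "\<dots> \<le> m * b" using dK_bounds[OF w(1)] b0 by (intro mult_right_mono) auto
  finally have "b * (\<bar>lam\<bar> - m) \<le> \<bar>mass\<bar>" by (simp add: algebra_simps)
  moreover have "\<bar>x k\<bar> * (\<bar>lam\<bar> - m) \<le> b * (\<bar>lam\<bar> - m)"
    using le[OF assms] big T0 m1 by (intro mult_right_mono) auto
  ultimately show ?thesis by linarith
qed

lemma lam_nz: "lam \<noteq> 0" using big T0 m1 by auto

lemma mass_nz: "mass \<noteq> 0" and sig_nz: "sig \<noteq> 0"
proof -
  have sig0: "sig = 0 \<Longrightarrow> \<forall>u\<in>U. x u = 0"
  proof
    fix u assume "sig = 0" "u \<in> U"
    then have "\<bar>x u\<bar> * (\<bar>lam\<bar> - T) \<le> 0" using sup_U by fastforce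
    moreover have "\<bar>lam\<bar> - T > 0" using big T0 m1 by auto
    ultimately show "x u = 0" by (simp add: mult_le_0_iff)
  qed
  have mass0: "mass = 0 \<Longrightarrow> \<forall>k\<in>K. x k = 0"
  proof
    fix k assume "mass = 0" "k \<in> K"
    then have "\<bar>x k\<bar> * (\<bar>lam\<bar> - m) \<le> 0" using sup_K by fastforce
    moreover have "\<bar>lam\<bar> - m > 0" using big T0 m1 by auto
    ultimately show "x k = 0" by (simp add: mult_le_0_iff)
  qed
  have sig: "sig \<noteq> 0"
  proof
    assume s: "sig = 0"
    then have "mass = 0" using sig0 by (simp add: mass_def)
    then have "sqnorm (K \<union> U) x = 0"
      using mass0 sig0 s finK finU by (subst sqnorm_eq_0_iff) auto
    then show False using nz by simp
  qed
  then show "sig \<noteq> 0" .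
  show "mass \<noteq> 0"
  proof
    assume "mass = 0"
    then have "sig = 0" using mass0 by (simp add: sig_def)
    then show False using sig by simp
  qed
qed

lemma mass_eq: "lam * mass = weight * sig + (\<Sum>u\<in>U. dU u * x u)"
proof -
  have "lam * mass = (\<Sum>u\<in>U. c u * (lam * x u))" by (simp add: mass_def sum_distrib_left mult_ac)
  also have "\<dots> = (\<Sum>u\<in>U. (c u)\<^sup>2 * sig + c u * (\<Sum>v\<in>U. adj E u v * x v))"
    by (intro sum.cong) (auto simp: eig_U algebra_simps power2_eq_square)
  also have "\<dots> = weight * sig + (\<Sum>u\<in>U. c u * (\<Sum>v\<in>U. adj E u v * x v))"
    by (simp add: sum.distrib weight_def sum_distrib_right)
  also have "(\<Sum>u\<in>U. c u * (\<Sum>v\<in>U. adj E u v * x v)) = (\<Sum>v\<in>U. x v * (\<Sum>u\<in>U. adj E v u * c u))"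
    by (rule swap_adj)
  also have "\<dots> = (\<Sum>v\<in>U. dU v * x v)"
  proof (rule sum.cong)
    fix v assume "v \<in> U"
    then have "(\<Sum>u\<in>U. adj E v u * c u) = (\<Sum>u\<in>U. adj E v u)"
      using c1 symE by (intro sum.cong) (auto simp: adj_def dest: symD)
    then show "x v * (\<Sum>u\<in>U. adj E v u * c u) = dU v * x v" by (simp add: dU_def)
  qed simp
  finally show ?thesis .
qed

text \<open>The equation on \<open>U\<close> is paired with \<open>dU\<close>. Since
  \<open>dU\<close> is an eigenvector for \<open>T\<close> up to \<open>defect\<close>, the same sum
  returns with factor \<open>T\<close>, and together with \<open>mass_eq\<close> the system
  closes.\<close>

lemma dU_eq: "(lam - T) * (\<Sum>u\<in>U. dU u * x u) = a1 * sig - (\<Sum>u\<in>U. defect u * x u)"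
proof -
  have "lam * (\<Sum>u\<in>U. dU u * x u) = (\<Sum>u\<in>U. dU u * (lam * x u))" by (simp add: sum_distrib_left mult_ac)
  also have "\<dots> = (\<Sum>u\<in>U. dU u * sig + dU u * (\<Sum>v\<in>U. adj E u v * x v))"
  proof (intro sum.cong)
    fix u assume u: "u \<in> U"
    have "dU u * (lam * x u) = (dU u * c u) * sig + dU u * (\<Sum>v\<in>U. adj E u v * x v)"
      by (simp add: eig_U[OF u] algebra_simps)
    then show "dU u * (lam * x u) = dU u * sig + dU u * (\<Sum>v\<in>U. adj E u v * x v)"
      by (simp add: dU_c[OF u])
  qed simp
  also have "\<dots> = a1 * sig + (\<Sum>u\<in>U. dU u * (\<Sum>v\<in>U. adj E u v * x v))"
    by (simp add: sum.distrib a1_def sum_distrib_right)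
  also have "(\<Sum>u\<in>U. dU u * (\<Sum>v\<in>U. adj E u v * x v)) = (\<Sum>v\<in>U. x v * (\<Sum>u\<in>U. adj E v u * dU u))"
    by (rule swap_adj)
  also have "\<dots> = (\<Sum>v\<in>U. T * (dU v * x v) - defect v * x v)"
    by (intro sum.cong) (auto simp: defect_def algebra_simps)
  also have "\<dots> = T * (\<Sum>u\<in>U. dU u * x u) - (\<Sum>u\<in>U. defect u * x u)"
    by (simp add: sum_subtractf sum_distrib_left)
  finally show ?thesis by (simp add: algebra_simps)
qed

lemma main_eq: "(lam - T) * (lam * mass - weight * sig) = a1 * sig - (\<Sum>u\<in>U. defect u * x u)"
  using mass_eq dU_eq by simp

text \<open>Gives the error a sign. Where \<open>defect u\<close> is nonzero the weight is 1, and
  \<open>lam * x u\<close> equals \<open>sig\<close> up to at most half of its size, so each product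
  \<open>lam * sig * x u\<close> is at least \<open>sig^2 / 2\<close>.\<close>

lemma defect_term: "(\<Sum>u\<in>U. defect u) * sig\<^sup>2 \<le> 2 * (lam * sig * (\<Sum>u\<in>U. defect u * x u))"
proof -
  have pt: "defect u * sig\<^sup>2 \<le> 2 * (lam * sig * (defect u * x u))" if u: "u \<in> U" for u
  proof (cases "defect u = 0")
    case False
    then have cu: "c u = 1" using defect_pos_c u by blast
    define r where "r = (\<Sum>v\<in>U. adj E u v * x v)"
    have pos: "\<bar>lam\<bar> - T > 0" using big T0 m1 by auto
    have "\<bar>r\<bar> \<le> dU u * (\<bar>sig\<bar> / (\<bar>lam\<bar> - T))"
      unfolding r_def dU_def using finU sup_U pos by (intro abs_sum_adj_le) (auto simp: field_simps)
    also have "\<dots> \<le> T * (\<bar>sig\<bar> / (\<bar>lam\<bar> - T))"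
      using dU_bounds[OF u] pos by (intro mult_right_mono) auto
    also have "\<dots> = T / (\<bar>lam\<bar> - T) * \<bar>sig\<bar>" by simp
    also have "\<dots> \<le> 1 / 2 * \<bar>sig\<bar>"
      using big pos m1 T0 by (intro mult_right_mono) (auto simp: field_simps)
    finally have r: "\<bar>r\<bar> \<le> \<bar>sig\<bar> / 2" by simp
    have "\<bar>sig * r\<bar> \<le> \<bar>sig\<bar> * (\<bar>sig\<bar> / 2)" unfolding abs_mult using r by (intro mult_left_mono) auto
    also have "\<dots> = sig\<^sup>2 / 2" by (simp add: power2_eq_square)
    finally have "sig\<^sup>2 \<le> 2 * (sig * (sig + r))" by (simp add: power2_eq_square algebra_simps)
    also have "sig + r = lam * x u" using eig_U[OF u] cu by (simp add: r_def)
    finally have "defect u * sig\<^sup>2 \<le> defect u * (2 * (sig * (lam * x u)))"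
      using defect_nonneg[OF u] by (intro mult_left_mono) auto
    then show ?thesis by (simp add: mult_ac)
  qed simp
  have "(\<Sum>u\<in>U. defect u) * sig\<^sup>2 = (\<Sum>u\<in>U. defect u * sig\<^sup>2)" by (simp add: sum_distrib_right)
  also have "\<dots> \<le> (\<Sum>u\<in>U. 2 * (lam * sig * (defect u * x u)))" by (intro sum_mono pt)
  finally show ?thesis by (simp add: sum_distrib_left)
qed


text \<open>A Neumann series inside \<open>K\<close>: substituting the eigenvalue equation
  repeatedly yields \<open>l1\<close> and \<open>l2\<close>, the numbers of walks of length 1 and 2
  in the hub graph. The remainder carries walks of length 2 weighted by the deviations
  \<open>y\<close>.\<close>

lemma sig_expansion: "\<bar>lam * sig - mass * (m + l1 / lam + l2 / lam\<^sup>2)\<bar> \<le> \<bar>mass\<bar> * (2 * m ^ 4 / \<bar>lam\<bar> ^ 3)"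
proof -
  define y where "y = (\<lambda>k. x k - mass / lam)"
  define w where "w = (\<lambda>k. \<Sum>v\<in>K. adj E k v * dK v)"
  have pos: "\<bar>lam\<bar> - m > 0" "\<bar>lam\<bar> > 0" using big T0 m1 by auto
  have lamy: "lam * y k = (\<Sum>v\<in>K. adj E k v * x v)" if "k \<in> K" for k
    using eig_K[OF that] lam_nz by (simp add: y_def right_diff_distrib)
  have half: "\<bar>lam\<bar> / 2 \<le> \<bar>lam\<bar> - m" using big T0 m1 by auto
  have xk: "\<bar>x k\<bar> \<le> 2 * \<bar>mass\<bar> / \<bar>lam\<bar>" if "k \<in> K" for k
  proof -
    have "\<bar>x k\<bar> * (\<bar>lam\<bar> / 2) \<le> \<bar>x k\<bar> * (\<bar>lam\<bar> - m)" using half by (intro mult_left_mono) auto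
    also have "\<dots> \<le> \<bar>mass\<bar>" by (rule sup_K[OF that])
    finally show ?thesis using pos by (simp add: field_simps)
  qed
  have yk: "\<bar>y k\<bar> \<le> 2 * m * \<bar>mass\<bar> / \<bar>lam\<bar>\<^sup>2" if "k \<in> K" for k
  proof -
    have "\<bar>lam\<bar> * \<bar>y k\<bar> = \<bar>\<Sum>v\<in>K. adj E k v * x v\<bar>" using lamy[OF that] by (simp add: abs_mult[symmetric])
    also have "\<dots> \<le> dK k * (2 * \<bar>mass\<bar> / \<bar>lam\<bar>)" unfolding dK_def using finK xk by (rule abs_sum_adj_le)
    also have "\<dots> \<le> m * (2 * \<bar>mass\<bar> / \<bar>lam\<bar>)" using dK_bounds[OF that] by (intro mult_right_mono) auto
    finally have "\<bar>y k\<bar> \<le> m * (2 * \<bar>mass\<bar> / \<bar>lam\<bar>) / \<bar>lam\<bar>"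
      using pos by (simp only: pos_le_divide_eq mult.commute)
    also have "\<dots> = 2 * m * \<bar>mass\<bar> / \<bar>lam\<bar>\<^sup>2" by (simp add: power2_eq_square)
    finally show ?thesis .
  qed
  have sw: "(\<Sum>k\<in>K. w k) = l2"
  proof -
    have "(\<Sum>k\<in>K. 1 * (\<Sum>v\<in>K. adj E k v * dK v)) = (\<Sum>v\<in>K. dK v * (\<Sum>k\<in>K. adj E v k * 1))" by (rule swap_adj)
    then show ?thesis by (simp add: w_def l2_def dK_def power2_eq_square)
  qed
  have w0: "0 \<le> w k" "w k \<le> m\<^sup>2" if "k \<in> K" for k
  proof -
    show "0 \<le> w k" unfolding w_def using dK_bounds by (intro sum_nonneg) auto
    have "w k \<le> (\<Sum>v\<in>K. adj E k v * m)" unfolding w_def using dK_bounds by (intro sum_mono mult_left_mono) auto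
    also have "\<dots> = dK k * m" by (simp add: dK_def sum_distrib_right)
    also have "\<dots> \<le> m * m" using dK_bounds[OF that] m1 by (intro mult_right_mono) auto
    finally show "w k \<le> m\<^sup>2" by (simp add: power2_eq_square)
  qed
  have e1: "lam * sig = m * mass + (\<Sum>k\<in>K. dK k * x k)"
  proof -
    have "lam * sig = (\<Sum>k\<in>K. 1 * (\<Sum>v\<in>K. adj E k v * x v) + mass)"
      by (simp add: sig_def sum_distrib_left eig_K)
    also have "\<dots> = (\<Sum>k\<in>K. 1 * (\<Sum>v\<in>K. adj E k v * x v)) + m * mass" by (simp add: sum.distrib card_K)
    also have "(\<Sum>k\<in>K. 1 * (\<Sum>v\<in>K. adj E k v * x v)) = (\<Sum>v\<in>K. x v * (\<Sum>k\<in>K. adj E v k * 1))" by (rule swap_adj)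
    finally show ?thesis by (simp add: dK_def mult.commute)
  qed
  have e2: "(\<Sum>k\<in>K. dK k * x k) = l1 * mass / lam + (\<Sum>k\<in>K. dK k * y k)"
    by (simp add: y_def l1_def right_diff_distrib sum_subtractf sum_distrib_right sum_divide_distrib)
  have e3: "lam * (\<Sum>k\<in>K. dK k * y k) = (\<Sum>k\<in>K. w k * x k)"
  proof -
    have "lam * (\<Sum>k\<in>K. dK k * y k) = (\<Sum>k\<in>K. dK k * (lam * y k))" by (simp add: sum_distrib_left mult_ac)
    also have "\<dots> = (\<Sum>k\<in>K. dK k * (\<Sum>v\<in>K. adj E k v * x v))" by (intro sum.cong) (auto simp: lamy)
    also have "\<dots> = (\<Sum>v\<in>K. x v * (\<Sum>k\<in>K. adj E v k * dK k))" by (rule swap_adj)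
    finally show ?thesis by (simp add: w_def mult.commute)
  qed
  have e4: "(\<Sum>k\<in>K. w k * x k) = l2 * mass / lam + (\<Sum>k\<in>K. w k * y k)"
    by (simp add: y_def sw[symmetric] right_diff_distrib sum_subtractf sum_distrib_right sum_divide_distrib)
  have "(\<Sum>k\<in>K. dK k * y k) = (l2 * mass / lam + (\<Sum>k\<in>K. w k * y k)) / lam"
    using e3 e4 lam_nz by (simp add: field_simps)
  then have "(\<Sum>k\<in>K. dK k * y k) = l2 * mass / lam\<^sup>2 + (\<Sum>k\<in>K. w k * y k) / lam"
    by (simp add: add_divide_distrib power2_eq_square)
  then have eq: "lam * sig - mass * (m + l1 / lam + l2 / lam\<^sup>2) = (\<Sum>k\<in>K. w k * y k) / lam"
    using e1 e2 by (simp add: algebra_simps)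
  have bnd: "\<bar>\<Sum>k\<in>K. w k * y k\<bar> \<le> 2 * m ^ 4 * \<bar>mass\<bar> / \<bar>lam\<bar>\<^sup>2"
  proof -
    have "\<bar>\<Sum>k\<in>K. w k * y k\<bar> \<le> (\<Sum>k\<in>K. \<bar>w k * y k\<bar>)" by (rule sum_abs)
    also have "\<dots> \<le> (\<Sum>k\<in>K. m\<^sup>2 * (2 * m * \<bar>mass\<bar> / \<bar>lam\<bar>\<^sup>2))"
      unfolding abs_mult using w0 yk by (intro sum_mono mult_mono) auto
    also have "\<dots> = m * (m\<^sup>2 * (2 * m * \<bar>mass\<bar> / \<bar>lam\<bar>\<^sup>2))" by (simp add: card_K)
    also have "\<dots> = 2 * m ^ 4 * \<bar>mass\<bar> / \<bar>lam\<bar>\<^sup>2" by (simp add: power2_eq_square power4_eq_xxxx)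
    finally show ?thesis .
  qed
  have "\<bar>lam * sig - mass * (m + l1 / lam + l2 / lam\<^sup>2)\<bar> \<le> (2 * m ^ 4 * \<bar>mass\<bar> / \<bar>lam\<bar>\<^sup>2) / \<bar>lam\<bar>"
    unfolding eq abs_divide using bnd pos by (intro divide_right_mono) auto
  also have "\<dots> = \<bar>mass\<bar> * (2 * m ^ 4 / \<bar>lam\<bar> ^ 3)" by (simp add: power2_eq_square power3_eq_cube)
  finally show ?thesis .
qed

end

section \<open>Expansion of the spread\<close>

lemma root_upper:
  fixes G C l r h g2 :: real
  assumes "G \<ge> 0" "C \<ge> 0" "l > 0" and r: "r \<ge> 1" and h: "\<bar>h\<bar> \<le> G" and g: "\<bar>g2\<bar> \<le> G"
    and le: "r ^ 3 \<le> l\<^sup>2 * (r + h + g2 / r + C / r\<^sup>2)"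
  shows "r \<le> l + (2 * G + C)"
proof (rule cubic_upper)
  have "g2 / r \<le> G / r" using g r by (intro divide_right_mono) auto
  also have "\<dots> \<le> G / 1" using assms(1) r by (intro divide_left_mono) auto
  finally have a1: "g2 / r \<le> G" by simp
  have "C / r\<^sup>2 \<le> C / 1" using assms(2) r by (intro divide_left_mono) (auto simp: one_le_power)
  then have "l\<^sup>2 * (r + h + g2 / r + C / r\<^sup>2) \<le> l\<^sup>2 * (r + (2 * G + C))"
    using h a1 by (intro mult_left_mono) auto
  then show "r ^ 3 \<le> l\<^sup>2 * (r + (2 * G + C))" using le by linarith
qed (use assms in auto)

text \<open>
  The constants \<open>expG\<close>, \<open>expC\<close>, \<open>expB\<close>, \<open>exp_const\<close> and \<open>exp_threshold\<close> are crude; only their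
  independence of the number of vertices matters.
\<close>

definition expG :: "real \<Rightarrow> real \<Rightarrow> real" where
  "expG m T = T\<^sup>2 + T * m + m\<^sup>2 + T + m"

definition expC :: "real \<Rightarrow> real \<Rightarrow> real" where
  "expC m T = T * m\<^sup>2 + T\<^sup>2 * m + T\<^sup>2 * m\<^sup>2 + 2 * T ^ 3 * (1 + m + m\<^sup>2 + 2 * m ^ 3) + 2 * m ^ 3 * (1 + T + T\<^sup>2)"

text \<open>All terms beyond second order are collected in \<open>expC\<close>. As \<open>e\<close>
  has the sign of the eigenvalue, these terms are estimated through \<open>r\<close>, while the
  first two orders stay exact.\<close>

lemma expansion_product:
  fixes e r \<alpha> T b1 b2 m :: real
  assumes r: "\<bar>e\<bar> = r" "r \<le> 1" and \<alpha>: "0 \<le> \<alpha>" "\<alpha> \<le> T" and b: "0 \<le> b1" "b1 \<le> m" "0 \<le> b2" "b2 \<le> m\<^sup>2"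
  shows "(1 + \<alpha> * e + T * \<alpha> * e\<^sup>2 + 2 * T ^ 3 * r ^ 3) * (1 + b1 * e + b2 * e\<^sup>2 + 2 * m ^ 3 * r ^ 3)
    \<le> 1 + (\<alpha> + b1) * e + (T * \<alpha> + \<alpha> * b1 + b2) * e\<^sup>2 + expC m T * r ^ 3"
proof -
  have T: "T \<ge> 0" and m: "m \<ge> 0" using \<alpha> b by linarith+
  have r0: "r \<ge> 0" using r by linarith
  have ek: "e ^ k \<le> 1 \<and> - (e ^ k) \<le> 1" for k
    using r by (metis abs_le_D1 abs_le_D2 power_abs power_le_one r0)
  have e1: "e \<le> 1" using r by linarith
  have e2: "e\<^sup>2 \<le> 1" "0 \<le> e\<^sup>2" using ek[of 2] by auto
  have r3: "r ^ 3 \<ge> 0" "r ^ 3 \<le> 1" using r0 r(2) by (auto simp: power_le_one)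
  have e3: "e ^ 3 \<le> r ^ 3" using r(1) by (metis abs_ge_self power_abs)
  have e4: "e ^ 4 \<le> r ^ 3"
  proof -
    have "e ^ 4 = r ^ 4" using r(1) by (metis power_even_abs_numeral even_numeral)
    also have "\<dots> \<le> r ^ 3" using r0 r(2) by (intro power_decreasing) auto
    finally show ?thesis .
  qed
  have up: "c * y \<le> c' * z" if "0 \<le> c" "c \<le> c'" "y \<le> z" "0 \<le> z" for c c' y z :: real
    using that by (meson mult_left_mono mult_right_mono order_trans)
  have 1: "(\<alpha> * b2) * e ^ 3 \<le> (T * m\<^sup>2) * r ^ 3"
    using \<alpha> b e3 r3 T by (intro up mult_mono mult_nonneg_nonneg) auto
  have 2: "(T * \<alpha> * b1) * e ^ 3 \<le> (T * T * m) * r ^ 3"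
    using \<alpha> b e3 r3 T by (intro up mult_mono mult_nonneg_nonneg) auto
  have 3: "(T * \<alpha> * b2) * e ^ 4 \<le> (T * T * m\<^sup>2) * r ^ 3"
    using \<alpha> b e4 r3 T by (intro up mult_mono mult_nonneg_nonneg) auto
  have bb: "1 + b1 * e + b2 * e\<^sup>2 + 2 * m ^ 3 * r ^ 3 \<le> 1 + m + m\<^sup>2 + 2 * m ^ 3"
  proof -
    have "b1 * e \<le> m * 1" using b e1 by (intro up) auto
    moreover have "b2 * e\<^sup>2 \<le> m\<^sup>2 * 1" using b e2 by (intro up) auto
    moreover have "2 * m ^ 3 * r ^ 3 \<le> 2 * m ^ 3 * 1" using m r3 by (intro up) auto
    ultimately show ?thesis by linarith
  qed
  have aa: "1 + \<alpha> * e + T * \<alpha> * e\<^sup>2 \<le> 1 + T + T\<^sup>2"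
  proof -
    have "\<alpha> * e \<le> T * 1" using \<alpha> e1 by (intro up) auto
    moreover have "T * \<alpha> * e\<^sup>2 \<le> T * T * 1" using \<alpha> e2 T by (intro up mult_left_mono mult_nonneg_nonneg) auto
    ultimately show ?thesis by (simp add: power2_eq_square)
  qed
  have 4: "2 * T ^ 3 * r ^ 3 * (1 + b1 * e + b2 * e\<^sup>2 + 2 * m ^ 3 * r ^ 3) \<le> 2 * T ^ 3 * r ^ 3 * (1 + m + m\<^sup>2 + 2 * m ^ 3)"
    using bb T r3 by (intro mult_left_mono) auto
  have 5: "2 * m ^ 3 * r ^ 3 * (1 + \<alpha> * e + T * \<alpha> * e\<^sup>2) \<le> 2 * m ^ 3 * r ^ 3 * (1 + T + T\<^sup>2)"
    using aa m r3 by (intro mult_left_mono) auto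
  have eq: "(1 + \<alpha> * e + T * \<alpha> * e\<^sup>2 + 2 * T ^ 3 * r ^ 3) * (1 + b1 * e + b2 * e\<^sup>2 + 2 * m ^ 3 * r ^ 3)
    = 1 + (\<alpha> + b1) * e + (T * \<alpha> + \<alpha> * b1 + b2) * e\<^sup>2
      + ((\<alpha> * b2) * e ^ 3 + (T * \<alpha> * b1) * e ^ 3 + (T * \<alpha> * b2) * e ^ 4
      + 2 * T ^ 3 * r ^ 3 * (1 + b1 * e + b2 * e\<^sup>2 + 2 * m ^ 3 * r ^ 3)
      + 2 * m ^ 3 * r ^ 3 * (1 + \<alpha> * e + T * \<alpha> * e\<^sup>2))"
    by (simp add: algebra_simps power2_eq_square power3_eq_cube power4_eq_xxxx)
  have eqC: "expC m T * r ^ 3 = (T * m\<^sup>2) * r ^ 3 + (T * T * m) * r ^ 3 + (T * T * m\<^sup>2) * r ^ 3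
      + 2 * T ^ 3 * r ^ 3 * (1 + m + m\<^sup>2 + 2 * m ^ 3) + 2 * m ^ 3 * r ^ 3 * (1 + T + T\<^sup>2)"
    by (simp add: expC_def algebra_simps power2_eq_square)
  show ?thesis unfolding eq eqC using 1 2 3 4 5 by linarith
qed

text \<open>Two terms of the geometric series with exact remainder; it is applied to
  \<open>w = lam - T\<close>.\<close>

lemma resolvent_expansion:
  fixes L w :: real
  assumes "L \<noteq> 0" "w \<noteq> 0"
  shows "1 / w = 1 / L + (L - w) * (1 / L)\<^sup>2 + (L - w)\<^sup>2 * (1 / L)\<^sup>2 * (1 / w)"
  using assms by (simp add: field_simps power2_eq_square)

context hub_graph
begin

lemma l1_bounds: "0 \<le> l1" "l1 \<le> m * m"
proof -
  show "0 \<le> l1" unfolding l1_def using dK_bounds by (intro sum_nonneg) auto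
  have "l1 \<le> (\<Sum>k\<in>K. m)" unfolding l1_def using dK_bounds by (intro sum_mono) auto
  then show "l1 \<le> m * m" using card_K by simp
qed

lemma l2_bounds: "0 \<le> l2" "l2 \<le> m * m\<^sup>2"
proof -
  show "0 \<le> l2" unfolding l2_def by (intro sum_nonneg) auto
  have "l2 \<le> (\<Sum>k\<in>K. m\<^sup>2)" unfolding l2_def using dK_bounds by (intro sum_mono power_mono) auto
  then show "l2 \<le> m * m\<^sup>2" using card_K by simp
qed

text \<open>With \<open>g1\<close> and \<open>g2\<close> below: the coefficients of
  \<open>1 / lam\<close> and \<open>1 / lam^2\<close> in the expansion bounding
  \<open>lam^2 / (m * weight)\<close>, obtained by multiplying the series of \<open>U\<close> and of
  \<open>K\<close>.\<close>

definition \<alpha> :: real where "\<alpha> = a1 / weight"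
definition g1 :: real where "g1 = \<alpha> + l1 / m"
definition g2 :: real where "g2 = T * \<alpha> + \<alpha> * (l1 / m) + l2 / m"

lemma coefficient_bounds:
  assumes w: "weight > 0"
  shows "0 \<le> \<alpha>" "\<alpha> \<le> T" "0 \<le> l1 / m" "l1 / m \<le> m" "0 \<le> l2 / m" "l2 / m \<le> m\<^sup>2"
    "\<bar>g1\<bar> \<le> expG m T" "\<bar>g2\<bar> \<le> expG m T"
proof -
  have m0: "m > 0" using m1 by simp
  show a: "0 \<le> \<alpha>" "\<alpha> \<le> T" using a1_bounds w by (auto simp: \<alpha>_def field_simps)
  show b: "0 \<le> l1 / m" "l1 / m \<le> m" using l1_bounds m0 by (auto simp: pos_divide_le_eq)
  show b2: "0 \<le> l2 / m" "l2 / m \<le> m\<^sup>2" using l2_bounds m0 by (auto simp: pos_divide_le_eq mult.commute)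
  have nn: "T\<^sup>2 \<ge> 0" "T * m \<ge> 0" "m\<^sup>2 \<ge> 0" "m \<ge> 0" "T \<ge> 0" using T0 m0 by auto
  have "g1 \<le> T + m" "g1 \<ge> 0" using a b unfolding g1_def by linarith+
  then show "\<bar>g1\<bar> \<le> expG m T" using nn unfolding expG_def by linarith
  have "T * \<alpha> \<le> T * T" using a T0 by (intro mult_left_mono) auto
  moreover have "\<alpha> * (l1 / m) \<le> T * m" using a b T0 by (intro mult_mono) auto
  ultimately have "g2 \<le> T\<^sup>2 + T * m + m\<^sup>2" using b2 unfolding g2_def by (simp add: power2_eq_square)
  moreover have "0 \<le> T * \<alpha>" using T0 a(1) by (rule mult_nonneg_nonneg)
  then have "g2 \<ge> 0" using mult_nonneg_nonneg[OF a(1) b(1)] b2 unfolding g2_def by linarith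
  ultimately show "\<bar>g2\<bar> \<le> expG m T" using nn unfolding expG_def by linarith
qed

end

context hub_eigen
begin

text \<open>In \<open>main_eq\<close> the defect term is divided by \<open>lam - T\<close>, which
  has the sign of \<open>lam\<close>. By \<open>defect_term\<close> the quotient lowers the ratio at
  both ends of the spectrum and may be dropped.\<close>

lemma mass_ratio_le:
  shows "lam * mass / sig \<le> weight + a1 / (lam - T)"
proof -
  define r where "r = (\<Sum>u\<in>U. defect u * x u)"
  have nzT: "lam - T \<noteq> 0" using big T0 m1 by auto
  have D: "0 \<le> (\<Sum>u\<in>U. defect u)" using defect_nonneg by (intro sum_nonneg) auto
  have "0 \<le> (\<Sum>u\<in>U. defect u) * sig\<^sup>2" using D by simp
  then have sgn: "0 \<le> lam * sig * r" using defect_term unfolding r_def by linarith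
  have "(lam - T) * (lam * mass / sig - weight) = a1 - r / sig"
  proof -
    have "(lam - T) * (lam * mass / sig - weight) = ((lam - T) * (lam * mass - weight * sig)) / sig"
      using sig_nz by (simp add: field_simps)
    also have "\<dots> = (a1 * sig - r) / sig" using main_eq by (simp add: r_def)
    finally show ?thesis using sig_nz by (simp add: field_simps)
  qed
  then have "lam * mass / sig - weight = (a1 - r / sig) / (lam - T)"
    using nzT by (simp add: field_simps)
  then have "lam * mass / sig = weight + a1 / (lam - T) - (r / sig) / (lam - T)"
    by (simp add: diff_divide_distrib)
  moreover have "0 \<le> (r / sig) / (lam - T)"
  proof -
    have rs: "r / sig = (sig * r) / sig\<^sup>2" by (simp add: power2_eq_square)
    show ?thesis
    proof (cases "lam > 0")
      case True
      then have 1: "lam - T > 0" using big T0 m1 by auto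
      have "0 \<le> sig * r" using sgn True by (simp add: zero_le_mult_iff mult.assoc)
      then have "0 \<le> r / sig" unfolding rs by simp
      then show ?thesis using 1 by (rule divide_nonneg_pos)
    next
      case False
      then have l: "lam < 0" using lam_nz by linarith
      then have 1: "lam - T < 0" using T0 by linarith
      have "sig * r \<le> 0" using sgn l by (simp add: zero_le_mult_iff mult.assoc)
      then have "r / sig \<le> 0" unfolding rs by (simp add: divide_nonpos_nonneg)
      then show ?thesis using 1 by (rule divide_nonpos_neg)
    qed
  qed
  ultimately show ?thesis by linarith
qed

text \<open>The square factors as \<open>lam * mass / sig\<close> times
  \<open>lam * sig / mass\<close>. The first factor involves only the graph on \<open>U\<close>, the
  second only the graph on \<open>K\<close>; both are positive, so their upper bounds can be
  multiplied.\<close>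

lemma lam_sq_le:
  assumes w: "weight > 0" and big2: "\<bar>lam\<bar> \<ge> 4 * m\<^sup>2"
  shows "lam\<^sup>2 \<le> m * weight * (1 + g1 / lam + g2 / lam\<^sup>2 + expC m T / \<bar>lam\<bar> ^ 3)"
proof -
  define Y Z where "Y = lam * mass / sig" and "Z = lam * sig / mass"
  define e r where "e = 1 / lam" and "r = \<bar>e\<bar>"
  have YZ: "lam\<^sup>2 = Y * Z" using sig_nz mass_nz by (simp add: Y_def Z_def power2_eq_square)
  have al: "\<bar>lam\<bar> > 0" "\<bar>lam\<bar> \<ge> 1" using big T0 m1 by auto
  have r: "0 \<le> r" "r \<le> 1" using al by (auto simp: r_def e_def divide_le_eq)
  have m0: "m > 0" using m1 by simp
  note cb = coefficient_bounds[OF w]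
  have pe: "1 / lam\<^sup>2 = e\<^sup>2" "1 / \<bar>lam\<bar> ^ 3 = r ^ 3" by (simp_all add: e_def r_def power_divide)
  define Zu where "Zu = m + l1 / lam + l2 / lam\<^sup>2 + 2 * m ^ 4 / \<bar>lam\<bar> ^ 3"
  have Zabs: "\<bar>Z - (m + l1 / lam + l2 / lam\<^sup>2)\<bar> \<le> 2 * m ^ 4 / \<bar>lam\<bar> ^ 3"
  proof -
    have "Z - (m + l1 / lam + l2 / lam\<^sup>2) = (lam * sig - mass * (m + l1 / lam + l2 / lam\<^sup>2)) / mass"
      using mass_nz by (simp add: Z_def diff_divide_distrib)
    then have "\<bar>Z - (m + l1 / lam + l2 / lam\<^sup>2)\<bar> = \<bar>lam * sig - mass * (m + l1 / lam + l2 / lam\<^sup>2)\<bar> / \<bar>mass\<bar>"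
      by (simp only: abs_divide)
    also have "\<dots> \<le> (\<bar>mass\<bar> * (2 * m ^ 4 / \<bar>lam\<bar> ^ 3)) / \<bar>mass\<bar>"
      using sig_expansion by (intro divide_right_mono) auto
    finally have "\<bar>Z - (m + l1 / lam + l2 / lam\<^sup>2)\<bar> \<le> (\<bar>mass\<bar> * (2 * m ^ 4 / \<bar>lam\<bar> ^ 3)) / \<bar>mass\<bar>" .
    then show ?thesis using mass_nz by simp
  qed
  have ZZu: "Z \<le> Zu" using Zabs unfolding Zu_def by linarith
  have Zpos: "Z > 0"
  proof -
    have "\<bar>l1 / lam\<bar> \<le> 1 / 4"
    proof -
      have "\<bar>l1 / lam\<bar> \<le> (m * m) / \<bar>lam\<bar>" using l1_bounds by (simp add: abs_divide divide_right_mono)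
      also have "\<dots> \<le> (m * m) / (4 * m\<^sup>2)"
        using big2 al zero_less_power[OF m0, of 2] by (intro divide_left_mono mult_pos_pos) auto
      finally show ?thesis using m0 by (simp add: power2_eq_square)
    qed
    moreover have "l2 / lam\<^sup>2 \<ge> 0" using l2_bounds by simp
    moreover have "2 * m ^ 4 / \<bar>lam\<bar> ^ 3 \<le> 1 / 2"
    proof -
      have sq4: "(4 * y\<^sup>2)\<^sup>2 = 16 * y ^ 4" for y :: real
        by (simp add: power2_eq_square power4_eq_xxxx)
      have "16 * m ^ 4 \<le> \<bar>lam\<bar> ^ 2"
        unfolding sq4[symmetric] using big2 by (intro power_mono) auto
      also have "\<dots> \<le> \<bar>lam\<bar> ^ 3" using al by (intro power_increasing) auto
      finally have "16 * m ^ 4 \<le> \<bar>lam\<bar> ^ 3" .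
      moreover have "0 \<le> m ^ 4" by simp
      ultimately have "2 * m ^ 4 \<le> 1 / 2 * \<bar>lam\<bar> ^ 3" by linarith
      then show ?thesis using al by (simp add: pos_divide_le_eq)
    qed
    moreover have "Z' > 0" if "\<bar>a\<bar> \<le> 1 / 4" "b \<ge> 0" "c \<le> 1 / 2" "\<bar>Z' - (m' + a + b)\<bar> \<le> c" "m' \<ge> 1"
      for a b c m' Z' :: real using that by linarith
    ultimately show ?thesis using Zabs m1 by blast
  qed
  have Ypos: "Y > 0"
  proof -
    have "0 < Y * Z" using YZ lam_nz by (metis zero_less_power2)
    then show ?thesis using Zpos by (simp add: zero_less_mult_iff)
  qed
  define Yu where "Yu = 1 + \<alpha> * e + T * \<alpha> * e\<^sup>2 + 2 * T ^ 3 * r ^ 3"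
  have YYu: "Y \<le> weight * Yu"
  proof -
    have nzT: "lam - T \<noteq> 0" using big T0 m1 by auto
    have "\<bar>lam\<bar> \<le> 2 * \<bar>lam - T\<bar>" using big T0 m1 by (auto simp: abs_if)
    then have half: "1 / \<bar>lam - T\<bar> \<le> 2 / \<bar>lam\<bar>" using al nzT by (simp add: field_simps)
    have "1 / (lam - T) = e + T * e\<^sup>2 + T\<^sup>2 * e\<^sup>2 * (1 / (lam - T))"
    proof -
      have LT: "lam - (lam - T) = T" by simp
      show ?thesis using resolvent_expansion[OF lam_nz nzT] unfolding LT e_def .
    qed
    also have "T\<^sup>2 * e\<^sup>2 * (1 / (lam - T)) \<le> T\<^sup>2 * e\<^sup>2 * (2 / \<bar>lam\<bar>)"
      using half by (intro mult_left_mono) (auto intro: order_trans[OF abs_ge_self] simp: abs_divide)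
    also have "T\<^sup>2 * e\<^sup>2 * (2 / \<bar>lam\<bar>) = 2 * T\<^sup>2 * r ^ 3"
      by (simp add: r_def e_def power2_eq_square power3_eq_cube)
    finally have "\<alpha> * (1 / (lam - T)) \<le> \<alpha> * (e + T * e\<^sup>2 + 2 * T\<^sup>2 * r ^ 3)"
      using cb(1) by (intro mult_left_mono) auto
    also have "\<dots> = \<alpha> * e + T * \<alpha> * e\<^sup>2 + \<alpha> * (2 * T\<^sup>2 * r ^ 3)" by (simp add: algebra_simps)
    also have "\<alpha> * (2 * T\<^sup>2 * r ^ 3) \<le> T * (2 * T\<^sup>2 * r ^ 3)"
      using cb(2) r by (intro mult_right_mono) auto
    also have "T * (2 * T\<^sup>2 * r ^ 3) = 2 * T ^ 3 * r ^ 3" by (simp add: power2_eq_square power3_eq_cube)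
    finally have "1 + \<alpha> * (1 / (lam - T)) \<le> Yu" unfolding Yu_def by linarith
    then have "weight * (1 + \<alpha> * (1 / (lam - T))) \<le> weight * Yu" using w by (intro mult_left_mono) auto
    moreover have "weight * (1 + \<alpha> * (1 / (lam - T))) = weight + a1 / (lam - T)"
    proof -
      have "weight * \<alpha> = a1" using w by (simp add: \<alpha>_def)
      moreover have "weight * (1 + \<alpha> * (1 / (lam - T))) = weight + (weight * \<alpha>) * (1 / (lam - T))"
        by (simp add: distrib_left)
      ultimately show ?thesis by simp
    qed
    ultimately show ?thesis using mass_ratio_le unfolding Y_def by linarith
  qed
  have Zu_eq: "Zu = m * (1 + l1 / m * e + l2 / m * e\<^sup>2 + 2 * m ^ 3 * r ^ 3)"
  proof -
    have "2 * m ^ 4 / \<bar>lam\<bar> ^ 3 = m * (2 * m ^ 3 * r ^ 3)"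
      unfolding pe(2)[symmetric] by (simp add: power3_eq_cube power4_eq_xxxx)
    then show ?thesis unfolding Zu_def using m0 by (simp add: distrib_left e_def power_divide)
  qed
  have "lam\<^sup>2 \<le> (weight * Yu) * Zu"
    unfolding YZ using YYu ZZu Ypos Zpos by (intro mult_mono) auto
  also have "\<dots> = m * weight * (Yu * (1 + l1 / m * e + l2 / m * e\<^sup>2 + 2 * m ^ 3 * r ^ 3))"
    unfolding Zu_eq by (simp add: mult_ac)
  also have "\<dots> \<le> m * weight * (1 + (\<alpha> + l1 / m) * e + (T * \<alpha> + \<alpha> * (l1 / m) + l2 / m) * e\<^sup>2 + expC m T * r ^ 3)"
    unfolding Yu_def using m0 w cb r
    by (intro mult_left_mono expansion_product) (auto simp: r_def)
  also have "\<dots> = m * weight * (1 + g1 / lam + g2 / lam\<^sup>2 + expC m T / \<bar>lam\<bar> ^ 3)"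
  proof -
    have "g1 * e = g1 / lam" "g2 * e\<^sup>2 = g2 / lam\<^sup>2" "expC m T * r ^ 3 = expC m T / \<bar>lam\<bar> ^ 3"
      by (simp_all add: e_def r_def power_divide)
    then show ?thesis unfolding g1_def[symmetric] g2_def[symmetric] by simp
  qed
  finally show ?thesis .
qed

text \<open>Rewritten in \<open>|lam|\<close>, the bounds for \<open>p\<close> and
  \<open>- q\<close> differ only in the sign of \<open>g1\<close>, as needed to add them.\<close>

lemma lam_cubed_le:
  assumes w: "weight > 0" and big2: "\<bar>lam\<bar> \<ge> 4 * m\<^sup>2"
  shows "\<bar>lam\<bar> ^ 3 \<le> m * weight * (\<bar>lam\<bar> + sgn lam * g1 + g2 / \<bar>lam\<bar> + expC m T / \<bar>lam\<bar>\<^sup>2)"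
proof -
  have al: "\<bar>lam\<bar> > 0" using lam_nz by simp
  have distr: "c * (1 + a + b + d) * y = c * (y + a * y + b * y + d * y)" for a b c d y :: real
    by (simp add: algebra_simps)
  have "\<bar>lam\<bar> ^ 3 = lam\<^sup>2 * \<bar>lam\<bar>" by (simp add: power3_eq_cube power2_eq_square)
  also have "\<dots> \<le> (m * weight * (1 + g1 / lam + g2 / lam\<^sup>2 + expC m T / \<bar>lam\<bar> ^ 3)) * \<bar>lam\<bar>"
    using lam_sq_le[OF assms] by (intro mult_right_mono) auto
  also have "\<dots> = m * weight * (\<bar>lam\<bar> + g1 / lam * \<bar>lam\<bar> + g2 / lam\<^sup>2 * \<bar>lam\<bar> + expC m T / \<bar>lam\<bar> ^ 3 * \<bar>lam\<bar>)"
    using distr by blast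
  also have "g1 / lam * \<bar>lam\<bar> = sgn lam * g1" using lam_nz by (simp add: sgn_if)
  also have "g2 / lam\<^sup>2 * \<bar>lam\<bar> = g2 / \<bar>lam\<bar>"
    using al by (simp add: power2_eq_square abs_if)
  also have "expC m T / \<bar>lam\<bar> ^ 3 * \<bar>lam\<bar> = expC m T / \<bar>lam\<bar>\<^sup>2"
    using al by (simp add: power3_eq_cube power2_eq_square)
  finally show ?thesis .
qed

end

section \<open>Bounds for the spread of a hub matrix\<close>

definition expB :: "real \<Rightarrow> real \<Rightarrow> real" where
  "expB m T = 2 * expG m T + expC m T"

definition exp_const :: "real \<Rightarrow> real \<Rightarrow> real" where
  "exp_const m T = 16 * expG m T * (2 * expB m T + (expB m T)\<^sup>2) + 16 * expC m T
     + 6 * expG m T * (2 * (expG m T + expC m T) + expB m T ^ 3)"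

definition exp_threshold :: "real \<Rightarrow> real \<Rightarrow> real" where
  "exp_threshold m T = 2 * expB m T + 2 + 3 * T + 2 * m + 4 * m\<^sup>2"

lemma expGC_nonneg:
  fixes m T :: real
  assumes "m \<ge> 0" "T \<ge> 0"
  shows "0 \<le> expG m T" "0 \<le> expC m T" "0 \<le> expB m T"
  using assms by (simp_all add: expG_def expC_def expB_def)

context hub_graph
begin

lemma exp_nonneg: "0 \<le> expG m T" "0 \<le> expC m T" "0 \<le> expB m T"
proof -
  have m0: "m \<ge> 0" using m1 by simp
  show "0 \<le> expG m T" "0 \<le> expC m T" "0 \<le> expB m T"
    using expGC_nonneg[OF m0 T0] by auto
qed

lemma hub_eigenI:
  assumes sp: "is_spread (K \<union> U) hubmat p q x z"
  shows "\<bar>p\<bar> \<ge> 3 * T + 2 * m + 1 \<Longrightarrow> hub_eigen K U E c s t p x"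
    and "\<bar>q\<bar> \<ge> 3 * T + 2 * m + 1 \<Longrightarrow> hub_eigen K U E c s t (- q) z"
  using sp unfolding is_spread_def by (unfold_locales; auto)+

text \<open>A bootstrap: \<open>q <= p\<close> makes \<open>p\<close> large, so the expansion
  applies to \<open>p\<close> and bounds it from above; then \<open>q\<close> must be large as well,
  and the expansion applies to \<open>- q\<close>.\<close>

lemma spread_localization:
  assumes sp: "is_spread (K \<union> U) hubmat p q x z" and w: "weight > 0"
    and l: "l = sqrt (m * weight)" "l \<ge> exp_threshold m T" and pq: "p + q \<ge> 2 * l"
  shows "p \<ge> l" "q \<ge> l - expB m T" "q \<ge> 3 * T + 2 * m + 1 + 4 * m\<^sup>2"
    "p ^ 3 \<le> l\<^sup>2 * (p + g1 + g2 / p + expC m T / p\<^sup>2)"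
    "q ^ 3 \<le> l\<^sup>2 * (q - g1 + g2 / q + expC m T / q\<^sup>2)"
proof -
  have sq: "l\<^sup>2 = m * weight" using l(1) w m1 by simp
  have m2: "m\<^sup>2 \<ge> 1" using m1 by (simp add: one_le_power)
  note nn = exp_nonneg
  note lt = l(2)[unfolded exp_threshold_def]
  have l0: "l > 0" using lt nn T0 m1 m2 by (smt (verit))
  show pl: "p \<ge> l" using spread_bottom_le_top[OF sp hubmat_nonneg] pq by (smt (verit))
  have p1: "p \<ge> 3 * T + 2 * m + 1" "p \<ge> 4 * m\<^sup>2" "p \<ge> 1" "p > 0" using pl lt nn T0 m1 m2 by (smt (verit))+
  interpret P: hub_eigen K U E c s t p x using hub_eigenI(1)[OF sp] p1 by simp
  show P: "p ^ 3 \<le> l\<^sup>2 * (p + g1 + g2 / p + expC m T / p\<^sup>2)"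
    using P.lam_cubed_le[OF w] p1 by (simp add: sq)
  have "p \<le> l + (2 * expG m T + expC m T)"
    by (rule root_upper[OF nn(1,2) l0 p1(3) coefficient_bounds(7)[OF w] coefficient_bounds(8)[OF w] P])
  then show ql: "q \<ge> l - expB m T" using pq unfolding expB_def by (smt (verit))
  then show q0: "q \<ge> 3 * T + 2 * m + 1 + 4 * m\<^sup>2" using lt nn by (smt (verit))
  have q1: "q \<ge> 3 * T + 2 * m + 1" "q \<ge> 4 * m\<^sup>2" "q \<ge> 1" "q > 0" using q0 T0 m1 m2 by (smt (verit))+
  interpret Q: hub_eigen K U E c s t "- q" z using hub_eigenI(2)[OF sp] q1 by simp
  show "q ^ 3 \<le> l\<^sup>2 * (q - g1 + g2 / q + expC m T / q\<^sup>2)"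
    using Q.lam_cubed_le[OF w] q1 by (simp add: sq)
qed

theorem coarse_bound:
  assumes sp: "is_spread (K \<union> U) hubmat p q x z" and w: "weight > 0"
    and l: "l = sqrt (m * weight)" "l \<ge> exp_threshold m T" and pq: "p + q \<ge> 2 * l"
  shows "(p + q)\<^sup>2 \<le> 4 * (m * weight) + 4 / 3 * T\<^sup>2
     + 4 / (3 * m) * (3 * l2 - 2 / m * l1\<^sup>2 - T * l1) + exp_const m T / l"
proof -
  note loc = spread_localization[OF assms]
  have sq: "l\<^sup>2 = m * weight" using l(1) w m1 by simp
  have m2: "m\<^sup>2 \<ge> 1" using m1 by (simp add: one_le_power)
  note nn = exp_nonneg
  note lt = l(2)[unfolded exp_threshold_def]
  have "(p + q)\<^sup>2 \<le> 4 * l\<^sup>2 + 4 * g2 - 3 * g1\<^sup>2 + exp_const m T / l"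
    unfolding exp_const_def expB_def
  proof (rule spread_expansion_bound)
    show "l \<ge> 2 * (2 * expG m T + expC m T) + 2" using lt T0 m1 m2 unfolding expB_def by (smt (verit))
    show "p \<ge> 1" using loc(1) lt nn T0 m1 m2 by (smt (verit))
    show "q \<ge> 1" using loc(3) T0 m1 m2 by (smt (verit))
  qed (use nn pq coefficient_bounds[OF w] loc in auto)
  moreover have "4 * g2 - 3 * g1\<^sup>2 \<le> 4 / 3 * T\<^sup>2 + 4 / (3 * m) * (3 * l2 - 2 / m * l1\<^sup>2 - T * l1)"
    unfolding g1_def g2_def using m1 by (intro expansion_coefficients) auto
  ultimately show ?thesis unfolding sq by (smt (verit))
qed

end

section \<open>The cubic equation over independent hubs\<close>

context hub_eigen
begin

text \<open>Without edges inside \<open>K\<close> all hub entries equal \<open>mass / lam\<close>,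
  so \<open>lam * sig = m * mass\<close> exactly and \<open>mass\<close> can be eliminated. The
  error \<open>r\<close> inherits its sign from \<open>defect_term\<close>.\<close>

lemma cubic_eq:
  assumes "\<And>k. k \<in> K \<Longrightarrow> dK k = 0"
  obtains r where "(lam - T) * (lam\<^sup>2 - m * weight) = m * (a1 - r)"
    "(\<Sum>u\<in>U. defect u) \<le> 2 * (lam * r)" "(\<Sum>u\<in>U. defect u) = 0 \<Longrightarrow> r = 0"
proof -
  have "(\<Sum>v\<in>K. adj E k v * x v) = 0" if k: "k \<in> K" for k
  proof -
    have "(\<Sum>v\<in>K. adj E k v) = 0" using assms[OF k] by (simp add: dK_def)
    then have "\<forall>v\<in>K. adj E k v = 0" using finK by (simp add: sum_nonneg_eq_0_iff)
    then show ?thesis by simp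
  qed
  then have "lam * x k = mass" if "k \<in> K" for k using eig_K[OF that] that by simp
  then have sm: "lam * sig = m * mass" by (simp add: sig_def sum_distrib_left card_K)
  define De where "De = (\<Sum>u\<in>U. defect u * x u)"
  define r where "r = De / sig"
  have "m * ((lam - T) * (lam * mass - weight * sig)) = m * (a1 * sig - De)"
    using main_eq by (simp add: De_def)
  moreover have "m * ((lam - T) * (lam * mass - weight * sig)) = (lam - T) * (lam * (m * mass) - m * weight * sig)"
    by (simp add: right_diff_distrib mult_ac)
  ultimately have "(lam - T) * (lam * (lam * sig) - m * weight * sig) = m * (a1 * sig - De)"
    using sm by simp
  moreover have "(lam - T) * (lam * (lam * sig) - m * weight * sig) = ((lam - T) * (lam\<^sup>2 - m * weight)) * sig"
    by (simp add: power2_eq_square left_diff_distrib right_diff_distrib mult_ac)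
  moreover have "m * (a1 * sig - De) = (m * (a1 - r)) * sig"
  proof -
    have De: "De = r * sig" using sig_nz by (simp add: r_def)
    show ?thesis unfolding De by (simp add: left_diff_distrib)
  qed
  ultimately have eq: "(lam - T) * (lam\<^sup>2 - m * weight) = m * (a1 - r)" using sig_nz by simp
  have "(\<Sum>u\<in>U. defect u) * sig\<^sup>2 \<le> (2 * (lam * r)) * sig\<^sup>2"
  proof -
    have De: "De = r * sig" using sig_nz by (simp add: r_def)
    have "(2 * (lam * r)) * sig\<^sup>2 = 2 * (lam * sig * De)"
      unfolding De by (simp add: power2_eq_square)
    then show ?thesis using defect_term unfolding De_def by linarith
  qed
  then have D: "(\<Sum>u\<in>U. defect u) \<le> 2 * (lam * r)" using sig_nz by simp
  have "r = 0" if "(\<Sum>u\<in>U. defect u) = 0"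
  proof -
    have "\<forall>u\<in>U. defect u = 0" using that finU defect_nonneg by (simp add: sum_nonneg_eq_0_iff)
    then show ?thesis by (simp add: r_def De_def)
  qed
  then show ?thesis using eq D that by blast
qed

end

text \<open>The difference of the two cubic equations is divisible by \<open>p + q\<close>. The
  quotient combines with \<open>(p + q)^2\<close> into a complete square in \<open>p - q\<close>,
  and the errors add because \<open>rp\<close> and \<open>- rq\<close> are both bounded below by
  positive multiples of \<open>D\<close>.\<close>

lemma cubic_pair_bound:
  fixes p q m w T a1 rp rq D :: real
  assumes pos: "p > 0" "q > 0" and m: "m > 0"
    and P: "(p - T) * (p\<^sup>2 - m * w) = m * (a1 - rp)" and Q: "(- q - T) * ((- q)\<^sup>2 - m * w) = m * (a1 - rq)"
    and rp: "D \<le> 2 * (p * rp)" and rq: "D \<le> 2 * (- q * rq)"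
  shows "(p + q)\<^sup>2 \<le> 4 * (m * w) + 4 / 3 * T\<^sup>2 - 2 * m * D / (p * q)"
proof -
  have id: "(p - T) * (p\<^sup>2 - m * w) - (- q - T) * ((- q)\<^sup>2 - m * w)
      = (p + q) * (p\<^sup>2 - p * q + q\<^sup>2 - T * (p - q) - m * w)"
    by (simp add: algebra_simps power2_eq_square)
  have "D / (2 * p) \<le> rp" using rp pos by (simp add: pos_divide_le_eq mult.commute mult.left_commute)
  moreover have "D / (2 * q) \<le> - rq" using rq pos by (simp add: pos_divide_le_eq mult.commute mult.left_commute)
  moreover have "D / (2 * p) + D / (2 * q) = (p + q) * (D / (2 * (p * q)))"
    using pos by (simp add: field_simps)
  ultimately have "(p + q) * (D / (2 * (p * q))) \<le> rp - rq" by linarith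
  then have "m * ((p + q) * (D / (2 * (p * q)))) \<le> m * (rp - rq)" using m by (intro mult_left_mono) auto
  moreover have "(p + q) * (p\<^sup>2 - p * q + q\<^sup>2 - T * (p - q) - m * w) = - (m * (rp - rq))"
    unfolding id[symmetric] P Q by (simp add: algebra_simps)
  ultimately have "(p + q) * (p\<^sup>2 - p * q + q\<^sup>2 - T * (p - q) - m * w) \<le> (p + q) * (- (m * D / (2 * (p * q))))"
    by (simp add: mult_ac)
  then have main: "p\<^sup>2 - p * q + q\<^sup>2 - T * (p - q) - m * w \<le> - (m * D / (2 * (p * q)))"
    by (rule mult_left_le_imp_le) (use pos in simp)
  have "4 * (m * D / (2 * (p * q))) = 2 * m * D / (p * q)" by simp
  moreover have "4 * (m * w) + 4 / 3 * T\<^sup>2 - (p + q)\<^sup>2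
     = 3 * (p - q - 2 / 3 * T)\<^sup>2 - 4 * (p\<^sup>2 - p * q + q\<^sup>2 - T * (p - q) - m * w)"
    by (simp add: field_simps power2_eq_square)
  moreover have "0 \<le> 3 * (p - q - 2 / 3 * T)\<^sup>2" by simp
  ultimately show ?thesis using main by (smt (verit))
qed

text \<open>
  The third root of the cubic is \<open>T / 3 + d\<close>, so the spread is governed by the distance \<open>d\<close> of this
  root from the inflection point, around which the cubic is odd.
\<close>

lemma cubic_pair_eq:
  fixes p q m w T a1 :: real
  assumes pos: "p > 0" "q > 0"
    and P: "(p - T) * (p\<^sup>2 - m * w) = m * a1" and Q: "(- q - T) * ((- q)\<^sup>2 - m * w) = m * a1"
  defines "d \<equiv> 2 / 3 * T - (p - q)"
  shows "(p + q)\<^sup>2 = 4 * (m * w) + 4 / 3 * T\<^sup>2 - 3 * d\<^sup>2"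
    and "m * a1 = 2 / 3 * (m * T * w) - 2 / 27 * T ^ 3 - (m * w + T\<^sup>2 / 3) * d + d ^ 3"
proof -
  have "(p - T) * (p\<^sup>2 - m * w) - (- q - T) * ((- q)\<^sup>2 - m * w)
      = (p + q) * (p\<^sup>2 - p * q + q\<^sup>2 - T * (p - q) - m * w)"
    by (simp add: algebra_simps power2_eq_square)
  then have "(p + q) * (p\<^sup>2 - p * q + q\<^sup>2 - T * (p - q) - m * w) = 0" using P Q by simp
  then have e: "m * w = p\<^sup>2 - p * q + q\<^sup>2 - T * (p - q)" using pos by simp
  show "(p + q)\<^sup>2 = 4 * (m * w) + 4 / 3 * T\<^sup>2 - 3 * d\<^sup>2"
    unfolding e d_def by (simp add: field_simps power2_eq_square)
  define a where "a = T / 3"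
  have T: "T = 3 * a" by (simp add: a_def)
  have "m * a1 = (p - 3 * a) * (p\<^sup>2 - m * w)" using P by (simp add: T)
  also have "\<dots> = 2 * a * (m * w) - 2 * a ^ 3 - (m * w + 3 * a\<^sup>2) * d + d ^ 3"
    unfolding e d_def T by (simp add: algebra_simps power2_eq_square power3_eq_cube)
  also have "\<dots> = 2 / 3 * (m * T * w) - 2 / 27 * T ^ 3 - (m * w + T\<^sup>2 / 3) * d + d ^ 3"
    by (simp add: T power_mult_distrib)
  finally show "m * a1 = 2 / 3 * (m * T * w) - 2 / 27 * T ^ 3 - (m * w + T\<^sup>2 / 3) * d + d ^ 3" .
qed

context hub_graph
begin

theorem fine_bound:
  assumes sp: "is_spread (K \<union> U) hubmat p q x z" and w: "weight > 0"
    and l: "sqrt (m * weight) \<ge> exp_threshold m T" and pq: "p + q \<ge> 2 * sqrt (m * weight)"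
    and empty: "\<And>k. k \<in> K \<Longrightarrow> dK k = 0"
  defines "D \<equiv> (\<Sum>u\<in>U. dU u * (T - dU u))"
  shows "p > 0" "q > 0" "(p + q)\<^sup>2 \<le> 4 * (m * weight) + 4 / 3 * T\<^sup>2 - 2 * m * D / (p * q)"
    and "D = 0 \<Longrightarrow> \<exists>d. (p + q)\<^sup>2 = 4 * (m * weight) + 4 / 3 * T\<^sup>2 - 3 * d\<^sup>2 \<and>
      m * a1 = 2 / 3 * (m * T * weight) - 2 / 27 * T ^ 3 - (m * weight + T\<^sup>2 / 3) * d + d ^ 3"
proof -
  note loc = spread_localization[OF sp w HOL.refl l pq]
  have m2: "m\<^sup>2 \<ge> 1" using m1 by (simp add: one_le_power)
  have p1: "p \<ge> 3 * T + 2 * m + 1"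
    using loc(1) l[unfolded exp_threshold_def] exp_nonneg T0 m1 m2 by (smt (verit))
  have q1: "q \<ge> 3 * T + 2 * m + 1" using loc(3) m2 by (smt (verit))
  show pos: "p > 0" "q > 0" using p1 q1 T0 m1 by (smt (verit))+
  have m0: "m > 0" using m1 by simp
  interpret P: hub_eigen K U E c s t p x using hub_eigenI(1)[OF sp] p1 by simp
  interpret Q: hub_eigen K U E c s t "- q" z using hub_eigenI(2)[OF sp] q1 by simp
  obtain rp where rp: "(p - T) * (p\<^sup>2 - m * weight) = m * (a1 - rp)"
    "(\<Sum>u\<in>U. defect u) \<le> 2 * (p * rp)" "(\<Sum>u\<in>U. defect u) = 0 \<Longrightarrow> rp = 0"
    using P.cubic_eq[OF empty] by blast
  obtain rq where rq: "(- q - T) * ((- q)\<^sup>2 - m * weight) = m * (a1 - rq)"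
    "(\<Sum>u\<in>U. defect u) \<le> 2 * (- q * rq)" "(\<Sum>u\<in>U. defect u) = 0 \<Longrightarrow> rq = 0"
    using Q.cubic_eq[OF empty] by blast
  have D: "(\<Sum>u\<in>U. defect u) = D" unfolding D_def by (rule sum_defect)
  show "(p + q)\<^sup>2 \<le> 4 * (m * weight) + 4 / 3 * T\<^sup>2 - 2 * m * D / (p * q)"
    using cubic_pair_bound[OF pos m0 rp(1) rq(1)] rp(2) rq(2) D by simp
  assume "D = 0"
  then have "rp = 0" "rq = 0" using rp(3) rq(3) D by auto
  then have "(p - T) * (p\<^sup>2 - m * weight) = m * a1" "(- q - T) * ((- q)\<^sup>2 - m * weight) = m * a1"
    using rp(1) rq(1) by simp_all
  from cubic_pair_eq[OF pos this]
  show "\<exists>d. (p + q)\<^sup>2 = 4 * (m * weight) + 4 / 3 * T\<^sup>2 - 3 * d\<^sup>2 \<and>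
      m * a1 = 2 / 3 * (m * T * weight) - 2 / 27 * T ^ 3 - (m * weight + T\<^sup>2 / 3) * d + d ^ 3"
    by blast
qed

end

section \<open>Comparison with weighted hub matrices\<close>

lemma abs_sum_le_card:
  fixes x :: "'a \<Rightarrow> real"
  assumes "finite V" "X \<subseteq> V" "sqnorm V x = 1"
  shows "(\<Sum>v\<in>X. \<bar>x v\<bar>) \<le> sqrt (card X)"
proof -
  have "(\<Sum>v\<in>X. \<bar>x v\<bar>)\<^sup>2 \<le> card X * sqnorm X (\<lambda>v. \<bar>x v\<bar>)" by (rule sum_squared_le_card)
  also have "sqnorm X (\<lambda>v. \<bar>x v\<bar>) \<le> 1"
    using sqnorm_mono[OF assms(2,1), of x] assms(3) by (simp add: sqnorm_def)
  finally have "(\<Sum>v\<in>X. \<bar>x v\<bar>)\<^sup>2 \<le> card X" by (simp add: mult_left_mono)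
  then show ?thesis by (rule real_le_rsqrt)
qed

text \<open>
  Vertices outside \<open>K\<close> that miss some hub lose all their edges and are instead joined to every hub with
  weight \<open>1 - kap\<close>. As eigenvector entries off \<open>K\<close> are tiny, this does not decrease the spread.
\<close>

locale hub_split = biclique_free +
  fixes K :: "'a set" and kap :: real
  assumes KV: "K \<subseteq> V" and cardK: "card K = s - 1" and s2: "2 \<le> s" and t1: "1 \<le> t"
    and kap: "0 \<le> kap" "kap \<le> 1"
begin

abbreviation W where "W \<equiv> common_nbrs V E K"
definition U where "U = V - K"
definition R where "R = V - K - W"
definition c where "c v = (if v \<in> W then 1 else 1 - kap)"
text \<open>Edges between \<open>K\<close> and the rest are omitted because \<open>hubmat\<close>
  reads those entries from \<open>c\<close>.\<close>

definition F where "F = E \<inter> (K \<times> K \<union> W \<times> W)"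

lemma WU: "W \<subseteq> U"
proof -
  have "K \<noteq> {}" using cardK s2 by auto
  then show ?thesis using edge_neq by (auto simp: common_nbrs_def U_def)
qed

lemma fin: "finite K" "finite U" "finite R" "finite W"
  using finV KV by (auto simp: U_def R_def common_nbrs_def intro: finite_subset)

lemma parts: "V = K \<union> U" "K \<inter> U = {}" "U = W \<union> R" "W \<inter> R = {}" "K \<inter> W = {}" "K \<inter> R = {}"
  using KV WU by (auto simp: U_def R_def)

text \<open>Together with \<open>v\<close> the hubs form a set of size \<open>s\<close> to which
  every neighbour of \<open>v\<close> in \<open>W\<close> is joined.\<close>

lemma few_W_nbrs: assumes "v \<in> U" shows "card (E `` {v} \<inter> W) \<le> t - 1"
proof -
  have v: "v \<in> V" "v \<notin> K" using assms by (auto simp: U_def)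
  have "card {w \<in> V. \<forall>a\<in>insert v K. (a, w) \<in> E} < t"
    using v KV cardK s2 fin by (intro few_common_nbrs) auto
  moreover have "E `` {v} \<inter> W \<subseteq> {w \<in> V. \<forall>a\<in>insert v K. (a, w) \<in> E}" by (auto simp: common_nbrs_def)
  then have "card (E `` {v} \<inter> W) \<le> card {w \<in> V. \<forall>a\<in>insert v K. (a, w) \<in> E}"
    using finV by (intro card_mono) auto
  ultimately show ?thesis by linarith
qed

sublocale H: hub_graph K U F c s t
proof
  show "sym F" using E_sym by (auto simp: F_def sym_def)
  show "irrefl F" using E_irr by (auto simp: F_def irrefl_def)
  show "0 \<le> c u \<and> c u \<le> 1" for u using kap by (simp add: c_def)
  show "u \<in> U \<Longrightarrow> v \<in> U \<Longrightarrow> (u, v) \<in> F \<Longrightarrow> c u = 1" for u v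
    using parts by (auto simp: F_def c_def)
  fix u assume u: "u \<in> U"
  have "F `` {u} \<inter> U \<subseteq> E `` {u} \<inter> W" using u parts by (auto simp: F_def)
  then have "card (F `` {u} \<inter> U) \<le> card (E `` {u} \<inter> W)" using fin by (intro card_mono) auto
  then show "card (F `` {u} \<inter> U) \<le> t - 1" using few_W_nbrs[OF u] by linarith
qed (use fin parts cardK s2 t1 in auto)

lemma qform_parts:
  assumes "\<And>i j. M i j = M j i"
  shows "qform V M x = qform K M x + qform W M x + qform R M x
    + 2 * (\<Sum>w\<in>W. x w * (\<Sum>k\<in>K. M w k * x k)) + 2 * (\<Sum>r\<in>R. x r * (\<Sum>k\<in>K. M r k * x k))
    + 2 * (\<Sum>r\<in>R. x r * (\<Sum>w\<in>W. M r w * x w))"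
proof -
  have V1: "U \<union> K = V" and U1: "R \<union> W = U" using parts by blast+
  have "qform (U \<union> K) M x = qform U M x + qform K M x + 2 * (\<Sum>u\<in>U. x u * (\<Sum>k\<in>K. M u k * x k))"
    by (rule qform_Un_disjoint) (use fin parts(2) assms in auto)
  moreover have "qform (R \<union> W) M x = qform R M x + qform W M x + 2 * (\<Sum>r\<in>R. x r * (\<Sum>w\<in>W. M r w * x w))"
    by (rule qform_Un_disjoint) (use fin parts(4) assms in auto)
  moreover have "(\<Sum>u\<in>R \<union> W. x u * (\<Sum>k\<in>K. M u k * x k)) = (\<Sum>r\<in>R. x r * (\<Sum>k\<in>K. M r k * x k)) + (\<Sum>w\<in>W. x w * (\<Sum>k\<in>K. M w k * x k))"
    using fin parts(4) by (intro sum.union_disjoint) auto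
  ultimately show ?thesis unfolding V1 U1 by simp
qed

lemma hubmat_parts:
  shows "k \<in> K \<Longrightarrow> k' \<in> K \<Longrightarrow> H.hubmat k k' = adj E k k'"
    and "w \<in> W \<Longrightarrow> w' \<in> W \<Longrightarrow> H.hubmat w w' = adj E w w'"
    and "w \<in> W \<Longrightarrow> k \<in> K \<Longrightarrow> H.hubmat w k = 1"
    and "r \<in> R \<Longrightarrow> k \<in> K \<Longrightarrow> H.hubmat r k = 1 - kap"
    and "r \<in> R \<Longrightarrow> u \<in> U \<Longrightarrow> H.hubmat r u = 0"
proof -
  have adjF: "i \<in> K \<Longrightarrow> j \<in> K \<Longrightarrow> adj F i j = adj E i j" "i \<in> W \<Longrightarrow> j \<in> W \<Longrightarrow> adj F i j = adj E i j"
    "i \<notin> K \<Longrightarrow> i \<notin> W \<Longrightarrow> adj F i j = 0" for i j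
    by (simp_all add: adj_def F_def)
  have K: "k \<notin> U \<and> k \<notin> W" if "k \<in> K" for k using that parts(2,5) by blast
  have W: "w \<in> U \<and> w \<notin> K" if "w \<in> W" for w using that WU parts(5) by blast
  have R: "r \<in> U \<and> r \<notin> K \<and> r \<notin> W" if "r \<in> R" for r using that parts(3,4,6) by blast
  have U: "u \<notin> K" if "u \<in> U" for u using that parts(2) by blast
  show "k \<in> K \<Longrightarrow> k' \<in> K \<Longrightarrow> H.hubmat k k' = adj E k k'"
    using K adjF by (simp add: H.hubmat_def)
  show "w \<in> W \<Longrightarrow> w' \<in> W \<Longrightarrow> H.hubmat w w' = adj E w w'"
    using W adjF by (simp add: H.hubmat_def)
  show "w \<in> W \<Longrightarrow> k \<in> K \<Longrightarrow> H.hubmat w k = 1"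
    using W K by (simp add: H.hubmat_def c_def)
  show "r \<in> R \<Longrightarrow> k \<in> K \<Longrightarrow> H.hubmat r k = 1 - kap"
    using R K by (simp add: H.hubmat_def c_def)
  show "r \<in> R \<Longrightarrow> u \<in> U \<Longrightarrow> H.hubmat r u = 0"
    using R U adjF by (simp add: H.hubmat_def)
qed

text \<open>The sign \<open>e\<close> selects the end of the spectrum and \<open>tau\<close> is the
  common sign on the hubs. A vertex \<open>r\<close> of \<open>R\<close> misses a hub, so its old
  hub edges give at most \<open>(sg - c0) |x r|\<close> and the new ones
  \<open>(1 - kap) sg |x r|\<close>; the deleted edges outside \<open>K\<close> cost at most
  \<open>(t + 2 ^ (s + t)) d\<close> times \<open>|x r|\<close> on summation. The hypothesis
  \<open>gap\<close> is this balance.\<close>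

lemma replace_rest:
  assumes e: "e = 1 \<or> e = - 1" and tau: "tau = 1 \<or> tau = - 1"
    and d: "d \<ge> 0" "\<And>v. v \<in> U \<Longrightarrow> \<bar>x v\<bar> \<le> d" and c0: "\<And>k. k \<in> K \<Longrightarrow> c0 \<le> tau * x k"
    and c00: "c0 \<ge> 0" and gap: "kap * (\<Sum>k\<in>K. \<bar>x k\<bar>) \<le> c0 - (real t + 2 ^ (s + t)) * d"
  shows "\<exists>x'. sqnorm V x' = sqnorm V x \<and> e * qform V (adj E) x \<le> e * qform V H.hubmat x'"
proof -
  define sg where "sg = (\<Sum>k\<in>K. \<bar>x k\<bar>)"
  \<comment> \<open>On \<open>R\<close> the sign is chosen so that every new hub edge contributes
    positively to \<open>e\<close> times the form; the norm is unchanged.\<close>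
  define x' where "x' = (\<lambda>v. if v \<in> R then e * tau * \<bar>x v\<bar> else x v)"
  have tau2: "tau * tau = 1" "e * e = 1" "\<bar>e\<bar> = 1" "\<bar>tau\<bar> = 1" using e tau by auto
  have xk: "x k = tau * \<bar>x k\<bar>" if "k \<in> K" for k
  proof -
    have "0 \<le> tau * x k" using c0[OF that] c00 by linarith
    then show ?thesis using tau by auto
  qed
  have sum_xk: "(\<Sum>k\<in>K. x k) = tau * sg" unfolding sg_def sum_distrib_left using xk by (intro sum.cong) auto
  have x'K: "x' v = x v" if "v \<in> K \<or> v \<in> W" for v using that parts by (auto simp: x'_def)
  have "sqnorm V x' = sqnorm V x"
    unfolding sqnorm_def by (intro sum.cong) (auto simp: x'_def power_mult_distrib power2_eq_square tau2 mult_ac)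
  moreover have "e * qform V (adj E) x \<le> e * qform V H.hubmat x'"
  proof -
    have M: "qform V H.hubmat x' = qform K (adj E) x + qform W (adj E) x
      + 2 * (\<Sum>w\<in>W. x w * (\<Sum>k\<in>K. x k)) + 2 * (\<Sum>r\<in>R. e * tau * \<bar>x r\<bar> * ((1 - kap) * (tau * sg)))"
    proof -
      have "qform K H.hubmat x' = qform K (adj E) x" "qform W H.hubmat x' = qform W (adj E) x"
        using hubmat_parts(1,2) x'K by (intro qform_cong; simp)+
      moreover have "qform R H.hubmat x' = 0"
        unfolding qform_def using hubmat_parts(5) parts by (intro sum.neutral ballI) auto
      moreover have "(\<Sum>w\<in>W. x' w * (\<Sum>k\<in>K. H.hubmat w k * x' k)) = (\<Sum>w\<in>W. x w * (\<Sum>k\<in>K. x k))"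
        using hubmat_parts(3) x'K by (intro sum.cong arg_cong2[of _ _ _ _ "(*)"]) auto
      moreover have "(\<Sum>r\<in>R. x' r * (\<Sum>k\<in>K. H.hubmat r k * x' k)) = (\<Sum>r\<in>R. e * tau * \<bar>x r\<bar> * ((1 - kap) * (tau * sg)))"
      proof (intro sum.cong arg_cong2[of _ _ _ _ "(*)"])
        fix r assume r: "r \<in> R"
        have "(\<Sum>k\<in>K. H.hubmat r k * x' k) = (\<Sum>k\<in>K. (1 - kap) * x k)"
          using hubmat_parts(4)[OF r] x'K by (intro sum.cong) auto
        then show "(\<Sum>k\<in>K. H.hubmat r k * x' k) = (1 - kap) * (tau * sg)"
          by (simp add: sum_distrib_left[symmetric] sum_xk)
      qed (auto simp: x'_def)
      moreover have "(\<Sum>r\<in>R. x' r * (\<Sum>w\<in>W. H.hubmat r w * x' w)) = 0"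
        using hubmat_parts(5) parts by (intro sum.neutral ballI) auto
      ultimately show ?thesis using qform_parts[where M = H.hubmat and x = x', OF H.hubmat_sym] by simp
    qed
    have A: "qform V (adj E) x = qform K (adj E) x + qform W (adj E) x + qform R (adj E) x
      + 2 * (\<Sum>w\<in>W. x w * (\<Sum>k\<in>K. x k)) + 2 * (\<Sum>r\<in>R. x r * (\<Sum>k\<in>K. adj E r k * x k))
      + 2 * (\<Sum>r\<in>R. x r * (\<Sum>w\<in>W. adj E r w * x w))"
    proof -
      have "(\<Sum>w\<in>W. x w * (\<Sum>k\<in>K. adj E w k * x k)) = (\<Sum>w\<in>W. x w * (\<Sum>k\<in>K. x k))"
        using edge_sym by (intro sum.cong arg_cong2[of _ _ _ _ "(*)"]) (auto simp: adj_def common_nbrs_def)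
      then show ?thesis using qform_parts[where M = "adj E" and x = x, OF adj_sym] by simp
    qed
    define \<rho> where "\<rho> = (\<Sum>r\<in>R. \<bar>x r\<bar>)"
    have \<rho>0: "\<rho> \<ge> 0" by (simp add: \<rho>_def sum_nonneg)
    have 1: "e * qform R (adj E) x \<le> 2 * 2 ^ (s + t) * d * \<rho>"
    proof -
      have "e * qform R (adj E) x \<le> qform R (adj E) (\<lambda>v. \<bar>x v\<bar>)"
        unfolding qform_def sum_distrib_left
      proof (intro sum_mono)
        fix i j
        have "e * (adj E i j * x i * x j) \<le> \<bar>e * (adj E i j * x i * x j)\<bar>" by (rule abs_ge_self)
        also have "\<dots> = adj E i j * \<bar>x i\<bar> * \<bar>x j\<bar>" by (simp add: abs_mult tau2)
        finally show "e * (adj E i j * x i * x j) \<le> adj E i j * \<bar>x i\<bar> * \<bar>x j\<bar>" .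
      qed
      also have "\<dots> \<le> 2 * 2 ^ (s + t) * d * \<rho>"
        unfolding \<rho>_def using parts d by (intro qform_sup_bound) (auto simp: R_def)
      finally show ?thesis .
    qed
    have 2: "e * (\<Sum>r\<in>R. x r * (\<Sum>w\<in>W. adj E r w * x w)) \<le> real t * d * \<rho>"
    proof -
      have "e * (x r * (\<Sum>w\<in>W. adj E r w * x w)) \<le> real t * d * \<bar>x r\<bar>" if r: "r \<in> R" for r
      proof -
        have rU: "r \<in> U" using r parts by blast
        have "\<bar>\<Sum>w\<in>W. adj E r w * x w\<bar> \<le> (\<Sum>w\<in>W. adj E r w * d)"
          using d parts by (intro order_trans[OF sum_abs] sum_mono) (auto simp: abs_mult intro!: mult_left_mono)
        also have "\<dots> = real (card (E `` {r} \<inter> W)) * d"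
          using fin by (simp add: card_nbrs_eq_sum sum_distrib_right)
        also have "\<dots> \<le> real t * d" using few_W_nbrs[OF rU] d by (intro mult_right_mono) auto
        finally have b: "\<bar>\<Sum>w\<in>W. adj E r w * x w\<bar> \<le> real t * d" .
        have "e * (x r * (\<Sum>w\<in>W. adj E r w * x w)) \<le> \<bar>e * (x r * (\<Sum>w\<in>W. adj E r w * x w))\<bar>" by (rule abs_ge_self)
        also have "\<dots> = \<bar>x r\<bar> * \<bar>\<Sum>w\<in>W. adj E r w * x w\<bar>" by (simp add: abs_mult tau2)
        also have "\<dots> \<le> \<bar>x r\<bar> * (real t * d)" using b by (intro mult_left_mono) auto
        finally show ?thesis by (simp add: mult_ac)
      qed
      then show ?thesis unfolding \<rho>_def sum_distrib_left by (intro sum_mono)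
    qed
    have 3: "e * (\<Sum>r\<in>R. x r * (\<Sum>k\<in>K. adj E r k * x k)) \<le> (sg - c0) * \<rho>"
    proof -
      have "e * (x r * (\<Sum>k\<in>K. adj E r k * x k)) \<le> (sg - c0) * \<bar>x r\<bar>" if r: "r \<in> R" for r
      proof -
        obtain k0 where k0: "k0 \<in> K" "(k0, r) \<notin> E" using r by (auto simp: R_def common_nbrs_def)
        then have a0: "adj E r k0 = 0" using edge_sym by (auto simp: adj_def)
        have "\<bar>\<Sum>k\<in>K. adj E r k * x k\<bar> = \<bar>\<Sum>k\<in>K - {k0}. adj E r k * x k\<bar>"
          using sum.remove[OF fin(1) k0(1), of "\<lambda>k. adj E r k * x k"] a0 by simp
        also have "\<dots> \<le> (\<Sum>k\<in>K - {k0}. 1 * \<bar>x k\<bar>)"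
          by (intro order_trans[OF sum_abs] sum_mono) (auto simp: abs_mult adj_def)
        also have "\<dots> = sg - \<bar>x k0\<bar>" unfolding sg_def using sum.remove[OF fin(1) k0(1), of "\<lambda>k. \<bar>x k\<bar>"] by simp
        also have "\<dots> \<le> sg - c0"
        proof -
          have "c0 \<le> \<bar>tau * x k0\<bar>" using c0[OF k0(1)] by linarith
          then show ?thesis by (simp add: abs_mult tau2)
        qed
        finally have b: "\<bar>\<Sum>k\<in>K. adj E r k * x k\<bar> \<le> sg - c0" .
        have "e * (x r * (\<Sum>k\<in>K. adj E r k * x k)) \<le> \<bar>e * (x r * (\<Sum>k\<in>K. adj E r k * x k))\<bar>" by (rule abs_ge_self)
        also have "\<dots> = \<bar>x r\<bar> * \<bar>\<Sum>k\<in>K. adj E r k * x k\<bar>" by (simp add: abs_mult tau2)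
        also have "\<dots> \<le> \<bar>x r\<bar> * (sg - c0)" using b by (intro mult_left_mono) auto
        finally show ?thesis by (simp add: mult_ac)
      qed
      then show ?thesis unfolding \<rho>_def sum_distrib_left by (intro sum_mono)
    qed
    have 4: "e * (\<Sum>r\<in>R. e * tau * \<bar>x r\<bar> * ((1 - kap) * (tau * sg))) = (1 - kap) * sg * \<rho>"
    proof -
      have "e * (e * tau * \<bar>x r\<bar> * ((1 - kap) * (tau * sg))) = (e * e) * (tau * tau) * ((1 - kap) * sg * \<bar>x r\<bar>)" for r
        by (simp only: mult_ac)
      then have "e * (e * tau * \<bar>x r\<bar> * ((1 - kap) * (tau * sg))) = (1 - kap) * sg * \<bar>x r\<bar>" for r
        unfolding tau2 by simp
      then show ?thesis unfolding \<rho>_def sum_distrib_left by (intro sum.cong) auto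
    qed
    have "2 ^ (s + t) * d * \<rho> + (sg - c0) * \<rho> + real t * d * \<rho> \<le> (1 - kap) * sg * \<rho>"
    proof -
      have "2 ^ (s + t) * d + (sg - c0) + real t * d \<le> (1 - kap) * sg"
        using gap unfolding sg_def[symmetric] by (simp add: algebra_simps)
      then have "(2 ^ (s + t) * d + (sg - c0) + real t * d) * \<rho> \<le> (1 - kap) * sg * \<rho>"
        using \<rho>0 by (rule mult_right_mono)
      then show ?thesis by (simp add: distrib_right)
    qed
    then have 5: "e * qform R (adj E) x + 2 * (e * (\<Sum>r\<in>R. x r * (\<Sum>k\<in>K. adj E r k * x k)))
      + 2 * (e * (\<Sum>r\<in>R. x r * (\<Sum>w\<in>W. adj E r w * x w))) \<le> 2 * (e * (\<Sum>r\<in>R. e * tau * \<bar>x r\<bar> * ((1 - kap) * (tau * sg))))"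
      using 1 2 3 unfolding 4 by linarith
    have ring: "e * (a + b + f + 2 * g + 2 * h + 2 * i) \<le> e * (a + b + 2 * g + 2 * j)"
      if "e * f + 2 * (e * h) + 2 * (e * i) \<le> 2 * (e * j)" for a b f g h i j
      using that by (simp add: algebra_simps)
    show ?thesis unfolding A M by (rule ring[OF 5])
  qed
  ultimately show ?thesis by blast
qed

text \<open>A vertex off \<open>K\<close> has at most about \<open>z n\<close> neighbours, so
  Cauchy-Schwarz keeps its entry of order \<open>sqrt z\<close>. The hub entries are nearly equal,
  and if all were tiny, the form could not reach \<open>|lam|\<close>; hence all share one sign and
  a fixed lower bound.\<close>

lemma eigenvector_shape:
  fixes z lam :: real
  assumes x: "sqnorm V x = 1" and eig: "\<And>i. i \<in> V \<Longrightarrow> (\<Sum>j\<in>V. adj E i j * x j) = lam * x i"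
    and z: "0 \<le> z" "(1 - z) * card V \<le> card W"
    and big: "\<bar>lam\<bar> \<ge> sqrt ((real s - 1) * card V) / 2"
    and small: "real s + sqrt t + (2 ^ (s + t) + 1) * sqrt t + 1 \<le> sqrt z * sqrt (card V)"
    and zs: "sqrt z \<le> 1 / (128 * real s)" "(2 ^ (s + t) + 1) * sqrt z \<le> 1 / 32"
  obtains tau where "tau = 1 \<or> tau = - 1" "\<And>v. v \<in> U \<Longrightarrow> \<bar>x v\<bar> \<le> 4 * sqrt z"
    "\<And>k. k \<in> K \<Longrightarrow> 1 / (16 * real s) \<le> tau * x k"
proof -
  let ?n = "real (card V)" and ?C = "2 ^ (s + t) + 1 :: real"
  have n0: "?n > 0" 
  proof -
    have "V \<noteq> {}" using x by (auto simp: sqnorm_def)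
    then show ?thesis using finV by (simp add: card_gt_0_iff)
  qed
  have t0: "sqrt t \<ge> 0" by simp
  have sqn: "sqrt ?n > 0" using n0 by simp
  have lam: "\<bar>lam\<bar> \<ge> sqrt ?n / 2"
  proof -
    have "1 * ?n \<le> (real s - 1) * ?n" using s2 n0 by (intro mult_right_mono) auto
    then have "sqrt ?n / 2 \<le> sqrt ((real s - 1) * ?n) / 2" by simp
    then show ?thesis using big by (rule order_trans)
  qed
  have lam0: "\<bar>lam\<bar> > 0" using lam sqn by linarith
  have cV: "card V = card K + card W + card R"
  proof -
    have "card V = card K + card U" using parts fin by (metis card_Un_disjoint)
    moreover have "card U = card W + card R" using parts fin by (metis card_Un_disjoint)
    ultimately show ?thesis by simp
  qed
  then have R: "real (card R) \<le> z * ?n" using z(2) by (simp add: algebra_simps)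
  have sK: "real (card K) \<le> real s" using cardK by simp
  have eigabs: "\<bar>lam\<bar> * \<bar>x i\<bar> = \<bar>\<Sum>j\<in>V. adj E i j * x j\<bar>" if "i \<in> V" for i
    using eig[OF that] by (simp add: abs_mult)
  have sqs: "sqrt (real s) \<le> real s" using s2 by (intro real_le_lsqrt) (auto simp: power2_eq_square)
  have unif: "y \<le> 4 * sqrt z" if "\<bar>lam\<bar> * y \<le> real s + sqrt t + sqrt z * sqrt ?n" "y \<ge> 0" for y
  proof -
    have "sqrt ?n / 2 * y \<le> \<bar>lam\<bar> * y" using lam that(2) by (rule mult_right_mono)
    also have "\<dots> \<le> 2 * (sqrt z * sqrt ?n)"
    proof -
      have "0 \<le> ?C * sqrt t" by simp
      then show ?thesis using that(1) small by linarith
    qed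
    finally have "sqrt ?n * y \<le> sqrt ?n * (4 * sqrt z)" by (simp add: mult_ac)
    then show ?thesis using sqn by (simp only: mult_le_cancel_left_pos)
  qed
  have sq_sum: "sqrt (a + b) \<le> sqrt a + sqrt b" if "a \<ge> 0" "b \<ge> 0" for a b
    using that by (rule sqrt_add_le)
  have dU: "real (card (E `` {v} \<inter> U)) \<le> real t + z * ?n" if v: "v \<in> U" for v
  proof -
    have "E `` {v} \<inter> U \<subseteq> (E `` {v} \<inter> W) \<union> R" using parts by blast
    then have "card (E `` {v} \<inter> U) \<le> card ((E `` {v} \<inter> W) \<union> R)" using fin by (intro card_mono) auto
    also have "\<dots> \<le> card (E `` {v} \<inter> W) + card R" by (rule card_Un_le)
    also have "\<dots> \<le> t + card R" using few_W_nbrs[OF v] by simp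
    finally have "real (card (E `` {v} \<inter> U)) \<le> real t + card R" by linarith
    then show ?thesis using R by linarith
  qed
  have zn: "z * ?n \<ge> 0" using z n0 by simp
  have small_U: "\<bar>x v\<bar> \<le> 4 * sqrt z" if v: "v \<in> U" for v
  proof (rule unif)
    have vV: "v \<in> V" using v by (simp add: U_def)
    have "\<bar>lam\<bar> * \<bar>x v\<bar> = \<bar>\<Sum>j\<in>E `` {v} \<inter> V. x j\<bar>" using eigabs[OF vV] finV by (simp add: sum_adj)
    also have "\<dots> \<le> (\<Sum>j\<in>E `` {v} \<inter> V. \<bar>x j\<bar>)" by (rule sum_abs)
    also have "\<dots> \<le> (\<Sum>j\<in>K \<union> (E `` {v} \<inter> U). \<bar>x j\<bar>)"
      using fin parts by (intro sum_mono2) auto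
    also have "\<dots> \<le> sqrt (card (K \<union> (E `` {v} \<inter> U)))"
      using finV x KV by (intro abs_sum_le_card) (auto simp: U_def)
    also have "\<dots> \<le> sqrt (real s + (real t + z * ?n))"
    proof (rule real_sqrt_le_mono)
      have "real (card (K \<union> (E `` {v} \<inter> U))) \<le> real (card K) + real (card (E `` {v} \<inter> U))"
        using card_Un_le[of K "E `` {v} \<inter> U"] by linarith
      then show "real (card (K \<union> (E `` {v} \<inter> U))) \<le> real s + (real t + z * ?n)"
        using sK dU[OF v] by linarith
    qed
    also have "\<dots> \<le> sqrt s + (sqrt t + sqrt (z * ?n))"
      using sq_sum[of "real s" "real t + z * ?n"] sq_sum[of "real t" "z * ?n"] zn by simp
    also have "\<dots> \<le> real s + sqrt t + sqrt z * sqrt ?n" using sqs by (simp add: real_sqrt_mult)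
    finally show "\<bar>lam\<bar> * \<bar>x v\<bar> \<le> real s + sqrt t + sqrt z * sqrt ?n" .
  qed simp
  \<comment> \<open>All hubs are joined to all of \<open>W\<close>, so in the difference of two hub
    equations only \<open>K\<close> and the few vertices of \<open>R\<close> survive.\<close>
  have diff: "\<bar>x k - x k'\<bar> \<le> 4 * sqrt z" if k: "k \<in> K" "k' \<in> K" for k k'
  proof (rule unif)
    have kV: "k \<in> V" "k' \<in> V" using k KV by auto
    have "lam * (x k - x k') = (\<Sum>j\<in>V. adj E k j * x j) - (\<Sum>j\<in>V. adj E k' j * x j)"
      using eig[OF kV(1)] eig[OF kV(2)] by (simp add: right_diff_distrib)
    also have "\<dots> = (\<Sum>j\<in>V. (adj E k j - adj E k' j) * x j)"
      by (simp add: left_diff_distrib sum_subtractf)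
    also have "\<dots> = (\<Sum>j\<in>K \<union> R. (adj E k j - adj E k' j) * x j)"
    proof (rule sum.mono_neutral_right)
      show "\<forall>j\<in>V - (K \<union> R). (adj E k j - adj E k' j) * x j = 0"
        using k by (auto simp: R_def common_nbrs_def adj_def)
    qed (use finV KV in \<open>auto simp: R_def\<close>)
    finally have "\<bar>lam\<bar> * \<bar>x k - x k'\<bar> = \<bar>\<Sum>j\<in>K \<union> R. (adj E k j - adj E k' j) * x j\<bar>"
      by (metis abs_mult)
    also have "\<dots> \<le> (\<Sum>j\<in>K \<union> R. 1 * \<bar>x j\<bar>)"
      by (intro order_trans[OF sum_abs] sum_mono) (auto simp: abs_mult adj_def)
    also have "\<dots> \<le> sqrt (card (K \<union> R))"
      using abs_sum_le_card[OF finV, of "K \<union> R" x] x KV by (auto simp: R_def)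
    also have "\<dots> \<le> sqrt (real s + z * ?n)"
    proof (rule real_sqrt_le_mono)
      have "real (card (K \<union> R)) \<le> real (card K) + real (card R)"
        using card_Un_le[of K R] by linarith
      then show "real (card (K \<union> R)) \<le> real s + z * ?n" using sK R by linarith
    qed
    also have "\<dots> \<le> sqrt s + sqrt (z * ?n)" using zn by (intro sq_sum) auto
    also have "\<dots> \<le> real s + sqrt t + sqrt z * sqrt ?n"
      unfolding real_sqrt_mult using sqs t0 by linarith
    finally show "\<bar>lam\<bar> * \<bar>x k - x k'\<bar> \<le> real s + sqrt t + sqrt z * sqrt ?n" .
  qed simp
  have "\<exists>k\<in>K. 1 / (8 * real s) \<le> \<bar>x k\<bar>"
  proof (rule ccontr)
    assume "\<not> ?thesis"
    then have lt: "\<bar>x k\<bar> \<le> 1 / (8 * real s)" if "k \<in> K" for k using that by force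
    have s0: "real s \<ge> 2" using s2 by simp
    have V1: "U \<union> K = V" using parts by blast
    let ?y = "\<lambda>v. \<bar>x v\<bar>"
    have ny: "sqnorm V ?y = 1" using x by (simp add: sqnorm_def)
    have "\<bar>lam\<bar> = \<bar>qform V (adj E) x\<bar>" using qform_eigenvector[OF eig] x by simp
    also have "\<dots> \<le> qform V (adj E) ?y"
      unfolding qform_def by (intro order_trans[OF sum_abs] sum_mono) (simp add: abs_mult)
    also have "\<dots> = qform U (adj E) ?y + qform K (adj E) ?y + 2 * (\<Sum>u\<in>U. ?y u * (\<Sum>k\<in>K. adj E u k * ?y k))"
      using qform_Un_disjoint[of U K "adj E" ?y] fin parts(2) adj_sym by (simp add: V1 Int_commute)
    also have "qform U (adj E) ?y \<le> ?C * sqrt (real t + z * ?n) * sqnorm U ?y"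
      using dU zn t1 by (intro qform_max_degree_bound) (auto simp: U_def)
    also have "\<dots> \<le> ?C * sqrt (real t + z * ?n) * 1"
      using sqnorm_mono[of U V ?y] finV ny zn by (intro mult_left_mono) (auto simp: U_def)
    also have "\<dots> \<le> ?C * (sqrt t + sqrt z * sqrt ?n)"
      using sq_sum[of "real t" "z * ?n"] zn by (simp add: real_sqrt_mult mult_left_mono)
    also have "qform K (adj E) ?y \<le> real (card K) * sqnorm K ?y"
      using fin adj_le_1 by (intro qform_le_card) auto
    also have "\<dots> \<le> real s * 1"
      using sqnorm_mono[OF KV finV, of ?y] ny sK by (intro mult_mono) (auto simp: sqnorm_nonneg)
    also have "(\<Sum>u\<in>U. ?y u * (\<Sum>k\<in>K. adj E u k * ?y k)) \<le> (\<Sum>u\<in>U. ?y u * (1 / 8))"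
    proof (intro sum_mono mult_left_mono)
      fix u
      have "(\<Sum>k\<in>K. adj E u k * ?y k) \<le> (\<Sum>k\<in>K. 1 * (1 / (8 * real s)))"
        using lt by (intro sum_mono mult_mono) (auto simp: adj_def)
      also have "\<dots> = real (card K) * (1 / (8 * real s))" by simp
      also have "\<dots> \<le> real s * (1 / (8 * real s))" using sK by (intro mult_right_mono) auto
      finally show "(\<Sum>k\<in>K. adj E u k * ?y k) \<le> 1 / 8" using s0 by simp
    qed auto
    also have "(\<Sum>u\<in>U. ?y u * (1 / 8)) \<le> sqrt ?n * (1 / 8)"
    proof -
      have "(\<Sum>u\<in>U. ?y u) \<le> sqrt (card U)" using finV x by (intro abs_sum_le_card) (auto simp: U_def)
      also have "\<dots> \<le> sqrt ?n" using finV by (intro real_sqrt_le_mono) (auto simp: U_def card_mono)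
      finally show ?thesis by (simp add: sum_divide_distrib[symmetric])
    qed
    finally have "\<bar>lam\<bar> \<le> ?C * (sqrt t + sqrt z * sqrt ?n) + real s * 1 + 2 * (sqrt ?n * (1 / 8))" by simp
    also have "?C * (sqrt t + sqrt z * sqrt ?n) = ?C * sqrt t + (?C * sqrt z) * sqrt ?n"
      by (simp add: distrib_left mult.assoc)
    also have "(?C * sqrt z) * sqrt ?n \<le> 1 / 32 * sqrt ?n" using zs(2) by (rule mult_right_mono) simp
    finally have up: "\<bar>lam\<bar> \<le> ?C * sqrt t + 1 / 32 * sqrt ?n + real s + sqrt ?n / 4" by simp
    have "\<bar>lam\<bar> < sqrt z * sqrt ?n + 1 / 32 * sqrt ?n + sqrt ?n / 4"
    proof -
      have "L < e + f + g" if "L \<le> a + f + b + g" "b + d + a + 1 \<le> e" "0 \<le> d" for L a b d e f g :: real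
        using that by linarith
      then show ?thesis using up small t0 by blast
    qed
    also have "sqrt z * sqrt ?n \<le> 1 / 128 * sqrt ?n"
    proof (rule mult_right_mono)
      have "1 / (128 * real s) \<le> 1 / 128" using s0 by (simp add: field_simps)
      then show "sqrt z \<le> 1 / 128" using zs(1) by linarith
    qed simp
    finally show False using lam sqn by simp
  qed
  then obtain k0 where k0: "k0 \<in> K" "1 / (8 * real s) \<le> \<bar>x k0\<bar>" by blast
  define tau :: real where "tau = (if x k0 \<ge> 0 then 1 else - 1)"
  have tau: "tau = 1 \<or> tau = - 1" "tau * x k0 = \<bar>x k0\<bar>" by (auto simp: tau_def)
  have "1 / (16 * real s) \<le> tau * x k" if k: "k \<in> K" for k
  proof -
    have "tau * (x k0 - x k) \<le> \<bar>x k0 - x k\<bar>" using tau(1) by auto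
    also have "\<dots> \<le> 4 * sqrt z" using diff[OF k0(1) k] .
    also have "\<dots> \<le> 4 * (1 / (128 * real s))" using zs(1) by linarith
    also have "\<dots> \<le> 1 / (16 * real s)" using s2 by (simp add: field_simps)
    finally have "tau * x k0 - 1 / (16 * real s) \<le> tau * x k" by (simp add: right_diff_distrib)
    moreover have "1 / (8 * real s) = 1 / (16 * real s) + 1 / (16 * real s)" by simp
    ultimately show ?thesis using k0(2) tau(2) by linarith
  qed
  then show ?thesis using that tau(1) small_U by blast
qed

end

section \<open>Components outside the hubs\<close>

text \<open>The handshake lemma, proved by adding vertices. Its parity gives the final contradiction
  for \<open>t = 3\<close>.\<close>

lemma even_arcs_in:
  assumes "finite U" "sym E" "irrefl E"
  shows "even (arcs_in E U)"
  using assms(1)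
proof (induction U rule: finite_induct)
  case empty
  then show ?case by (simp add: arcs_in_def)
next
  case (insert y U)
  then show ?case using arcs_in_insert[OF insert(1,2) assms(2,3)] by simp
qed

definition reach :: "'a rel \<Rightarrow> 'a set \<Rightarrow> 'a \<Rightarrow> 'a set" where
  "reach E X y = {v. (y, v) \<in> (E \<inter> X \<times> X)\<^sup>*}"

lemma reach_subset: "y \<in> X \<Longrightarrow> reach E X y \<subseteq> X"
proof
  fix v assume "y \<in> X" "v \<in> reach E X y"
  then show "v \<in> X" unfolding reach_def by (auto elim: rtranclE)
qed

lemma reach_closed:
  assumes "v \<in> reach E X y" "(v, w) \<in> E" "v \<in> X" "w \<in> X"
  shows "w \<in> reach E X y"
  using assms unfolding reach_def by (auto intro: rtrancl_into_rtrancl)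

lemma reach_connected:
  assumes "sym E" "y \<in> X"
  shows "connected_in E (reach E X y)"
proof -
  let ?Y = "reach E X y"
  let ?R = "E \<inter> ?Y \<times> ?Y"
  have sub: "?Y \<subseteq> X" by (rule reach_subset[OF assms(2)])
  have y: "(y, v) \<in> ?R\<^sup>*" if "v \<in> ?Y" for v
  proof -
    have "(y, v) \<in> (E \<inter> X \<times> X)\<^sup>*" using that by (simp add: reach_def)
    then show ?thesis
    proof (induction rule: rtrancl_induct)
      case base then show ?case by simp
    next
      case (step v w)
      then have "v \<in> ?Y" "w \<in> ?Y" by (auto simp: reach_def intro: rtrancl_into_rtrancl)
      then have "(v, w) \<in> ?R" using step(2) by blast
      then show ?case using step(3) by (meson rtrancl.rtrancl_into_rtrancl)
    qed
  qed
  have "sym ?R" using assms(1) by (auto simp: sym_def)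
  then have "(v, y) \<in> ?R\<^sup>*" if "v \<in> ?Y" for v using y[OF that] by (metis sym_rtrancl symD)
  then show ?thesis unfolding connected_in_def using y by (meson rtrancl_trans)
qed

lemma connected_in_pair:
  assumes "sym E" "(a, b) \<in> E"
  shows "connected_in E {a, b}"
  using connected_in_insert[OF connected_in_singleton assms(1), of a a b] assms(2)
  by (simp add: insert_commute)

lemma singleton_if_card_le_1:
  assumes "finite S" "card S \<le> 1" "y \<in> S"
  shows "S = {y}"
  using card_seteq[of S "{y}"] assms by simp

lemma disjoint_insert_singletons:
  assumes "A \<inter> S = {}"
  shows "disjoint (insert A ((\<lambda>v. {v}) ` S))"
  unfolding disjoint_def
proof (intro ballI impI)
  fix B C assume BC: "B \<in> insert A ((\<lambda>v. {v}) ` S)" "C \<in> insert A ((\<lambda>v. {v}) ` S)" "B \<noteq> C"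
  then consider "B = A" "C = A" | v where "B = A" "C = {v}" "v \<in> S" | v where "B = {v}" "v \<in> S" "C = A"
    | v w where "B = {v}" "C = {w}" by blast
  then show "B \<inter> C = {}"
    using BC(3) assms by cases auto
qed

section \<open>Components outside complete hubs are cliques\<close>

locale hub_complete = biclique_free +
  fixes K :: "'a set"
  assumes KV: "K \<subseteq> V" and cardK: "card K = s - 1" and s2: "2 \<le> s" and st: "s \<le> t"
    and complete: "\<And>k u. k \<in> K \<Longrightarrow> u \<in> V - K \<Longrightarrow> (k, u) \<in> E"
    and regular: "\<And>u. u \<in> V - K \<Longrightarrow> E `` {u} \<inter> (V - K) \<noteq> {} \<Longrightarrow> card (E `` {u} \<inter> (V - K)) = t - 1"
    and isolated: "s \<le> card {u \<in> V - K. E `` {u} \<inter> (V - K) = {}}"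
begin

definition nb where "nb u = E `` {u} \<inter> (V - K)"

lemma finK: "finite K" using KV finV by (rule finite_subset)

lemma fin_nb: "finite (nb u)" using finV by (simp add: nb_def)

lemma nb_sym: "u \<in> V - K \<Longrightarrow> v \<in> nb u \<Longrightarrow> u \<in> nb v"
  using edge_sym by (auto simp: nb_def)

lemma nb_irr: "u \<notin> nb u" using edge_neq by (auto simp: nb_def)

lemma nb_sub: "nb u \<subseteq> V - K" by (auto simp: nb_def)

lemma card_nb: "u \<in> V - K \<Longrightarrow> v \<in> nb u \<Longrightarrow> card (nb u) = t - 1"
  using regular by (auto simp: nb_def)

text \<open>Merge the edge \<open>ab\<close> into one branch set next to the hubs. It sees the
  \<open>t - 2\<close> other neighbours of \<open>a\<close>; two private neighbours of
  \<open>b\<close> would complete the side of size \<open>t\<close>.\<close>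

lemma one_private_nbr:
  assumes a: "a \<in> V - K" and b: "b \<in> nb a"
  shows "card (nb b - insert a (nb a)) \<le> 1"
proof (rule ccontr)
  assume "\<not> ?thesis"
  then have two: "2 \<le> card (nb b - insert a (nb a))" by simp
  have bU: "b \<in> V - K" "b \<noteq> a" using b nb_irr by (auto simp: nb_def)
  let ?L = "(nb a - {b}) \<union> (nb b - insert a (nb a))"
  have "card ?L = card (nb a - {b}) + card (nb b - insert a (nb a))"
    using fin_nb by (intro card_Un_disjoint) auto
  moreover have "card (nb a - {b}) = t - 1 - 1" using card_nb[OF a b] b fin_nb by simp
  ultimately have "t \<le> card ?L" using two st s2 by linarith
  then obtain L where L: "L \<subseteq> ?L" "card L = t" by (meson obtain_subset_with_card_n)
  have finL: "finite L" using L(1) fin_nb by (meson finite_Diff finite_UnI finite_subset)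
  have LU: "L \<subseteq> V - K" using L(1) nb_sub by blast
  have abL: "a \<notin> L" "b \<notin> L" using L(1) nb_irr by blast+
  let ?X = "insert {a, b} ((\<lambda>k. {k}) ` K)" and ?Y = "(\<lambda>v. {v}) ` L"
  have ab: "(a, b) \<in> E" using b by (simp add: nb_def)
  have "biclique_model s t V E ?X ?Y"
    unfolding biclique_model_def
  proof (intro conjI)
    have "{a, b} \<notin> (\<lambda>k. {k}) ` K" using bU by auto
    then show "card ?X = s" using finK cardK s2 by (simp add: card_image)
    show "card ?Y = t" using L by (simp add: card_image)
    show "?X \<inter> ?Y = {}" using abL LU by auto
    have XY: "?X \<union> ?Y = insert {a, b} ((\<lambda>v. {v}) ` (K \<union> L))" by (simp add: image_Un)
    show "disjoint (?X \<union> ?Y)"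
      unfolding XY using abL a bU by (intro disjoint_insert_singletons) auto
    have "{a, b} \<noteq> {} \<and> {a, b} \<subseteq> V \<and> connected_in E {a, b}"
      using a bU connected_in_pair[OF E_sym ab] by simp
    moreover have "{v} \<noteq> {} \<and> {v} \<subseteq> V \<and> connected_in E {v}" if "v \<in> K \<union> L" for v
      using that KV LU by (auto simp: connected_in_singleton)
    ultimately show "\<forall>A\<in>?X \<union> ?Y. A \<noteq> {} \<and> A \<subseteq> V \<and> connected_in E A"
      unfolding XY by blast
    show "\<forall>A\<in>?X. \<forall>B\<in>?Y. \<exists>x\<in>A. \<exists>y\<in>B. (x, y) \<in> E"
    proof (intro ballI)
      fix A B assume A: "A \<in> ?X" and B: "B \<in> ?Y"
      then obtain v where v: "v \<in> L" "B = {v}" by blast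
      show "\<exists>x\<in>A. \<exists>y\<in>B. (x, y) \<in> E"
      proof (cases "A = {a, b}")
        case True
        have "v \<in> nb a \<or> v \<in> nb b" using v L(1) by blast
        then show ?thesis using True v by (auto simp: nb_def)
      next
        case False
        then obtain k where "k \<in> K" "A = {k}" using A by blast
        then show ?thesis using complete[of k v] v LU by auto
      qed
    qed
  qed (use finK finL in auto)
  then show False using no_model by blast
qed

text \<open>
  Otherwise \<open>{u}\<close>, \<open>Y\<close> and \<open>s - 2\<close> pairs of a hub and an isolated vertex form one side of a model, and
  \<open>nb u\<close> with the remaining hub forms the other: the pairs reach that hub through their isolated vertex.
\<close>

lemma nbr_without_nbrs_in_connected:
  assumes u: "u \<in> V - K" and Y: "Y \<noteq> {}" "Y \<subseteq> V - K - insert u (nb u)" "connected_in E Y"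
    and noniso: "\<And>y. y \<in> Y \<Longrightarrow> nb y \<noteq> {}" and deg: "card (nb u) = t - 1"
  shows "\<exists>a\<in>nb u. nb a \<inter> Y = {}"
proof (rule ccontr)
  assume "\<not> ?thesis"
  then have S: "\<And>a. a \<in> nb u \<Longrightarrow> \<exists>y\<in>Y. (y, a) \<in> E" using edge_sym unfolding nb_def by blast
  have "K \<noteq> {}" using cardK s2 by auto
  then obtain k1 where k1: "k1 \<in> K" by blast
  let ?Z = "{z \<in> V - K. E `` {z} \<inter> (V - K) = {}}"
  have finZ: "finite ?Z" using finV by simp
  have "card (K - {k1}) \<le> card ?Z" using isolated cardK k1 finK by (simp add: card_Diff_singleton)
  then obtain f where f: "f ` (K - {k1}) \<subseteq> ?Z" "inj_on f (K - {k1})"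
    using card_le_inj[OF finite_Diff[OF finK] finZ] by blast
  have nt: "nb u \<noteq> {}" using deg st s2 by auto
  have fZ: "f k \<in> V - K" "nb (f k) = {}" if "k \<in> K - {k1}" for k
    using f(1) that by (auto simp: nb_def)
  have fu: "f k \<noteq> u" "f k \<notin> nb u" "f k \<notin> Y" if k: "k \<in> K - {k1}" for k
  proof -
    show "f k \<noteq> u" using fZ[OF k] nt by auto
    show "f k \<notin> nb u" using fZ[OF k] nb_sym[OF u] by auto
    show "f k \<notin> Y" using fZ[OF k] noniso by blast
  qed
  define P where "P = (\<lambda>k. {k, f k}) ` (K - {k1})"
  have PE: "\<exists>k\<in>K - {k1}. A = {k, f k}" if "A \<in> P" for A using that by (auto simp: P_def)
  have finP: "finite P" using finK by (simp add: P_def)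
  let ?X = "insert {u} (insert Y P)" and ?Y = "insert {k1} ((\<lambda>v. {v}) ` nb u)"
  have YU: "Y \<subseteq> V - K" "u \<notin> Y" "Y \<inter> nb u = {}" using Y(2) by auto
  have Pcard: "card P = s - 2"
  proof -
    have "inj_on (\<lambda>k. {k, f k}) (K - {k1})"
    proof (rule inj_onI)
      fix k k' assume k: "k \<in> K - {k1}" "k' \<in> K - {k1}" "{k, f k} = {k', f k'}"
      then show "k = k'" using fZ(1)[OF k(1)] fZ(1)[OF k(2)] by (auto simp: doubleton_eq_iff)
    qed
    then show ?thesis using finK k1 cardK by (simp add: card_image P_def)
  qed
  have uP: "{u} \<notin> insert Y P" "Y \<notin> P" using u YU by (auto simp: P_def)
  have "biclique_model s t V E ?X ?Y"
    unfolding biclique_model_def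
  proof (intro conjI)
    show "card ?X = s" using uP Pcard finP s2 by simp
    have "{k1} \<notin> (\<lambda>v. {v}) ` nb u" using k1 nb_sub by auto
    then show "card ?Y = t" using deg fin_nb st s2 by (simp add: card_image)
    have P1: "A \<inter> {u} = {}" "A \<inter> Y = {}" "k1 \<notin> A" "A \<inter> nb u = {}" if A: "A \<in> P" for A
    proof -
      obtain k where k: "k \<in> K - {k1}" "A = {k, f k}" using PE[OF A] by blast
      have "k \<noteq> u" "k \<notin> Y" "k \<notin> nb u" "f k \<noteq> k1" using k(1) u YU(1) nb_sub fZ(1)[OF k(1)] k1 by auto
      then show "A \<inter> {u} = {}" "A \<inter> Y = {}" "k1 \<notin> A" "A \<inter> nb u = {}"
        unfolding k(2) using fu[OF k(1)] k(1) by auto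
    qed
    have P2: "A \<inter> B = {}" if AB: "A \<in> P" "B \<in> P" and ne: "A \<noteq> B" for A B
    proof -
      obtain k k' where k: "k \<in> K - {k1}" "A = {k, f k}" "k' \<in> K - {k1}" "B = {k', f k'}"
        using PE[OF AB(1)] PE[OF AB(2)] by blast
      then have "k \<noteq> k'" using ne by auto
      moreover have "f k \<noteq> f k'" using f(2) k(1,3) \<open>k \<noteq> k'\<close> by (auto dest: inj_onD)
      ultimately show ?thesis using k fZ(1)[OF k(1)] fZ(1)[OF k(3)] by auto
    qed
    have O: "{u} \<inter> Y = {}" "k1 \<noteq> u" "k1 \<notin> Y" "u \<notin> nb u" "Y \<inter> nb u = {}" "k1 \<notin> nb u"
      using YU k1 u nb_irr subsetD[OF nb_sub, of k1 u] by auto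
    have dX: "disjoint ?X" unfolding disjoint_def 
    proof (intro ballI impI)
      fix A B assume A: "A \<in> ?X" and B: "B \<in> ?X" and ne: "A \<noteq> B"
      consider "A \<in> P" "B \<in> P" | "A \<in> P" "B = {u} \<or> B = Y" | "B \<in> P" "A = {u} \<or> A = Y"
        | "A = {u}" "B = Y" | "A = Y" "B = {u}"
        using A B ne unfolding insert_iff by metis
      then show "A \<inter> B = {}"
      proof cases
        case 1 then show ?thesis using P2 ne by blast
      next
        case 2 then show ?thesis using P1(1,2)[of A] by metis
      next
        case 3 then show ?thesis using P1(1,2)[of B] by (metis Int_commute)
      next
        case 4 then show ?thesis using O(1) by simp
      next
        case 5 then show ?thesis using O(1) by (simp add: Int_commute)
      qed
    qed
    have dY: "disjoint ?Y" 
    proof -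
      have "?Y = (\<lambda>v. {v}) ` insert k1 (nb u)" by simp
      moreover have "disjoint ((\<lambda>v. {v}) ` S)" for S :: "'a set" by (auto simp: disjoint_def)
      ultimately show ?thesis by metis
    qed
    have dXY: "A \<inter> B = {}" if A: "A \<in> ?X" and B: "B \<in> ?Y" for A B
    proof -
      have "A \<inter> insert k1 (nb u) = {}"
      proof -
        consider "A = {u}" | "A = Y" | "A \<in> P" using A unfolding insert_iff by metis
        then show ?thesis using P1(3,4)[of A] O by cases auto
      qed
      moreover have "B \<subseteq> insert k1 (nb u)" using B by auto
      ultimately show ?thesis by blast
    qed
    have neX: "A \<noteq> {}" if "A \<in> ?X" for A using that Y(1) PE[of A] by auto
    show "?X \<inter> ?Y = {}"
    proof (rule ccontr)
      assume "?X \<inter> ?Y \<noteq> {}"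
      then obtain A where "A \<in> ?X" "A \<in> ?Y" by (metis IntE ex_in_conv)
      then show False using dXY[of A A] neX[of A] by simp
    qed
    show "disjoint (?X \<union> ?Y)"
      unfolding disjoint_def
    proof (intro ballI impI)
      fix A B assume A: "A \<in> ?X \<union> ?Y" and B: "B \<in> ?X \<union> ?Y" and ne: "A \<noteq> B"
      consider "A \<in> ?X" "B \<in> ?X" | "A \<in> ?X" "B \<in> ?Y" | "A \<in> ?Y" "B \<in> ?X" | "A \<in> ?Y" "B \<in> ?Y"
        using A B unfolding Un_iff by metis
      then show "A \<inter> B = {}"
      proof cases
        case 1 then show ?thesis using disjointD[OF dX] ne by metis
      next
        case 2 then show ?thesis by (rule dXY)
      next
        case 3 then show ?thesis using dXY[of B A] by (simp add: Int_commute)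
      next
        case 4 then show ?thesis using disjointD[OF dY] ne by metis
      qed
    qed
    have cP: "connected_in E A \<and> A \<subseteq> V \<and> A \<noteq> {}" if A: "A \<in> P" for A
    proof -
      obtain k where k: "k \<in> K - {k1}" "A = {k, f k}" using PE[OF A] by blast
      have "(k, f k) \<in> E" using k(1) fZ(1)[OF k(1)] by (intro complete) auto
      then show ?thesis using connected_in_pair[OF E_sym] k fZ(1)[OF k(1)] KV by auto
    qed
    show "\<forall>A\<in>?X \<union> ?Y. A \<noteq> {} \<and> A \<subseteq> V \<and> connected_in E A"
    proof
      fix A assume "A \<in> ?X \<union> ?Y"
      then consider "A = {u}" | "A = Y" | "A \<in> P" | "A = {k1}" | v where "v \<in> nb u" "A = {v}"
        unfolding Un_iff insert_iff image_iff by metis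
      then show "A \<noteq> {} \<and> A \<subseteq> V \<and> connected_in E A"
      proof cases
        case 1 then show ?thesis using u by (simp add: connected_in_singleton)
      next
        case 2 then show ?thesis using Y YU by auto
      next
        case 3 then show ?thesis using cP by blast
      next
        case 4 then show ?thesis using k1 KV by (auto simp: connected_in_singleton)
      next
        case 5 then show ?thesis using nb_sub by (auto simp: connected_in_singleton)
      qed
    qed
    show "\<forall>A\<in>?X. \<forall>B\<in>?Y. \<exists>x\<in>A. \<exists>y\<in>B. (x, y) \<in> E"
    proof (intro ballI)
      fix A B assume A: "A \<in> ?X" and B: "B \<in> ?Y"
      obtain y0 where y0: "y0 \<in> Y" using Y(1) by blast
      have h: "\<exists>x\<in>A. (x, k1) \<in> E"
      proof -
        consider "A = {u}" | "A = Y" | k where "k \<in> K - {k1}" "A = {k, f k}"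
          using A PE[of A] unfolding insert_iff by metis
        then have "\<exists>x\<in>A. x \<in> V - K" using u y0 YU(1) fZ(1) by cases auto
        then show ?thesis using complete[OF k1] edge_sym by blast
      qed
      have v: "\<exists>x\<in>A. (x, v) \<in> E" if v: "v \<in> nb u" for v
      proof -
        consider "A = {u}" | "A = Y" | k where "k \<in> K - {k1}" "A = {k, f k}"
          using A PE[of A] unfolding insert_iff by metis
        then show ?thesis
        proof cases
          case 1 then show ?thesis using v by (simp add: nb_def)
        next
          case 2 then show ?thesis using S[OF v] by blast
        next
          case 3 then show ?thesis using complete[of k v] v nb_sub by blast
        qed
      qed
      show "\<exists>x\<in>A. \<exists>y\<in>B. (x, y) \<in> E" using B h v by blast
    qed
  qed (use finP fin_nb in auto)
  then show False using no_model by blast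
qed

text \<open>Suppose \<open>v\<close> has a neighbour outside the closed neighbourhood of
  \<open>u\<close>, and let \<open>Y\<close> be its component there. Some \<open>a\<close> in
  \<open>nb u\<close> has no neighbour in \<open>Y\<close>, while all other members of
  \<open>nb u\<close> have exactly one and are not adjacent to \<open>a\<close>. Thus
  \<open>a\<close> has degree at most 2, which forces \<open>t = 3\<close>, and then
  \<open>Y\<close> has exactly one vertex of odd degree.\<close>

theorem nbrs_are_twins:
  assumes u: "u \<in> V - K" and v: "v \<in> nb u"
  shows "insert v (nb v) = insert u (nb u)"
proof (rule ccontr)
  assume ne: "insert v (nb v) \<noteq> insert u (nb u)"
  have vU: "v \<in> V - K" using v nb_sub by blast
  have uv: "u \<in> nb v" using nb_sym[OF u v] .
  have du: "card (nb u) = t - 1" using card_nb[OF u v] .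
  have dv: "card (nb v) = t - 1" using card_nb[OF vU uv] .
  have cu: "card (insert u (nb u)) = t" "card (insert v (nb v)) = t"
    using du dv nb_irr fin_nb st s2 by simp_all
  have "\<not> insert v (nb v) \<subseteq> insert u (nb u)"
  proof
    assume sub: "insert v (nb v) \<subseteq> insert u (nb u)"
    have "insert v (nb v) = insert u (nb u)"
      by (rule card_subset_eq[OF _ sub]) (use cu fin_nb in simp_all)
    then show False using ne by simp
  qed
  then obtain y where y: "y \<in> nb v" "y \<notin> insert u (nb u)" using v by blast
  define X where "X = V - K - insert u (nb u)"
  define Y where "Y = reach E X y"
  have yX: "y \<in> X" using y nb_sub by (auto simp: X_def)
  have yY: "y \<in> Y" by (simp add: Y_def reach_def)
  have YX: "Y \<subseteq> X" unfolding Y_def using yX by (rule reach_subset)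
  have closed: "w \<in> Y \<or> w \<in> nb u" if yy: "y' \<in> Y" and w: "w \<in> nb y'" for y' w
  proof (cases "w \<in> insert u (nb u)")
    case True
    have "w \<noteq> u"
    proof
      assume "w = u"
      then have "y' \<in> nb u" using nb_sym[of y' w] w yy YX by (auto simp: X_def)
      then show False using yy YX by (auto simp: X_def)
    qed
    then show ?thesis using True by blast
  next
    case False
    then have "w \<in> X" using w nb_sub by (auto simp: X_def)
    then show ?thesis using reach_closed[of y' E X y w] yy YX w by (auto simp: Y_def nb_def)
  qed
  have noniso: "nb y' \<noteq> {}" if "y' \<in> Y" for y'
  proof (cases "y' = y")
    case True
    then show ?thesis using nb_sym[OF vU y(1)] by blast
  next
    case False
    have "(y, y') \<in> (E \<inter> X \<times> X)\<^sup>*" using that by (simp add: Y_def reach_def)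
    then obtain w where "(w, y') \<in> E" "w \<in> X" using False by (auto elim: rtranclE)
    then show ?thesis using edge_sym by (auto simp: nb_def X_def)
  qed
  have "connected_in E Y" unfolding Y_def using E_sym yX by (rule reach_connected)
  then obtain a where a: "a \<in> nb u" "nb a \<inter> Y = {}"
    using nbr_without_nbrs_in_connected[OF u, of Y] yY YX noniso du by (auto simp: X_def)
  have aU: "a \<in> V - K" using a nb_sub by blast
  \<comment> \<open>\<open>one_private_nbr\<close> is used for two edges at \<open>b\<close>:
    against \<open>u\<close> it leaves \<open>y'\<close> as the only outside neighbour, against
    \<open>y'\<close> it leaves \<open>u\<close> as the only private one. So the other neighbours of
    \<open>b\<close> lie in \<open>nb y'\<close>, and \<open>a\<close> is not among them. Counting
    then shows that \<open>b\<close> misses only \<open>a\<close> and itself in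
    \<open>nb u\<close>.\<close>
  have bfacts: "a \<notin> nb b" "\<exists>y'. nb b \<inter> Y = {y'}" "nb u - nb b \<subseteq> {a, b}"
    if b: "b \<in> nb u" "nb b \<inter> Y \<noteq> {}" for b
  proof -
    have bU: "b \<in> V - K" using b nb_sub by blast
    have ub: "u \<in> nb b" using nb_sym[OF u b(1)] .
    obtain y' where y': "y' \<in> nb b" "y' \<in> Y" using b(2) by blast
    have y'n: "y' \<notin> insert u (nb u)" "y' \<in> V - K" using y' YX by (auto simp: X_def)
    have by': "b \<in> nb y'" using nb_sym[OF bU y'(1)] .
    have fin1: "finite (nb b - insert u (nb u))" using fin_nb by simp
    have sing: "nb b - insert u (nb u) = {y'}"
      using one_private_nbr[OF u b(1)] y'(1) y'n(1) fin1 by (intro singleton_if_card_le_1) auto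
    have "nb b - insert y' (nb y') = {u}"
    proof -
      have "u \<in> nb b - insert y' (nb y')" using ub y'n nb_sym[of y' u] y'(2) YX by (auto simp: X_def)
      moreover have "card (nb b - insert y' (nb y')) \<le> 1" using one_private_nbr[OF y'n(2) by'] .
      ultimately show ?thesis using fin_nb by (intro singleton_if_card_le_1) auto
    qed
    then have *: "w = u \<or> w = y' \<or> w \<in> nb y'" if "w \<in> nb b" for w using that by blast
    have sub: "nb b \<inter> nb u \<subseteq> nb y'"
    proof
      fix w assume "w \<in> nb b \<inter> nb u"
      then show "w \<in> nb y'" using *[of w] nb_irr[of u] y'n(1) by auto
    qed
    show ab: "a \<notin> nb b"
    proof
      assume "a \<in> nb b"
      then have "a \<in> nb y'" using sub a by blast
      then have "y' \<in> nb a" using nb_sym[OF y'n(2)] by blast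
      then show False using a(2) y'(2) by blast
    qed
    show "\<exists>y'. nb b \<inter> Y = {y'}"
    proof
      have "nb b \<inter> Y \<subseteq> nb b - insert u (nb u)" using YX by (auto simp: X_def)
      then show "nb b \<inter> Y = {y'}" using sing y' by blast
    qed
    show "nb u - nb b \<subseteq> {a, b}"
    proof -
      define I where "I = nb b \<inter> nb u"
      have "nb b = insert u (insert y' I)" unfolding I_def using sing ub y'(1) by blast
      moreover have "card (insert u (insert y' I)) = Suc (Suc (card I))"
      proof -
        have "u \<notin> insert y' I" "y' \<notin> I" "finite I" using nb_irr[of u] y'n(1) fin_nb by (auto simp: I_def)
        then show ?thesis by simp
      qed
      ultimately have cb: "card (nb b) = Suc (Suc (card I))" by simp
      moreover have "card (nb b) = t - 1" using card_nb[OF bU ub] .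
      moreover have "card (nb u) = card I + card (nb u - nb b)"
        using card_Int_Diff[OF fin_nb, of u "nb b"] by (simp add: I_def Int_commute)
      ultimately have "card (nb u - nb b) = 2" using du by linarith
      moreover have "{a, b} \<subseteq> nb u - nb b" using a b(1) ab nb_irr by blast
      moreover have "a \<noteq> b" using a(2) b(2) by blast
      ultimately show ?thesis using card_subset_eq[of "nb u - nb b" "{a, b}"] fin_nb by simp
    qed
  qed
  have vb: "v \<in> nb u" "nb v \<inter> Y \<noteq> {}" using v y yY by auto
  have na: "nb u - {a, v} \<subseteq> nb v" using bfacts(3)[OF vb] by blast
  \<comment> \<open>Otherwise \<open>b\<close> is adjacent to \<open>v\<close> but not to the
    neighbour \<open>y'\<close> of \<open>v\<close> in \<open>Y\<close>; the same holds for
    \<open>u\<close>, and \<open>v\<close> would have two private neighbours relative to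
    \<open>y'\<close>.\<close>
  have other: "nb b \<inter> Y \<noteq> {}" if b: "b \<in> nb u" "b \<noteq> a" for b
  proof (rule ccontr)
    assume "\<not> ?thesis"
    then have "nb b \<inter> Y = {}" by simp
    then have bv: "b \<noteq> v" using vb by blast
    then have "b \<in> nb v" using na b by blast
    obtain y' where y': "nb v \<inter> Y = {y'}" using bfacts(2)[OF vb] by blast
    have sep: "card (nb v - insert y' (nb y')) \<le> 1"
    proof -
      have "y' \<in> V - K" "v \<in> nb y'" using y' YX nb_sym[OF vU, of y'] by (auto simp: X_def)
      then show ?thesis by (rule one_private_nbr)
    qed
    have "b \<notin> insert y' (nb y')"
    proof -
      have "y' \<in> Y" using y' by blast
      then have "b \<noteq> y'" using b YX by (auto simp: X_def)
      moreover have "b \<notin> nb y'"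
      proof
        assume "b \<in> nb y'"
        then have "y' \<in> nb b" using nb_sym[of y' b] \<open>y' \<in> Y\<close> YX by (auto simp: X_def)
        then show False using \<open>nb b \<inter> Y = {}\<close> \<open>y' \<in> Y\<close> by blast
      qed
      ultimately show ?thesis by blast
    qed
    moreover have "u \<notin> insert y' (nb y')"
    proof -
      have "y' \<in> Y" using y' by blast
      then have "y' \<notin> insert u (nb u)" "y' \<in> V - K" using YX by (auto simp: X_def)
      then show ?thesis using nb_sym[of y' u] by blast
    qed
    ultimately have "{u, b} \<subseteq> nb v - insert y' (nb y')" using uv \<open>b \<in> nb v\<close> by blast
    then have "card {u, b} \<le> 1" using sep fin_nb card_mono[of "nb v - insert y' (nb y')" "{u, b}"] by simp
    moreover have "u \<noteq> b" using b nb_irr by blast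
    ultimately show False by simp
  qed
  have "nb a \<inter> nb u = {}"
  proof -
    have "b \<notin> nb a" if "b \<in> nb u" for b
    proof (cases "b = a")
      case False
      then have "a \<notin> nb b" using bfacts(1) other that by blast
      then show ?thesis using nb_sym[OF aU] by blast
    qed (use nb_irr in simp)
    then show ?thesis by blast
  qed
  then have "nb a \<subseteq> insert u (nb a - insert u (nb u))" by blast
  then have "card (nb a) \<le> card (insert u (nb a - insert u (nb u)))"
    using fin_nb by (intro card_mono) auto
  also have "\<dots> \<le> Suc (card (nb a - insert u (nb u)))" using fin_nb by (intro card_insert_le_m1) auto
  also have "\<dots> \<le> 2" using one_private_nbr[OF u a(1)] by simp
  finally have t3: "t \<le> 3" using card_nb[OF aU nb_sym[OF u a(1)]] by simp
  have av: "a \<noteq> v" using a vb by blast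
  have "{a, v} \<subseteq> nb u" using a v by blast
  then have "2 \<le> card (nb u)" using card_mono[OF fin_nb, of "{a, v}" u] av by simp
  then have t: "t = 3" "nb u = {a, v}"
    using t3 du card_subset_eq[OF fin_nb, of "{a, v}" u] \<open>{a, v} \<subseteq> nb u\<close> av by auto
  obtain y' where y': "nb v \<inter> Y = {y'}" using bfacts(2)[OF vb] by blast
  have finY: "finite Y" using YX finV by (auto simp: X_def intro: finite_subset)
  \<comment> \<open>Every vertex of \<open>Y\<close> has degree 2 outside the hubs, and the only
    edge leaving \<open>Y\<close> there is the one from \<open>y'\<close> to
    \<open>v\<close>.\<close>
  have degY: "card (E `` {w} \<inter> Y) = (if w = y' then 1 else 2)" if w: "w \<in> Y" for w
  proof -
    have wU: "w \<in> V - K" using w YX by (auto simp: X_def)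
    obtain w' where "w' \<in> nb w" using noniso[OF w] by blast
    then have dw: "card (nb w) = 2" using card_nb[OF wU] t(1) by simp
    have EY: "E `` {w} \<inter> Y = nb w \<inter> Y" using YX by (auto simp: nb_def X_def)
    have out: "nb w - Y \<subseteq> {v}"
    proof
      fix b assume b: "b \<in> nb w - Y"
      then have "b \<in> {a, v}" using closed[OF w, of b] t(2) by blast
      moreover have "b \<noteq> a" using b nb_sym[OF wU, of b] a(2) w by blast
      ultimately show "b \<in> {v}" by blast
    qed
    have vw: "v \<in> nb w \<longleftrightarrow> w = y'"
      using nb_sym[OF wU, of v] nb_sym[OF vU, of w] y' w by blast
    have vY: "v \<notin> Y" using v YX by (auto simp: X_def)
    show ?thesis
    proof (cases "w = y'")
      case True
      then have "nb w = insert v (nb w \<inter> Y)" using vw out by blast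
      moreover have "card (insert v (nb w \<inter> Y)) = Suc (card (nb w \<inter> Y))"
        using vY fin_nb by simp
      ultimately have "card (nb w) = Suc (card (nb w \<inter> Y))" by metis
      then show ?thesis using dw True EY by simp
    next
      case False
      then have "nb w \<inter> Y = nb w" using vw out by blast
      then show ?thesis using dw False EY by simp
    qed
  qed
  have "arcs_in E Y = (\<Sum>w\<in>Y. if w = y' then 1 else 2)"
    unfolding arcs_in_eq_sum[OF finY] by (intro sum.cong) (auto simp: degY)
  also have "\<dots> = 1 + (\<Sum>w\<in>Y - {y'}. 2)"
    using y' finY by (subst sum.remove[of Y y']) auto
  finally have "odd (arcs_in E Y)" by simp
  then show False using even_arcs_in[OF finY E_sym E_irr] by blast
qed

end

section \<open>Structure of graphs with nearly maximal spread\<close>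

lemma sqrt_hub_count:
  fixes n s :: real
  assumes "s \<ge> 1" "n \<ge> s"
  shows "sqrt ((s - 1) * n) \<le> sqrt ((s - 1) * (n - s + 1)) + s"
proof -
  have "(s - 1) * n = (s - 1) * (n - s + 1) + (s - 1)\<^sup>2"
    by (simp add: algebra_simps power2_eq_square)
  then have "sqrt ((s - 1) * n) \<le> sqrt ((s - 1) * (n - s + 1)) + sqrt ((s - 1)\<^sup>2)"
    using assms sqrt_add_le[of "(s - 1) * (n - s + 1)" "(s - 1)\<^sup>2"] by simp
  then show ?thesis using assms by simp
qed

text \<open>Each end is compared on its own: the modified eigenvectors are test vectors for the
  weighted matrix and give \<open>p <= p'\<close> and \<open>q <= q'\<close>. The same
  \<open>K\<close> must serve both ends, and it is found from the top eigenvector alone.\<close>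

theorem hub_comparison:
  fixes s t :: nat
  assumes s: "2 \<le> s" and st: "s \<le> t"
  defines "kap \<equiv> 1 / (32 * (real s)\<^sup>2)"
  shows "\<exists>N. \<forall>V (E :: 'a rel) p q x z. biclique_free V E s t \<longrightarrow> N \<le> card V \<longrightarrow> is_spread V (adj E) p q x z \<longrightarrow>
     2 * sqrt ((real s - 1) * (real (card V) - real s + 1)) \<le> p + q \<longrightarrow>
     (\<exists>K. hub_split V E s t K kap \<and> card V \<le> 2 * card (common_nbrs V E K) \<and>
       (\<forall>p' q' x' z'. is_spread V (hub_graph.hubmat K (hub_split.U V K) (hub_split.F V E K) (hub_split.c V E K kap)) p' q' x' z' \<longrightarrow>
         p + q \<le> p' + q'))"
proof -
  define C where "C = (2 ^ (s + t) + 1 :: real)"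
  \<comment> \<open>The root of \<open>z\<close>: entries off the hubs are at most
    \<open>4 w\<close>, and the factor \<open>t + C\<close> makes the edges lost outside the hubs
    cheap compared with \<open>1 / s\<close>.\<close>
  define w where "w = 1 / (1000 * real s * (real t + C))"
  define z where "z = w\<^sup>2"
  have s0: "real s \<ge> 2" "real s > 0" using s by auto
  have C1: "C \<ge> 1" by (simp add: C_def)
  have tC: "real t + C \<ge> 1" "real t + C > 0" "C \<le> real t + C" using C1 by auto
  have w0: "w > 0" using s0 tC by (simp add: w_def)
  have sqz: "sqrt z = w" using w0 by (simp add: z_def)
  have wtC: "(real t + C) * w = 1 / (1000 * real s)" using tC by (simp add: w_def)
  have w1: "w \<le> 1 / (1000 * real s)"
  proof -
    have "1 * w \<le> (real t + C) * w" using tC w0 by (intro mult_right_mono) auto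
    then show ?thesis using wtC by simp
  qed
  have w128: "w \<le> 1 / (128 * real s)" using w1 s0 by (rule_tac order_trans[OF w1]) (simp add: field_simps)
  have s2000: "1 / (1000 * real s) \<le> 1 / 2000" using s0 by (simp add: field_simps)
  have Cw: "C * w \<le> 1 / 32"
  proof -
    have "C * w \<le> (real t + C) * w" using tC w0 by (intro mult_right_mono) auto
    then show ?thesis using wtC s2000 by linarith
  qed
  have z0: "0 < z" using w0 by (simp add: z_def)
  have z1: "z \<le> 1 / 2"
  proof -
    have "w \<le> 1 / 2" using w1 s2000 by linarith
    then have "w * w \<le> (1 / 2) * 1" using w0 by (intro mult_mono) auto
    then show ?thesis by (simp add: z_def power2_eq_square)
  qed
  have z_lt: "z < 1" using z1 by simp
  have kap: "0 \<le> kap" "kap \<le> 1"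
  proof -
    show "0 \<le> kap" by (simp add: kap_def)
    have "1 \<le> (real s)\<^sup>2" using s0 by (simp add: one_le_power)
    then show "kap \<le> 1" by (simp add: kap_def divide_le_eq)
  qed
  \<comment> \<open>Hub entries are at least \<open>1 / (16 s)\<close>. Half of this pays for
    \<open>kap * s\<close>, the cost of the reduced weight, and the other half covers the lost
    edges.\<close>
  have gap: "kap * real s \<le> 1 / (16 * real s) - (real t + 2 ^ (s + t)) * (4 * w)"
  proof -
    have "(real t + 2 ^ (s + t)) * (4 * w) \<le> (real t + C) * (4 * w)"
      using w0 by (intro mult_right_mono) (auto simp: C_def)
    also have "\<dots> = 4 * (1 / (1000 * real s))" using wtC by simp
    also have "\<dots> \<le> 1 / (32 * real s)" using s0 by (simp add: field_simps)
    finally have "(real t + 2 ^ (s + t)) * (4 * w) \<le> 1 / (32 * real s)" .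
    moreover have "kap * real s = 1 / (32 * real s)" using s0 by (simp add: kap_def power2_eq_square)
    moreover have "1 / (16 * real s) = 1 / (32 * real s) + 1 / (32 * real s)" by simp
    ultimately show ?thesis by linarith
  qed
  obtain N1 where N1: "\<And>V (E :: 'a rel) x. biclique_free V E s t \<Longrightarrow> N1 \<le> card V \<Longrightarrow> sqnorm V x = 1 \<Longrightarrow>
     sqrt ((real s - 1) * (real (card V) - real s + 1)) \<le> qform V (adj E) x \<Longrightarrow>
     \<exists>K\<subseteq>V. card K = s - 1 \<and> (1 - z) * card V \<le> card (common_nbrs V E K)"
    using hubs_exist[OF s z0 z_lt, of t, where 'a = 'a] by blast
  obtain N2 where N2: "\<And>V (E :: 'a rel) x. biclique_free V E s t \<Longrightarrow> N2 \<le> card V \<Longrightarrow> sqnorm V x = 1 \<Longrightarrow>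
     qform V (adj E) x \<le> sqrt ((real s - 1) * card V) + 1 / 8 * sqrt (card V)"
    using qform_upper_bound[OF s, of "1 / 8" t] by auto
  obtain N3 where N3: "\<And>n. n \<ge> N3 \<Longrightarrow> real s + sqrt t + C * sqrt t + 1 \<le> w * sqrt (real n)"
    using sqrt_dominates[OF w0] by blast
  obtain N4 where N4: "\<And>n. n \<ge> N4 \<Longrightarrow> 2 * real s \<le> 1 / 8 * sqrt (real n)"
    using sqrt_dominates[of "1 / 8" "2 * real s"] by auto
  show ?thesis
  proof (intro exI[of _ "Max {N1, N2, N3, N4, s}"] allI impI)
    fix V and E :: "'a rel" and p q x zz
    assume bf: "biclique_free V E s t" and n: "Max {N1, N2, N3, N4, s} \<le> card V"
      and sp: "is_spread V (adj E) p q x zz" and S: "2 * sqrt ((real s - 1) * (real (card V) - real s + 1)) \<le> p + q"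
    have nn: "N1 \<le> card V" "N2 \<le> card V" "N3 \<le> card V" "N4 \<le> card V" "s \<le> card V" using n by auto
    note sp' = sp[unfolded is_spread_def]
    have qp: "q \<le> p" using sp by (rule spread_bottom_le_top) simp
    define l0 where "l0 = sqrt ((real s - 1) * (real (card V) - real s + 1))"
    define sn where "sn = sqrt (real (card V))"
    define L where "L = sqrt ((real s - 1) * real (card V))"
    have p_l0: "l0 \<le> p" using S qp unfolding l0_def by linarith
    have fx: "qform V (adj E) x = p" "qform V (adj E) zz = - q"
      using qform_eigenvector[of V "adj E" x p] qform_eigenvector[of V "adj E" zz "- q"] sp' by auto
    have p_up: "p \<le> L + 1 / 8 * sn" using N2[OF bf nn(2), of x] sp' fx by (simp add: L_def sn_def)
    have Ll: "L \<le> l0 + real s"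
      unfolding L_def l0_def using sqrt_hub_count[of "real s" "real (card V)"] s0 nn(5) by simp
    have snL: "sn \<le> L" unfolding sn_def L_def
    proof (rule real_sqrt_le_mono)
      have "1 * real (card V) \<le> (real s - 1) * real (card V)" using s0 by (intro mult_right_mono) auto
      then show "real (card V) \<le> (real s - 1) * real (card V)" by simp
    qed
    have s_sn: "2 * real s \<le> 1 / 8 * sn" using N4[OF nn(4)] by (simp add: sn_def)
    have S': "2 * l0 \<le> p + q" using S by (simp add: l0_def)
    have sn0: "sn \<ge> 0" by (simp add: sn_def)
    have s16: "16 * real s \<le> sn" using s_sn by (simp add: field_simps)
    have p8: "8 * p \<le> 8 * L + sn" using p_up by (simp add: field_simps)
    \<comment> \<open>As \<open>p\<close> exceeds \<open>L\<close> by at most \<open>sn / 8\<close>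
      and \<open>p + q\<close> is at least \<open>2 l0\<close>, which is within \<open>2 s\<close>
      of \<open>2 L\<close>, the value \<open>q\<close> cannot drop below half of
      \<open>L\<close>.\<close>
    have "L \<le> 2 * q" using p8 Ll snL s16 S' sn0 by (smt (verit))
    then have q_lo: "L / 2 \<le> q" by simp
    have "L \<le> 2 * p" using p_l0 Ll snL s16 sn0 by (smt (verit))
    then have p_lo: "L / 2 \<le> p" by simp
    have L0: "L \<ge> 0" using snL sn0 by linarith
    obtain K where K: "K \<subseteq> V" "card K = s - 1" "(1 - z) * card V \<le> card (common_nbrs V E K)"
      using N1[OF bf nn(1), of x] sp' fx p_l0 by (auto simp: l0_def)
    interpret biclique_free V E s t by fact
    interpret hub_split V E s t K kap
      using K s st kap by unfold_locales auto
    have half: "card V \<le> 2 * card (common_nbrs V E K)"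
    proof -
      have "1 / 2 * real (card V) \<le> (1 - z) * card V" using z1 by (intro mult_right_mono) auto
      then have "real (card V) \<le> 2 * real (card (common_nbrs V E K))" using K(3) by linarith
      then show ?thesis by linarith
    qed
    have shape: "\<exists>y'. sqnorm V y' = sqnorm V y \<and> e * qform V (adj E) y \<le> e * qform V H.hubmat y'"
      if e: "e = 1 \<or> e = - 1" and y: "sqnorm V y = 1" and eig: "\<And>i. i \<in> V \<Longrightarrow> (\<Sum>j\<in>V. adj E i j * y j) = lam * y i"
        and lam: "L / 2 \<le> \<bar>lam\<bar>" for e y lam
    proof (rule eigenvector_shape[OF y eig, where z = z])
      show "sqrt ((real s - 1) * real (card V)) / 2 \<le> \<bar>lam\<bar>" using lam by (simp add: L_def)
      show "real s + sqrt (real t) + (2 ^ (s + t) + 1) * sqrt (real t) + 1 \<le> sqrt z * sqrt (real (card V))"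
        using N3[OF nn(3)] by (simp add: sqz C_def)
      show "sqrt z \<le> 1 / (128 * real s)" using w128 by (simp add: sqz)
      show "(2 ^ (s + t) + 1) * sqrt z \<le> 1 / 32" using Cw by (simp add: sqz C_def)
      fix tau :: real
      assume tau: "tau = 1 \<or> tau = - 1" and U: "\<And>v. v \<in> U \<Longrightarrow> \<bar>y v\<bar> \<le> 4 * sqrt z"
        and Kk: "\<And>k. k \<in> K \<Longrightarrow> 1 / (16 * real s) \<le> tau * y k"
      show ?thesis
      proof (rule replace_rest[OF e tau, of "4 * w" y "1 / (16 * real s)"])
        have "(\<Sum>k\<in>K. \<bar>y k\<bar>) \<le> sqrt (card K)" using finV KV y by (rule abs_sum_le_card)
        also have "\<dots> \<le> real s"
        proof -
          have "real (card K) \<le> (real s)\<^sup>2"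
          proof -
            have "real (card K) \<le> real s * 1" using cardK by simp
            also have "\<dots> \<le> real s * real s" using s0 by (intro mult_left_mono) auto
            finally show ?thesis by (simp add: power2_eq_square)
          qed
          then show ?thesis using s0 by (intro real_le_lsqrt) auto
        qed
        finally have "kap * (\<Sum>k\<in>K. \<bar>y k\<bar>) \<le> kap * real s" using kap by (intro mult_left_mono) auto
        then show "kap * (\<Sum>k\<in>K. \<bar>y k\<bar>) \<le> 1 / (16 * real s) - (real t + 2 ^ (s + t)) * (4 * w)"
          using gap by linarith
      qed (use w0 U Kk sqz in auto)
    qed (use z0 K in auto)
    have "p + q \<le> p' + q'" if M: "is_spread V H.hubmat p' q' x' z'" for p' q' x' z'
    proof -
      note M' = M[unfolded is_spread_def]
      obtain y where y: "sqnorm V y = 1" "1 * qform V (adj E) x \<le> 1 * qform V H.hubmat y"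
        using shape[of 1 x p] sp' p_lo by force
      obtain y2 where y2: "sqnorm V y2 = 1" "- 1 * qform V (adj E) zz \<le> - 1 * qform V H.hubmat y2"
        using shape[of "- 1" zz "- q"] sp' q_lo by force
      have "p \<le> p' * sqnorm V y" using y(2) M' fx by (metis mult_1 order_trans)
      moreover have "q \<le> q' * sqnorm V y2" using y2(2) M' fx by (smt (verit))
      ultimately show ?thesis using y(1) y2(1) by simp
    qed
    then show "\<exists>K. hub_split V E s t K kap \<and> card V \<le> 2 * card (common_nbrs V E K) \<and>
       (\<forall>p' q' x' z'. is_spread V (hub_graph.hubmat K (hub_split.U V K) (hub_split.F V E K) (hub_split.c V E K kap)) p' q' x' z' \<longrightarrow>
         p + q \<le> p' + q')"
      using half hub_split_axioms by blast
  qed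
qed

text \<open>The formula of \<open>psi\<close> on a set and a relation, so that it applies to the
  edges among the hubs without forming a graph.\<close>

definition edge_psi :: "nat \<Rightarrow> nat \<Rightarrow> 'a set \<Rightarrow> 'a rel \<Rightarrow> real" where
  "edge_psi s t K E = 3 * (\<Sum>v\<in>K. (real (card (E `` {v} \<inter> K)))\<^sup>2)
     - 2 / (real s - 1) * (\<Sum>v\<in>K. real (card (E `` {v} \<inter> K)))\<^sup>2
     - (real t - 1) * (\<Sum>v\<in>K. real (card (E `` {v} \<inter> K)))"

lemma admissible_edge_psi:
  fixes K :: "nat set"
  assumes adm: "admissible s t" and K: "finite K" "card K = s - 1" and E: "sym E" "irrefl E"
  shows "edge_psi s t K E \<le> 0" "edge_psi s t K E = 0 \<Longrightarrow> E \<inter> K \<times> K = {}"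
proof -
  define L where "L = \<lparr> pverts = K, parcs = E \<inter> K \<times> K \<rparr>"
  have pg: "pair_graph L"
  proof unfold_locales
    show "symmetric (with_proj L)" using E(1) by (auto simp: L_def symmetric_def sym_def)
  qed (use K E in \<open>auto simp: L_def irrefl_def\<close>)
  interpret pair_graph L by fact
  have od: "out_degree (with_proj L) v = card (E `` {v} \<inter> K)" if "v \<in> K" for v
  proof -
    have "out_arcs (with_proj L) v = (\<lambda>w. (v, w)) ` (E `` {v} \<inter> K)"
      using that by (auto simp: out_arcs_def L_def)
    then show ?thesis by (simp add: out_degree_def card_image inj_on_def)
  qed
  have psi: "psi s t L = edge_psi s t K E"
  proof -
    have vL: "pverts L = K" by (simp add: L_def)
    have "(\<Sum>v\<in>K. (real (out_degree (with_proj L) v))\<^sup>2) = (\<Sum>v\<in>K. (real (card (E `` {v} \<inter> K)))\<^sup>2)"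
      "(\<Sum>v\<in>K. real (out_degree (with_proj L) v)) = (\<Sum>v\<in>K. real (card (E `` {v} \<inter> K)))"
      by (intro sum.cong; simp add: od)+
    then show ?thesis by (simp add: psi_def edge_psi_def vL)
  qed
  have "card (pverts L) = s - 1" using K by (simp add: L_def)
  then have a: "psi s t L \<le> 0" "psi s t L = 0 \<Longrightarrow> digraph_iso (with_proj L) (with_proj (copies (s - 1) (complete_graph 1)))"
    using adm pg unfolding admissible_def by blast+
  show "edge_psi s t K E \<le> 0" using a(1) psi by simp
  assume "edge_psi s t K E = 0"
  then obtain h where "parcs (copies (s - 1) (complete_graph 1)) = map_prod h h ` parcs L"
    using a(2) psi digraph_iso_with_proj_iff[OF pair_wf_digraph_axioms] by metis
  moreover have "parcs (copies (s - 1) (complete_graph 1)) = {}" by (auto simp: copies_def complete_graph_def)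
  ultimately show "E \<inter> K \<times> K = {}" by (simp add: L_def)
qed

text \<open>Multiplied by \<open>s - 1\<close> the value is an integer. This gap, independent of
  \<open>n\<close>, is what the vanishing expansion error is measured against.\<close>

lemma edge_psi_gap:
  assumes s: "2 \<le> s" and neg: "edge_psi s t K E < 0"
  shows "edge_psi s t K E \<le> - 1 / (real s - 1)"
proof -
  define A B :: int where "A = (\<Sum>v\<in>K. (int (card (E `` {v} \<inter> K)))\<^sup>2)" and "B = (\<Sum>v\<in>K. int (card (E `` {v} \<inter> K)))"
  have AB: "(\<Sum>v\<in>K. (real (card (E `` {v} \<inter> K)))\<^sup>2) = of_int A" "(\<Sum>v\<in>K. real (card (E `` {v} \<inter> K))) = of_int B"
    by (simp_all add: A_def B_def)
  have m: "real s - 1 > 0" using s by simp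
  define I :: int where "I = 3 * A * (int s - 1) - 2 * B\<^sup>2 - (int t - 1) * B * (int s - 1)"
  have eq: "edge_psi s t K E * (real s - 1) = of_int I"
    unfolding edge_psi_def AB using m by (simp add: I_def field_simps)
  have "edge_psi s t K E * (real s - 1) < 0" using neg m by (rule mult_neg_pos)
  then have "I \<le> - 1" unfolding eq by simp
  then have "edge_psi s t K E * (real s - 1) \<le> - 1" unfolding eq by simp
  then show ?thesis by (simp only: pos_le_divide_eq[OF m])
qed

text \<open>The deficit \<open>eta\<close> and the expansion error together are smaller than the
  cost of a single vertex missing a hub or of a single edge inside \<open>K\<close>.\<close>

theorem extremal_structure:
  fixes s t :: nat
  assumes s: "2 \<le> s" and st: "s \<le> t" and adm: "admissible s t"
  shows "\<exists>N eta. eta > 0 \<and> (\<forall>V (E :: nat rel) p q x z. biclique_free V E s t \<longrightarrow> N \<le> card V \<longrightarrow>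
     is_spread V (adj E) p q x z \<longrightarrow> 0 \<le> p + q \<longrightarrow>
     4 * ((real s - 1) * (real (card V) - real s + 1)) + 4 / 3 * (real t - 1)\<^sup>2 - eta \<le> (p + q)\<^sup>2 \<longrightarrow>
     (\<exists>K. K \<subseteq> V \<and> card K = s - 1 \<and> E \<inter> K \<times> K = {} \<and> (\<forall>k\<in>K. \<forall>u\<in>V - K. (k, u) \<in> E)))"
proof -
  define kap where "kap = 1 / (32 * (real s)\<^sup>2)"
  define m T where "m = real s - 1" and "T = real t - 1"
  have m1: "m \<ge> 1" and T1: "T \<ge> 1" using s st by (auto simp: m_def T_def)
  have kap0: "kap > 0" "kap \<le> 1" 
  proof -
    show "kap > 0" using s by (simp add: kap_def)
    have "1 \<le> (real s)\<^sup>2" using s by (simp add: one_le_power)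
    then show "kap \<le> 1" by (simp add: kap_def divide_le_eq)
  qed
  \<comment> \<open>A vertex of \<open>R\<close> costs at least \<open>4 kap\<close>, and an edge
    inside \<open>K\<close> at least \<open>4 / (3 m^2)\<close>. Both exceed \<open>2 eta\<close>:
    one \<open>eta\<close> for the assumed deficit and one for the expansion error.\<close>
  define eta where "eta = min kap (1 / (2 * m\<^sup>2))"
  have eta: "eta > 0" "eta \<le> kap" "eta \<le> 1 / (2 * m\<^sup>2)" using kap0 m1 by (auto simp: eta_def)
  obtain N1 where N1: "\<And>V (E :: nat rel) p q x z. biclique_free V E s t \<Longrightarrow> N1 \<le> card V \<Longrightarrow> is_spread V (adj E) p q x z \<Longrightarrow>
     2 * sqrt ((real s - 1) * (real (card V) - real s + 1)) \<le> p + q \<Longrightarrow>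
     (\<exists>K. hub_split V E s t K kap \<and> card V \<le> 2 * card (common_nbrs V E K) \<and>
       (\<forall>p' q' x' z'. is_spread V (hub_graph.hubmat K (hub_split.U V K) (hub_split.F V E K) (hub_split.c V E K kap)) p' q' x' z' \<longrightarrow>
         p + q \<le> p' + q'))"
    using hub_comparison[OF s st, where 'a = nat] unfolding kap_def by blast
  define Q where "Q = max (exp_threshold m T) (exp_const m T / eta)"
  obtain N2 where N2: "\<And>n. n \<ge> N2 \<Longrightarrow> Q \<le> 1 / 2 * sqrt (real n)"
    using sqrt_dominates[of "1 / 2" Q] by auto
  show ?thesis
  proof (intro exI[of _ "Max {N1, N2, 1, s}"] exI[of _ eta] conjI allI impI)
    fix V and E :: "nat rel" and p q x z
    assume bf: "biclique_free V E s t" and n: "Max {N1, N2, 1, s} \<le> card V" and sp: "is_spread V (adj E) p q x z"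
      and pq0: "0 \<le> p + q"
      and S: "4 * ((real s - 1) * (real (card V) - real s + 1)) + 4 / 3 * (real t - 1)\<^sup>2 - eta \<le> (p + q)\<^sup>2"
    have nn: "N1 \<le> card V" "N2 \<le> card V" "1 \<le> card V" "s \<le> card V" using n by auto
    define N where "N = real (card V) - real s + 1"
    have N0: "N \<ge> 1" using nn(4) by (simp add: N_def)
    have S': "4 * (m * N) + 4 / 3 * T\<^sup>2 - eta \<le> (p + q)\<^sup>2" using S by (simp add: m_def T_def N_def)
    have T2: "T\<^sup>2 \<ge> 1" using T1 by (simp add: one_le_power)
    have mN: "m * N \<ge> 0" using m1 N0 by simp
    have big: "2 * sqrt (m * N) \<le> p + q"
    proof -
      have "(2 * sqrt (m * N))\<^sup>2 = 4 * (m * N)" using mN by (simp add: power_mult_distrib)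
      also have "\<dots> \<le> (p + q)\<^sup>2" using S' T2 eta kap0 by linarith
      finally show ?thesis using pq0 by (rule power2_le_imp_le)
    qed
    obtain K where K: "hub_split V E s t K kap" "card V \<le> 2 * card (common_nbrs V E K)"
      and cmp: "\<And>p' q' x' z'. is_spread V (hub_graph.hubmat K (hub_split.U V K) (hub_split.F V E K) (hub_split.c V E K kap)) p' q' x' z' \<Longrightarrow>
         p + q \<le> p' + q'"
      using N1[OF bf nn(1) sp] big unfolding m_def N_def by blast
    interpret hub_split V E s t K kap by fact
    have KU: "K \<union> U = V" using parts by blast
    have cU: "real (card U) = N"
    proof -
      have "card (K \<union> U) = card K + card U" using parts(2) fin by (simp add: card_Un_disjoint)
      then have "card V = card K + card U" unfolding KU .
      then show ?thesis using cardK s2 by (simp add: N_def)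
    qed
    have cWR: "card U = card W + card R"
    proof -
      have "card (W \<union> R) = card W + card R" using parts(4) fin by (simp add: card_Un_disjoint)
      then show ?thesis using parts(3) by simp
    qed
    have weight: "H.weight = real (card W) + (1 - kap)\<^sup>2 * real (card R)"
    proof -
      have "H.weight = (\<Sum>u\<in>W \<union> R. (c u)\<^sup>2)" unfolding H.weight_def using parts(3) by simp
      also have "\<dots> = (\<Sum>u\<in>W. (c u)\<^sup>2) + (\<Sum>u\<in>R. (c u)\<^sup>2)"
        using fin parts(4) by (intro sum.union_disjoint) auto
      also have "(\<Sum>u\<in>W. (c u)\<^sup>2) = (\<Sum>u\<in>W. 1)" by (intro sum.cong) (auto simp: c_def)
      also have "(\<Sum>u\<in>R. (c u)\<^sup>2) = (\<Sum>u\<in>R. (1 - kap)\<^sup>2)"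
        using parts(4) by (intro sum.cong) (auto simp: c_def R_def)
      finally show ?thesis by simp
    qed
    have kk: "(1 - kap)\<^sup>2 \<le> 1 - kap"
    proof -
      have "(1 - kap) * (1 - kap) \<le> 1 * (1 - kap)" using kap0 by (intro mult_right_mono) auto
      then show ?thesis by (simp add: power2_eq_square)
    qed
    \<comment> \<open>Each vertex of \<open>R\<close> has squared weight at most
      \<open>1 - kap\<close>, so the total weight falls short of \<open>N\<close> by at least
      \<open>kap\<close> per vertex.\<close>
    have w_le: "H.weight \<le> N - kap * real (card R)"
    proof -
      have "(1 - kap)\<^sup>2 * real (card R) \<le> (1 - kap) * real (card R)" using kk by (intro mult_right_mono) auto
      moreover have "N = real (card W) + real (card R)" using cU cWR by simp
      moreover have "(1 - kap) * real (card R) = real (card R) - kap * real (card R)" by (simp add: left_diff_distrib)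
      ultimately show ?thesis unfolding weight by linarith
    qed
    have w_ge: "H.weight \<ge> real (card V) / 2"
    proof -
      have "real (card V) \<le> 2 * real (card W)" using K(2) by linarith
      moreover have "0 \<le> (1 - kap)\<^sup>2 * real (card R)" by simp
      ultimately show ?thesis unfolding weight by (smt (verit) field_sum_of_halves)
    qed
    have w0: "H.weight > 0" using w_ge nn(3) by (smt (verit) half_gt_zero of_nat_le_iff of_nat_1)
    define l where "l = sqrt (m * H.weight)"
    have l_ge: "1 / 2 * sqrt (real (card V)) \<le> l"
    proof -
      have "1 / 2 * sqrt (real (card V)) = sqrt (real (card V) / 4)" by (simp add: real_sqrt_divide)
      also have "\<dots> \<le> l" unfolding l_def
      proof (rule real_sqrt_le_mono)
        have "real (card V) / 4 \<le> 1 * H.weight" using w_ge w0 by simp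
        also have "\<dots> \<le> m * H.weight" using m1 w0 by (intro mult_right_mono) auto
        finally show "real (card V) / 4 \<le> m * H.weight" .
      qed
      finally show ?thesis .
    qed
    have lQ: "Q \<le> l" using N2[OF nn(2)] l_ge by linarith
    have l0: "l > 0" using m1 w0 by (simp add: l_def)
    have hyp: "\<And>i j. i \<in> V \<Longrightarrow> j \<in> V \<Longrightarrow> H.hubmat i j = H.hubmat j i" by (rule H.hubmat_sym)
    have nV: "V \<noteq> {}" using nn(3) by auto
    obtain p' q' x' z' where M: "is_spread V H.hubmat p' q' x' z'"
      using is_spread_exists[where V = V and A = H.hubmat, OF finV nV hyp] by blast
    have pp: "p + q \<le> p' + q'" by (rule cmp[OF M])
    have "2 * l \<le> p' + q'"
    proof -
      have "l \<le> sqrt (m * N)" unfolding l_def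
      proof (rule real_sqrt_le_mono)
        have "H.weight \<le> N" using w_le kap0 mult_nonneg_nonneg[of kap "real (card R)"] by linarith
        then show "m * H.weight \<le> m * N" using m1 by (intro mult_left_mono) auto
      qed
      then show ?thesis using big pp by linarith
    qed
    then have cb: "(p' + q')\<^sup>2 \<le> 4 * (m * H.weight) + 4 / 3 * T\<^sup>2
       + 4 / (3 * m) * (3 * H.l2 - 2 / m * H.l1\<^sup>2 - T * H.l1) + exp_const m T / l"
      using H.coarse_bound[of p' q' x' z' l] M w0 lQ KU unfolding m_def T_def l_def Q_def by simp
    have psi: "3 * H.l2 - 2 / m * H.l1\<^sup>2 - T * H.l1 = edge_psi s t K E"
    proof -
      have dK: "H.dK k = real (card (E `` {k} \<inter> K))" if "k \<in> K" for k
      proof -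
        have "H.dK k = real (card (F `` {k} \<inter> K))" unfolding H.dK_def using fin(1) by (rule H.sum_adj_eq_card)
        also have "F `` {k} \<inter> K = E `` {k} \<inter> K" using that by (auto simp: F_def)
        finally show ?thesis .
      qed
      have "H.l2 = (\<Sum>v\<in>K. (real (card (E `` {v} \<inter> K)))\<^sup>2)" "H.l1 = (\<Sum>v\<in>K. real (card (E `` {v} \<inter> K)))"
        unfolding H.l1_def H.l2_def by (intro sum.cong; simp add: dK)+
      then show ?thesis by (simp add: edge_psi_def m_def T_def)
    qed
    have err: "exp_const m T / l \<le> eta"
    proof -
      have "exp_const m T / eta \<le> l" using lQ by (simp add: Q_def)
      then have "exp_const m T \<le> l * eta" using eta by (simp add: pos_divide_le_eq)
      then show ?thesis using l0 by (simp add: pos_divide_le_eq mult.commute)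
    qed
    have "(p + q)\<^sup>2 \<le> (p' + q')\<^sup>2" using pp pq0 by (rule power_mono)
    \<comment> \<open>The left side is the loss through weights, and \<open>edge_psi\<close> is
      nonpositive by admissibility. Two losses of equal sign are thus bounded by
      \<open>2 eta\<close>, and each can be excluded separately.\<close>
    then have main: "4 * (m * N) - 4 * (m * H.weight) \<le> 4 / (3 * m) * edge_psi s t K E + 2 * eta"
      using cb S' err unfolding psi by linarith
    have psi0: "edge_psi s t K E \<le> 0"
      using admissible_edge_psi(1)[OF adm fin(1) cardK E_sym E_irr] .
    have psi_term: "4 / (3 * m) * edge_psi s t K E \<le> 0" using psi0 m1 by (intro mult_nonneg_nonpos) auto
    have kR: "kap * real (card R) \<le> m * N - m * H.weight"
    proof -
      have "kap * real (card R) \<le> 1 * (N - H.weight)" using w_le by simp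
      also have "\<dots> \<le> m * (N - H.weight)"
      proof (rule mult_right_mono)
        have "0 \<le> kap * real (card R)" using kap0 by simp
        then show "0 \<le> N - H.weight" using w_le by linarith
      qed (rule m1)
      finally show ?thesis by (simp add: right_diff_distrib)
    qed
    have "card R = 0"
    proof (rule ccontr)
      assume "card R \<noteq> 0"
      then have "kap * 1 \<le> kap * real (card R)" using kap0 by (intro mult_left_mono) auto
      then show False using kR main psi_term eta kap0 by linarith
    qed
    then have R0: "R = {}" using fin by simp
    have "edge_psi s t K E = 0"
    proof (rule ccontr)
      assume "edge_psi s t K E \<noteq> 0"
      then have "edge_psi s t K E \<le> - 1 / m" using psi0 edge_psi_gap[OF s, of t K E] by (simp add: m_def)
      then have "4 / (3 * m) * edge_psi s t K E \<le> 4 / (3 * m) * (- 1 / m)" using m1 by (intro mult_left_mono) auto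
      also have "\<dots> = - (4 / 3) * (1 / m\<^sup>2)" by (simp add: power2_eq_square)
      finally have 1: "4 / (3 * m) * edge_psi s t K E \<le> - (4 / 3) * (1 / m\<^sup>2)" .
      have 2: "2 * eta \<le> 1 / m\<^sup>2" using eta(3) by simp
      have "1 / m\<^sup>2 > 0" using m1 by simp
      moreover have "0 \<le> kap * real (card R)" using kap0 by simp
      ultimately show False using main kR 1 2 by linarith
    qed
    then have E0: "E \<inter> K \<times> K = {}"
      using admissible_edge_psi(2)[OF adm fin(1) cardK E_sym E_irr] by blast
    have "(k, u) \<in> E" if "k \<in> K" "u \<in> V - K" for k u
      using that R0 by (auto simp: R_def common_nbrs_def)
    then show "\<exists>K. K \<subseteq> V \<and> card K = s - 1 \<and> E \<inter> K \<times> K = {} \<and> (\<forall>k\<in>K. \<forall>u\<in>V - K. (k, u) \<in> E)"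
      using KV cardK E0 by blast
  qed (rule eta(1))
qed

section \<open>The candidate graphs\<close>

lemma pair_wf_digraph_image:
  assumes "pair_wf_digraph G" "pverts H = h ` pverts G" "parcs H = map_prod h h ` parcs G"
  shows "pair_wf_digraph H"
proof -
  interpret pair_wf_digraph G by fact
  show ?thesis
    using assms(2,3) in_arcsD1 in_arcsD2 by unfold_locales (auto intro!: imageI)
qed

lemma digraph_iso_wf:
  assumes "pair_wf_digraph G" "digraph_iso (with_proj G) (with_proj H)"
  shows "pair_wf_digraph H"
  using assms pair_wf_digraph_image by (metis digraph_iso_with_proj_iff)

lemma digraph_iso_trans':
  assumes wf: "pair_wf_digraph G" and GH: "digraph_iso (with_proj G) (with_proj H)"
    and HI: "digraph_iso (with_proj H) (with_proj I)"
  shows "digraph_iso (with_proj G) (with_proj I)"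
proof -
  obtain h where h: "inj_on h (pverts G)" "pverts H = h ` pverts G" "parcs H = map_prod h h ` parcs G"
    using GH digraph_iso_with_proj_iff[OF wf] by metis
  obtain k where k: "inj_on k (pverts H)" "pverts I = k ` pverts H" "parcs I = map_prod k k ` parcs H"
    using HI digraph_iso_with_proj_iff[OF digraph_iso_wf[OF wf GH]] by metis
  have "inj_on (k \<circ> h) (pverts G)" using h k by (simp add: comp_inj_on)
  moreover have "pverts I = (k \<circ> h) ` pverts G" using h k by (simp add: image_comp)
  moreover have "parcs I = map_prod (k \<circ> h) (k \<circ> h) ` parcs G"
    unfolding k(3) h(3) image_comp by (simp add: map_prod.comp)
  ultimately show ?thesis using digraph_iso_with_proj_iff[OF wf] by blast
qed

lemma digraph_iso_sym':
  assumes wf: "pair_wf_digraph G" and GH: "digraph_iso (with_proj G) (with_proj H)"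
  shows "digraph_iso (with_proj H) (with_proj G)"
proof -
  interpret pair_wf_digraph G by fact
  obtain h where h: "inj_on h (pverts G)" "pverts H = h ` pverts G" "parcs H = map_prod h h ` parcs G"
    using GH digraph_iso_with_proj_iff[OF wf] by metis
  define k where "k = the_inv_into (pverts G) h"
  have kh: "k (h v) = v" if "v \<in> pverts G" for v unfolding k_def using h(1) that by (rule the_inv_into_f_f)
  have "inj_on k (pverts H)" unfolding h(2) using kh by (auto simp: inj_on_def)
  moreover have "pverts G = k ` pverts H" unfolding h(2) using kh by force
  moreover have "parcs G = map_prod k k ` parcs H"
  proof -
    have "map_prod k k (map_prod h h e) = e" if "e \<in> parcs G" for e
      using kh arc_fst_in_verts[OF that] arc_snd_in_verts[OF that] by (cases e) auto
    then show ?thesis unfolding h(3) by force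
  qed
  ultimately show ?thesis using digraph_iso_with_proj_iff[OF digraph_iso_wf[OF wf GH]] by blast
qed

abbreviation hubV :: "nat \<Rightarrow> nat \<times> nat + (nat \<times> nat + nat \<times> nat)" where "hubV i \<equiv> Inl (i, 0)"
abbreviation blockV :: "nat \<Rightarrow> nat \<Rightarrow> nat \<times> nat + (nat \<times> nat + nat \<times> nat)" where "blockV i j \<equiv> Inr (Inl (i, j))"
abbreviation isoV :: "nat \<Rightarrow> nat \<times> nat + (nat \<times> nat + nat \<times> nat)" where "isoV i \<equiv> Inr (Inr (i, 0))"

definition cand_hubs where "cand_hubs s = {hubV i | i. i < s - 1}"
definition cand_block where "cand_block t i = {blockV i j | j. j < t}"
definition cand_rest where "cand_rest s t n l = (\<Union>i<l. cand_block t i) \<union> {isoV i | i. i < n - s + 1 - t * l}"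

lemma pverts_cand: "pverts (extremal_candidate s t n l) = cand_hubs s \<union> cand_rest s t n l"
  by (auto simp: extremal_candidate_def join_def disjoint_union_def copies_def complete_graph_def
      cand_hubs_def cand_rest_def cand_block_def)

lemma parcs_cand: "parcs (extremal_candidate s t n l) =
    (\<Union>i<l. {(blockV i j, blockV i j') | j j'. j < t \<and> j' < t \<and> j \<noteq> j'})
    \<union> cand_hubs s \<times> cand_rest s t n l \<union> cand_rest s t n l \<times> cand_hubs s"
proof -
  let ?H = "copies l (complete_graph t)" and ?I = "copies (n - s + 1 - t * l) (complete_graph 1)"
  have 1: "parcs (copies k (complete_graph (Suc 0))) = {}" for k by (auto simp: copies_def complete_graph_def)
  have 2: "Inl ` pverts (copies (s - 1) (complete_graph 1)) = cand_hubs s"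
    by (auto simp: copies_def complete_graph_def cand_hubs_def)
  have 3: "Inr ` pverts (disjoint_union ?H ?I) = cand_rest s t n l"
    by (auto simp: copies_def complete_graph_def disjoint_union_def cand_rest_def cand_block_def)
  have 4: "map_prod Inr Inr ` map_prod Inl Inl ` parcs ?H
      = (\<Union>i<l. {(blockV i j, blockV i j') | j j'. j < t \<and> j' < t \<and> j \<noteq> j'})"
    by (fastforce simp: copies_def complete_graph_def image_iff)
  show ?thesis
    unfolding extremal_candidate_def join_def using 2 3 4
    by (simp add: disjoint_union_def 1 image_Un)
qed

lemma card_cand_block: "card (cand_block t i) = t" "finite (cand_block t i)"
proof -
  have e: "cand_block t i = blockV i ` {..<t}" by (auto simp: cand_block_def)
  show "finite (cand_block t i)" unfolding e by simp
  show "card (cand_block t i) = t" unfolding e by (subst card_image) (auto simp: inj_on_def)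
qed

lemma card_cand_hubs: "card (cand_hubs s) = s - 1" "finite (cand_hubs s)"
proof -
  have e: "cand_hubs s = hubV ` {..<s - 1}" by (auto simp: cand_hubs_def)
  show "finite (cand_hubs s)" unfolding e by simp
  show "card (cand_hubs s) = s - 1" unfolding e by (subst card_image) (auto simp: inj_on_def)
qed

lemma card_cand_rest:
  assumes "t * l \<le> n - s + 1"
  shows "card (cand_rest s t n l) = n - s + 1" "finite (cand_rest s t n l)"
proof -
  let ?I = "{isoV i | i. i < n - s + 1 - t * l}"
  have e: "?I = isoV ` {..<n - s + 1 - t * l}" by auto
  have I: "finite ?I" "card ?I = n - s + 1 - t * l"
    unfolding e by (simp, subst card_image) (auto simp: inj_on_def)
  have B: "card (\<Union>i<l. cand_block t i) = (\<Sum>i<l. card (cand_block t i))"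
    by (rule card_UN_disjoint) (auto simp: card_cand_block, auto simp: cand_block_def)
  show "finite (cand_rest s t n l)" using I(1) by (simp add: cand_rest_def card_cand_block)
  have "card (cand_rest s t n l) = card (\<Union>i<l. cand_block t i) + card ?I"
    unfolding cand_rest_def using I(1)
    by (intro card_Un_disjoint) (auto simp: card_cand_block, auto simp: cand_block_def)
  then show "card (cand_rest s t n l) = n - s + 1"
    using B I(2) assms by (simp add: card_cand_block mult.commute)
qed

lemma cand_hubs_rest: "cand_hubs s \<inter> cand_rest s t n l = {}"
  by (auto simp: cand_hubs_def cand_rest_def cand_block_def)

text \<open>The number of arcs is strictly increasing in \<open>l\<close>, which distinguishes the
  two extremal graphs in the half-integer case.\<close>

lemma card_parcs_cand:
  assumes "t * l \<le> n - s + 1"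
  shows "card (parcs (extremal_candidate s t n l)) = l * (t * (t - 1)) + 2 * ((s - 1) * (n - s + 1))"
proof -
  let ?B = "\<lambda>i. {(blockV i j, blockV i j') | j j'. j < t \<and> j' < t \<and> j \<noteq> j'}"
  have eB: "?B i = (\<lambda>(j, j'). (blockV i j, blockV i j')) ` Sigma {..<t} (\<lambda>j. {..<t} - {j})" for i
    by auto
  have cB: "finite (?B i)" "card (?B i) = t * (t - 1)" for i
  proof -
    show "finite (?B i)" unfolding eB by simp
    have "inj_on (\<lambda>(j, j'). (blockV i j, blockV i j')) (Sigma {..<t} (\<lambda>j. {..<t} - {j}))"
      by (auto simp: inj_on_def)
    then have "card (?B i) = card (Sigma {..<t} (\<lambda>j. {..<t} - {j}))" unfolding eB by (rule card_image)
    also have "\<dots> = (\<Sum>j<t. card ({..<t} - {j}))" by simp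
    also have "\<dots> = (\<Sum>j<t. t - 1)" by (intro sum.cong) auto
    finally show "card (?B i) = t * (t - 1)" by simp
  qed
  have U: "card (\<Union>i<l. ?B i) = l * (t * (t - 1))"
  proof -
    have "card (\<Union>i<l. ?B i) = (\<Sum>i<l. card (?B i))"
      by (rule card_UN_disjoint) (use cB(1) in auto)
    then show ?thesis by (simp add: cB(2))
  qed
  have finU: "finite (\<Union>i<l. ?B i)" using cB(1) by blast
  let ?h = "cand_hubs s" and ?r = "cand_rest s t n l"
  have fin: "finite ?h" "finite ?r" using card_cand_hubs card_cand_rest[OF assms] by auto
  have d1: "(\<Union>i<l. ?B i) \<inter> ?h \<times> ?r = {}" "((\<Union>i<l. ?B i) \<union> ?h \<times> ?r) \<inter> ?r \<times> ?h = {}"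
    using cand_hubs_rest[of s t n l] by (auto simp: cand_hubs_def)
  show ?thesis
    unfolding parcs_cand using fin finU d1
    by (simp add: card_Un_disjoint U card_cartesian_product card_cand_hubs card_cand_rest[OF assms])
qed

lemma pair_graph_cand:
  assumes "t * l \<le> n - s + 1"
  shows "pair_graph (extremal_candidate s t n l)"
proof -
  note v = pverts_cand[of s t n l] and a = parcs_cand[of s t n l]
  have fin: "finite (pverts (extremal_candidate s t n l))"
    unfolding v using card_cand_hubs card_cand_rest[OF assms] by simp
  have bl: "i < l \<Longrightarrow> j < t \<Longrightarrow> blockV i j \<in> cand_rest s t n l" for i j
    by (auto simp: cand_rest_def cand_block_def)
  have wf: "parcs (extremal_candidate s t n l) \<subseteq> pverts (extremal_candidate s t n l) \<times> pverts (extremal_candidate s t n l)"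
    unfolding v a using bl by auto
  have sy: "sym (parcs (extremal_candidate s t n l))" unfolding a by (auto simp: sym_def)
  have ir: "irrefl (parcs (extremal_candidate s t n l))"
    unfolding a using cand_hubs_rest[of s t n l] by (auto simp: irrefl_def)
  show ?thesis
  proof unfold_locales
    show "finite (parcs (extremal_candidate s t n l))" using wf fin by (meson finite_SigmaI finite_subset)
    show "symmetric (with_proj (extremal_candidate s t n l))" using sy by (simp add: symmetric_def)
  qed (use wf ir fin in \<open>auto simp: irrefl_def\<close>)
qed

section \<open>Graphs of candidate shape on an arbitrary vertex type\<close>

locale clique_hub_graph = simple_graph +
  fixes s t l :: nat and K :: "'a set" and B :: "nat \<Rightarrow> 'a set"
  assumes KV: "K \<subseteq> V" and cardK: "card K = s - 1" and s2: "2 \<le> s" and st: "s \<le> t"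
    and complete: "\<And>k u. k \<in> K \<Longrightarrow> u \<in> V - K \<Longrightarrow> (k, u) \<in> E"
    and empty: "E \<inter> K \<times> K = {}"
    and B_sub: "\<And>i. i < l \<Longrightarrow> B i \<subseteq> V - K" and B_card: "\<And>i. i < l \<Longrightarrow> card (B i) = t"
    and B_disj: "\<And>i j. i < l \<Longrightarrow> j < l \<Longrightarrow> i \<noteq> j \<Longrightarrow> B i \<inter> B j = {}"
    and B_edges: "\<And>u v. u \<in> V - K \<Longrightarrow> v \<in> V - K \<Longrightarrow> (u, v) \<in> E \<longleftrightarrow> u \<noteq> v \<and> (\<exists>i<l. u \<in> B i \<and> v \<in> B i)"
begin

lemma finB: "i < l \<Longrightarrow> finite (B i)"
  using B_sub finV by (meson finite_Diff finite_subset)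

lemma finK': "finite K" using KV finV by (rule finite_subset)

text \<open>Every edge outside the hubs lies inside one block, so a path avoiding \<open>K\<close>
  cannot leave the block in which it starts.\<close>

lemma connected_in_block:
  assumes A: "connected_in E A" "A \<subseteq> V - K" and x: "x \<in> A" "x \<in> B i" "i < l"
  shows "A \<subseteq> B i"
proof
  fix y assume "y \<in> A"
  then have "(x, y) \<in> (E \<inter> A \<times> A)\<^sup>*" using A(1) x unfolding connected_in_def by blast
  then show "y \<in> B i"
  proof (induction rule: rtrancl_induct)
    case base then show ?case using x by blast
  next
    case (step y z)
    then have "(y, z) \<in> E" "y \<in> V - K" "z \<in> V - K" using A(2) by auto
    then obtain j where j: "j < l" "y \<in> B j" "z \<in> B j" using B_edges by blast
    then have "j = i" using B_disj[OF j(1) x(3)] step(3) by blast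
    then show ?case using j by simp
  qed
qed

text \<open>At most \<open>s - 1\<close> branch sets meet \<open>K\<close>, so each side has one
  that avoids it. Adjacency across the sides then puts all hub-free branch sets into a single block;
  at least \<open>t + 1\<close> disjoint nonempty sets would have to fit into its \<open>t\<close>
  vertices.\<close>

lemma no_biclique_model: "\<not> biclique_model s t V E \<X> \<Y>"
proof
  assume m: "biclique_model s t V E \<X> \<Y>"
  note m' = m[unfolded biclique_model_def]
  define free where "free = (\<lambda>A::'a set. A \<inter> K = {})"
  define Z where "Z = {A \<in> \<X> \<union> \<Y>. \<not> free A}"
  have fin: "finite \<X>" "finite \<Y>" using m' by auto
  have finZ: "finite Z" using fin by (simp add: Z_def)
  have "\<exists>f. \<forall>A\<in>Z. f A \<in> A \<inter> K" by (rule bchoice) (auto simp: Z_def free_def)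
  then obtain f where f: "\<And>A. A \<in> Z \<Longrightarrow> f A \<in> A \<inter> K" by blast
  have "inj_on f Z"
  proof (rule inj_onI)
    fix A A' assume A: "A \<in> Z" "A' \<in> Z" "f A = f A'"
    have d: "disjoint (\<X> \<union> \<Y>)" using m' by blast
    have "f A \<in> A" "f A \<in> A'" using f[OF A(1)] f[OF A(2)] A(3) by auto
    then show "A = A'" using disjointD[OF d, of A A'] A(1,2) by (auto simp: Z_def)
  qed
  moreover have "f ` Z \<subseteq> K" using f by blast
  ultimately have "card Z \<le> card K" using finK' card_inj_on_le by blast
  then have cZ: "card Z \<le> s - 1" using cardK by simp
  have exf: "\<exists>A\<in>\<A>. free A" if "\<A> \<subseteq> \<X> \<union> \<Y>" "card \<A> \<ge> s" for \<A>
  proof (rule ccontr)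
    assume "\<not> ?thesis"
    then have "\<A> \<subseteq> Z" using that(1) by (auto simp: Z_def)
    then have "card \<A> \<le> card Z" using finZ by (rule card_mono[rotated])
    then show False using that(2) cZ s2 by linarith
  qed
  obtain X0 where X0: "X0 \<in> \<X>" "free X0" using exf[of \<X>] m' by auto
  obtain Y0 where Y0: "Y0 \<in> \<Y>" "free Y0" using exf[of \<Y>] m' st by auto
  have sub: "A \<subseteq> V - K \<and> connected_in E A \<and> A \<noteq> {}" if "A \<in> \<X> \<union> \<Y>" "free A" for A
    using m' that by (auto simp: free_def)
  have link: "\<exists>i<l. X \<subseteq> B i \<and> Y \<subseteq> B i" if XY: "X \<in> \<X>" "Y \<in> \<Y>" "free X" "free Y" for X Y
  proof -
    obtain x y where xy: "x \<in> X" "y \<in> Y" "(x, y) \<in> E" using m' XY by blast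
    have X: "X \<subseteq> V - K" "connected_in E X" and Y: "Y \<subseteq> V - K" "connected_in E Y"
      using sub[of X] sub[of Y] XY by auto
    obtain i where i: "i < l" "x \<in> B i" "y \<in> B i" using B_edges[of x y] X Y xy by blast
    then show ?thesis using connected_in_block[OF X(2,1) xy(1)] connected_in_block[OF Y(2,1) xy(2)] by blast
  qed
  obtain i where i: "i < l" "X0 \<subseteq> B i" "Y0 \<subseteq> B i" using link[OF X0(1) Y0(1) X0(2) Y0(2)] by blast
  have same: "A \<subseteq> B i" if A: "A \<in> \<X> \<union> \<Y>" "free A" for A
  proof (cases "A \<in> \<X>")
    case True
    obtain j where j: "j < l" "A \<subseteq> B j" "Y0 \<subseteq> B j" using link[OF True Y0(1) A(2) Y0(2)] by blast
    have "Y0 \<noteq> {}" using sub[of Y0] Y0 by simp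
    then have "j = i" using B_disj[OF j(1) i(1)] j(3) i(3) by blast
    then show ?thesis using j by simp
  next
    case False
    then have "A \<in> \<Y>" using A by simp
    then obtain j where j: "j < l" "X0 \<subseteq> B j" "A \<subseteq> B j" using link[OF X0(1) _ X0(2) A(2)] by blast
    have "X0 \<noteq> {}" using sub[of X0] X0 by simp
    then have "j = i" using B_disj[OF j(1) i(1)] j(2) i(2) by blast
    then show ?thesis using j by simp
  qed
  define F where "F = (\<X> \<union> \<Y>) - Z"
  have F: "A \<subseteq> B i \<and> A \<noteq> {}" if "A \<in> F" for A
    using same[of A] sub[of A] that by (auto simp: F_def Z_def)
  have "card (\<X> \<union> \<Y>) = s + t" using m' by (simp add: card_Un_disjoint)
  moreover have "Z \<subseteq> \<X> \<union> \<Y>" by (auto simp: Z_def)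
  ultimately have "card F = s + t - card Z" unfolding F_def using finZ by (simp add: card_Diff_subset)
  then have cF: "t < card F" using cZ s2 by linarith
  have "\<exists>g. \<forall>A\<in>F. g A \<in> A" by (rule bchoice) (use F in blast)
  then obtain g where g: "\<And>A. A \<in> F \<Longrightarrow> g A \<in> A" by blast
  have "inj_on g F"
  proof (rule inj_onI)
    fix A A' assume A: "A \<in> F" "A' \<in> F" "g A = g A'"
    have d: "disjoint (\<X> \<union> \<Y>)" using m' by blast
    have "g A \<in> A" "g A \<in> A'" using g[OF A(1)] g[OF A(2)] A(3) by auto
    then show "A = A'" using disjointD[OF d, of A A'] A(1,2) by (auto simp: F_def)
  qed
  moreover have "g ` F \<subseteq> B i" using F g by blast
  ultimately have "card F \<le> card (B i)" using finB[OF i(1)] card_inj_on_le by blast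
  then show False using cF B_card[OF i(1)] by simp
qed

lemma block_nbrs:
  assumes "i < l" "u \<in> B i"
  shows "E `` {u} \<inter> (V - K) = B i - {u}"
proof -
  have u: "u \<in> V - K" using assms B_sub by blast
  show ?thesis
  proof (intro equalityI subsetI)
    fix v assume "v \<in> E `` {u} \<inter> (V - K)"
    then obtain j where j: "j < l" "u \<in> B j" "v \<in> B j" "u \<noteq> v" using B_edges[OF u, of v] by blast
    then have "j = i" using B_disj[OF j(1) assms(1)] assms(2) by blast
    then show "v \<in> B i - {u}" using j by blast
  next
    fix v assume v: "v \<in> B i - {u}"
    then have "v \<in> V - K" using B_sub[OF assms(1)] by blast
    then show "v \<in> E `` {u} \<inter> (V - K)" using B_edges[OF u, of v] v assms by blast
  qed
qed

lemma degree_values: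
  assumes u: "u \<in> V - K"
  shows "card (E `` {u} \<inter> (V - K)) = (if \<exists>i<l. u \<in> B i then t - 1 else 0)"
proof (cases "\<exists>i<l. u \<in> B i")
  case True
  then obtain i where i: "i < l" "u \<in> B i" by blast
  then show ?thesis using block_nbrs[OF i] B_card[OF i(1)] finB[OF i(1)] by auto
next
  case False
  then have "E `` {u} \<inter> (V - K) = {}" using B_edges[OF u] by blast
  then show ?thesis using False by auto
qed

lemma card_blocks: "card (\<Union>i<l. B i) = t * l" "(\<Union>i<l. B i) \<subseteq> V - K"
proof -
  have "card (\<Union>i<l. B i) = (\<Sum>i<l. card (B i))"
    by (rule card_UN_disjoint) (use finB B_disj in auto)
  then show "card (\<Union>i<l. B i) = t * l" using B_card by (simp add: mult.commute)
  show "(\<Union>i<l. B i) \<subseteq> V - K" using B_sub by blast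
qed

lemma sum_degrees: "(\<Sum>u\<in>V - K. real (card (E `` {u} \<inter> (V - K)))) = real (t * l) * (real t - 1)"
proof -
  let ?U = "\<Union>i<l. B i"
  have "(\<Sum>u\<in>V - K. real (card (E `` {u} \<inter> (V - K)))) = (\<Sum>u\<in>V - K. if u \<in> ?U then real t - 1 else 0)"
    using degree_values st s2 by (intro sum.cong) (auto simp: of_nat_diff)
  also have "\<dots> = (\<Sum>u\<in>(V - K) \<inter> ?U. real t - 1)"
    by (rule sum.inter_restrict[symmetric]) (use finV in simp)
  also have "(V - K) \<inter> ?U = ?U" using card_blocks(2) by blast
  finally show ?thesis using card_blocks(1) by simp
qed

text \<open>The vertex map is assembled from separate enumerations of the hubs, of each block and of
  the isolated rest.\<close>

lemma iso_candidate:
  assumes G: "pverts G = V" "parcs G = E" and n: "card V = n" "s \<le> n"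
  shows "digraph_iso (with_proj (extremal_candidate s t n l)) (with_proj G)"
    and "t * l \<le> n - s + 1"
proof -
  let ?Bl = "\<Union>i<l. B i"
  define I where "I = V - K - ?Bl"
  have cU: "card (V - K) = n - s + 1"
    using KV finK' cardK n s2 by (simp add: card_Diff_subset)
  have finU: "finite (V - K)" using finV by simp
  have "card ?Bl \<le> card (V - K)" using card_blocks(2) finU by (intro card_mono) auto
  then show tl: "t * l \<le> n - s + 1" using card_blocks(1) cU by simp
  have finBl: "finite ?Bl" using finB by blast
  have cI: "card I = n - s + 1 - t * l"
    unfolding I_def using card_blocks finBl cU by (simp add: card_Diff_subset)
  have finI: "finite I" using finV by (simp add: I_def)
  obtain fK where fK: "bij_betw fK {..<s - 1} K"
    using ex_bij_betw_nat_finite[OF finK'] cardK by (auto simp: lessThan_atLeast0)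
  obtain fI where fI: "bij_betw fI {..<n - s + 1 - t * l} I"
    using ex_bij_betw_nat_finite[OF finI] cI by (auto simp: lessThan_atLeast0)
  have "\<forall>i\<in>{..<l}. \<exists>f. bij_betw f {..<t} (B i)"
    using ex_bij_betw_nat_finite[OF finB] B_card by (auto simp: lessThan_atLeast0)
  then obtain fB where fB: "\<And>i. i < l \<Longrightarrow> bij_betw (fB i) {..<t} (B i)"
    by (metis lessThan_iff)
  define h :: "nat \<times> nat + (nat \<times> nat + nat \<times> nat) \<Rightarrow> 'a" where "h = (\<lambda>v. case v of Inl (i, _) \<Rightarrow> fK i | Inr (Inl (i, j)) \<Rightarrow> fB i j | Inr (Inr (i, _)) \<Rightarrow> fI i)"
  have h: "h (hubV i) = fK i" "h (blockV i j) = fB i j" "h (isoV i) = fI i" for i j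
    by (simp_all add: h_def)
  let ?C = "extremal_candidate s t n l"
  have imK: "h ` cand_hubs s = K"
  proof -
    have "cand_hubs s = hubV ` {..<s - 1}" by (auto simp: cand_hubs_def)
    then show ?thesis using fK by (simp add: image_image h bij_betw_def)
  qed
  have imB: "h ` cand_block t i = B i" if "i < l" for i
  proof -
    have "cand_block t i = blockV i ` {..<t}" by (auto simp: cand_block_def)
    then show ?thesis using fB[OF that] by (simp add: image_image h bij_betw_def)
  qed
  have imI: "h ` {isoV i | i. i < n - s + 1 - t * l} = I"
  proof -
    have "{isoV i | i. i < n - s + 1 - t * l} = isoV ` {..<n - s + 1 - t * l}" by auto
    then show ?thesis using fI by (simp add: image_image h bij_betw_def)
  qed
  have imR: "h ` cand_rest s t n l = V - K"
  proof -
    have "h ` cand_rest s t n l = (\<Union>i<l. h ` cand_block t i) \<union> I"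
      unfolding cand_rest_def image_Un imI by blast
    also have "(\<Union>i<l. h ` cand_block t i) = ?Bl" using imB by simp
    finally show ?thesis using card_blocks(2) by (auto simp: I_def)
  qed
  have imV: "pverts G = h ` pverts ?C" unfolding pverts_cand image_Un imK imR G using KV by blast
  have "card (pverts ?C) = card V"
  proof -
    have "card (pverts ?C) = (s - 1) + (n - s + 1)"
      unfolding pverts_cand using cand_hubs_rest[of s t n l] card_cand_hubs card_cand_rest[OF tl]
      by (simp add: card_Un_disjoint)
    then show ?thesis using n s2 by simp
  qed
  \<comment> \<open>A surjection between finite sets of equal size is injective, so overlaps between
    the pieces of \<open>h\<close> need not be examined.\<close>
  then have inj: "inj_on h (pverts ?C)"
    using imV G pair_graph_cand[OF tl] by (intro eq_card_imp_inj_on) (auto simp: pair_graph_def pair_digraph_def pair_fin_digraph_def pair_fin_digraph_axioms_def)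
  have arcs: "parcs G = map_prod h h ` parcs ?C"
  proof -
    have blk: "map_prod h h ` {(blockV i j, blockV i j') | j j'. j < t \<and> j' < t \<and> j \<noteq> j'}
        = {(u, v). u \<in> B i \<and> v \<in> B i \<and> u \<noteq> v}" if i: "i < l" for i
    proof (intro equalityI subrelI)
      fix u v assume "(u, v) \<in> map_prod h h ` {(blockV i j, blockV i j') | j j'. j < t \<and> j' < t \<and> j \<noteq> j'}"
      then obtain j j' where j: "u = fB i j" "v = fB i j'" "j < t" "j' < t" "j \<noteq> j'" by (auto simp: h)
      have "u \<in> B i" "v \<in> B i" using fB[OF i] j by (auto simp: bij_betw_def)
      moreover have "u \<noteq> v" using fB[OF i] j by (auto simp: bij_betw_def inj_on_def)
      ultimately show "(u, v) \<in> {(u, v). u \<in> B i \<and> v \<in> B i \<and> u \<noteq> v}" by blast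
    next
      fix u v assume "(u, v) \<in> {(u, v). u \<in> B i \<and> v \<in> B i \<and> u \<noteq> v}"
      then have uv: "u \<in> fB i ` {..<t}" "v \<in> fB i ` {..<t}" "u \<noteq> v" using fB[OF i] by (auto simp: bij_betw_def)
      then obtain j j' where j: "j < t" "j' < t" "u = fB i j" "v = fB i j'" by auto
      then have "j \<noteq> j'" using uv(3) by blast
      then have "(blockV i j, blockV i j') \<in> {(blockV i j, blockV i j') | j j'. j < t \<and> j' < t \<and> j \<noteq> j'}"
        using j by blast
      then have "map_prod h h (blockV i j, blockV i j') \<in> map_prod h h ` {(blockV i j, blockV i j') | j j'. j < t \<and> j' < t \<and> j \<noteq> j'}"
        by (rule imageI)
      then show "(u, v) \<in> map_prod h h ` {(blockV i j, blockV i j') | j j'. j < t \<and> j' < t \<and> j \<noteq> j'}"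
        using j by (simp add: h)
    qed
    have prod: "map_prod h h ` (X \<times> Y) = (h ` X) \<times> (h ` Y)" for X Y
      by (rule map_prod_surj_on[symmetric, THEN sym]) auto
    have "map_prod h h ` parcs ?C = (\<Union>i<l. {(u, v). u \<in> B i \<and> v \<in> B i \<and> u \<noteq> v}) \<union> K \<times> (V - K) \<union> (V - K) \<times> K"
      unfolding parcs_cand image_Un image_UN prod imK imR using blk by simp
    also have "\<dots> = E"
    proof (intro equalityI subrelI)
      fix u v assume "(u, v) \<in> (\<Union>i<l. {(u, v). u \<in> B i \<and> v \<in> B i \<and> u \<noteq> v}) \<union> K \<times> (V - K) \<union> (V - K) \<times> K"
      then consider i where "i < l" "u \<in> B i" "v \<in> B i" "u \<noteq> v" | "u \<in> K" "v \<in> V - K" | "u \<in> V - K" "v \<in> K"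
        by blast
      then show "(u, v) \<in> E"
      proof cases
        case 1
        then have "u \<in> V - K" "v \<in> V - K" using B_sub by blast+
        then show ?thesis using B_edges[of u v] 1 by blast
      next
        case 2 then show ?thesis by (rule complete)
      next
        case 3 then show ?thesis using complete[of v u] edge_sym by blast
      qed
    next
      fix u v assume uv: "(u, v) \<in> E"
      then have V: "u \<in> V" "v \<in> V" using edge_verts by auto
      have "\<not> (u \<in> K \<and> v \<in> K)" using empty uv by blast
      moreover have "\<exists>i<l. u \<in> B i \<and> v \<in> B i \<and> u \<noteq> v" if "u \<notin> K" "v \<notin> K"
        using B_edges[of u v] V that uv by blast
      ultimately show "(u, v) \<in> (\<Union>i<l. {(u, v). u \<in> B i \<and> v \<in> B i \<and> u \<noteq> v}) \<union> K \<times> (V - K) \<union> (V - K) \<times> K"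
        using V by blast
    qed
    finally show ?thesis by (simp add: G(2))
  qed
  have "pair_wf_digraph ?C" using pair_graph_cand[OF tl] by (simp add: pair_graph_def pair_digraph_def pair_fin_digraph_def)
  then show "digraph_iso (with_proj ?C) (with_proj G)"
    using digraph_iso_with_proj_iff[of ?C G] inj imV arcs by blast
qed

end

lemma clique_hub_graph_if_iso:
  fixes G :: "'a pair_pre_digraph"
  assumes iso: "digraph_iso (with_proj (extremal_candidate s t n l)) (with_proj G)"
    and tl: "t * l \<le> n - s + 1" and s: "2 \<le> s" "s \<le> t" "s \<le> n"
  shows "\<exists>K B. clique_hub_graph (pverts G) (parcs G) s t l K B" "card (pverts G) = n"
proof -
  let ?C = "extremal_candidate s t n l"
  interpret C: pair_graph ?C using pair_graph_cand[OF tl] .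
  obtain h where h: "inj_on h (pverts ?C)" "pverts G = h ` pverts ?C" "parcs G = map_prod h h ` parcs ?C"
    using iso digraph_iso_with_proj_iff[OF C.pair_wf_digraph_axioms] by metis
  have cC: "card (pverts ?C) = n"
    unfolding pverts_cand using cand_hubs_rest[of s t n l] card_cand_hubs card_cand_rest[OF tl] s
    by (simp add: card_Un_disjoint)
  then show "card (pverts G) = n" using h by (simp add: card_image)
  have arc: "(h a, h b) \<in> parcs G \<longleftrightarrow> (a, b) \<in> parcs ?C" if ab: "a \<in> pverts ?C" "b \<in> pverts ?C" for a b
  proof
    assume "(h a, h b) \<in> parcs G"
    then obtain a' b' where a': "(a', b') \<in> parcs ?C" "h a = h a'" "h b = h b'" by (auto simp: h(3))
    have "a = a'" using inj_onD[OF h(1) a'(2) ab(1)] C.in_arcsD1[OF a'(1)] by simp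
    moreover have "b = b'" using inj_onD[OF h(1) a'(3) ab(2)] C.in_arcsD2[OF a'(1)] by simp
    ultimately show "(a, b) \<in> parcs ?C" using a'(1) by simp
  next
    assume "(a, b) \<in> parcs ?C"
    then show "(h a, h b) \<in> parcs G" unfolding h(3) by force
  qed
  define K B where "K = h ` cand_hubs s" and "B = (\<lambda>i. h ` cand_block t i)"
  have hubs: "cand_hubs s \<subseteq> pverts ?C" and rest: "cand_rest s t n l \<subseteq> pverts ?C" by (auto simp: pverts_cand)
  have blk: "cand_block t i \<subseteq> cand_rest s t n l" if "i < l" for i using that by (auto simp: cand_rest_def)
  have VK: "pverts G - K = h ` cand_rest s t n l"
  proof -
    have "h ` pverts ?C - h ` cand_hubs s = h ` (pverts ?C - cand_hubs s)"
      using inj_on_image_set_diff[OF h(1), of "pverts ?C" "cand_hubs s"] hubs by simp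
    moreover have "pverts ?C - cand_hubs s = cand_rest s t n l"
      using cand_hubs_rest[of s t n l] by (auto simp: pverts_cand)
    ultimately show ?thesis by (simp add: h(2) K_def)
  qed
  have G: "parcs G \<subseteq> pverts G \<times> pverts G" "sym (parcs G)" "irrefl (parcs G)"
  proof -
    show "parcs G \<subseteq> pverts G \<times> pverts G" using C.in_arcsD1 C.in_arcsD2 by (auto simp: h(2,3))
    have "sym (parcs ?C)" using C.pair_sym_arcs by (simp add: symmetric_def)
    then show "sym (parcs G)" unfolding h(3) sym_def by force
    show "irrefl (parcs G)" unfolding irrefl_def
    proof (intro allI notI)
      fix v assume "(v, v) \<in> parcs G"
      then obtain a b where ab: "(a, b) \<in> parcs ?C" "h a = v" "h b = v" by (auto simp: h(3))
      have "a = b" using inj_onD[OF h(1), of a b] ab C.in_arcsD1[OF ab(1)] C.in_arcsD2[OF ab(1)] by simp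
      then show False using C.pair_no_loops[OF ab(1)] by simp
    qed
  qed
  have "clique_hub_graph (pverts G) (parcs G) s t l K B"
  proof (unfold_locales)
    show "finite (pverts G)" using C.pair_finite_verts by (simp add: h(2))
    show "K \<subseteq> pverts G" using hubs by (auto simp: K_def h(2))
    show "card K = s - 1" unfolding K_def using inj_on_subset[OF h(1) hubs] by (simp add: card_image card_cand_hubs)
    show "(k, u) \<in> parcs G" if "k \<in> K" "u \<in> pverts G - K" for k u
    proof -
      have "k \<in> h ` cand_hubs s" using that(1) by (simp add: K_def)
      moreover have "u \<in> h ` cand_rest s t n l" using that(2) by (simp only: VK)
      ultimately obtain a b where "a \<in> cand_hubs s" "b \<in> cand_rest s t n l" "k = h a" "u = h b"
        by blast
      then show ?thesis using arc[of a b] hubs rest by (auto simp: parcs_cand)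
    qed
    show "parcs G \<inter> K \<times> K = {}"
    proof -
      have "(h a, h b) \<notin> parcs G" if "a \<in> cand_hubs s" "b \<in> cand_hubs s" for a b
        using arc[of a b] that hubs cand_hubs_rest[of s t n l] by (auto simp: parcs_cand cand_hubs_def)
      then show ?thesis by (auto simp: K_def)
    qed
    show "B i \<subseteq> pverts G - K" if "i < l" for i unfolding VK B_def using blk[OF that] by blast
    show "card (B i) = t" if "i < l" for i
      unfolding B_def using inj_on_subset[OF h(1) subset_trans[OF blk[OF that] rest]]
      by (simp add: card_image card_cand_block)
    show "B i \<inter> B j = {}" if "i < l" "j < l" "i \<noteq> j" for i j
    proof -
      have "cand_block t i \<inter> cand_block t j = {}" using that by (auto simp: cand_block_def)
      moreover have "cand_block t i \<subseteq> pverts ?C" "cand_block t j \<subseteq> pverts ?C" using blk that rest by blast+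
      ultimately show ?thesis unfolding B_def using inj_on_image_Int[OF h(1)] by (metis image_empty)
    qed
    show "(u, v) \<in> parcs G \<longleftrightarrow> u \<noteq> v \<and> (\<exists>i<l. u \<in> B i \<and> v \<in> B i)" if uv: "u \<in> pverts G - K" "v \<in> pverts G - K" for u v
    proof -
      obtain a b where ab: "a \<in> cand_rest s t n l" "b \<in> cand_rest s t n l" "u = h a" "v = h b"
        using uv unfolding VK by blast
      have abC: "a \<in> pverts ?C" "b \<in> pverts ?C" using ab rest by auto
      have inB: "h c \<in> B i \<longleftrightarrow> c \<in> cand_block t i" if "i < l" "c \<in> pverts ?C" for c i
        unfolding B_def using inj_on_image_mem_iff[OF h(1) that(2)] blk[OF that(1)] rest by (meson subset_trans)
      have "(a, b) \<in> parcs ?C \<longleftrightarrow> a \<noteq> b \<and> (\<exists>i<l. a \<in> cand_block t i \<and> b \<in> cand_block t i)"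
        using ab(1,2) cand_hubs_rest[of s t n l] unfolding parcs_cand by (auto simp: cand_block_def)
      moreover have "u = v \<longleftrightarrow> a = b" using inj_onD[OF h(1), of a b] abC ab by auto
      ultimately show ?thesis using arc[OF abC] inB abC ab(3,4) by auto
    qed
  qed (use G s in auto)
  then show "\<exists>K B. clique_hub_graph (pverts G) (parcs G) s t l K B" by blast
qed

context hub_complete
begin

text \<open>By \<open>nbrs_are_twins\<close> the closed neighbourhoods of the non-isolated vertices
  are equal or disjoint; listed without repetition they are the blocks.\<close>

lemma clique_hub_graph_exists:
  assumes empty: "E \<inter> K \<times> K = {}"
  shows "\<exists>l B. clique_hub_graph V E s t l K B"
proof -
  define NI where "NI = {u \<in> V - K. nb u \<noteq> {}}"
  define Bl where "Bl = (\<lambda>u. insert u (nb u)) ` NI"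
  have finNI: "finite NI" using finV by (simp add: NI_def)
  then have finBl: "finite Bl" by (simp add: Bl_def)
  have mem: "insert w (nb w) = insert u (nb u) \<and> w \<in> NI" if u: "u \<in> NI" and w: "w \<in> insert u (nb u)" for u w
  proof (cases "w = u")
    case False
    then have wn: "w \<in> nb u" using w by blast
    have uU: "u \<in> V - K" using u by (simp add: NI_def)
    have "u \<in> nb w" using nb_sym[OF uU wn] .
    then show ?thesis using nbrs_are_twins[OF uU wn] wn nb_sub by (auto simp: NI_def)
  qed (use u in simp)
  define l where "l = card Bl"
  obtain B where B: "bij_betw B {..<l} Bl"
    using ex_bij_betw_nat_finite[OF finBl] by (auto simp: l_def lessThan_atLeast0)
  have BE: "\<exists>u\<in>NI. B i = insert u (nb u)" if "i < l" for i
  proof -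
    have "B i \<in> Bl" using bij_betwE[OF B] that by blast
    then show ?thesis by (auto simp: Bl_def)
  qed
  have Bin: "\<exists>i<l. B i = insert u (nb u)" if "u \<in> NI" for u
  proof -
    have "insert u (nb u) \<in> B ` {..<l}" using B that by (auto simp: bij_betw_def Bl_def)
    then show ?thesis by auto
  qed
  have "clique_hub_graph V E s t l K B"
  proof (unfold_locales)
    show "B i \<subseteq> V - K" if i: "i < l" for i
    proof -
      obtain u where u: "u \<in> NI" "B i = insert u (nb u)" using BE[OF i] by blast
      then show ?thesis using nb_sub[of u] by (auto simp: NI_def)
    qed
    show "card (B i) = t" if i: "i < l" for i
    proof -
      obtain u where u: "u \<in> NI" "B i = insert u (nb u)" using BE[OF i] by blast
      then obtain v where "v \<in> nb u" by (auto simp: NI_def)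
      then have "card (nb u) = t - 1" using card_nb[of u v] u by (simp add: NI_def)
      then show ?thesis using u nb_irr[of u] fin_nb[of u] st s2 by simp
    qed
    show "B i \<inter> B j = {}" if ij: "i < l" "j < l" "i \<noteq> j" for i j
    proof (rule ccontr)
      assume "B i \<inter> B j \<noteq> {}"
      then obtain w where w: "w \<in> B i" "w \<in> B j" by blast
      obtain u where u: "u \<in> NI" "B i = insert u (nb u)" using BE[OF ij(1)] by blast
      obtain v where v: "v \<in> NI" "B j = insert v (nb v)" using BE[OF ij(2)] by blast
      have "B i = B j" using mem[OF u(1), of w] mem[OF v(1), of w] w u(2) v(2) by metis
      then show False using B ij by (auto simp: bij_betw_def dest: inj_onD)
    qed
    show "(u, v) \<in> E \<longleftrightarrow> u \<noteq> v \<and> (\<exists>i<l. u \<in> B i \<and> v \<in> B i)" if uv: "u \<in> V - K" "v \<in> V - K" for u v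
    proof
      assume e: "(u, v) \<in> E"
      then have vn: "v \<in> nb u" using uv by (simp add: nb_def)
      then have "u \<in> NI" using uv by (auto simp: NI_def)
      then obtain i where "i < l" "B i = insert u (nb u)" using Bin by blast
      then show "u \<noteq> v \<and> (\<exists>i<l. u \<in> B i \<and> v \<in> B i)" using vn edge_neq[OF e] by blast
    next
      assume "u \<noteq> v \<and> (\<exists>i<l. u \<in> B i \<and> v \<in> B i)"
      then obtain i where i: "i < l" "u \<in> B i" "v \<in> B i" "u \<noteq> v" by blast
      obtain w where w: "w \<in> NI" "B i = insert w (nb w)" using BE[OF i(1)] by blast
      have "insert u (nb u) = insert w (nb w)" using mem[OF w(1), of u] i w by metis
      then have "v \<in> insert u (nb u)" using i(3) w(2) by simp
      then have "v \<in> nb u" using i(4) by simp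
      then show "(u, v) \<in> E" by (simp add: nb_def)
    qed
  qed (use KV cardK s2 st complete empty in auto)
  then show ?thesis by blast
qed

end

section \<open>The optimal number of cliques\<close>

lemma is_spread_cong:
  assumes "\<And>i j. i \<in> V \<Longrightarrow> j \<in> V \<Longrightarrow> M i j = M' i j" and "is_spread V M p q x z"
  shows "is_spread V M' p q x z"
proof -
  have "qform V M y = qform V M' y" for y using assms(1) by (intro qform_cong) auto
  moreover have "(\<Sum>j\<in>V. M i j * y j) = (\<Sum>j\<in>V. M' i j * y j)" if "i \<in> V" for i y
    using assms(1) that by (intro sum.cong) auto
  ultimately show ?thesis using assms(2) unfolding is_spread_def by simp
qed

text \<open>The situation after \<open>extremal_structure\<close>: every vertex outside
  \<open>K\<close> has weight 1, the hub matrix is the adjacency matrix itself, and the exact cubic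
  is available.\<close>

locale full_hubs = biclique_free +
  fixes K :: "'a set"
  assumes KV: "K \<subseteq> V" and cardK: "card K = s - 1" and s2: "2 \<le> s" and st: "s \<le> t"
    and complete: "\<And>k u. k \<in> K \<Longrightarrow> u \<in> V - K \<Longrightarrow> (k, u) \<in> E"
    and empty: "E \<inter> K \<times> K = {}"
    and large: "s \<le> card V"
begin

lemma finK': "finite K" using KV finV by (rule finite_subset)

sublocale H: hub_graph K "V - K" E "\<lambda>_. 1" s t
proof
  fix u assume u: "u \<in> V - K"
  have "card {w \<in> V. \<forall>a\<in>insert u K. (a, w) \<in> E} < t"
    using u KV cardK s2 finK' by (intro few_common_nbrs) auto
  moreover have "card (E `` {u} \<inter> (V - K)) \<le> card {w \<in> V. \<forall>a\<in>insert u K. (a, w) \<in> E}"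
    using finV complete by (intro card_mono) auto
  ultimately show "card (E `` {u} \<inter> (V - K)) \<le> t - 1" by linarith
qed (use finV finK' E_sym E_irr cardK s2 st in auto)

definition N :: real where "N = real (card V) - real s + 1"

lemma card_rest: "real (card (V - K)) = N"
  using KV finK' cardK s2 large by (simp add: card_Diff_subset card_mono finV N_def of_nat_diff)

lemma weight_eq: "H.weight = N"
  using card_rest by (simp add: H.weight_def)

lemma N1: "N \<ge> 1" using large by (simp add: N_def)

lemma KU: "K \<union> (V - K) = V" using KV by blast

lemma hubmat_eq: "i \<in> V \<Longrightarrow> j \<in> V \<Longrightarrow> H.hubmat i j = adj E i j"
  using complete edge_sym by (auto simp: H.hubmat_def adj_def)

lemma dK_0: assumes "k \<in> K" shows "H.dK k = 0"
proof -
  have "E `` {k} \<inter> K = {}" using assms empty by blast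
  then show ?thesis unfolding H.dK_def using H.sum_adj_eq_card[OF finK', of k] by simp
qed

lemma fine:
  assumes sp: "is_spread V (adj E) p q x z" and l: "exp_threshold H.m H.T \<le> sqrt (H.m * N)"
    and pq: "2 * sqrt (H.m * N) \<le> p + q"
  defines "D \<equiv> (\<Sum>u\<in>V - K. H.dU u * (H.T - H.dU u))"
  shows "p > 0" "q > 0" "(p + q)\<^sup>2 \<le> 4 * (H.m * N) + 4 / 3 * H.T\<^sup>2 - 2 * H.m * D / (p * q)"
    and "D = 0 \<Longrightarrow> \<exists>d. (p + q)\<^sup>2 = 4 * (H.m * N) + 4 / 3 * H.T\<^sup>2 - 3 * d\<^sup>2 \<and>
      H.m * H.a1 = 2 / 3 * (H.m * H.T * N) - 2 / 27 * H.T ^ 3 - (H.m * N + H.T\<^sup>2 / 3) * d + d ^ 3"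
proof -
  have sp': "is_spread (K \<union> (V - K)) H.hubmat p q x z"
    unfolding KU by (rule is_spread_cong[OF _ sp]) (simp add: hubmat_eq)
  have w: "H.weight > 0" using weight_eq N1 by simp
  note f = H.fine_bound[OF sp' w, unfolded weight_eq, OF l pq dK_0]
  show "p > 0" "q > 0" "(p + q)\<^sup>2 \<le> 4 * (H.m * N) + 4 / 3 * H.T\<^sup>2 - 2 * H.m * D / (p * q)"
    "D = 0 \<Longrightarrow> \<exists>d. (p + q)\<^sup>2 = 4 * (H.m * N) + 4 / 3 * H.T\<^sup>2 - 3 * d\<^sup>2 \<and>
      H.m * H.a1 = 2 / 3 * (H.m * H.T * N) - 2 / 27 * H.T ^ 3 - (H.m * N + H.T\<^sup>2 / 3) * d + d ^ 3"
    unfolding D_def using f by blast+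
qed

text \<open>Test vectors constant on \<open>K\<close> and on \<open>V - K\<close> with half of the
  mass on each, the sign on \<open>V - K\<close> deciding the end. Edges outside \<open>K\<close>
  raise the top and the bottom value equally, so they cancel in the spread.\<close>

lemma spread_lower:
  assumes sp: "is_spread V (adj E) p q x z"
  shows "2 * sqrt (H.m * N) \<le> p + q"
proof -
  note sp' = sp[unfolded is_spread_def]
  let ?m = "H.m"
  have m0: "?m > 0" using H.m1 by simp
  have N0: "N > 0" using N1 by simp
  define a b where "a = 1 / sqrt (2 * ?m)" and "b = 1 / sqrt (2 * N)"
  have a2: "a\<^sup>2 = 1 / (2 * ?m)" and b2: "b\<^sup>2 = 1 / (2 * N)"
    using m0 N0 by (simp_all add: a_def b_def power_divide)
  have ab: "2 * (N * (b * (?m * a))) = sqrt (?m * N)"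
  proof -
    have "sqrt (2 * ?m) * sqrt (2 * N) = 2 * sqrt (?m * N)"
    proof -
      have "sqrt (2 * ?m) * sqrt (2 * N) = sqrt (4 * (?m * N))"
        unfolding real_sqrt_mult[symmetric] by (simp add: mult_ac)
      also have "\<dots> = 2 * sqrt (?m * N)" by (simp only: real_sqrt_mult) simp
      finally show ?thesis .
    qed
    then have "a * b = 1 / (2 * sqrt (?m * N))" by (simp add: a_def b_def)
    moreover have "2 * (N * (b * (?m * a))) = (2 * (?m * N)) * (a * b)" by (simp only: mult_ac)
    ultimately have "2 * (N * (b * (?m * a))) = (?m * N) / sqrt (?m * N)" by simp
    also have "\<dots> = sqrt (?m * N)" using m0 N0 by (simp add: real_div_sqrt)
    finally show ?thesis .
  qed
  define y where "y = (\<lambda>e v. if v \<in> K then a else e * b :: real)"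
  have VV: "(V - K) \<union> K = V" using KV by blast
  have main: "sqnorm V (y e) = 1" "qform V (adj E) (y e) = b\<^sup>2 * H.a1 + e * sqrt (?m * N)"
    if e: "e = 1 \<or> e = - 1" for e
  proof -
    have e2: "e * e = 1" using e by auto
    have "sqnorm ((V - K) \<union> K) (y e) = sqnorm (V - K) (y e) + sqnorm K (y e)"
      using finV finK' by (intro sqnorm_Un_disjoint) auto
    also have "sqnorm (V - K) (y e) = (\<Sum>v\<in>V - K. b\<^sup>2)"
      unfolding sqnorm_def by (intro sum.cong) (auto simp: y_def power_mult_distrib power2_eq_square e2)
    also have "sqnorm K (y e) = (\<Sum>v\<in>K. a\<^sup>2)"
      unfolding sqnorm_def by (intro sum.cong) (auto simp: y_def)
    finally have "sqnorm V (y e) = N * b\<^sup>2 + ?m * a\<^sup>2"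
      unfolding VV by (simp add: card_rest H.card_K)
    moreover have half: "c * (1 / (2 * c)) = 1 / 2" if "c > 0" for c :: real using that by simp
    have "N * b\<^sup>2 = 1 / 2" "?m * a\<^sup>2 = 1 / 2" unfolding a2 b2 using half[OF N0] half[OF m0] .
    ultimately show "sqnorm V (y e) = 1" by (metis field_sum_of_halves)
    have "qform ((V - K) \<union> K) (adj E) (y e) = qform (V - K) (adj E) (y e) + qform K (adj E) (y e)
        + 2 * (\<Sum>u\<in>V - K. y e u * (\<Sum>k\<in>K. adj E u k * y e k))"
      by (rule qform_Un_disjoint) (use finV finK' adj_sym in auto)
    also have "qform K (adj E) (y e) = 0"
      unfolding qform_def using empty by (intro sum.neutral ballI) (auto simp: adj_def)
    also have "qform (V - K) (adj E) (y e) = b\<^sup>2 * H.a1"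
    proof -
      have "qform (V - K) (adj E) (y e) = (\<Sum>u\<in>V - K. \<Sum>v\<in>V - K. b\<^sup>2 * adj E u v)"
        unfolding qform_def using e by (intro sum.cong HOL.refl) (auto simp: y_def power2_eq_square)
      then show ?thesis by (simp add: H.a1_def H.dU_def sum_distrib_left)
    qed
    also have "(\<Sum>u\<in>V - K. y e u * (\<Sum>k\<in>K. adj E u k * y e k)) = (\<Sum>u\<in>V - K. e * b * (?m * a))"
    proof (intro sum.cong arg_cong2[of _ _ _ _ "(*)"])
      fix u assume u: "u \<in> V - K"
      have "(\<Sum>k\<in>K. adj E u k * y e k) = (\<Sum>k\<in>K. a)"
        using complete[OF _ u] edge_sym by (intro sum.cong) (auto simp: adj_def y_def)
      then show "(\<Sum>k\<in>K. adj E u k * y e k) = ?m * a" by (simp add: H.card_K)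
    qed (auto simp: y_def)
    also have "2 * (\<Sum>u\<in>V - K. e * b * (?m * a)) = e * (2 * (N * (b * (?m * a))))"
      by (simp add: card_rest)
    finally show "qform V (adj E) (y e) = b\<^sup>2 * H.a1 + e * sqrt (?m * N)" unfolding VV ab by simp
  qed
  have "b\<^sup>2 * H.a1 + sqrt (?m * N) \<le> p" using main[of 1] sp' by (metis mult.right_neutral mult_1)
  moreover have "- (b\<^sup>2 * H.a1 - sqrt (?m * N)) \<le> q"
  proof -
    have "- qform V (adj E) (y (- 1)) \<le> q * sqnorm V (y (- 1))" using sp' by blast
    then show ?thesis using main[of "- 1"] by simp
  qed
  ultimately show ?thesis by linarith
qed

end

section \<open>Translation to families of graphs and nearest integers\<close>

lemma simple_graph_if_pair_graph: "pair_graph G \<Longrightarrow> simple_graph (pverts G) (parcs G)"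
proof -
  assume "pair_graph G"
  then interpret pair_graph G .
  show ?thesis
    using pair_finite_verts in_arcsD1 in_arcsD2 pair_sym_arcs
    by unfold_locales (auto simp: symmetric_def irrefl_def dest: pair_no_loops)
qed

lemma pair_graph_if_simple_graph: "simple_graph (pverts G) (parcs G) \<Longrightarrow> pair_graph G"
proof -
  assume "simple_graph (pverts G) (parcs G)"
  then interpret simple_graph "pverts G" "parcs G" .
  show ?thesis
  proof unfold_locales
    show "finite (parcs G)" using E_sub finV by (meson finite_SigmaI finite_subset)
    show "symmetric (with_proj G)" using E_sym by (simp add: symmetric_def)
  qed (use finV edge_verts edge_neq in auto)
qed

lemma in_family_iff: "in_family s t n G \<longleftrightarrow> pverts G = {..<n} \<and> biclique_free (pverts G) (parcs G) s t"
proof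
  assume f: "in_family s t n G"
  then have pg: "pair_graph G" by (simp add: in_family_def)
  have "\<not> biclique_model s t (pverts G) (parcs G) \<X> \<Y>" for \<X> \<Y>
    using not_minor_free_if_biclique_model[OF pg] f by (auto simp: in_family_def)
  then show "pverts G = {..<n} \<and> biclique_free (pverts G) (parcs G) s t"
    using simple_graph_if_pair_graph[OF pg] f
    by (simp add: biclique_free_def biclique_free_axioms_def in_family_def)
next
  assume f: "pverts G = {..<n} \<and> biclique_free (pverts G) (parcs G) s t"
  then have "simple_graph (pverts G) (parcs G)" using biclique_free.axioms(1) by blast
  then have "pair_graph G" by (rule pair_graph_if_simple_graph)
  moreover have "biclique_minor_free s t G"
    using biclique_model_if_minor[OF \<open>pair_graph G\<close>] f unfolding biclique_free_def biclique_free_axioms_def by blast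
  ultimately show "in_family s t n G" using f by (simp add: in_family_def)
qed

lemma spread_exists:
  assumes "pair_graph G" "pverts G = {..<n}" "n > 0"
  obtains p q x z where "is_spread (pverts G) (adj (parcs G)) p q x z" "spread G = p + q"
proof -
  interpret simple_graph "pverts G" "parcs G" using assms(1) by (rule simple_graph_if_pair_graph)
  have ne: "pverts G \<noteq> {}" using assms by auto
  have sy: "\<And>i j. i \<in> pverts G \<Longrightarrow> j \<in> pverts G \<Longrightarrow> adj (parcs G) i j = adj (parcs G) j i" by (rule adj_sym)
  obtain p q x z where sp: "is_spread (pverts G) (adj (parcs G)) p q x z"
    using is_spread_exists[where V = "pverts G" and A = "adj (parcs G)", OF finV ne sy] by blast
  then have "spread G = p + q" using spread_eq[of G n p q x z] assms by simp
  then show ?thesis using that sp by blast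
qed

lemma nearest_integer_iff: "nearest_integer x l \<longleftrightarrow> \<bar>x - of_int l\<bar> \<le> 1 / 2"
proof
  assume "nearest_integer x l"
  then have "\<not> \<bar>x - of_int (round x)\<bar> < \<bar>x - of_int l\<bar>" by (auto simp: nearest_integer_def is_arg_min_def)
  then show "\<bar>x - of_int l\<bar> \<le> 1 / 2" using of_int_round_abs_le[of x] by linarith
next
  assume l: "\<bar>x - of_int l\<bar> \<le> 1 / 2"
  have "\<not> \<bar>x - of_int k\<bar> < \<bar>x - of_int l\<bar>" for k :: int
  proof
    assume k: "\<bar>x - of_int k\<bar> < \<bar>x - of_int l\<bar>"
    then have "\<bar>real_of_int l - of_int k\<bar> < 1" using l by linarith
    then have "\<bar>l - k\<bar> < 1" by linarith
    then show False using k by simp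
  qed
  then show "nearest_integer x l" by (simp add: nearest_integer_def is_arg_min_def)
qed

lemma nearest_integer_same_dist:
  "nearest_integer x l \<Longrightarrow> nearest_integer x k \<Longrightarrow> \<bar>x - of_int l\<bar> = \<bar>x - of_int k\<bar>"
  unfolding nearest_integer_def is_arg_min_def by (meson linorder_neqE)

text \<open>On \<open>[0, R]\<close> the function \<open>A u - u^3\<close> is strictly increasing
  because \<open>3 R^2 < A\<close>, and it is odd. Hence distance to \<open>ell1\<close> and size of
  the offset order candidates in the same way.\<close>

lemma odd_cubic_abs_le_iff:
  fixes A R a b :: real
  assumes A: "3 * R\<^sup>2 < A" and ab: "\<bar>a\<bar> \<le> R" "\<bar>b\<bar> \<le> R"
  shows "\<bar>a ^ 3 - A * a\<bar> \<le> \<bar>b ^ 3 - A * b\<bar> \<longleftrightarrow> \<bar>a\<bar> \<le> \<bar>b\<bar>"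
proof -
  have pos: "0 < A - (u\<^sup>2 + u * v + v\<^sup>2)" if "0 \<le> u" "u \<le> R" "0 \<le> v" "v \<le> R" for u v
  proof -
    have "u * u \<le> R * R" "u * v \<le> R * R" "v * v \<le> R * R" using that by (auto intro!: mult_mono)
    then show ?thesis using A by (simp add: power2_eq_square)
  qed
  have sq: "u\<^sup>2 \<le> A" if "\<bar>u\<bar> \<le> R" for u
  proof -
    have "u\<^sup>2 \<le> R\<^sup>2" using that by (metis abs_ge_zero power2_abs power_mono)
    moreover have "0 \<le> R\<^sup>2" by simp
    ultimately show ?thesis using A by linarith
  qed
  have abs_eq: "\<bar>u ^ 3 - A * u\<bar> = A * \<bar>u\<bar> - \<bar>u\<bar> ^ 3" if "\<bar>u\<bar> \<le> R" for u
  proof -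
    have "u ^ 3 - A * u = - (u * (A - u\<^sup>2))" by (simp add: power3_eq_cube power2_eq_square algebra_simps)
    then have "\<bar>u ^ 3 - A * u\<bar> = \<bar>u\<bar> * (A - u\<^sup>2)" using sq[OF that] by (simp add: abs_mult)
    also have "\<dots> = A * \<bar>u\<bar> - \<bar>u\<bar> ^ 3"
      by (simp add: right_diff_distrib power3_eq_cube power2_eq_square)
    finally show ?thesis .
  qed
  have mono: "A * u - u ^ 3 < A * v - v ^ 3" if "0 \<le> u" "u < v" "v \<le> R" for u v
  proof -
    have "(A * v - v ^ 3) - (A * u - u ^ 3) = (v - u) * (A - (u\<^sup>2 + u * v + v\<^sup>2))"
      by (simp add: power3_eq_cube power2_eq_square algebra_simps)
    also have "\<dots> > 0" using pos[of u v] that by simp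
    finally show ?thesis by simp
  qed
  show ?thesis
    unfolding abs_eq[OF ab(1)] abs_eq[OF ab(2)]
    using mono[of "\<bar>a\<bar>" "\<bar>b\<bar>"] mono[of "\<bar>b\<bar>" "\<bar>a\<bar>"] ab by (metis abs_ge_zero less_eq_real_def not_less)
qed

text \<open>For small \<open>a\<close> the factor \<open>A - a^2\<close> is at least
  \<open>A / 2\<close>, so the cubic controls \<open>a\<close> linearly.\<close>

lemma odd_cubic_small:
  fixes A R a h :: real
  assumes A: "2 * R\<^sup>2 \<le> A" "A > 0" and a: "\<bar>a\<bar> \<le> R"
  shows "\<bar>a\<bar> \<le> 2 * \<bar>a ^ 3 - A * a\<bar> / A"
proof -
  have "a\<^sup>2 \<le> R\<^sup>2" using a by (metis abs_ge_zero power2_abs power_mono)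
  then have half: "A / 2 \<le> A - a\<^sup>2" using A by (simp add: field_simps)
  have "u ^ 3 - A * u = - (u * (A - u\<^sup>2))" for u by (simp add: power3_eq_cube power2_eq_square algebra_simps)
  then have "\<bar>a ^ 3 - A * a\<bar> = \<bar>a\<bar> * \<bar>A - a\<^sup>2\<bar>" by (simp add: abs_mult)
  moreover have "A / 2 \<le> \<bar>A - a\<^sup>2\<bar>" using half by (rule order_trans) simp
  then have "\<bar>a\<bar> * (A / 2) \<le> \<bar>a\<bar> * \<bar>A - a\<^sup>2\<bar>" by (intro mult_left_mono) auto
  ultimately have "\<bar>a\<bar> * A \<le> 2 * \<bar>a ^ 3 - A * a\<bar>" by simp
  then show ?thesis using A(2) by (simp add: pos_le_divide_eq)
qed

text \<open>\<open>big1\<close> makes the eigenvalue analysis applicable and \<open>big2\<close>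
  keeps the nearest candidates within the deficit \<open>eta\<close>. \<open>big3\<close> makes
  their loss smaller than \<open>1 / N\<close>, lets them fit on \<open>n\<close> vertices and
  provides isolated vertices. The abbreviated quantities are fixed by equations so that they stay
  atomic in the arithmetic.\<close>

locale large_parameters =
  fixes s t n :: nat and eta :: real
  assumes s2: "2 \<le> s" and st: "s \<le> t" and sn: "s \<le> n" and eta: "eta > 0"
  fixes m T N A :: real
  assumes m_def: "m = real s - 1" and T_def: "T = real t - 1" and N_def: "N = real n - real s + 1"
    and A_def: "A = (real s - 1) * (real n - real s + 1) + (real t - 1)\<^sup>2 / 3"
    and big1: "exp_threshold m T \<le> sqrt (m * N)"
    and big2: "3 * T\<^sup>2 * (real t)\<^sup>2 / eta \<le> N"
    and big3: "3 * T\<^sup>2 * (real t)\<^sup>2 + 3 * T\<^sup>2 + 6 * real t + 3 * real s + 3 \<le> N"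
begin

lemma params: "m \<ge> 1" "T \<ge> 1" "real t = T + 1" "N \<ge> 3" "T\<^sup>2 \<ge> 1" "3 * T\<^sup>2 < N" "m * N \<ge> N" "m * N > 0"
proof -
  show m1: "m \<ge> 1" and T1: "T \<ge> 1" and "real t = T + 1" using s2 st by (auto simp: m_def T_def)
  show T2: "T\<^sup>2 \<ge> 1" using T1 by (simp add: one_le_power)
  have "3 \<le> N \<and> 3 * x < N" if "y + 3 * x + 6 * u + 3 * v + 3 \<le> N" "0 \<le> y" "0 \<le> x" "0 \<le> u" "0 \<le> v" for x y u v :: real
    using that by linarith
  from this[OF big3] have "3 \<le> N \<and> 3 * T\<^sup>2 < N" by simp
  then show N3: "N \<ge> 3" and "3 * T\<^sup>2 < N" by auto
  have "1 * N \<le> m * N" using m1 N3 by (intro mult_right_mono) auto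
  then show "m * N \<ge> N" by simp
  then show "m * N > 0" using N3 by linarith
qed

lemma N_lower: "3 * T\<^sup>2 * (real t)\<^sup>2 < N" "T\<^sup>2 + 2 * real t \<le> N" "real s \<le> N / 3 - 2 * real t - T\<^sup>2"
proof -
  have "y < N \<and> x + 2 * u \<le> N \<and> v \<le> N / 3 - 2 * u - x"
    if "y + 3 * x + 6 * u + 3 * v + 3 \<le> N" "0 \<le> y" "0 \<le> x" "0 \<le> u" "0 \<le> v" for x y u v :: real
  proof -
    have "3 * (v + 2 * u + x) \<le> N" using that(1,2) by (simp add: field_simps)
    then have "v + 2 * u + x \<le> N / 3" by simp
    moreover have "y < N" "x + 2 * u \<le> N" using that by linarith+
    ultimately show ?thesis by linarith
  qed
  from this[OF big3] show "3 * T\<^sup>2 * (real t)\<^sup>2 < N" "T\<^sup>2 + 2 * real t \<le> N" "real s \<le> N / 3 - 2 * real t - T\<^sup>2"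
    by simp_all
qed

lemma abs_scaled: "m * T * real t * (real l - ell1 s t n) = X \<Longrightarrow> \<bar>X\<bar> = (m * T * real t) * \<bar>ell1 s t n - real l\<bar>"
proof -
  assume X: "m * T * real t * (real l - ell1 s t n) = X"
  have "\<bar>X\<bar> = \<bar>m * T * real t\<bar> * \<bar>real l - ell1 s t n\<bar>" unfolding X[symmetric] by (rule abs_mult)
  also have "\<bar>m * T * real t\<bar> = m * T * real t" using params by simp
  finally show ?thesis by (simp only: abs_minus_commute)
qed

lemma A_eq: "A = m * N + T\<^sup>2 / 3" by (simp add: A_def m_def N_def T_def)

lemma A_big: "3 * T\<^sup>2 < A" "2 * T\<^sup>2 \<le> A" "A > 0" "A \<le> 2 * (m * N)" "m * N \<le> A"
proof -
  have *: "3 * x < y + x / 3 \<and> 2 * x \<le> y + x / 3 \<and> 0 < y + x / 3 \<and> y + x / 3 \<le> 2 * y \<and> y \<le> y + x / 3"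
    if "1 \<le> x" "3 * x < N" "N \<le> y" for x y :: real
    using that by (auto simp: field_simps)
  show "3 * T\<^sup>2 < A" "2 * T\<^sup>2 \<le> A" "A > 0" "A \<le> 2 * (m * N)" "m * N \<le> A"
    using *[OF params(5,6,7)] unfolding A_eq by auto
qed

text \<open>The right-hand side is the constant term of the cubic in \<open>d\<close> from
  \<open>cubic_pair_eq\<close>, and \<open>l\<close> cliques give \<open>a1 = t * l * T\<close>. So
  \<open>ell1\<close> is the real number of cliques for which the offset \<open>d\<close> would be 0
  and the spread largest.\<close>

lemma ell1_eq: "m * T * real t * ell1 s t n = 2 / 3 * (m * T * N) - 2 / 27 * T ^ 3"
proof -
  have t0: "real t \<noteq> 0" and m0: "m \<noteq> 0" using params by auto
  have e: "ell1 s t n = 2 / (3 * real t) * (N - T\<^sup>2 / (9 * m))"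
    by (simp add: ell1_def N_def T_def m_def)
  have "m * T * real t * ell1 s t n = (real t / real t) * (2 / 3 * (m * T * N) - 2 / 27 * (m / m) * T ^ 3)"
    unfolding e by (simp add: right_diff_distrib power2_eq_square power3_eq_cube mult_ac)
  then show ?thesis using t0 m0 by simp
qed

text \<open>Of the roots of the cubic this singles out the one in the range where \<open>d\<close>
  is monotone in the number of cliques.\<close>

lemma spread_sq_offset:
  assumes sq: "S\<^sup>2 = 4 * (m * N) + 4 / 3 * T\<^sup>2 - 3 * d\<^sup>2" and S: "2 * sqrt (m * N) \<le> S"
  shows "\<bar>d\<bar> \<le> T"
proof -
  have "(2 * sqrt (m * N))\<^sup>2 \<le> S\<^sup>2" using S params by (intro power_mono) auto
  then have "4 * (m * N) \<le> S\<^sup>2" using params by (simp add: power_mult_distrib)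
  then have "9 * d\<^sup>2 \<le> 4 * T\<^sup>2" using sq by (simp add: field_simps)
  then have "d\<^sup>2 \<le> T\<^sup>2" using zero_le_power2[of T] by linarith
  then show ?thesis using params by (simp add: abs_le_square_iff[symmetric])
qed

text \<open>All degrees outside the hubs are \<open>0\<close> or \<open>T\<close>, so
  \<open>D\<close> vanishes and the cubic holds without error; inserting the number of edges turns
  it into a relation between \<open>l - ell1\<close> and \<open>d\<close>.\<close>

lemma candidate_spread:
  assumes iso: "digraph_iso (with_proj (extremal_candidate s t n l)) (with_proj G)" and tl: "t * l \<le> n - s + 1"
    and V: "pverts G = {..<n}"
  shows "in_family s t n G" "\<exists>d. 0 \<le> spread G \<and> 2 * sqrt (m * N) \<le> spread G \<and> (spread G)\<^sup>2 = 4 * (m * N) + 4 / 3 * T\<^sup>2 - 3 * d\<^sup>2 \<and> \<bar>d\<bar> \<le> T \<and>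
    m * T * real t * (real l - ell1 s t n) = d ^ 3 - A * d"
proof -
  obtain K B where "clique_hub_graph (pverts G) (parcs G) s t l K B"
    using clique_hub_graph_if_iso(1)[OF iso tl s2 st sn] by blast
  then interpret C: clique_hub_graph "pverts G" "parcs G" s t l K B .
  interpret F: full_hubs "pverts G" "parcs G" s t K
    using C.no_biclique_model C.KV C.cardK s2 st C.complete C.empty V sn by unfold_locales auto
  show fam: "in_family s t n G" unfolding in_family_iff using V F.biclique_free_axioms by simp
  then have pg: "pair_graph G" by (simp add: in_family_def)
  have n0: "n > 0" using s2 sn by simp
  obtain p q x z where sp: "is_spread (pverts G) (adj (parcs G)) p q x z" "spread G = p + q"
    using spread_exists[OF pg V n0] .
  have FN: "F.N = N" unfolding F.N_def N_def by (simp add: V)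
  have mT: "real s - 1 = m" "real t - 1 = T" by (simp_all add: m_def T_def)
  note lower = F.spread_lower[OF sp(1), unfolded FN mT]
  note f = F.fine[OF sp(1), unfolded FN mT, OF big1 lower]
  have dU: "F.H.dU u = (if \<exists>i<l. u \<in> B i then T else 0)" if "u \<in> pverts G - K" for u
    using C.degree_values[OF that] st s2 by (simp add: F.H.dU_card T_def of_nat_diff)
  have "(\<Sum>u\<in>pverts G - K. F.H.dU u * (T - F.H.dU u)) = 0"
    using dU by (intro sum.neutral ballI) auto
  then obtain d where d: "(p + q)\<^sup>2 = 4 * (m * N) + 4 / 3 * T\<^sup>2 - 3 * d\<^sup>2"
    "m * F.H.a1 = 2 / 3 * (m * T * N) - 2 / 27 * T ^ 3 - (m * N + T\<^sup>2 / 3) * d + d ^ 3"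
    using f(4) by blast
  have "F.H.a1 = real (t * l) * T"
    unfolding F.H.a1_def F.H.dU_card using C.sum_degrees by (simp add: T_def)
  then have "m * T * real t * real l = 2 / 3 * (m * T * N) - 2 / 27 * T ^ 3 - A * d + d ^ 3"
    using d(2) unfolding A_eq by (simp add: mult_ac)
  then have "m * T * real t * (real l - ell1 s t n) = d ^ 3 - A * d"
    using ell1_eq by (simp add: right_diff_distrib)
  moreover have "\<bar>d\<bar> \<le> T" using d(1) lower by (rule spread_sq_offset)
  moreover have "0 \<le> spread G" using f(1,2) sp(2) by simp
  ultimately show "\<exists>d. 0 \<le> spread G \<and> 2 * sqrt (m * N) \<le> spread G \<and> (spread G)\<^sup>2 = 4 * (m * N) + 4 / 3 * T\<^sup>2 - 3 * d\<^sup>2 \<and> \<bar>d\<bar> \<le> T \<and>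
    m * T * real t * (real l - ell1 s t n) = d ^ 3 - A * d"
    using d(1) lower sp(2) by metis
qed

lemma dist_le_iff:
  assumes "m * T * real t * (real l - ell1 s t n) = d ^ 3 - A * d" "m * T * real t * (real k - ell1 s t n) = e ^ 3 - A * e"
    and "\<bar>d\<bar> \<le> T" "\<bar>e\<bar> \<le> T"
  shows "\<bar>ell1 s t n - real l\<bar> \<le> \<bar>ell1 s t n - real k\<bar> \<longleftrightarrow> \<bar>d\<bar> \<le> \<bar>e\<bar>"
proof -
  have c: "m * T * real t > 0" using params by simp
  have "\<bar>d ^ 3 - A * d\<bar> = (m * T * real t) * \<bar>ell1 s t n - real l\<bar>"
    by (rule abs_scaled[OF assms(1)])
  moreover have "\<bar>e ^ 3 - A * e\<bar> = (m * T * real t) * \<bar>ell1 s t n - real k\<bar>"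
    by (rule abs_scaled[OF assms(2)])
  ultimately show ?thesis
    using odd_cubic_abs_le_iff[OF A_big(1) assms(3,4)] c by (simp add: mult_le_cancel_left_pos)
qed

text \<open>Rounding to within one half leaves \<open>d\<close> of order \<open>1 / N\<close>, since
  the slope of the cubic is about \<open>m N\<close>. The loss \<open>3 d^2\<close> is therefore
  smaller than both quantities it has to compete with.\<close>

lemma near_offset:
  assumes "m * T * real t * (real l - ell1 s t n) = d ^ 3 - A * d" "\<bar>d\<bar> \<le> T" "\<bar>ell1 s t n - real l\<bar> \<le> 1 / 2"
  shows "\<bar>d\<bar> \<le> T * real t / N" "3 * d\<^sup>2 \<le> eta" "3 * d\<^sup>2 < 1 / N"
proof -
  have N0: "N > 0" using params(4) by linarith
  have "\<bar>d\<bar> \<le> 2 * \<bar>d ^ 3 - A * d\<bar> / A" using A_big assms(2) by (intro odd_cubic_small) auto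
  also have "\<bar>d ^ 3 - A * d\<bar> = (m * T * real t) * \<bar>ell1 s t n - real l\<bar>"
    by (rule abs_scaled[OF assms(1)])
  also have "2 * ((m * T * real t) * \<bar>ell1 s t n - real l\<bar>) / A \<le> 2 * ((m * T * real t) * (1 / 2)) / A"
    using assms(3) A_big params by (intro divide_right_mono mult_left_mono) auto
  also have "\<dots> = m * T * real t / A" by simp
  also have "\<dots> \<le> m * T * real t / (m * N)" using A_big params by (intro divide_left_mono) auto
  also have "\<dots> = T * real t / N" using params by simp
  finally show d: "\<bar>d\<bar> \<le> T * real t / N" .
  have "\<bar>d\<bar>\<^sup>2 \<le> (T * real t / N)\<^sup>2" using d by (intro power_mono) auto
  then have "3 * d\<^sup>2 \<le> 3 * (T * real t / N)\<^sup>2" by simp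
  also have "\<dots> = 3 * T\<^sup>2 * (real t)\<^sup>2 / N / N"
    by (simp add: power_divide power_mult_distrib power2_eq_square)
  finally have "3 * d\<^sup>2 \<le> 3 * T\<^sup>2 * (real t)\<^sup>2 / N / N" .
  moreover have "3 * T\<^sup>2 * (real t)\<^sup>2 / N / N \<le> eta"
  proof -
    have "3 * T\<^sup>2 * (real t)\<^sup>2 \<le> N * eta" using big2 eta by (simp add: pos_divide_le_eq)
    then have "3 * T\<^sup>2 * (real t)\<^sup>2 / N \<le> eta" using N0 by (simp add: pos_divide_le_eq mult.commute)
    moreover have "3 * T\<^sup>2 * (real t)\<^sup>2 / N / N \<le> 3 * T\<^sup>2 * (real t)\<^sup>2 / N / 1"
      using N0 params(4) by (intro divide_left_mono) auto
    ultimately show ?thesis by simp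
  qed
  moreover have "3 * T\<^sup>2 * (real t)\<^sup>2 / N / N < 1 / N"
  proof (rule divide_strict_right_mono)
    have "3 * T\<^sup>2 * (real t)\<^sup>2 < N" by (rule N_lower(1))
    then show "3 * T\<^sup>2 * (real t)\<^sup>2 / N < 1" using N0 by simp
  qed (rule N0)
  ultimately show "3 * d\<^sup>2 \<le> eta" "3 * d\<^sup>2 < 1 / N" by linarith+
qed

text \<open>A graph at least as good as a nearest candidate is forced into candidate form:
  \<open>struc\<close> supplies the hubs, integrality of \<open>D\<close> the degrees, the cubic the
  isolated vertices, and regularity then the clique components.\<close>

lemma better_is_candidate:
  assumes struc: "\<forall>(V :: nat set) E p q x z. biclique_free V E s t \<longrightarrow> card V = n \<longrightarrow>
     is_spread V (adj E) p q x z \<longrightarrow> 0 \<le> p + q \<longrightarrow> 4 * (m * N) + 4 / 3 * T\<^sup>2 - eta \<le> (p + q)\<^sup>2 \<longrightarrow>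
     (\<exists>K. K \<subseteq> V \<and> card K = s - 1 \<and> E \<inter> K \<times> K = {} \<and> (\<forall>k\<in>K. \<forall>u\<in>V - K. (k, u) \<in> E))"
    and c: "(spread Gc)\<^sup>2 = 4 * (m * N) + 4 / 3 * T\<^sup>2 - 3 * d0\<^sup>2" "0 \<le> spread Gc" "2 * sqrt (m * N) \<le> spread Gc"
    and d0: "\<bar>d0\<bar> \<le> T" "m * T * real t * (real l0 - ell1 s t n) = d0 ^ 3 - A * d0" "\<bar>ell1 s t n - real l0\<bar> \<le> 1 / 2"
    and fam: "in_family s t n G" and ge: "spread Gc \<le> spread G"
  shows "\<exists>l. t * l \<le> n - s + 1 \<and> digraph_iso (with_proj (extremal_candidate s t n l)) (with_proj G) \<and>
    \<bar>ell1 s t n - real l\<bar> \<le> \<bar>ell1 s t n - real l0\<bar>"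
proof -
  note near = near_offset[OF d0(2,1,3)]
  have V: "pverts G = {..<n}" and bf: "biclique_free (pverts G) (parcs G) s t" and pg: "pair_graph G"
    using fam in_family_iff by (auto simp: in_family_def)
  have n0: "n > 0" using s2 sn by simp
  obtain p q x z where sp: "is_spread (pverts G) (adj (parcs G)) p q x z" "spread G = p + q"
    using spread_exists[OF pg V n0] .
  have pq: "0 \<le> p + q" "2 * sqrt (m * N) \<le> p + q" using ge c sp(2) by auto
  have sq: "4 * (m * N) + 4 / 3 * T\<^sup>2 - 3 * d0\<^sup>2 \<le> (p + q)\<^sup>2"
    unfolding c(1)[symmetric] using ge c(2) sp(2) by (simp add: power_mono)
  have sq_eta: "4 * (m * N) + 4 / 3 * T\<^sup>2 - eta \<le> (p + q)\<^sup>2" using sq near(2) by linarith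
  obtain K where K: "K \<subseteq> pverts G" "card K = s - 1" "parcs G \<inter> K \<times> K = {}" "\<forall>k\<in>K. \<forall>u\<in>pverts G - K. (k, u) \<in> parcs G"
    using struc[rule_format, OF bf _ sp(1) pq(1) sq_eta] V by auto
  interpret biclique_free "pverts G" "parcs G" s t by fact
  interpret F: full_hubs "pverts G" "parcs G" s t K
    using K s2 st V sn by unfold_locales auto
  have FN: "F.N = N" unfolding F.N_def N_def by (simp add: V)
  have mT: "real s - 1 = m" "real t - 1 = T" by (simp_all add: m_def T_def)
  note f = F.fine[OF sp(1), unfolded FN mT, OF big1 pq(2)]
  let ?U = "pverts G - K"
  have finU: "finite ?U" using finV by simp
  have dT: "F.H.dU u \<le> T" if "u \<in> ?U" for u using F.H.dU_bounds[OF that] mT by simp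
  define D where "D = (\<Sum>u\<in>?U. F.H.dU u * (T - F.H.dU u))"
  \<comment> \<open>\<open>D\<close> is a nonnegative integer. If it were at least 1, it would cost
    \<open>2 m D / (p q) >= 1 / N\<close>, because \<open>p q\<close> is at most
    \<open>2 m N\<close>, whereas the reference candidate loses less than
    \<open>1 / N\<close>.\<close>
  have D0: "D = 0"
  proof (rule ccontr)
    assume "D \<noteq> 0"
    define D' :: int where "D' = (\<Sum>u\<in>?U. int (card (parcs G `` {u} \<inter> ?U)) * (int t - 1 - int (card (parcs G `` {u} \<inter> ?U))))"
    have DD: "D = of_int D'" unfolding D_def D'_def F.H.dU_card by (simp add: T_def)
    have "0 \<le> D" unfolding D_def using dT F.H.dU_bounds(1) by (intro sum_nonneg mult_nonneg_nonneg) auto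
    then have "D' \<ge> 1" using DD \<open>D \<noteq> 0\<close> by linarith
    then have D1: "D \<ge> 1" using DD by simp
    have pos: "p * q > 0" using f(1,2) by simp
    have up: "(p + q)\<^sup>2 \<le> 4 * (m * N) + 4 / 3 * T\<^sup>2 - 2 * m * D / (p * q)" using f(3) by (simp add: D_def)
    have mD: "2 * m * 1 \<le> 2 * m * D" using D1 params by (intro mult_left_mono) auto
    have "2 * m * D / (p * q) \<ge> 0" using pos D1 params by simp
    then have "4 * (p * q) \<le> 4 * (m * N) + 4 / 3 * T\<^sup>2"
    proof -
      assume a: "2 * m * D / (p * q) \<ge> 0"
      have "(p + q)\<^sup>2 - 4 * (p * q) = (p - q)\<^sup>2" by (simp add: power2_eq_square algebra_simps)
      then have "4 * (p * q) \<le> (p + q)\<^sup>2" using zero_le_power2[of "p - q"] by linarith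
      then show ?thesis using up a by linarith
    qed
    then have pq_le: "p * q \<le> 2 * m * N" using params by (simp add: field_simps)
    have mN0: "0 < 2 * m * N" using params(1,4) by simp
    have "1 / N = 2 * m * 1 / (2 * m * N)" using params(1) by simp
    also have "\<dots> \<le> 2 * m * D / (2 * m * N)" using mD mN0 by (intro divide_right_mono) auto
    also have "\<dots> \<le> 2 * m * D / (p * q)"
    proof (rule divide_left_mono[OF pq_le])
      show "0 \<le> 2 * m * D" using D1 params(1) by simp
      show "0 < 2 * m * N * (p * q)" using mN0 pos by (rule mult_pos_pos)
    qed
    finally show False using up sq near(3) by linarith
  qed
  have vals: "F.H.dU u = 0 \<or> F.H.dU u = T" if "u \<in> ?U" for u
  proof -
    have nn: "\<And>u. u \<in> ?U \<Longrightarrow> 0 \<le> F.H.dU u * (T - F.H.dU u)"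
      using dT F.H.dU_bounds(1) by (intro mult_nonneg_nonneg) auto
    have "F.H.dU u * (T - F.H.dU u) = 0"
      using D0 sum_nonneg_eq_0_iff[OF finU, of "\<lambda>u. F.H.dU u * (T - F.H.dU u)"] nn that
      unfolding D_def by blast
    then show ?thesis by auto
  qed
  obtain d where d: "(p + q)\<^sup>2 = 4 * (m * N) + 4 / 3 * T\<^sup>2 - 3 * d\<^sup>2"
    "m * F.H.a1 = 2 / 3 * (m * T * N) - 2 / 27 * T ^ 3 - (m * N + T\<^sup>2 / 3) * d + d ^ 3"
    using f(4) D0 unfolding D_def by blast
  have "d\<^sup>2 \<le> d0\<^sup>2" using sq d(1) by simp
  then have dd: "\<bar>d\<bar> \<le> \<bar>d0\<bar>" by (simp add: abs_le_square_iff)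
  define I where "I = {u \<in> ?U. parcs G `` {u} \<inter> ?U = {}}"
  have a1: "F.H.a1 = T * (N - real (card I))"
  proof -
    have "F.H.a1 = (\<Sum>u\<in>?U. T - (if u \<in> I then T else 0))"
      unfolding F.H.a1_def
    proof (intro sum.cong)
      fix u assume u: "u \<in> ?U"
      have "u \<in> I \<longleftrightarrow> F.H.dU u = 0" using u finU by (simp add: I_def F.H.dU_card)
      then show "F.H.dU u = T - (if u \<in> I then T else 0)" using vals[OF u] by auto
    qed simp
    also have "\<dots> = T * real (card ?U) - (\<Sum>u\<in>?U. if u \<in> I then T else 0)" by (simp add: sum_subtractf)
    also have "(\<Sum>u\<in>?U. if u \<in> I then T else 0) = (\<Sum>u\<in>?U \<inter> I. T)"
      by (rule sum.inter_restrict[OF finU, symmetric])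
    also have "?U \<inter> I = I" by (auto simp: I_def)
    finally show ?thesis using F.card_rest FN by (simp add: right_diff_distrib mult.commute)
  qed
  \<comment> \<open>For small \<open>d\<close> the cubic makes \<open>a1\<close> about
    \<open>2 T N / 3\<close>, and all nonzero degrees equal \<open>T\<close>, so about a third of
    the vertices outside the hubs are isolated. The terms in \<open>d\<close> stay bounded since
    \<open>A\<close> is at most \<open>2 m N\<close> and \<open>d\<close> is of order
    \<open>1 / N\<close>.\<close>
  have iso: "s \<le> card I"
  proof -
    have N0: "N > 0" using params(4) by linarith
    have dN: "\<bar>d\<bar> \<le> T * real t / N" using dd near(1) by linarith
    have dT1: "\<bar>d\<bar> \<le> T" using dd d0(1) by linarith
    have "\<bar>A * d - d ^ 3\<bar> \<le> \<bar>A * d\<bar> + \<bar>d ^ 3\<bar>" by (rule abs_triangle_ineq4)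
    also have "\<bar>A * d\<bar> \<le> (2 * (m * N)) * (T * real t / N)"
      unfolding abs_mult using A_big dN by (intro mult_mono) auto
    also have "\<dots> = m * (2 * T * real t)" using N0 by simp
    also have "\<bar>d ^ 3\<bar> \<le> T ^ 3" unfolding power_abs using dT1 by (intro power_mono) auto
    also have "T ^ 3 \<le> m * T ^ 3" using params mult_right_mono[of 1 m "T ^ 3"] by simp
    finally have b: "\<bar>A * d - d ^ 3\<bar> \<le> m * (2 * T * real t) + m * T ^ 3" by simp
    have T3: "T ^ 3 \<ge> 0" using params by simp
    have "m * (T * real (card I)) = m * (T * N) - m * F.H.a1" unfolding a1 by (simp add: right_diff_distrib)
    also have "\<dots> = m * T * N / 3 + 2 / 27 * T ^ 3 + (A * d - d ^ 3)"
      unfolding d(2) A_eq[symmetric] by simp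
    also have "\<dots> \<ge> m * T * N / 3 - (m * (2 * T * real t) + m * T ^ 3)"
    proof -
      have "- (m * (2 * T * real t) + m * T ^ 3) \<le> A * d - d ^ 3"
        using abs_le_D2[OF b] by (subst minus_le_iff)
      moreover have "0 \<le> 2 / 27 * T ^ 3" using T3 by simp
      moreover have "a - b' \<le> a + c + e" if "- b' \<le> e" "0 \<le> c" for a b' c e :: real using that by linarith
      ultimately show ?thesis by blast
    qed
    finally have "m * (T * (N / 3 - 2 * real t - T\<^sup>2)) \<le> m * (T * real (card I))"
      by (simp add: right_diff_distrib power3_eq_cube power2_eq_square mult_ac)
    then have "N / 3 - 2 * real t - T\<^sup>2 \<le> real (card I)" using params by simp
    moreover have "real s \<le> N / 3 - 2 * real t - T\<^sup>2"
      by (rule N_lower(3))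
    ultimately show ?thesis by linarith
  qed
  interpret HC: hub_complete "pverts G" "parcs G" s t K
  proof unfold_locales
    show "card (parcs G `` {u} \<inter> ?U) = t - 1" if "u \<in> ?U" "parcs G `` {u} \<inter> ?U \<noteq> {}" for u
    proof -
      have "F.H.dU u \<noteq> 0" using that finU by (simp add: F.H.dU_card)
      then have "real (card (parcs G `` {u} \<inter> ?U)) = real t - 1"
        using vals[OF that(1)] by (simp add: F.H.dU_card T_def)
      then show ?thesis by linarith
    qed
    show "s \<le> card {u \<in> ?U. parcs G `` {u} \<inter> ?U = {}}" using iso by (simp add: I_def)
  qed (use K s2 st in auto)
  obtain l B where "clique_hub_graph (pverts G) (parcs G) s t l K B"
    using HC.clique_hub_graph_exists[OF K(3)] by blast
  then interpret C: clique_hub_graph "pverts G" "parcs G" s t l K B .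
  have cn: "card (pverts G) = n" by (simp add: V)
  have isoG: "digraph_iso (with_proj (extremal_candidate s t n l)) (with_proj G)" and tl: "t * l \<le> n - s + 1"
    using C.iso_candidate[OF HOL.refl HOL.refl cn sn] by auto
  obtain e where e: "(spread G)\<^sup>2 = 4 * (m * N) + 4 / 3 * T\<^sup>2 - 3 * e\<^sup>2" "\<bar>e\<bar> \<le> T"
    "m * T * real t * (real l - ell1 s t n) = e ^ 3 - A * e"
    using candidate_spread(2)[OF isoG tl V] by blast
  have "e\<^sup>2 \<le> d0\<^sup>2" using e(1) sq sp(2) by simp
  then have "\<bar>e\<bar> \<le> \<bar>d0\<bar>" by (simp add: abs_le_square_iff)
  then have "\<bar>ell1 s t n - real l\<bar> \<le> \<bar>ell1 s t n - real l0\<bar>"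
    using dist_le_iff[OF e(3) d0(2) e(2) d0(1)] by simp
  then show ?thesis using isoG tl by blast
qed

text \<open>For these \<open>n\<close> the number \<open>ell1\<close> is at least one half and
  \<open>t * ell1\<close> at most \<open>2 N / 3\<close>. Rounding therefore cannot produce a
  negative number or too many cliques, and neither \<open>nat\<close> nor the natural subtractions
  truncate.\<close>

lemma nearest_bounds:
  assumes "nearest_integer (ell1 s t n) l"
  shows "0 \<le> l" "int t * l \<le> int n - int s + 1" "t * nat l \<le> n - s + 1" "\<bar>ell1 s t n - real (nat l)\<bar> \<le> 1 / 2"
proof -
  have d: "\<bar>ell1 s t n - of_int l\<bar> \<le> 1 / 2" using assms by (simp add: nearest_integer_iff)
  have t0: "real t > 0" and T0: "T > 0" and m0: "m > 0" using params by auto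
  have e: "ell1 s t n = 2 / (3 * real t) * (N - T\<^sup>2 / (9 * m))"
    by (simp add: ell1_def N_def T_def m_def)
  have "T\<^sup>2 / (9 * m) \<le> T\<^sup>2 / 1" using params by (intro divide_left_mono) auto
  then have f1: "T\<^sup>2 / (9 * m) \<le> T\<^sup>2" by simp
  have f2: "0 \<le> T\<^sup>2 / (9 * m)" using params by simp
  have Nt: "T\<^sup>2 + 2 * real t \<le> N"
    by (rule N_lower(2))
  have te: "real t * ell1 s t n = 2 / 3 * (N - T\<^sup>2 / (9 * m))" unfolding e using t0 by simp
  have lo: "real t * (1 / 2) \<le> real t * ell1 s t n" unfolding te using f1 Nt t0 by (simp add: field_simps)
  have "1 / 2 \<le> ell1 s t n" using mult_left_le_imp_le[OF lo t0] .
  then have "real_of_int l \<ge> 0" using d by linarith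
  then show l0: "0 \<le> l" by simp
  have "real t * real_of_int l \<le> real t * (ell1 s t n + 1 / 2)"
  proof (rule mult_left_mono)
    show "real_of_int l \<le> ell1 s t n + 1 / 2" using d by linarith
  qed (use t0 in simp)
  also have "\<dots> \<le> N"
  proof -
    have "real t * (ell1 s t n + 1 / 2) = real t * ell1 s t n + real t / 2" by (simp add: distrib_left)
    also have "\<dots> \<le> 2 / 3 * N + real t / 2" unfolding te using f2 by simp
    also have "\<dots> \<le> N"
    proof -
      have "2 * real t \<le> N" using Nt zero_le_power2[of T] by linarith
      then show ?thesis using t0 by linarith
    qed
    finally show ?thesis .
  qed
  finally have "real_of_int (int t * l) \<le> real_of_int (int n - int s + 1)" by (simp add: N_def)
  then show tl: "int t * l \<le> int n - int s + 1" by (simp only: of_int_le_iff)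
  have "int (t * nat l) \<le> int (n - s + 1)" using tl l0 sn by (simp add: of_nat_diff)
  then show "t * nat l \<le> n - s + 1" by (simp only: of_nat_le_iff)
  show "\<bar>ell1 s t n - real (nat l)\<bar> \<le> 1 / 2" using d l0 by simp
qed

lemma candidate_exists:
  assumes tl: "t * l \<le> n - s + 1"
  obtains G :: "nat pair_pre_digraph" where "pverts G = {..<n}"
    "digraph_iso (with_proj (extremal_candidate s t n l)) (with_proj G)"
proof -
  let ?C = "extremal_candidate s t n l"
  interpret C: pair_graph ?C using pair_graph_cand[OF tl] .
  have c: "card (pverts ?C) = n"
    unfolding pverts_cand using cand_hubs_rest[of s t n l] card_cand_hubs card_cand_rest[OF tl] s2 sn
    by (simp add: card_Un_disjoint)
  obtain h where h: "bij_betw h (pverts ?C) {..<n}"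
    using ex_bij_betw_finite_nat[OF C.pair_finite_verts] c by (auto simp: lessThan_atLeast0)
  let ?G = "\<lparr>pverts = {..<n}, parcs = map_prod h h ` parcs ?C\<rparr>"
  have "digraph_iso (with_proj ?C) (with_proj ?G)"
    using digraph_iso_with_proj_iff[OF C.pair_wf_digraph_axioms, of ?G] h by (auto simp: bij_betw_def)
  then show ?thesis using that[of ?G] by simp
qed

end

section \<open>From nearest candidates to all extremal graphs\<close>

lemma card_parcs_iso:
  assumes "pair_wf_digraph G" "digraph_iso (with_proj G) (with_proj H)"
  shows "card (parcs G) = card (parcs H)"
proof -
  interpret pair_wf_digraph G by fact
  obtain h where h: "inj_on h (pverts G)" "parcs H = map_prod h h ` parcs G"
    using assms(2) digraph_iso_with_proj_iff[OF assms(1), of H] by auto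
  have "inj_on (map_prod h h) (pverts G \<times> pverts G)"
    using h(1) by (intro map_prod_inj_on)
  then have "inj_on (map_prod h h) (parcs G)"
    by (rule inj_on_subset) (auto dest: in_arcsD1 in_arcsD2)
  then show ?thesis by (simp add: h(2) card_image)
qed

theorem theorem2:
  fixes s t :: nat
  assumes "2 \<le> s" and "s \<le> t" and "admissible s t"
  shows "\<exists>N. \<forall>n\<ge>N.
    (\<forall>l0 :: int. nearest_integer (ell1 s t n) l0 \<longrightarrow>
       0 \<le> l0 \<and> int s \<le> int n \<and> int t * l0 \<le> int n - int s + 1 \<and>
       (\<exists>G. extremal s t n G \<and>
            digraph_iso (with_proj G) (with_proj (extremal_candidate s t n (nat l0))))) \<and>
    (\<forall>G. extremal s t n G \<longrightarrow>
       (\<exists>l0 :: int. nearest_integer (ell1 s t n) l0 \<and>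
            digraph_iso (with_proj G) (with_proj (extremal_candidate s t n (nat l0))))) \<and>
    (\<not> half_integer (ell1 s t n) \<longrightarrow>
       (\<exists>G. extremal s t n G \<and>
            (\<forall>H. extremal s t n H \<longrightarrow> digraph_iso (with_proj H) (with_proj G)))) \<and>
    (half_integer (ell1 s t n) \<longrightarrow>
       (\<exists>G1 G2. extremal s t n G1 \<and> extremal s t n G2 \<and>
            \<not> digraph_iso (with_proj G1) (with_proj G2) \<and>
            (\<forall>H. extremal s t n H \<longrightarrow>
               digraph_iso (with_proj H) (with_proj G1) \<or>
               digraph_iso (with_proj H) (with_proj G2))))"
proof -
  define m T where "m = real s - 1" and "T = real t - 1"
  obtain N1 eta where eta: "eta > 0" and N1: "\<forall>V (E :: nat rel) p q x z. biclique_free V E s t \<longrightarrow> N1 \<le> card V \<longrightarrow>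
     is_spread V (adj E) p q x z \<longrightarrow> 0 \<le> p + q \<longrightarrow>
     4 * ((real s - 1) * (real (card V) - real s + 1)) + 4 / 3 * (real t - 1)\<^sup>2 - eta \<le> (p + q)\<^sup>2 \<longrightarrow>
     (\<exists>K. K \<subseteq> V \<and> card K = s - 1 \<and> E \<inter> K \<times> K = {} \<and> (\<forall>k\<in>K. \<forall>u\<in>V - K. (k, u) \<in> E))"
    using extremal_structure[OF assms] by (elim exE conjE) (rule that)
  \<comment> \<open>The sum of all thresholds; its summands are nonnegative, so a single lower bound
    on \<open>n\<close> yields each of them.\<close>
  define Q where "Q = 3 * T\<^sup>2 * (real t)\<^sup>2 / eta + (3 * T\<^sup>2 * (real t)\<^sup>2 + 3 * T\<^sup>2 + 6 * real t + 3 * real s + 3) + (exp_threshold m T)\<^sup>2 + real s"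
  have Qnn: "0 \<le> 3 * T\<^sup>2 * (real t)\<^sup>2 / eta" "0 \<le> 3 * T\<^sup>2 * (real t)\<^sup>2 + 3 * T\<^sup>2 + 6 * real t + 3 * real s + 3" "0 \<le> (exp_threshold m T)\<^sup>2"
    using eta by simp_all
  obtain N2 where N2: "real N2 \<ge> Q" using real_arch_simple by blast
  show ?thesis
  proof (intro exI[of _ "max N1 (max N2 s)"] allI impI)
    fix n assume n: "max N1 (max N2 s) \<le> n"
    have nn: "N1 \<le> n" "N2 \<le> n" "s \<le> n" using n by auto
    have Qn: "Q \<le> real n" using N2 nn(2) by linarith
    interpret large_parameters s t n eta m T "real n - real s + 1" "(real s - 1) * (real n - real s + 1) + (real t - 1)\<^sup>2 / 3"
    proof (unfold_locales)
      show "m = real s - 1" "T = real t - 1" by (simp_all add: m_def T_def)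
      show "exp_threshold m T \<le> sqrt (m * (real n - real s + 1))"
      proof (rule real_le_rsqrt)
        have "(exp_threshold m T)\<^sup>2 \<le> real n - real s + 1" using Qn Qnn unfolding Q_def by linarith
        also have "\<dots> = 1 * (real n - real s + 1)" by simp
        also have "\<dots> \<le> m * (real n - real s + 1)" using assms(1) nn(3) by (intro mult_right_mono) (auto simp: m_def)
        finally show "(exp_threshold m T)\<^sup>2 \<le> m * (real n - real s + 1)" .
      qed
      show "3 * T\<^sup>2 * (real t)\<^sup>2 / eta \<le> real n - real s + 1" using Qn Qnn unfolding Q_def by linarith
      show "3 * T\<^sup>2 * (real t)\<^sup>2 + 3 * T\<^sup>2 + 6 * real t + 3 * real s + 3 \<le> real n - real s + 1"
        using Qn Qnn unfolding Q_def by linarith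
    qed (use assms eta nn in auto)
    have struc: "\<forall>(V :: nat set) E p q x z. biclique_free V E s t \<longrightarrow> card V = n \<longrightarrow>
      is_spread V (adj E) p q x z \<longrightarrow> 0 \<le> p + q \<longrightarrow>
      4 * (m * (real n - real s + 1)) + 4 / 3 * T\<^sup>2 - eta \<le> (p + q)\<^sup>2 \<longrightarrow>
      (\<exists>K. K \<subseteq> V \<and> card K = s - 1 \<and> E \<inter> K \<times> K = {} \<and> (\<forall>k\<in>K. \<forall>u\<in>V - K. (k, u) \<in> E))"
      using N1 nn(1) by (auto simp: m_def T_def)
    define near where "near = nearest_integer (ell1 s t n)"
    define cand where "cand = (\<lambda>l. extremal_candidate s t n (nat l))"
    have wfc: "pair_wf_digraph (cand l)" if "near l" for l
      using pair_graph_cand[OF nearest_bounds(3)[of l]] that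
      by (simp add: near_def cand_def pair_graph_def pair_digraph_def pair_fin_digraph_def)
    \<comment> \<open>A graph that does at least as well as one nearest candidate is itself a
      nearest candidate of the same spread. This shows that nearest candidates are maximal and also
      that nothing else is.\<close>
    have key: "in_family s t n Gc \<and> (\<forall>G. in_family s t n G \<longrightarrow> spread Gc \<le> spread G \<longrightarrow>
        spread G = spread Gc \<and> (\<exists>l. near l \<and> digraph_iso (with_proj (cand l)) (with_proj G)))"
      if l0: "near l0" and Gc: "pverts Gc = {..<n}" "digraph_iso (with_proj (cand l0)) (with_proj Gc)" for l0 Gc
    proof (intro conjI allI impI)
      note nb = nearest_bounds[OF l0[unfolded near_def]]
      note cs = candidate_spread[OF Gc(2)[unfolded cand_def] nb(3) Gc(1)]
      show "in_family s t n Gc" by (rule cs(1))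
      obtain d0 where d0: "0 \<le> spread Gc" "2 * sqrt (m * (real n - real s + 1)) \<le> spread Gc"
        "(spread Gc)\<^sup>2 = 4 * (m * (real n - real s + 1)) + 4 / 3 * T\<^sup>2 - 3 * d0\<^sup>2" "\<bar>d0\<bar> \<le> T"
        "m * T * real t * (real (nat l0) - ell1 s t n) = d0 ^ 3 - ((real s - 1) * (real n - real s + 1) + (real t - 1)\<^sup>2 / 3) * d0"
        using cs(2) by blast
      fix G assume G: "in_family s t n G" "spread Gc \<le> spread G"
      obtain l where l: "t * l \<le> n - s + 1" "digraph_iso (with_proj (extremal_candidate s t n l)) (with_proj G)"
        "\<bar>ell1 s t n - real l\<bar> \<le> \<bar>ell1 s t n - real (nat l0)\<bar>"
        using better_is_candidate[OF struc d0(3,1,2,4,5) nb(4) G] by (elim exE conjE) (rule that)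
      have nl: "near (int l)" unfolding near_def nearest_integer_iff using l(3) nb(4) by simp
      have V: "pverts G = {..<n}" using G(1) by (simp add: in_family_def)
      obtain e where e: "0 \<le> spread G" "(spread G)\<^sup>2 = 4 * (m * (real n - real s + 1)) + 4 / 3 * T\<^sup>2 - 3 * e\<^sup>2" "\<bar>e\<bar> \<le> T"
        "m * T * real t * (real l - ell1 s t n) = e ^ 3 - ((real s - 1) * (real n - real s + 1) + (real t - 1)\<^sup>2 / 3) * e"
        using candidate_spread(2)[OF l(2,1) V] by blast
      have "\<bar>ell1 s t n - of_int (int l)\<bar> = \<bar>ell1 s t n - of_int l0\<bar>"
        using nearest_integer_same_dist nl l0 unfolding near_def by blast
      then have "\<bar>ell1 s t n - real (nat l0)\<bar> \<le> \<bar>ell1 s t n - real l\<bar>" using nb(1) by simp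
      then have "\<bar>d0\<bar> \<le> \<bar>e\<bar>" using dist_le_iff[OF d0(5) e(4) d0(4) e(3)] by simp
      then have "d0\<^sup>2 \<le> e\<^sup>2" by (simp add: abs_le_square_iff)
      then have "(spread G)\<^sup>2 \<le> (spread Gc)\<^sup>2" using e(2) d0(3) by simp
      then have "spread G \<le> spread Gc" using d0(1) by (rule power2_le_imp_le)
      then show "spread G = spread Gc" using G(2) by simp
      show "\<exists>l. near l \<and> digraph_iso (with_proj (cand l)) (with_proj G)"
        using nl l(2) by (intro exI[of _ "int l"]) (simp add: cand_def)
    qed
    have rep: "\<exists>G. pverts G = {..<n} \<and> digraph_iso (with_proj (cand l)) (with_proj G) \<and> extremal s t n G" if l: "near l" for l
    proof -
      obtain G :: "nat pair_pre_digraph" where G: "pverts G = {..<n}" "digraph_iso (with_proj (cand l)) (with_proj G)"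
        using candidate_exists[OF nearest_bounds(3)[OF l[unfolded near_def]]] unfolding cand_def by blast
      have "extremal s t n G"
        unfolding extremal_def is_arg_max_def
      proof (intro conjI notI)
        show "in_family s t n G" using key[OF l G] by blast
        assume "\<exists>H. in_family s t n H \<and> spread G < spread H"
        then obtain H where H: "in_family s t n H" "spread G < spread H" by blast
        then have "spread H = spread G" using key[OF l G] by (meson less_imp_le)
        then show False using H(2) by simp
      qed
      then show ?thesis using G by blast
    qed
    have ex_near: "near (round (ell1 s t n))"
      unfolding near_def nearest_integer_iff using of_int_round_abs_le[of "ell1 s t n"] by (simp add: abs_minus_commute)
    have ext: "\<exists>l. near l \<and> digraph_iso (with_proj (cand l)) (with_proj H)" if H: "extremal s t n H" for H
    proof -
      obtain G where G: "pverts G = {..<n}" "digraph_iso (with_proj (cand (round (ell1 s t n)))) (with_proj G)"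
        using rep[OF ex_near] by blast
      have k: "in_family s t n G" "\<And>H. in_family s t n H \<Longrightarrow> spread G \<le> spread H \<Longrightarrow> \<exists>l. near l \<and> digraph_iso (with_proj (cand l)) (with_proj H)"
        using key[OF ex_near G] by blast+
      have "in_family s t n H" "spread G \<le> spread H"
        using H k(1) unfolding extremal_def is_arg_max_def by (auto simp: not_less)
      then show ?thesis by (rule k(2))
    qed
    have wfH: "pair_wf_digraph H" if "extremal s t n H" for H
      using that by (simp add: extremal_def is_arg_max_def in_family_def pair_graph_def pair_digraph_def pair_fin_digraph_def)
    have same: "digraph_iso (with_proj H) (with_proj G)"
      if "near l" "digraph_iso (with_proj (cand l)) (with_proj H)" "digraph_iso (with_proj (cand l)) (with_proj G)" "pair_wf_digraph H"
      for l and H G :: "nat pair_pre_digraph"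
      using digraph_iso_trans'[OF that(4) digraph_iso_sym'[OF wfc[OF that(1)] that(2)] that(3)] .
    show "(\<forall>l0 :: int. nearest_integer (ell1 s t n) l0 \<longrightarrow>
       0 \<le> l0 \<and> int s \<le> int n \<and> int t * l0 \<le> int n - int s + 1 \<and>
       (\<exists>G. extremal s t n G \<and>
            digraph_iso (with_proj G) (with_proj (extremal_candidate s t n (nat l0))))) \<and>
    (\<forall>G. extremal s t n G \<longrightarrow>
       (\<exists>l0 :: int. nearest_integer (ell1 s t n) l0 \<and>
            digraph_iso (with_proj G) (with_proj (extremal_candidate s t n (nat l0))))) \<and>
    (\<not> half_integer (ell1 s t n) \<longrightarrow>
       (\<exists>G. extremal s t n G \<and>
            (\<forall>H. extremal s t n H \<longrightarrow> digraph_iso (with_proj H) (with_proj G)))) \<and>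
    (half_integer (ell1 s t n) \<longrightarrow>
       (\<exists>G1 G2. extremal s t n G1 \<and> extremal s t n G2 \<and>
            \<not> digraph_iso (with_proj G1) (with_proj G2) \<and>
            (\<forall>H. extremal s t n H \<longrightarrow>
               digraph_iso (with_proj H) (with_proj G1) \<or>
               digraph_iso (with_proj H) (with_proj G2))))"
    proof (intro conjI allI impI)
      fix l0 assume l0: "nearest_integer (ell1 s t n) l0"
      show "0 \<le> l0" "int t * l0 \<le> int n - int s + 1" using nearest_bounds[OF l0] by auto
      show "int s \<le> int n" using nn(3) by simp
      have nl0: "near l0" using l0 by (simp add: near_def)
      obtain G where G: "digraph_iso (with_proj (cand l0)) (with_proj G)" "extremal s t n G"
        using rep[OF nl0] by blast
      then show "\<exists>G. extremal s t n G \<and> digraph_iso (with_proj G) (with_proj (extremal_candidate s t n (nat l0)))"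
        using digraph_iso_sym'[OF wfc[OF nl0]] unfolding cand_def by blast
    next
      fix G assume G: "extremal s t n G"
      obtain l where l: "near l" "digraph_iso (with_proj (cand l)) (with_proj G)" using ext[OF G] by blast
      then show "\<exists>l0 :: int. nearest_integer (ell1 s t n) l0 \<and>
            digraph_iso (with_proj G) (with_proj (extremal_candidate s t n (nat l0)))"
        using digraph_iso_sym'[OF wfc[OF l(1)] l(2)] unfolding near_def cand_def by blast
    next
      assume nh: "\<not> half_integer (ell1 s t n)"
      let ?r = "round (ell1 s t n)"
      obtain G where G: "digraph_iso (with_proj (cand ?r)) (with_proj G)" "extremal s t n G"
        using rep[OF ex_near] by blast
      \<comment> \<open>Two different nearest integers would both be at distance exactly one half,
        making \<open>ell1\<close> a half-integer.\<close>
      have uniq: "l = ?r" if l: "near l" for l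
      proof (rule ccontr)
        assume ne: "l \<noteq> ?r"
        have d: "\<bar>ell1 s t n - of_int l\<bar> \<le> 1 / 2" "\<bar>ell1 s t n - of_int ?r\<bar> \<le> 1 / 2"
          using l ex_near by (auto simp: near_def nearest_integer_iff)
        have "\<bar>real_of_int l - of_int ?r\<bar> \<ge> 1" using ne by linarith
        then have "ell1 s t n = of_int l + 1 / 2 \<or> ell1 s t n = of_int ?r + 1 / 2" using d by linarith
        then show False using nh unfolding half_integer_def by blast
      qed
      have "digraph_iso (with_proj H) (with_proj G)" if H: "extremal s t n H" for H
      proof -
        obtain l where l: "near l" "digraph_iso (with_proj (cand l)) (with_proj H)" using ext[OF H] by blast
        then show ?thesis using same[OF ex_near _ G(1) wfH[OF H]] uniq by metis
      qed
      then show "\<exists>G. extremal s t n G \<and> (\<forall>H. extremal s t n H \<longrightarrow> digraph_iso (with_proj H) (with_proj G))"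
        using G(2) by blast
    next
      assume "half_integer (ell1 s t n)"
      then obtain k :: int where k: "ell1 s t n = of_int k + 1 / 2" unfolding half_integer_def by blast
      have near_iff: "near l \<longleftrightarrow> l = k \<or> l = k + 1" for l
      proof
        assume "near l"
        then have "\<bar>of_int k + 1 / 2 - real_of_int l\<bar> \<le> 1 / 2" by (simp add: near_def nearest_integer_iff k)
        then have "real_of_int k \<le> of_int l" "real_of_int l \<le> of_int k + 1" by linarith+
        then have "k \<le> l" "l \<le> k + 1" by linarith+
        then show "l = k \<or> l = k + 1" by linarith
      next
        assume "l = k \<or> l = k + 1"
        then show "near l" by (auto simp: near_def nearest_integer_iff k)
      qed
      have nk: "near k" "near (k + 1)" using near_iff by auto
      obtain G1 where G1: "digraph_iso (with_proj (cand k)) (with_proj G1)" "extremal s t n G1" using rep[OF nk(1)] by blast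
      obtain G2 where G2: "digraph_iso (with_proj (cand (k + 1))) (with_proj G2)" "extremal s t n G2" using rep[OF nk(2)] by blast
      have k0: "0 \<le> k" using nearest_bounds(1)[OF nk(1)[unfolded near_def]] .
      have "\<not> digraph_iso (with_proj G1) (with_proj G2)"
      proof
        assume i: "digraph_iso (with_proj G1) (with_proj G2)"
        have "card (parcs (cand k)) = card (parcs G1)" using card_parcs_iso[OF wfc[OF nk(1)] G1(1)] .
        also have "\<dots> = card (parcs G2)" using card_parcs_iso[OF wfH[OF G1(2)] i] .
        also have "\<dots> = card (parcs (cand (k + 1)))" using card_parcs_iso[OF wfc[OF nk(2)] G2(1)] by simp
        \<comment> \<open>Isomorphic graphs have equally many arcs, and the arcs between hubs and
          rest are the same for both candidates, so the arcs inside the cliques would have to agree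
          in number.\<close>
        finally have "nat k * (t * (t - 1)) = nat (k + 1) * (t * (t - 1))"
          using card_parcs_cand[OF nearest_bounds(3)[OF nk(1)[unfolded near_def]]]
            card_parcs_cand[OF nearest_bounds(3)[OF nk(2)[unfolded near_def]]] by (simp add: cand_def)
        moreover have "t * (t - 1) > 0" using assms by simp
        ultimately have "nat k = nat (k + 1)" by (metis mult_cancel2 not_less_zero)
        then show False using k0 by simp
      qed
      moreover have "digraph_iso (with_proj H) (with_proj G1) \<or> digraph_iso (with_proj H) (with_proj G2)" if H: "extremal s t n H" for H
      proof -
        obtain l where l: "near l" "digraph_iso (with_proj (cand l)) (with_proj H)" using ext[OF H] by blast
        then show ?thesis using same[OF nk(1) _ G1(1) wfH[OF H]] same[OF nk(2) _ G2(1) wfH[OF H]] near_iff by metis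
      qed
      ultimately show "\<exists>G1 G2. extremal s t n G1 \<and> extremal s t n G2 \<and>
            \<not> digraph_iso (with_proj G1) (with_proj G2) \<and>
            (\<forall>H. extremal s t n H \<longrightarrow>
               digraph_iso (with_proj H) (with_proj G1) \<or>
               digraph_iso (with_proj H) (with_proj G2))"
        using G1(2) G2(2) by blast
    qed
  qed
qed

end
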